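(* Let $\mathcal{F}\in\{\mathcal{A},\mathcal{S}\}$. For all positive integers $1\le i\le r<k$, one has $$\sum_{\boldsymbol{k}=(k_1,\ldots,k_r)\in I_i(k,r)}(2^{k_i-2}-1)\,\zeta^{\frac12}_{\mathcal{F}}(\boldsymbol{k})=\frac{(-1)^i\{(-1)^r-(-1)^k\}}{2^r}\left\{2^{k-1}-\sum_{u=0}^{i-1}\binom{k-1}{u}-\sum_{v=0}^{r-i}\binom{k-1}{v}\right\}\mathfrak{Z}_{\mathcal{F}}(k)$$ and $$\sum_{\boldsymbol{k}=(k_1,\ldots,k_r)\in I_r(k,r)}2^{k_r}\,\zeta^{\frac12}_{\mathcal{F}}(\boldsymbol{k})=\frac{1+(-1)^r}{2^{r-2}}\left\{2^{k-1}-1+\sum_{u=0}^{r-1}\binom{k-1}{u}\right\}\mathfrak{Z}_{\mathcal{F}}(k).$$ The identities hold in $\mathcal{A}$ if $\mathcal{F}=\mathcal{A}$ and in $\overline{\mathcal{Z}}$ if $\mathcal{F}=\mathcal{S}$.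
   Context: An index is a finite tuple $\boldsymbol{k}=(k_1,\ldots,k_r)$ of positive integers (the empty index $\varnothing$ allowed); $\mathrm{wt}(\boldsymbol{k})=k_1+\cdots+k_r$, $\mathrm{dep}(\boldsymbol{k})=r$. Any function of indices takes the value $1$ (unit element) at $\varnothing$. For positive integers $i\le r<k$, $I_i(k,r)$ is the set of indices $(k_1,\ldots,k_r)$ of weight $k$ and depth $r$ with $k_i\ge2$. Write $\boldsymbol{l}\preceq\boldsymbol{k}$ if $\boldsymbol{l}$ has the form $(k_1\,\square\cdots\square\,k_r)$ with each box filled by a comma or a plus; sums over $\boldsymbol{l}\preceq\boldsymbol{k}$ run over all $2^{r-1}$ choices. Finite side. $\mathcal{A}=\left(\prod_{p}\mathbb{Z}/p\mathbb{Z}\right)/\left(\bigoplus_{p}\mathbb{Z}/p\mathbb{Z}\right)$, $p$ running over all primes; it is a commutative $\mathbb{Q}$-algebra (via the diagonal embedding of $\mathbb{Q}$), and an element is determined by its components at all but finitely many $p$. For an index, $\zeta_{\mathcal{A}}(k_1,\ldots,k_r)=\left(\sum_{0<n_1<\cdots<n_r\le p-1}\frac{1}{n_1^{k_1}\cdots n_r^{k_r}}\bmod p\right)_p\in\mathcal{A}$. Symmetric side. Multiple zeta values are $\zeta(k_1,\ldots,k_r)=\sum_{0<n_1<\cdots<n_r}n_1^{-k_1}\cdots n_r^{-k_r}$ ($k_r\ge2$); $\mathcal{Z}$ is the $\mathbb{Q}$-algebra generated by all of them and $\overline{\mathcal{Z}}=\mathcal{Z}/\zeta(2)\mathcal{Z}$.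 Let $\mathfrak{H}^1$ be the free noncommutative $\mathbb{Q}$-algebra on $e_1,e_2,e_3,\ldots$, with $e_{\boldsymbol{k}}=e_{k_1}\cdots e_{k_r}$, and equip it with the commutative harmonic product $\ast$ determined $\mathbb{Q}$-bilinearly by $w\ast1=1\ast w=w$ and $(w_1e_k)\ast(w_2e_l)=(w_1\ast w_2e_l)e_k+(w_1e_k\ast w_2)e_l+(w_1\ast w_2)e_{k+l}$. The harmonic regularized values $\zeta^{\ast}(\boldsymbol{k};T)=Z^{\ast}_T(e_{\boldsymbol{k}})\in\mathcal{Z}[T]$ are given by the unique $\mathbb{Q}$-algebra homomorphism $Z^{\ast}_T:(\mathfrak{H}^1,\ast)\to\mathbb{R}[T]$ with $Z^{\ast}_T(e_1)=T$ and $Z^{\ast}_T(e_{\boldsymbol{k}})=\zeta(\boldsymbol{k})$ whenever $\boldsymbol{k}=\varnothing$ or $k_r\ge2$. Put $$\zeta^{\ast}_{\mathcal{S}}(k_1,\ldots,k_r)=\sum_{i=0}^{r}(-1)^{k_{i+1}+\cdots+k_r}\zeta^{\ast}(k_1,\ldots,k_i;T)\,\zeta^{\ast}(k_r,\ldots,k_{i+1};T);$$ this is known to be independent of $T$, and $\zeta_{\mathcal{S}}(\boldsymbol{k})=\zeta^{\ast}_{\mathcal{S}}(\boldsymbol{k})\bmod\zeta(2)\mathcal{Z}\in\overline{\mathcal{Z}}$ (using shuffle-regularized values in place of harmonic-regularized ones gives the same element of $\overline{\mathcal{Z}}$). Interpolation: for $\mathcal{F}\in\{\mathcal{A},\mathcal{S}\}$,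 $\zeta^{t}_{\mathcal{F}}(\boldsymbol{k})=\sum_{\boldsymbol{l}\preceq\boldsymbol{k}}\zeta_{\mathcal{F}}(\boldsymbol{l})\,t^{r-\mathrm{dep}(\boldsymbol{l})}$, and $\zeta^{\frac12}_{\mathcal{F}}$ is the value at $t=\frac12$. For $k\ge2$: $\mathfrak{Z}_{\mathcal{A}}(k)=\left(\frac{B_{p-k}}{k}\bmod p\right)_p\in\mathcal{A}$, where $B_n$ are the Bernoulli numbers $\frac{te^t}{e^t-1}=\sum_{n\ge0}\frac{B_n}{n!}t^n$; and $\mathfrak{Z}_{\mathcal{S}}(k)=\zeta(k)\bmod\zeta(2)\mathcal{Z}\in\overline{\mathcal{Z}}$. *)

theory Defs
  imports
    "HOL-Analysis.Analysis"
    "HOL-Number_Theory.Modular_Inverse"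
    "HOL-Computational_Algebra.Computational_Algebra"
    "HOL-Library.Poly_Mapping"
begin

subsection \<open>Indices\<close>

text \<open>The weight and depth of an index \<open>ks\<close> are \<open>sum_list ks\<close> and \<open>length ks\<close>.\<close>

definition is_index :: "nat list \<Rightarrow> bool" where
  "is_index ks \<longleftrightarrow> 0 \<notin> set ks"

text \<open>Positions are counted from 1 in \<open>I\<^sub>i(k,r)\<close> and from 0 in lists.\<close>

definition index_set :: "nat \<Rightarrow> nat \<Rightarrow> nat \<Rightarrow> nat list set" where
  "index_set i k r = {ks. is_index ks \<and> sum_list ks = k \<and> length ks = r \<and> ks ! (i - 1) \<ge> 2}"

lemma finite_index_set: "finite (index_set i k r)"
proof (rule finite_subset)
  show "index_set i k r \<subseteq> {ks. set ks \<subseteq> {..k} \<and> length ks = r}"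
    by (auto simp: index_set_def member_le_sum_list)
  show "finite {ks. set ks \<subseteq> {..k} \<and> length ks = r}"
    by (rule finite_lists_length_eq) simp
qed

text \<open>One entry for each way of filling the boxes of \<open>(k\<^sub>1 \<box> \<dots> \<box> k\<^sub>r)\<close> with commas and pluses.\<close>

fun coarsenings :: "nat list \<Rightarrow> nat list list" where
  "coarsenings [] = [[]]"
| "coarsenings [k] = [[k]]"
| "coarsenings (k # l # ks) = map ((#) k) (coarsenings (l # ks)) @ coarsenings ((k + l) # ks)"

lemma length_coarsenings: "length (coarsenings ks) = 2 ^ (length ks - 1)"
  by (induction ks rule: coarsenings.induct) auto


subsection \<open>Rational algebras\<close>

text \<open>The class does not demand \<open>0 \<noteq> 1\<close>: it is not known that the ring of multiple zeta values
  modulo \<open>\<zeta>(2)\<close> is non-trivial.\<close>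

class rat_algebra = comm_ring + comm_monoid_mult +
  fixes scaleQ :: "rat \<Rightarrow> 'a \<Rightarrow> 'a" (infixr \<open>*\<^sub>Q\<close> 75)
  assumes scaleQ_add_right: "a *\<^sub>Q (x + y) = a *\<^sub>Q x + a *\<^sub>Q y"
    and scaleQ_add_left: "(a + b) *\<^sub>Q x = a *\<^sub>Q x + b *\<^sub>Q x"
    and scaleQ_scaleQ: "a *\<^sub>Q (b *\<^sub>Q x) = (a * b) *\<^sub>Q x"
    and scaleQ_one: "1 *\<^sub>Q x = x"
    and mult_scaleQ_left: "(a *\<^sub>Q x) * y = a *\<^sub>Q (x * y)"

definition interpolated :: "(nat list \<Rightarrow> 'a::rat_algebra) \<Rightarrow> rat \<Rightarrow> nat list \<Rightarrow> 'a" where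
  "interpolated z t ks = (\<Sum>l\<leftarrow>coarsenings ks. t ^ (length ks - length l) *\<^sub>Q z l)"


subsection \<open>Multiple zeta values modulo \<open>\<zeta>(2)\<close>\<close>

definition mzv :: "nat list \<Rightarrow> real" where
  "mzv ks = (\<Sum>\<^sub>\<infinity>ns\<in>{ns. length ns = length ks \<and> sorted_wrt (<) ns \<and> 0 \<notin> set ns}.
     \<Prod>i<length ks. 1 / real (ns ! i) ^ (ks ! i))"

definition admissible :: "nat list \<Rightarrow> bool" where
  "admissible ks \<longleftrightarrow> is_index ks \<and> (ks = [] \<or> last ks \<ge> 2)"

inductive_set mzv_algebra :: "real set" where
  rat: "of_rat q \<in> mzv_algebra"
| mzv: "admissible ks \<Longrightarrow> mzv ks \<in> mzv_algebra"
| add: "x \<in> mzv_algebra \<Longrightarrow> y \<in> mzv_algebra \<Longrightarrow> x + y \<in> mzv_algebra"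
| mult: "x \<in> mzv_algebra \<Longrightarrow> y \<in> mzv_algebra \<Longrightarrow> x * y \<in> mzv_algebra"

lemma mzv_algebra_uminus: "x \<in> mzv_algebra \<Longrightarrow> - x \<in> mzv_algebra"
  using mzv_algebra.mult[OF mzv_algebra.rat[of "-1"], of x] by simp

lemma mzv_algebra_diff: "x \<in> mzv_algebra \<Longrightarrow> y \<in> mzv_algebra \<Longrightarrow> x - y \<in> mzv_algebra"
  using mzv_algebra.add[OF _ mzv_algebra_uminus, of x y] by simp

lemma mzv_algebra_01: "0 \<in> mzv_algebra" "1 \<in> mzv_algebra"
  using mzv_algebra.rat[of 0] mzv_algebra.rat[of 1] by auto

definition mzv_rel :: "real \<Rightarrow> real \<Rightarrow> bool" where
  "mzv_rel x y \<longleftrightarrow> x \<in> mzv_algebra \<and> y \<in> mzv_algebra \<and> (\<exists>z\<in>mzv_algebra. x - y = mzv [2] * z)"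

lemma mzv_relI:
  "x \<in> mzv_algebra \<Longrightarrow> y \<in> mzv_algebra \<Longrightarrow> z \<in> mzv_algebra \<Longrightarrow> x - y = mzv [2] * z \<Longrightarrow> mzv_rel x y"
  by (auto simp: mzv_rel_def)

lemma mzv_relE:
  assumes "mzv_rel x y"
  obtains z where "x \<in> mzv_algebra" "y \<in> mzv_algebra" "z \<in> mzv_algebra" "x = y + mzv [2] * z"
proof -
  from assms obtain z where z: "x \<in> mzv_algebra" "y \<in> mzv_algebra" "z \<in> mzv_algebra"
    "x - y = mzv [2] * z"
    by (auto simp: mzv_rel_def)
  show thesis by (rule that[of z]) (use z in auto)
qed

lemma mzv_rel_refl: "x \<in> mzv_algebra \<Longrightarrow> mzv_rel x x"
  by (rule mzv_relI[of _ _ 0]) (auto simp: mzv_algebra_01)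

lemma part_equivp_mzv_rel: "part_equivp mzv_rel"
proof (rule part_equivpI)
  show "\<exists>x. mzv_rel x x"
    using mzv_rel_refl mzv_algebra_01 by blast
  show "symp mzv_rel"
  proof (rule sympI)
    fix x y assume "mzv_rel x y"
    then obtain z where "x \<in> mzv_algebra" "y \<in> mzv_algebra" "z \<in> mzv_algebra" "x = y + mzv [2] * z"
      by (rule mzv_relE)
    then show "mzv_rel y x"
      by (intro mzv_relI[of _ _ "- z"]) (auto simp: mzv_algebra_uminus)
  qed
  show "transp mzv_rel"
  proof (rule transpI)
    fix x y w assume "mzv_rel x y" "mzv_rel y w"
    then obtain z z' where "x \<in> mzv_algebra" "w \<in> mzv_algebra" "z \<in> mzv_algebra" "z' \<in> mzv_algebra"
      "x = y + mzv [2] * z" "y = w + mzv [2] * z'"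
      by (metis mzv_relE)
    then show "mzv_rel x w"
      by (intro mzv_relI[of _ _ "z + z'"]) (auto simp: mzv_algebra.add algebra_simps)
  qed
qed

text \<open>The quotient of \<open>mzv_algebra\<close> by the ideal generated by \<open>\<zeta>(2)\<close>. For \<open>x \<in> mzv_algebra\<close>,
  \<open>abs_zbar x\<close> is the residue class of \<open>x\<close>.\<close>

quotient_type zbar = real / partial: mzv_rel
  by (rule part_equivp_mzv_rel)

instantiation zbar :: rat_algebra
begin

lift_definition zero_zbar :: zbar is 0
  by (intro mzv_rel_refl mzv_algebra_01)

lift_definition one_zbar :: zbar is 1
  by (intro mzv_rel_refl mzv_algebra_01)

lift_definition plus_zbar :: "zbar \<Rightarrow> zbar \<Rightarrow> zbar" is "(+)"
proof -
  fix x x' y y' assume "mzv_rel x x'" "mzv_rel y y'"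
  then obtain z z' where "x \<in> mzv_algebra" "x' \<in> mzv_algebra" "y \<in> mzv_algebra" "y' \<in> mzv_algebra"
    "z \<in> mzv_algebra" "z' \<in> mzv_algebra" "x = x' + mzv [2] * z" "y = y' + mzv [2] * z'"
    by (metis mzv_relE)
  then show "mzv_rel (x + y) (x' + y')"
    by (intro mzv_relI[of _ _ "z + z'"] mzv_algebra.add) (auto simp: algebra_simps)
qed

lift_definition minus_zbar :: "zbar \<Rightarrow> zbar \<Rightarrow> zbar" is "(-)"
proof -
  fix x x' y y' assume "mzv_rel x x'" "mzv_rel y y'"
  then obtain z z' where "x \<in> mzv_algebra" "x' \<in> mzv_algebra" "y \<in> mzv_algebra" "y' \<in> mzv_algebra"
    "z \<in> mzv_algebra" "z' \<in> mzv_algebra" "x = x' + mzv [2] * z" "y = y' + mzv [2] * z'"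
    by (metis mzv_relE)
  then show "mzv_rel (x - y) (x' - y')"
    by (intro mzv_relI[of _ _ "z - z'"] mzv_algebra_diff) (auto simp: algebra_simps)
qed

lift_definition uminus_zbar :: "zbar \<Rightarrow> zbar" is uminus
proof -
  fix x x' assume "mzv_rel x x'"
  then obtain z where "x \<in> mzv_algebra" "x' \<in> mzv_algebra" "z \<in> mzv_algebra" "x = x' + mzv [2] * z"
    by (rule mzv_relE)
  then show "mzv_rel (- x) (- x')"
    by (intro mzv_relI[of _ _ "- z"] mzv_algebra_uminus) auto
qed

lift_definition times_zbar :: "zbar \<Rightarrow> zbar \<Rightarrow> zbar" is "(*)"
proof -
  fix x x' y y' assume "mzv_rel x x'" "mzv_rel y y'"
  then obtain z z' where *: "x \<in> mzv_algebra" "x' \<in> mzv_algebra" "y \<in> mzv_algebra" "y' \<in> mzv_algebra"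
    "z \<in> mzv_algebra" "z' \<in> mzv_algebra" "x = x' + mzv [2] * z" "y = y' + mzv [2] * z'"
    by (metis mzv_relE)
  have "x * y - x' * y' = mzv [2] * (x * z' + z * y')"
    by (simp add: *(7,8) algebra_simps)
  moreover have "x * z' + z * y' \<in> mzv_algebra"
    using * by (intro mzv_algebra.add mzv_algebra.mult)
  ultimately show "mzv_rel (x * y) (x' * y')"
    using * by (intro mzv_relI[of _ _ "x * z' + z * y'"] mzv_algebra.mult)
qed

lift_definition scaleQ_zbar :: "rat \<Rightarrow> zbar \<Rightarrow> zbar" is "\<lambda>q x. of_rat q * x"
proof -
  fix q :: rat and x x' assume "mzv_rel x x'"
  then obtain z where "x \<in> mzv_algebra" "x' \<in> mzv_algebra" "z \<in> mzv_algebra" "x = x' + mzv [2] * z"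
    by (rule mzv_relE)
  then show "mzv_rel (of_rat q * x) (of_rat q * x')"
    by (intro mzv_relI[of _ _ "of_rat q * z"] mzv_algebra.mult mzv_algebra.rat)
       (auto simp: algebra_simps)
qed

instance
proof
  have in_alg: "x \<in> mzv_algebra" if "mzv_rel x x" for x
    using that by (auto simp: mzv_rel_def)
  note [intro!] = mzv_rel_refl
    and [intro] = mzv_algebra_01 mzv_algebra.rat mzv_algebra.add mzv_algebra.mult
      mzv_algebra_uminus mzv_algebra_diff
    and [dest!] = in_alg
  fix x y z :: zbar and a b :: rat
  show "x + y + z = x + (y + z)"
    by transfer (auto simp: add.assoc)
  show "x + y = y + x"
    by transfer (auto simp: add.commute)
  show "0 + x = x"
    by transfer auto
  show "- x + x = 0"
    by transfer auto
  show "x - y = x + - y"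
    by transfer auto
  show "x * y * z = x * (y * z)"
    by transfer (auto simp: mult.assoc)
  show "x * y = y * x"
    by transfer (auto simp: mult.commute)
  show "(x + y) * z = x * z + y * z"
    by transfer (auto simp: ring_distribs)
  show "1 * x = x"
    by transfer auto
  show "a *\<^sub>Q (x + y) = a *\<^sub>Q x + a *\<^sub>Q y"
    by transfer (auto simp: ring_distribs)
  show "(a + b) *\<^sub>Q x = a *\<^sub>Q x + b *\<^sub>Q x"
    by transfer (auto simp: of_rat_add ring_distribs)
  show "a *\<^sub>Q (b *\<^sub>Q x) = (a * b) *\<^sub>Q x"
    by transfer (auto simp: of_rat_mult mult.assoc)
  show "1 *\<^sub>Q x = x"
    by transfer auto
  show "(a *\<^sub>Q x) * y = a *\<^sub>Q (x * y)"
    by transfer (auto simp: mult.assoc)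
qed

end


subsection \<open>The harmonic algebra and symmetric multiple zeta values\<close>

text \<open>The word \<open>e\<^sub>k\<^sub>1 \<dots> e\<^sub>k\<^sub>r\<close> is represented by the list \<open>[k\<^sub>1, \<dots>, k\<^sub>r]\<close>. Since there is no letter
  \<open>e\<^sub>0\<close>, the algebra is the subspace \<open>H1\<close> of the type \<open>hcomb\<close>.\<close>

type_synonym hcomb = "nat list \<Rightarrow>\<^sub>0 rat"

definition H1 :: "hcomb set" where
  "H1 = {x. \<forall>w\<in>Poly_Mapping.keys x. is_index w}"

definition word :: "nat list \<Rightarrow> hcomb" where
  "word ks = Poly_Mapping.single ks 1"

definition hscale :: "rat \<Rightarrow> hcomb \<Rightarrow> hcomb" where
  "hscale q = Poly_Mapping.map ((*) q)"

definition lin_ext :: "(nat list \<Rightarrow> hcomb) \<Rightarrow> hcomb \<Rightarrow> hcomb" where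
  "lin_ext f x = (\<Sum>w\<in>Poly_Mapping.keys x. hscale (Poly_Mapping.lookup x w) (f w))"

definition append_letter :: "hcomb \<Rightarrow> nat \<Rightarrow> hcomb" where
  "append_letter x k = lin_ext (\<lambda>w. word (w @ [k])) x"

function harmonic_words :: "nat list \<Rightarrow> nat list \<Rightarrow> hcomb" where
  "harmonic_words u v =
     (if u = [] then word v
      else if v = [] then word u
      else append_letter (harmonic_words (butlast u) v) (last u)
         + append_letter (harmonic_words u (butlast v)) (last v)
         + append_letter (harmonic_words (butlast u) (butlast v)) (last u + last v))"
  by auto
termination
  by (relation "Wellfounded.measure (\<lambda>(u, v). length u + length v)") (auto intro: add_less_le_mono)

declare harmonic_words.simps [simp del]

lemma harmonic_words_Nil: "harmonic_words [] v = word v" "harmonic_words u [] = word u"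
  by (auto simp: harmonic_words.simps)

lemma harmonic_words_snoc:
  "harmonic_words (u @ [k]) (v @ [l]) =
     append_letter (harmonic_words u (v @ [l])) k + append_letter (harmonic_words (u @ [k]) v) l
       + append_letter (harmonic_words u v) (k + l)"
  by (subst harmonic_words.simps) (simp add: add.commute)

definition harmonic :: "hcomb \<Rightarrow> hcomb \<Rightarrow> hcomb" where
  "harmonic x y = lin_ext (\<lambda>u. lin_ext (\<lambda>v. harmonic_words u v) y) x"

definition is_harmonic_regularization :: "(hcomb \<Rightarrow> real poly) \<Rightarrow> bool" where
  "is_harmonic_regularization Z \<longleftrightarrow>
     (\<forall>x\<in>H1. \<forall>y\<in>H1. Z (x + y) = Z x + Z y) \<and>
     (\<forall>q. \<forall>x\<in>H1. Z (hscale q x) = smult (of_rat q) (Z x)) \<and>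
     (\<forall>x\<in>H1. \<forall>y\<in>H1. Z (harmonic x y) = Z x * Z y) \<and>
     Z (word []) = 1 \<and>
     Z (word [1]) = [:0, 1:] \<and>
     (\<forall>ks. admissible ks \<longrightarrow> Z (word ks) = [:mzv ks:])"

text \<open>Such a map is unique on \<open>H1\<close>; \<open>extensional\<close> fixes its irrelevant values elsewhere.\<close>

definition harmonic_regularization :: "hcomb \<Rightarrow> real poly" where
  "harmonic_regularization = (THE Z. is_harmonic_regularization Z \<and> Z \<in> extensional H1)"

definition zeta_star :: "nat list \<Rightarrow> real poly" where
  "zeta_star ks = harmonic_regularization (word ks)"

definition zeta_star_S :: "nat list \<Rightarrow> real poly" where
  "zeta_star_S ks = (\<Sum>i\<le>length ks.
     (-1) ^ sum_list (drop i ks) * zeta_star (take i ks) * zeta_star (rev (drop i ks)))"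

text \<open>\<open>zeta_star_S ks\<close> is a constant polynomial with value in \<open>mzv_algebra\<close>.\<close>

definition zeta_S :: "nat list \<Rightarrow> zbar" where
  "zeta_S ks = abs_zbar (coeff (zeta_star_S ks) 0)"

definition frakZ_S :: "nat \<Rightarrow> zbar" where
  "frakZ_S k = abs_zbar (mzv [k])"


subsection \<open>The ring \<open>\<A>\<close> and finite multiple zeta values\<close>

text \<open>Elements of \<open>\<Prod>\<^sub>p \<int>/p\<int>\<close> are represented by families of integers, only whose entries at primes
  matter, and only modulo those primes.\<close>

definition adele_rel :: "(nat \<Rightarrow> int) \<Rightarrow> (nat \<Rightarrow> int) \<Rightarrow> bool" where
  "adele_rel f g \<longleftrightarrow> finite {p. prime p \<and> \<not> [f p = g p] (mod int p)}"

lemma adele_rel_mono: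
  assumes "adele_rel f g"
    and "\<And>p. prime p \<Longrightarrow> [f p = g p] (mod int p) \<Longrightarrow> [f' p = g' p] (mod int p)"
  shows "adele_rel f' g'"
  using assms(1) unfolding adele_rel_def
  by (rule rev_finite_subset) (use assms(2) in blast)

lemma adele_rel_mono2:
  assumes "adele_rel f g" "adele_rel f2 g2"
    and "\<And>p. prime p \<Longrightarrow> [f p = g p] (mod int p) \<Longrightarrow> [f2 p = g2 p] (mod int p) \<Longrightarrow>
           [f' p = g' p] (mod int p)"
  shows "adele_rel f' g'"
proof -
  have "finite ({p. prime p \<and> \<not> [f p = g p] (mod int p)} \<union> {p. prime p \<and> \<not> [f2 p = g2 p] (mod int p)})"
    using assms(1,2) by (simp add: adele_rel_def)
  then show ?thesis unfolding adele_rel_def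
    by (rule rev_finite_subset) (use assms(3) in blast)
qed

lemma adele_rel_refl: "adele_rel f f"
  by (simp add: adele_rel_def)

lemma equivp_adele_rel: "equivp adele_rel"
proof (rule equivpI)
  show "reflp adele_rel"
    by (simp add: reflpI adele_rel_refl)
  show "symp adele_rel"
    by (rule sympI) (erule adele_rel_mono, rule cong_sym)
  show "transp adele_rel"
    by (rule transpI) (erule (1) adele_rel_mono2, rule cong_trans)
qed

quotient_type ring_A = "nat \<Rightarrow> int" / adele_rel
  by (rule equivp_adele_rel)

text \<open>Reduction modulo \<open>p\<close> of a rational number whose denominator is prime to \<open>p\<close>. The other rational
  numbers get an arbitrary value; for the families below, and for a fixed rational scalar, this
  concerns only finitely many \<open>p\<close>.\<close>

definition rat_mod :: "nat \<Rightarrow> rat \<Rightarrow> int" where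
  "rat_mod p q = fst (quotient_of q) * modular_inverse (int p) (snd (quotient_of q)) mod int p"

lemma rat_mod_unique:
  assumes "prime p" "q = of_int a / of_int b" "\<not> int p dvd b" "[b * c = a] (mod int p)"
  shows "[rat_mod p q = c] (mod int p)"
proof -
  obtain n d where nd: "quotient_of q = (n, d)" by fastforce
  have d: "d > 0" "coprime n d" "q = of_int n / of_int d"
    using quotient_of_denom_pos[OF nd] quotient_of_coprime[OF nd] quotient_of_div[OF nd] by auto
  have b: "b \<noteq> 0" using assms(3) by auto
  have "(of_int (n * b) :: rat) = of_int (a * d)"
    using assms(2) d b by (simp add: field_simps)
  then have eq: "n * b = a * d" by (simp only: of_int_eq_iff)
  have "d dvd b"
    using eq d(2) by (metis coprime_commute coprime_dvd_mult_right_iff dvd_triv_right)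
  then have "\<not> int p dvd d" using assms(3) dvd_trans by blast
  have cop: "coprime d (int p)" "coprime b (int p)"
    using \<open>prime p\<close> \<open>\<not> int p dvd d\<close> assms(3)
    by (simp_all add: prime_imp_coprime coprime_commute[of _ "int p"])
  have "[b * (n * modular_inverse (int p) d) = a * (d * modular_inverse (int p) d)] (mod int p)"
    unfolding mult.assoc[symmetric] using eq by (simp add: mult.commute)
  also have "[a * (d * modular_inverse (int p) d) = a * 1] (mod int p)"
    by (intro cong_mult cong_refl cong_modular_inverse1 cop)
  also have "[a * 1 = b * c] (mod int p)"
    using assms(4) by (simp add: cong_sym)
  finally have "[n * modular_inverse (int p) d = c] (mod int p)"
    using cop(2) by (simp add: cong_mult_lcancel)
  then show ?thesis by (simp add: rat_mod_def nd cong_def)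
qed

lemma rat_mod_denom:
  assumes "prime p" "\<not> int p dvd snd (quotient_of q)"
  shows "[snd (quotient_of q) * rat_mod p q = fst (quotient_of q)] (mod int p)"
proof -
  have "coprime (snd (quotient_of q)) (int p)"
    using assms by (simp add: prime_imp_coprime coprime_commute[of _ "int p"])
  then have "[fst (quotient_of q) * (snd (quotient_of q) * modular_inverse (int p) (snd (quotient_of q)))
      = fst (quotient_of q) * 1] (mod int p)"
    by (intro cong_mult cong_refl cong_modular_inverse1)
  then show ?thesis
    unfolding rat_mod_def cong_def by (simp add: mod_mult_right_eq mult.left_commute)
qed

lemma finite_denom_primes: "finite {p. prime p \<and> int p dvd snd (quotient_of q)}"
proof (rule finite_subset)
  have pos: "snd (quotient_of q) > 0" by (rule quotient_of_denom_pos')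
  show "{p. prime p \<and> int p dvd snd (quotient_of q)} \<subseteq> {..nat (snd (quotient_of q))}"
  proof clarsimp
    fix p :: nat assume "int p dvd snd (quotient_of q)"
    from zdvd_imp_le[OF this pos] show "p \<le> nat (snd (quotient_of q))" by linarith
  qed
qed simp

lemma adele_rel_denoms:
  assumes "\<And>p. prime p \<Longrightarrow> \<not> int p dvd snd (quotient_of a) \<Longrightarrow> \<not> int p dvd snd (quotient_of b) \<Longrightarrow>
             [f p = g p] (mod int p)"
  shows "adele_rel f g"
proof -
  have "finite ({p. prime p \<and> int p dvd snd (quotient_of a)} \<union> {p. prime p \<and> int p dvd snd (quotient_of b)})"
    by (simp add: finite_denom_primes)
  then show ?thesis unfolding adele_rel_def
    by (rule rev_finite_subset) (use assms in blast)
qed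

lemma rat_mod_add_mult:
  assumes p: "prime p" "\<not> int p dvd snd (quotient_of a)" "\<not> int p dvd snd (quotient_of b)"
  shows "[rat_mod p (a + b) = rat_mod p a + rat_mod p b] (mod int p)"
    and "[rat_mod p (a * b) = rat_mod p a * rat_mod p b] (mod int p)"
proof -
  obtain n d where nd: "quotient_of a = (n, d)" by fastforce
  obtain n' d' where nd': "quotient_of b = (n', d')" by fastforce
  have eq: "a = of_int n / of_int d" "b = of_int n' / of_int d'" "d > 0" "d' > 0"
    using quotient_of_div[OF nd] quotient_of_div[OF nd']
      quotient_of_denom_pos[OF nd] quotient_of_denom_pos[OF nd'] by auto
  have c: "[d * rat_mod p a = n] (mod int p)" "[d' * rat_mod p b = n'] (mod int p)"
    using rat_mod_denom[OF p(1,2)] rat_mod_denom[OF p(1,3)] by (simp_all add: nd nd')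
  have dd: "\<not> int p dvd d * d'"
    using p by (simp add: nd nd' prime_dvd_mult_iff)
  show "[rat_mod p (a + b) = rat_mod p a + rat_mod p b] (mod int p)"
  proof (rule rat_mod_unique[OF p(1) _ dd])
    show "a + b = of_int (n * d' + n' * d) / of_int (d * d')"
      using eq by (simp add: field_simps)
    have "[d' * (d * rat_mod p a) + d * (d' * rat_mod p b) = d' * n + d * n'] (mod int p)"
      by (intro cong_add cong_mult cong_refl c)
    then show "[d * d' * (rat_mod p a + rat_mod p b) = n * d' + n' * d] (mod int p)"
      by (simp add: algebra_simps)
  qed
  show "[rat_mod p (a * b) = rat_mod p a * rat_mod p b] (mod int p)"
  proof (rule rat_mod_unique[OF p(1) _ dd])
    show "a * b = of_int (n * n') / of_int (d * d')"
      using eq by simp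
    have "[(d * rat_mod p a) * (d' * rat_mod p b) = n * n'] (mod int p)"
      by (intro cong_mult c)
    then show "[d * d' * (rat_mod p a * rat_mod p b) = n * n'] (mod int p)"
      by (simp add: algebra_simps)
  qed
qed

lemma rat_mod_1: "prime p \<Longrightarrow> [rat_mod p 1 = 1] (mod int p)"
  by (rule rat_mod_unique[of p 1 1 1]) (auto dest: prime_gt_1_nat)

lemma adele_rel_scale_add:
  "adele_rel (\<lambda>p. rat_mod p (a + b) * f p) (\<lambda>p. rat_mod p a * f p + rat_mod p b * f p)"
  unfolding distrib_right[symmetric]
  by (rule adele_rel_denoms[of a b]) (intro cong_mult cong_refl rat_mod_add_mult)

lemma adele_rel_scale_mult:
  "adele_rel (\<lambda>p. rat_mod p a * (rat_mod p b * f p)) (\<lambda>p. rat_mod p (a * b) * f p)"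
  unfolding mult.assoc[symmetric]
  by (rule adele_rel_denoms[of a b]) (intro cong_mult cong_refl cong_sym[OF rat_mod_add_mult(2)])

instantiation ring_A :: rat_algebra
begin

lift_definition zero_ring_A :: ring_A is "\<lambda>_. 0" .

lift_definition one_ring_A :: ring_A is "\<lambda>_. 1" .

lift_definition plus_ring_A :: "ring_A \<Rightarrow> ring_A \<Rightarrow> ring_A" is "\<lambda>f g p. f p + g p"
  by (erule (1) adele_rel_mono2) (rule cong_add)

lift_definition minus_ring_A :: "ring_A \<Rightarrow> ring_A \<Rightarrow> ring_A" is "\<lambda>f g p. f p - g p"
  by (erule (1) adele_rel_mono2) (rule cong_diff)

lift_definition uminus_ring_A :: "ring_A \<Rightarrow> ring_A" is "\<lambda>f p. - f p"
  by (erule adele_rel_mono) (simp add: cong_minus_minus_iff)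

lift_definition times_ring_A :: "ring_A \<Rightarrow> ring_A \<Rightarrow> ring_A" is "\<lambda>f g p. f p * g p"
  by (erule (1) adele_rel_mono2) (rule cong_mult)

lift_definition scaleQ_ring_A :: "rat \<Rightarrow> ring_A \<Rightarrow> ring_A" is "\<lambda>q f p. rat_mod p q * f p"
  by (erule adele_rel_mono) (rule cong_mult[OF cong_refl])

instance
proof
  fix x y z :: ring_A and a b :: rat
  show "x + y + z = x + (y + z)"
    by transfer (simp add: add.assoc adele_rel_refl)
  show "x + y = y + x"
    by transfer (simp add: add.commute adele_rel_refl)
  show "0 + x = x"
    by transfer (simp add: adele_rel_refl)
  show "- x + x = 0"
    by transfer (simp add: adele_rel_refl)
  show "x - y = x + - y"
    by transfer (simp add: adele_rel_refl)
  show "x * y * z = x * (y * z)"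
    by transfer (simp add: mult.assoc adele_rel_refl)
  show "x * y = y * x"
    by transfer (simp add: mult.commute adele_rel_refl)
  show "(x + y) * z = x * z + y * z"
    by transfer (simp add: ring_distribs adele_rel_refl)
  show "1 * x = x"
    by transfer (simp add: adele_rel_refl)
  show "a *\<^sub>Q (x + y) = a *\<^sub>Q x + a *\<^sub>Q y"
    by transfer (simp add: ring_distribs adele_rel_refl)
  show "(a + b) *\<^sub>Q x = a *\<^sub>Q x + b *\<^sub>Q x"
    by transfer (rule adele_rel_scale_add)
  show "a *\<^sub>Q (b *\<^sub>Q x) = (a * b) *\<^sub>Q x"
    by transfer (rule adele_rel_scale_mult)
  show "1 *\<^sub>Q x = x"
  proof transfer
    fix x :: "nat \<Rightarrow> int"
    show "adele_rel (\<lambda>p. rat_mod p 1 * x p) x"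
    proof (rule adele_rel_denoms[of 1 1])
      fix p :: nat assume "prime p"
      from cong_mult[OF rat_mod_1[OF this] cong_refl, of "x p"]
      show "[rat_mod p 1 * x p = x p] (mod int p)" by simp
    qed
  qed
  show "(a *\<^sub>Q x) * y = a *\<^sub>Q (x * y)"
    by transfer (simp add: mult.assoc adele_rel_refl)
qed

end

text \<open>The class of the family \<open>(f p mod p)\<^sub>p\<close>.\<close>

definition family_A :: "(nat \<Rightarrow> rat) \<Rightarrow> ring_A" where
  "family_A f = abs_ring_A (\<lambda>p. rat_mod p (f p))"

definition mult_harmonic_sum :: "nat \<Rightarrow> nat list \<Rightarrow> rat" where
  "mult_harmonic_sum N ks =
     (\<Sum>ns\<in>{ns. length ns = length ks \<and> sorted_wrt (<) ns \<and> set ns \<subseteq> {1..N}}.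
        \<Prod>i<length ks. 1 / of_nat (ns ! i) ^ (ks ! i))"

definition zeta_A :: "nat list \<Rightarrow> ring_A" where
  "zeta_A ks = family_A (\<lambda>p. mult_harmonic_sum (p - 1) ks)"

text \<open>Bernoulli numbers with generating function \<open>t e\<^sup>t / (e\<^sup>t - 1)\<close>, so that \<open>bernoulli 1 = 1/2\<close>.\<close>

definition bernoulli :: "nat \<Rightarrow> rat" where
  "bernoulli n = fact n * fps_nth (fps_X * fps_exp 1 / (fps_exp 1 - 1)) n"

lemma bernoulli_egf:
  "Abs_fps (\<lambda>n. bernoulli n / fact n) * (fps_exp 1 - 1) = fps_X * fps_exp 1"
proof -
  have "fps_nth (fps_exp 1 - 1 :: rat fps) 0 = 0" "fps_nth (fps_exp 1 - 1 :: rat fps) 1 \<noteq> 0"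
    by simp_all
  then have nz: "(fps_exp 1 - 1 :: rat fps) \<noteq> 0" and "subdegree (fps_exp 1 - 1 :: rat fps) = 1"
    by (fastforce, intro subdegreeI, auto)
  then have "(fps_exp 1 - 1 :: rat fps) dvd fps_X * fps_exp 1"
    using nz by (subst fps_dvd_iff) auto
  moreover have "Abs_fps (\<lambda>n. bernoulli n / fact n) = fps_X * fps_exp 1 / (fps_exp 1 - 1)"
    by (rule fps_ext) (simp add: bernoulli_def)
  ultimately show ?thesis by simp
qed

definition frakZ_A :: "nat \<Rightarrow> ring_A" where
  "frakZ_A k = family_A (\<lambda>p. bernoulli (p - k) / of_nat k)"

end

theory Submission
  imports Defs
begin

text \<open>Both families of values come from one kind of nested sum: for a list \<open>M\<close> of nonzero numbers,
\<open>chain_sum M ks\<close> runs over increasing positions in \<open>M\<close>. The list \<open>1, \<dots>, p - 1\<close> gives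
\<open>\<zeta>\<^sub>A\<close> modulo \<open>p\<close>. The list \<open>1, \<dots>, N, -N, \<dots>, -1\<close> gives sums that converge to \<open>\<zeta>\<^sub>S\<close>
as \<open>N\<close> grows, because cutting a nested sum between \<open>N\<close> and \<open>-N\<close> produces exactly the alternating
convolution in the definition of \<open>zeta_star_S\<close>. So both statements concern the generating function
\<open>marked_gf y z w M\<close>, in which a formal variable \<open>X\<close> records the weight, \<open>y\<close> and \<open>z\<close> count the entries before and
after a marked entry, and the marked entry \<open>k\<^sub>i\<close> carries the factor \<open>w k\<^sub>i\<close>.

At the parameter \<open>1/2\<close>, prepending one number \<open>m\<close> to \<open>M\<close> multiplies the unmarked generating function by
\<open>(m - X + y X / 2) / (m - X - y X / 2)\<close> (\<open>chain_gf_eq\<close>), so the marked one is a sum over the marked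
number of products of such quotients (\<open>marked_gf_eq\<close>). For \<open>w k = 2 ^ (k - 2) - 1\<close> its terms are those of
a well-poised hypergeometric series, and for \<open>w k = 1\<close> (\<open>k \<ge> 2\<close>) those of a series of Gauss type. Both
have closed evaluations as sums of partial fractions \<open>1 / (i + u X)\<close>, proved from explicit telescoping
certificates (\<open>wp_sum_finite\<close>, \<open>wp_sum_terminating\<close>, \<open>gauss_sum_finite\<close>, \<open>gauss_sum_terminating\<close>).

On the symmetric side the limit \<open>N \<rightarrow> \<infinity>\<close> turns the partial fractions into power series with coefficients
\<open>\<plusminus>\<zeta>(k)\<close> times a rational number (\<open>wp_sum_tendsto\<close>, \<open>gauss_sum_tendsto\<close>). The remaining factors are quotients of sine
products, whose nonconstant coefficients are rational multiples of powers of \<open>\<zeta>(2)\<close>; hence they are 1 modulo \<open>\<zeta>(2)\<close>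
(\<open>sinc_quot_I\<close>). That the limits really represent \<open>\<zeta>\<^sub>S\<close> needs the description of the harmonic
regularization as the asymptotic expansion of nested sums in powers of the harmonic numbers
(\<open>harmonic_regularization_eq\<close>, \<open>zeta_star_S_asymptotic\<close>).

On the finite side the hypergeometric sum over \<open>1 \<le> n < p\<close> is, up to a denominator that is easily controlled, a
polynomial of degree less than \<open>p\<close> in one parameter. Modulo \<open>p\<close> it is determined by its values at the negative integers (\<open>interpolation\<close>), where
the series terminates and the evaluation applies. The result is a double sum over \<open>1 \<le> i \<le> j < p\<close>, and
Faulhaber's formula reduces such sums to the Bernoulli number \<open>B\<^bsub>p-k\<^esub>\<close> (\<open>double_sum\<close>).

For even \<open>k\<close> all coefficients vanish with \<open>frakZ_A k\<close> and \<open>frakZ_S k\<close>. For odd \<open>k\<close> the marked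
generating function in weight \<open>k\<close> is in both cases the same rational function of \<open>y\<close> and \<open>z\<close>,
\<open>kappa_main\<close> or \<open>kappa_sum\<close>, times \<open>frakZ_A k\<close> or \<open>frakZ_S k\<close>. This function is a polynomial whose
coefficients are built from the powers of two and partial sums of binomial coefficients in the theorem (\<open>kappa_main_polynomial\<close>,
\<open>kappa_sum_polynomial\<close>), and comparing coefficients in \<open>y\<close> and \<open>z\<close> isolates a single depth and
position. The second formula follows since \<open>2 ^ k = 4 * (2 ^ (k - 2) - 1) + 4\<close>.\<close>

unbundle no vec_syntax

section \<open>Nested sums and their generating functions\<close>

text \<open>The sum of \<open>\<Prod> 1 / M ! n\<^sub>i ^ k\<^sub>i\<close> over positions \<open>n\<^sub>1 < \<dots> < n\<^sub>r\<close> of \<open>M\<close>, defined by deciding whether the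
first position is used; this recursion is what the generating functions follow.\<close>

fun chain_sum :: "'a::field list \<Rightarrow> nat list \<Rightarrow> 'a" where
  "chain_sum M [] = 1"
| "chain_sum [] (k # ks) = 0"
| "chain_sum (m # M) (k # ks) = chain_sum M (k # ks) + chain_sum M ks / m ^ k"

definition half_chain_sum :: "'a::field list \<Rightarrow> nat list \<Rightarrow> 'a" where
  "half_chain_sum M ks = (\<Sum>l\<leftarrow>coarsenings ks. (1/2) ^ (length ks - length l) * chain_sum M l)"

text \<open>The contribution to \<open>half_chain_sum (m # M)\<close> of the coarsenings whose first part is placed on \<open>m\<close>. Each
further entry merged into that first part costs a factor \<open>1/2\<close>, which is the second summand.\<close>

fun head_sum :: "'a::field \<Rightarrow> 'a list \<Rightarrow> nat list \<Rightarrow> 'a" where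
  "head_sum m M [] = 0"
| "head_sum m M (k # ks) = (half_chain_sum M ks + head_sum m M ks / 2) / m ^ k"

lemma coarsenings_length_le: "l \<in> set (coarsenings ks) \<Longrightarrow> length l \<le> length ks"
  by (induction ks arbitrary: l rule: coarsenings.induct) fastforce+

lemma coarsenings_nonempty: "ks \<noteq> [] \<Longrightarrow> l \<in> set (coarsenings ks) \<Longrightarrow> l \<noteq> []"
  by (induction ks arbitrary: l rule: coarsenings.induct) auto

lemma head_sum_coarsenings:
  "(\<Sum>l\<leftarrow>coarsenings (k # ks). (1/2) ^ (length (k # ks) - length l) * (chain_sum M (tl l) / m ^ hd l))
     = head_sum m M (k # ks)"
proof (induction ks arbitrary: k)
  case Nil
  show ?case by (simp add: half_chain_sum_def)
next
  case (Cons l ks)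
  let ?S = "\<lambda>k. (\<Sum>w\<leftarrow>coarsenings (k # ks). (1/2) ^ (length (k # ks) - length w) * (chain_sum M (tl w) / m ^ hd w))"
  have hd_shift: "map (\<lambda>w. (hd w + k, tl w)) (coarsenings (l # ks)) = map (\<lambda>w. (hd w, tl w)) (coarsenings ((k + l) # ks))" for k l ks
  proof (induction ks arbitrary: k l)
    case (Cons j ks)
    have "map (\<lambda>w. (hd w + k, tl w)) (coarsenings ((l + j) # ks)) = map (\<lambda>w. (hd w, tl w)) (coarsenings ((k + (l + j)) # ks))"
      by (rule Cons.IH)
    then show ?case by (simp add: comp_def add_ac)
  qed (simp add: add.commute)
  have merge: "?S (k + l) = ?S l / m ^ k"
  proof -
    have len: "length ks - length (tl w) = length (a # ks) - length w" if "w \<in> set (coarsenings (a # ks))" for a w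
      using coarsenings_nonempty[OF _ that] by (cases w) auto
    have g: "?S a = sum_list (map (\<lambda>(h, t). (1/2) ^ (length ks - length t) * (chain_sum M t / m ^ h))
              (map (\<lambda>w. (hd w, tl w)) (coarsenings (a # ks))))" for a
      unfolding map_map comp_def
      by (intro arg_cong[of _ _ sum_list] map_cong refl) (simp only: case_prod_conv len)
    have "?S (k + l) = sum_list (map (\<lambda>(h, t). (1/2) ^ (length ks - length t) * (chain_sum M t / m ^ h))
              (map (\<lambda>w. (hd w + k, tl w)) (coarsenings (l # ks))))"
      unfolding g hd_shift ..
    also have "\<dots> = (\<Sum>w\<leftarrow>coarsenings (l # ks). ((1/2) ^ (length (l # ks) - length w) * (chain_sum M (tl w) / m ^ hd w)) * inverse (m ^ k))"
      unfolding map_map comp_def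
      by (intro arg_cong[of _ _ sum_list] map_cong refl)
         (simp only: case_prod_conv len[of _ l] power_add divide_inverse inverse_mult_distrib mult.assoc)
    also have "\<dots> = ?S l / m ^ k"
      by (simp only: sum_list_mult_const divide_inverse)
    finally show ?thesis .
  qed
  have "(\<Sum>w\<leftarrow>coarsenings (k # l # ks). (1/2) ^ (length (k # l # ks) - length w) * (chain_sum M (tl w) / m ^ hd w))
     = (\<Sum>w\<leftarrow>coarsenings (l # ks). ((1/2) ^ (length (l # ks) - length w) * chain_sum M w) * inverse (m ^ k))
       + (\<Sum>w\<leftarrow>coarsenings ((k + l) # ks). (1/2) * ((1/2) ^ (length (l # ks) - length w) * (chain_sum M (tl w) / m ^ hd w)))"
  proof -
    have "(1/2) ^ (length (k # l # ks) - length w) = (1/2) * (1/2 :: 'a) ^ (length (l # ks) - length w)"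
      if "w \<in> set (coarsenings ((k + l) # ks))" for w
      using coarsenings_length_le[OF that] by (simp add: Suc_diff_le)
    then have *: "map (\<lambda>w. (1/2) ^ (length (k # l # ks) - length w) * (chain_sum M (tl w) / m ^ hd w)) (coarsenings ((k + l) # ks))
       = map (\<lambda>w. (1/2) * ((1/2) ^ (length (l # ks) - length w) * (chain_sum M (tl w) / m ^ hd w))) (coarsenings ((k + l) # ks))"
      by (intro map_cong refl) (simp only: mult.assoc)
    show ?thesis
      unfolding coarsenings.simps(3) map_append sum_list_append *
      unfolding map_map comp_def list.sel length_Cons diff_Suc_Suc divide_inverse mult.assoc ..
  qed
  also have "\<dots> = half_chain_sum M (l # ks) * inverse (m ^ k) + (1/2) * ?S (k + l)"
    by (simp only: half_chain_sum_def sum_list_mult_const sum_list_const_mult length_Cons)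
  also have "\<dots> = head_sum m M (k # l # ks)"
    unfolding merge Cons.IH
    by (simp add: algebra_simps add_divide_distrib power_add, simp only: divide_inverse mult.commute)
  finally show ?case .
qed

lemma half_chain_sum_Cons: "half_chain_sum (m # M) ks = half_chain_sum M ks + head_sum m M ks"
proof (cases ks)
  case (Cons k ks')
  have "map (\<lambda>l. (1/2) ^ (length ks - length l) * chain_sum (m # M) l) (coarsenings ks)
     = map (\<lambda>l. (1/2) ^ (length ks - length l) * chain_sum M l + (1/2) ^ (length ks - length l) * (chain_sum M (tl l) / m ^ hd l)) (coarsenings ks)"
  proof (intro map_cong refl)
    fix l assume "l \<in> set (coarsenings ks)"
    then have "l \<noteq> []"
      using coarsenings_nonempty[of ks l] Cons by blast
    then obtain j l' where "l = j # l'"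
      by (cases l) auto
    then show "(1/2) ^ (length ks - length l) * chain_sum (m # M) l = (1/2) ^ (length ks - length l) * chain_sum M l + (1/2) ^ (length ks - length l) * (chain_sum M (tl l) / m ^ hd l)"
      by (simp add: distrib_left)
  qed
  then have "half_chain_sum (m # M) ks = half_chain_sum M ks
     + (\<Sum>l\<leftarrow>coarsenings ks. (1/2) ^ (length ks - length l) * (chain_sum M (tl l) / m ^ hd l))"
    by (simp only: half_chain_sum_def sum_list_addf)
  then show ?thesis
    using head_sum_coarsenings[where k = k and ks = ks' and M = M and m = m] unfolding Cons by simp
qed (simp add: half_chain_sum_def)

lemma half_chain_sum_Nil:
  "half_chain_sum (M :: 'a::field list) [] = 1" "half_chain_sum ([] :: 'a list) (k # ks) = 0"
proof -
  show "half_chain_sum M [] = 1" by (simp add: half_chain_sum_def)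
  have "chain_sum ([] :: 'a list) l = 0" if "l \<in> set (coarsenings (k # ks))" for l
    using coarsenings_nonempty[OF _ that] by (cases l) auto
  then have "map (\<lambda>l. (1/2) ^ (length (k # ks) - length l) * chain_sum ([] :: 'a list) l) (coarsenings (k # ks)) = map (\<lambda>_. 0) (coarsenings (k # ks))"
    by (intro map_cong refl) simp
  then show "half_chain_sum ([] :: 'a list) (k # ks) = 0"
    unfolding half_chain_sum_def by (simp only: sum_list_0)
qed

definition indices :: "nat \<Rightarrow> nat list set" where
  "indices k = {ks. is_index ks \<and> sum_list ks = k}"

lemma indices_0: "indices 0 = {[]}"
  by (auto simp: indices_def is_index_def) (metis list.set_intros(1) neq_Nil_conv)

lemma indices_rec: "k > 0 \<Longrightarrow> indices k = (\<Union>j\<in>{1..k}. (#) j ` indices (k - j))"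
proof (intro equalityI subsetI)
  fix ks assume "k > 0" "ks \<in> indices k"
  then obtain j l where "ks = j # l" by (cases ks) (auto simp: indices_def)
  with \<open>ks \<in> indices k\<close> show "ks \<in> (\<Union>j\<in>{1..k}. (#) j ` indices (k - j))"
    by (auto simp: indices_def is_index_def intro!: bexI[of _ j])
qed (auto simp: indices_def is_index_def)

lemma finite_indices: "finite (indices k)"
proof (induction k rule: less_induct)
  case (less k)
  then show ?case by (cases "k = 0") (auto simp: indices_0 indices_rec)
qed

lemma sum_indices:
  assumes "k > 0"
  shows "(\<Sum>ks\<in>indices k. f ks) = (\<Sum>j=1..k. \<Sum>ks\<in>indices (k - j). f (j # ks))"
proof -
  have "(\<Sum>ks\<in>indices k. f ks) = (\<Sum>j=1..k. \<Sum>ks\<in>(#) j ` indices (k - j). f ks)"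
    unfolding indices_rec[OF assms] by (intro sum.UNION_disjoint) (auto simp: finite_indices)
  also have "\<dots> = (\<Sum>j=1..k. \<Sum>ks\<in>indices (k - j). f (j # ks))"
    by (simp add: sum.reindex)
  finally show ?thesis .
qed

text \<open>The ordinary generating function by weight of a function of indices.\<close>

definition gen :: "(nat list \<Rightarrow> 'a) \<Rightarrow> 'a::field fps" where
  "gen f = Abs_fps (\<lambda>k. \<Sum>ks\<in>indices k. f ks)"

lemma gen_add: "gen (\<lambda>ks. f ks + g ks) = gen f + gen g"
  by (intro fps_ext) (simp add: gen_def sum.distrib)

lemma gen_cmult: "gen (\<lambda>ks. c * f ks) = fps_const c * gen f"
  by (intro fps_ext) (simp add: gen_def sum_distrib_left)

definition letters :: "(nat \<Rightarrow> 'a) \<Rightarrow> 'a::field fps" where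
  "letters w = Abs_fps (\<lambda>j. if j = 0 then 0 else w j)"

lemma gen_Cons:
  assumes "\<And>j ks. j \<ge> 1 \<Longrightarrow> f (j # ks) = w j * g ks + v j * h ks"
  shows "gen f = fps_const (f []) + letters w * gen g + letters v * gen h"
proof (rule fps_ext)
  fix k
  show "gen f $ k = (fps_const (f []) + letters w * gen g + letters v * gen h) $ k"
  proof (cases "k = 0")
    case False
    have eq: "{0..k} = insert 0 {1..k}" by auto
    show ?thesis using False
      by (simp add: gen_def letters_def fps_mult_nth sum_indices assms eq sum_distrib_left sum.distrib)
  qed (simp add: gen_def letters_def indices_0)
qed

definition geo :: "'a::field \<Rightarrow> 'a fps" where
  "geo m = letters (\<lambda>j. 1 / m ^ j)"

text \<open>The linear power series \<open>m + u X\<close>; all factors below are of this form or inverses of it.\<close>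

definition lin :: "'a::field \<Rightarrow> 'a \<Rightarrow> 'a fps" where
  "lin m u = fps_const m + fps_const u * fps_X"

lemma lin_nth: "lin m u $ n = (if n = 0 then m else if n = 1 then u else 0)"
  by (simp add: lin_def fps_X_def)

lemma lin_mult_nth: "(lin m u * f) $ n = (if n = 0 then m * f $ 0 else m * f $ n + u * f $ (n - 1))"
  unfolding lin_def by (simp add: distrib_right mult.assoc)

lemma geo_lin: "m \<noteq> 0 \<Longrightarrow> lin m (-1) * geo m = fps_X"
  by (rule fps_ext) (auto simp: lin_mult_nth geo_def letters_def fps_X_def field_simps power_eq_if)

definition mark :: "'a::field \<Rightarrow> 'a \<Rightarrow> (nat \<Rightarrow> 'a) \<Rightarrow> (nat list \<Rightarrow> 'a) \<Rightarrow> nat list \<Rightarrow> 'a" where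
  "mark y z w f ks = (\<Sum>i<length ks. y ^ i * z ^ (length ks - 1 - i) * w (ks ! i) * f ks)"

definition chain_gf :: "'a::field \<Rightarrow> 'a list \<Rightarrow> 'a fps" where
  "chain_gf y M = gen (\<lambda>ks. y ^ length ks * half_chain_sum M ks)"

definition marked_gf :: "'a::field \<Rightarrow> 'a \<Rightarrow> (nat \<Rightarrow> 'a) \<Rightarrow> 'a list \<Rightarrow> 'a fps" where
  "marked_gf y z w M = gen (mark y z w (half_chain_sum M))"

text \<open>Write \<open>C\<close> for the generating function of \<open>M\<close> and \<open>Q\<close> for that of \<open>head_sum m M\<close>. Splitting off the first entry,
which contributes \<open>X / (m - X)\<close>, gives \<open>Q (m - X) = y X (C + Q / 2)\<close>, a linear equation for \<open>Q\<close>. The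
weight \<open>1/2\<close> makes the resulting factor of \<open>C\<close> a quotient that is symmetric under \<open>y \<mapsto> -y\<close> up to inversion.\<close>

lemma chain_gf_Cons:
  fixes m :: "'a::field_char_0"
  assumes "m \<noteq> 0"
  shows "chain_gf y (m # M) * lin m (- 1 - y / 2) = chain_gf y M * lin m (- 1 + y / 2)"
    and "(chain_gf y M + fps_const (1/2) * gen (\<lambda>ks. y ^ length ks * head_sum m M ks)) * lin m (- 1 - y / 2)
           = chain_gf y M * lin m (- 1)"
proof -
  define Q where "Q = gen (\<lambda>ks. y ^ length ks * head_sum m M ks)"
  define P where "P = chain_gf y M"
  have P': "chain_gf y (m # M) = P + Q"
    by (simp add: P_def Q_def chain_gf_def half_chain_sum_Cons distrib_left gen_add)
  have "Q = fps_const 0 + letters (\<lambda>j. y / m ^ j) * P + letters (\<lambda>j. y / 2 / m ^ j) * Q"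
    unfolding Q_def P_def chain_gf_def
    by (subst gen_Cons[where g = "\<lambda>ks. y ^ length ks * half_chain_sum M ks"
          and h = "\<lambda>ks. y ^ length ks * head_sum m M ks"
          and w = "\<lambda>j. y / m ^ j" and v = "\<lambda>j. y / 2 / m ^ j"])
       (auto simp: algebra_simps add_divide_distrib)
  moreover have "letters (\<lambda>j. c / m ^ j) = fps_const c * geo m" for c
    by (rule fps_ext) (simp add: letters_def geo_def)
  ultimately have "Q = fps_const 0 + fps_const y * geo m * P + fps_const (y / 2) * geo m * Q"
    by (simp only:)
  then have Q: "Q = geo m * (fps_const y * P + fps_const (y / 2) * Q)"
    by (simp add: algebra_simps)
  have "lin m (-1) * Q = (lin m (-1) * geo m) * (fps_const y * P + fps_const (y / 2) * Q)"
    by (subst Q) (simp only: mult.assoc)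
  then have Q2: "lin m (-1) * Q = fps_X * (fps_const y * P + fps_const (y / 2) * Q)"
    by (simp add: geo_lin assms)
  have l: "lin m (- 1 - y / 2) = lin m (-1) - fps_const (y / 2) * fps_X"
    "lin m (- 1 + y / 2) = lin m (-1) + fps_const (y / 2) * fps_X"
    by (rule fps_ext; simp add: lin_nth)+
  have y: "fps_const y = fps_const (y / 2) + fps_const (y / 2)"
    by (simp add: fps_eq_iff)
  have half: "fps_const (1/2) * (fps_const y * P + fps_const (y/2) * Q) = fps_const (y / 2) * P + fps_const (y / 2) * (fps_const (1/2) * Q)"
    by (simp add: fps_eq_iff algebra_simps)
  show "chain_gf y (m # M) * lin m (- 1 - y / 2) = chain_gf y M * lin m (- 1 + y / 2)"
    unfolding P' P_def[symmetric] l using Q2 unfolding y by (simp add: algebra_simps)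
  have "lin m (-1) * (fps_const (1/2) * Q) = fps_X * (fps_const (y / 2) * P + fps_const (y / 2) * (fps_const (1/2) * Q))"
    using arg_cong[OF Q2, of "\<lambda>u. fps_const (1/2) * u"] half by (simp add: mult.left_commute)
  then show "(chain_gf y M + fps_const (1/2) * gen (\<lambda>ks. y ^ length ks * head_sum m M ks)) * lin m (- 1 - y / 2) = chain_gf y M * lin m (- 1)"
    unfolding P_def[symmetric] Q_def[symmetric] l by (simp add: algebra_simps)
qed

lemma mark_Cons:
  "mark y z w f (j # ks) = z ^ length ks * w j * f (j # ks) + y * mark y z w (\<lambda>ks. f (j # ks)) ks"
  by (simp add: mark_def sum.lessThan_Suc_shift sum_distrib_left mult_ac del: sum.lessThan_Suc)

lemma mark_Nil: "mark y z w f [] = 0"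
  by (simp add: mark_def)

lemma mark_cmult_add: "mark y z w (\<lambda>ks. c * (f ks + d * g ks)) ks = c * mark y z w f ks + c * d * mark y z w g ks"
  by (simp add: mark_def sum.distrib sum_distrib_left algebra_simps)

text \<open>Either the number \<open>m\<close> lies to the left of the marked entry, and the factor is the one for unmarked sums in \<open>y\<close>,
or the marked entry involves \<open>m\<close>, and what follows is an unmarked sum in \<open>z\<close>. Merging with the marked entry
from the left and from the right produces the two factors \<open>m - X\<close>.\<close>

lemma marked_gf_Cons:
  fixes m :: "'a::field_char_0"
  assumes "m \<noteq> 0"
  shows "marked_gf y z w (m # M) * (lin m (- 1 - y / 2) * lin m (- 1 - z / 2))
      = marked_gf y z w M * (lin m (- 1 + y / 2) * lin m (- 1 - z / 2))
        + letters (\<lambda>j. w j / m ^ j) * lin m (-1) * lin m (-1) * chain_gf z M"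
proof -
  define Phi where "Phi = marked_gf y z w M"
  define Psi where "Psi = gen (mark y z w (head_sum m M))"
  define W where "W = letters (\<lambda>j. w j / m ^ j)"
  define U where "U = chain_gf z M + fps_const (1/2) * gen (\<lambda>ks. z ^ length ks * head_sum m M ks)"
  have split: "marked_gf y z w (m # M) = Phi + Psi"
    unfolding marked_gf_def Phi_def Psi_def gen_add[symmetric]
    by (intro arg_cong[of _ _ gen] ext) (simp add: half_chain_sum_Cons mark_def distrib_left sum.distrib)
  have hs: "head_sum m M (j # ks) = inverse (m ^ j) * (half_chain_sum M ks + (1/2) * head_sum m M ks)" for j ks
    by (simp add: field_simps)
  have U': "gen (\<lambda>ks. z ^ length ks * (half_chain_sum M ks + (1/2) * head_sum m M ks)) = U"
    unfolding U_def chain_gf_def gen_cmult[symmetric] gen_add[symmetric]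
    by (simp add: algebra_simps)
  have V': "gen (\<lambda>ks. mark y z w (half_chain_sum M) ks + (1/2) * mark y z w (head_sum m M) ks) = Phi + fps_const (1/2) * Psi"
    unfolding Phi_def Psi_def marked_gf_def gen_cmult[symmetric] gen_add[symmetric] ..
  have "Psi = fps_const (mark y z w (head_sum m M) [])
      + letters (\<lambda>j. w j / m ^ j) * gen (\<lambda>ks. z ^ length ks * (half_chain_sum M ks + (1/2) * head_sum m M ks))
      + letters (\<lambda>j. y / m ^ j) * gen (\<lambda>ks. mark y z w (half_chain_sum M) ks + (1/2) * mark y z w (head_sum m M) ks)"
    unfolding Psi_def
    by (rule gen_Cons) (simp only: mark_Cons hs mark_cmult_add, simp add: field_simps, simp add: add_divide_distrib)
  moreover have "letters (\<lambda>j. y / m ^ j) = fps_const y * geo m"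
    by (rule fps_ext) (simp add: letters_def geo_def)
  ultimately have Psi: "Psi = W * U + fps_const y * geo m * (Phi + fps_const (1/2) * Psi)"
    by (simp only: mark_Nil U' V' W_def fps_const_0_eq_0 add_0_left)
  have "lin m (-1) * Psi = lin m (-1) * W * U + (lin m (-1) * geo m) * (fps_const y * (Phi + fps_const (1/2) * Psi))"
    by (subst Psi) (simp add: algebra_simps)
  then have Psi2: "lin m (-1) * Psi = lin m (-1) * W * U + fps_X * (fps_const y * Phi + fps_const (y / 2) * Psi)"
    by (simp add: geo_lin assms distrib_left flip: mult.assoc)
  have U: "U * lin m (- 1 - z / 2) = chain_gf z M * lin m (- 1)"
    unfolding U_def by (rule chain_gf_Cons(2)[OF assms])
  have l: "lin m (- 1 - y / 2) = lin m (-1) - fps_const (y / 2) * fps_X"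
    "lin m (- 1 + y / 2) = lin m (-1) + fps_const (y / 2) * fps_X"
    by (rule fps_ext; simp add: lin_nth)+
  have y: "fps_const y = fps_const (y / 2) + fps_const (y / 2)"
    by (simp add: fps_eq_iff)
  have "(Phi + Psi) * lin m (- 1 - y / 2) = Phi * lin m (- 1 + y / 2) + lin m (-1) * W * U"
    unfolding l using Psi2 unfolding y by (simp add: algebra_simps)
  then have "(Phi + Psi) * lin m (- 1 - y / 2) * lin m (- 1 - z / 2)
      = Phi * lin m (- 1 + y / 2) * lin m (- 1 - z / 2) + lin m (-1) * W * (U * lin m (- 1 - z / 2))"
    by (simp add: distrib_right mult.assoc)
  then show ?thesis
    unfolding split U Phi_def[symmetric] W_def[symmetric] by (simp add: mult_ac)
qed

text \<open>The solution of the recursion in \<open>marked_gf_Cons\<close>: numbers before the distinguished one contribute \<open>r\<close>,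
the distinguished one \<open>c\<close>, and numbers after it \<open>s\<close>.\<close>

fun transfer_sum :: "('b \<Rightarrow> 'a) \<Rightarrow> ('b \<Rightarrow> 'a) \<Rightarrow> ('b \<Rightarrow> 'a) \<Rightarrow> 'b list \<Rightarrow> 'a::comm_ring_1" where
  "transfer_sum r s c [] = 0"
| "transfer_sum r s c (m # M) = r m * transfer_sum r s c M + c m * prod_list (map s M)"

lemma transfer_sum_append:
  "transfer_sum r s c (M @ M') = transfer_sum r s c M * prod_list (map s M') + prod_list (map r M) * transfer_sum r s c M'"
  by (induction M) (simp_all add: algebra_simps)

lemma prod_list_rev: "prod_list (rev M) = prod_list (M :: 'a::comm_monoid_mult list)"
  by (induction M) (simp_all add: mult.commute)

lemma transfer_sum_rev: "transfer_sum r s c (rev M) = transfer_sum s r c M"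
  by (induction M) (simp_all add: transfer_sum_append prod_list_rev algebra_simps flip: rev_map)

text \<open>Taking out the full product of the \<open>s m\<close> leaves a sum whose consecutive terms differ by the factor \<open>r m / s m\<close>, that
is, a series of hypergeometric shape.\<close>

lemma transfer_sum_factor:
  assumes "\<And>m. m \<in> set M \<Longrightarrow> s m * s' m = 1"
  shows "transfer_sum r s c M = prod_list (map s M) *
     (\<Sum>n<length M. (\<Prod>i<n. r (M ! i) * s' (M ! i)) * (c (M ! n) * s' (M ! n)))"
  using assms
proof (induction M)
  case (Cons m M)
  have s: "s m * s' m = 1" by (simp add: Cons.prems)
  define X where "X = (\<Sum>n<length M. (\<Prod>i<n. r (M ! i) * s' (M ! i)) * (c (M ! n) * s' (M ! n)))"
  have X: "(\<Sum>n<length (m # M). (\<Prod>i<n. r ((m # M) ! i) * s' ((m # M) ! i)) * (c ((m # M) ! n) * s' ((m # M) ! n)))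
      = c m * s' m + r m * s' m * X"
    unfolding X_def
    by (simp add: sum.lessThan_Suc_shift prod.lessThan_Suc_shift sum_distrib_left mult.assoc
             del: sum.lessThan_Suc prod.lessThan_Suc)
  have "transfer_sum r s c M = prod_list (map s M) * X"
    unfolding X_def by (rule Cons.IH) (simp add: Cons.prems)
  then have "transfer_sum r s c (m # M) = prod_list (map s M) * (c m + r m * X)"
    by (simp add: algebra_simps)
  also have "\<dots> = prod_list (map s M) * (c m + r m * X) * (s m * s' m)"
    by (simp only: s mult_1_right)
  also have "\<dots> = prod_list (map s (m # M)) * (c m * s' m + r m * s' m * X)"
    by (simp add: algebra_simps)
  finally show ?case unfolding X .
qed simp

definition lin_quot :: "'a::field \<Rightarrow> 'a \<Rightarrow> 'a \<Rightarrow> 'a fps" where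
  "lin_quot u v m = lin m u * inverse (lin m v)"

lemma lin_inverse: "m \<noteq> 0 \<Longrightarrow> lin m u * inverse (lin m u) = 1"
  by (subst mult.commute, rule inverse_mult_eq_1) (simp add: lin_nth)

lemma lin_quot_inverse: "m \<noteq> 0 \<Longrightarrow> lin_quot u v m * lin_quot v u m = 1"
  using lin_inverse[of m u] lin_inverse[of m v] unfolding lin_quot_def
  by (metis mult.assoc mult.commute mult_1_right)

lemma lin_cancel: "m \<noteq> 0 \<Longrightarrow> f * lin m u = g \<Longrightarrow> f = g * inverse (lin m u)"
  using lin_inverse[of m u] by (metis mult.assoc mult_1_right)

lemma chain_gf_eq:
  fixes M :: "'a::field_char_0 list"
  assumes "0 \<notin> set M"
  shows "chain_gf y M = prod_list (map (lin_quot (- 1 + y / 2) (- 1 - y / 2)) M)"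
  using assms
proof (induction M)
  case Nil
  have "(\<Sum>ks\<in>indices k. y ^ length ks * half_chain_sum ([] :: 'a list) ks) = (if k = 0 then 1 else 0)" for k
  proof (cases "k = 0")
    case False
    have "half_chain_sum ([] :: 'a list) ks = 0" if "ks \<in> indices k" for ks
      using that False half_chain_sum_Nil(2) by (cases ks) (auto simp: indices_def)
    then show ?thesis using False by simp
  qed (simp add: indices_0 half_chain_sum_Nil)
  then show ?case by (simp add: chain_gf_def gen_def fps_eq_iff)
next
  case (Cons m M)
  have "m \<noteq> 0" using Cons.prems by auto
  from lin_cancel[OF this chain_gf_Cons(1)[OF this]] Cons show ?case
    by (simp add: lin_quot_def mult_ac)
qed

definition mark_factor :: "'a::field \<Rightarrow> 'a \<Rightarrow> (nat \<Rightarrow> 'a) \<Rightarrow> 'a \<Rightarrow> 'a fps" where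
  "mark_factor y z w m = letters (\<lambda>j. w j / m ^ j) * lin m (-1) * lin m (-1)
     * inverse (lin m (- 1 - y / 2)) * inverse (lin m (- 1 - z / 2))"

lemma marked_gf_eq:
  fixes M :: "'a::field_char_0 list"
  assumes "0 \<notin> set M"
  shows "marked_gf y z w M = transfer_sum (lin_quot (- 1 + y / 2) (- 1 - y / 2))
      (lin_quot (- 1 + z / 2) (- 1 - z / 2)) (mark_factor y z w) M"
  using assms
proof (induction M)
  case Nil
  have "half_chain_sum ([] :: 'a list) ks = 0" if "ks \<noteq> []" for ks
    using that half_chain_sum_Nil(2) by (cases ks) auto
  then have "mark y z w (half_chain_sum ([] :: 'a list)) ks = 0" for ks
    by (cases ks) (auto simp: mark_def)
  then show ?case by (simp add: marked_gf_def gen_def fps_eq_iff)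
next
  case (Cons m M)
  have m: "m \<noteq> 0" using Cons.prems by auto
  note i = lin_inverse[OF m, of "- 1 - z / 2"]
  from marked_gf_Cons[OF m, of y z w M] have "marked_gf y z w (m # M) * lin m (- 1 - y / 2) * lin m (- 1 - z / 2)
      = marked_gf y z w M * lin m (- 1 + y / 2) * lin m (- 1 - z / 2)
        + letters (\<lambda>j. w j / m ^ j) * lin m (-1) * lin m (-1) * chain_gf z M"
    by (simp add: mult.assoc)
  from lin_cancel[OF m this] have "marked_gf y z w (m # M) * lin m (- 1 - y / 2)
      = marked_gf y z w M * lin m (- 1 + y / 2) * (lin m (- 1 - z / 2) * inverse (lin m (- 1 - z / 2)))
        + letters (\<lambda>j. w j / m ^ j) * lin m (-1) * lin m (-1) * inverse (lin m (- 1 - z / 2)) * chain_gf z M"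
    by (simp add: algebra_simps)
  from lin_cancel[OF m this] show ?case
    using Cons unfolding i
    by (simp add: mark_factor_def[of y z w m] lin_quot_def[of _ _ m] chain_gf_eq algebra_simps)
qed

definition w_main :: "nat \<Rightarrow> 'a::field" where "w_main j = (if j \<ge> 2 then 2 ^ (j - 2) - 1 else 0)"
definition w_sum :: "nat \<Rightarrow> 'a::field" where "w_sum j = (if j \<ge> 2 then 1 else 0)"

lemma letters_w_sum: "m \<noteq> 0 \<Longrightarrow> letters (\<lambda>j. w_sum j / m ^ j) * (lin m (-1) * fps_const m) = fps_X ^ 2"
proof (rule fps_ext)
  fix n assume m: "m \<noteq> (0::'a)"
  consider "n = 0" | "n = 1" | "n = 2" | k where "n = Suc (Suc (Suc k))"
    by (metis One_nat_def numeral_2_eq_2 not0_implies_Suc)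
  then show "(letters (\<lambda>j. w_sum j / m ^ j) * (lin m (-1) * fps_const m)) $ n = fps_X ^ 2 $ n"
    unfolding mult.commute[of "letters _"] mult.commute[of _ "fps_const m"] mult.assoc fps_mult_left_const_nth lin_mult_nth
    using m by cases (simp_all add: letters_def w_sum_def fps_X_power_nth power2_eq_square field_simps)
qed

lemma letters_w_main: "m \<noteq> 0 \<Longrightarrow> letters (\<lambda>j. w_main j / m ^ j) * (lin m (-1) * lin m (-2) * fps_const m) = fps_X ^ 3"
proof -
  assume m: "m \<noteq> (0::'a)"
  have 2: "letters (\<lambda>j. w_main j / m ^ j) * lin m (-2) = letters (\<lambda>j. if j \<ge> 3 then 1 / m ^ (j - 1) else 0)"
  proof (rule fps_ext)
    fix n
    consider "n = 0" | "n = 1" | "n = 2" | k where "n = Suc (Suc (Suc k))"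
      by (metis One_nat_def numeral_2_eq_2 not0_implies_Suc)
    then show "(letters (\<lambda>j. w_main j / m ^ j) * lin m (-2)) $ n = letters (\<lambda>j. if j \<ge> 3 then 1 / m ^ (j - 1) else 0) $ n"
      unfolding mult.commute[of "letters _"] lin_mult_nth
      using m by cases (simp_all add: letters_def w_main_def field_simps)
  qed
  have 1: "letters (\<lambda>j. if j \<ge> 3 then 1 / m ^ (j - 1) else 0) * (lin m (-1) * fps_const m) = fps_X ^ 3"
  proof (rule fps_ext)
    fix n
    consider "n = 0" | "n = 1" | "n = 2" | "n = 3" | k where "n = Suc (Suc (Suc (Suc k)))"
      by (metis One_nat_def numeral_2_eq_2 numeral_3_eq_3 not0_implies_Suc)
    then show "(letters (\<lambda>j. if j \<ge> 3 then 1 / m ^ (j - 1) else 0) * (lin m (-1) * fps_const m)) $ n = fps_X ^ 3 $ n"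
      unfolding mult.commute[of "letters _"] mult.commute[of _ "fps_const m"] mult.assoc fps_mult_left_const_nth lin_mult_nth
      using m by cases (simp_all add: letters_def fps_X_power_nth power2_eq_square field_simps)
  qed
  show ?thesis using 1 unfolding 2[symmetric] by (simp add: mult_ac)
qed

section \<open>Two terminating hypergeometric identities\<close>

text \<open>The approach of Wilf and Zeilberger with the certificate summed over \<open>N\<close>: if the change of \<open>t\<close> in \<open>N\<close> is a
difference of \<open>G\<close> in the summation index, then only the boundary terms \<open>G N 0\<close> survive.\<close>

lemma certified_sum:
  fixes t G :: "nat \<Rightarrow> nat \<Rightarrow> 'a::comm_ring_1"
  assumes "\<And>N m. m \<le> N \<Longrightarrow> t (Suc N) (Suc m) - t N (Suc m) = G N (Suc m) - G N m"
    and "\<And>N. t N (Suc N) = 0" and "\<And>N. G N (Suc N) = 0"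
  shows "(\<Sum>m<N. t N (Suc m)) = (\<Sum>i<N. - G i 0)"
proof (induction N)
  case (Suc N)
  have "(\<Sum>m<Suc N. t (Suc N) (Suc m)) = (\<Sum>m<Suc N. t N (Suc m) + (G N (Suc m) - G N m))"
    by (intro sum.cong refl) (metis assms(1) add.commute diff_add_cancel less_Suc_eq_le lessThan_iff)
  also have "\<dots> = (\<Sum>m<Suc N. t N (Suc m)) + (G N (Suc N) - G N 0)"
    by (simp only: sum.distrib sum_lessThan_telescope)
  also have "(\<Sum>m<Suc N. t N (Suc m)) = (\<Sum>m<N. t N (Suc m))"
    by (simp add: assms(2))
  finally show ?case by (simp add: Suc.IH assms(3))
qed simp

lemma pochhammer_minus_of_nat: "N < n \<Longrightarrow> pochhammer (- of_nat N :: 'a::{comm_ring_1, ring_char_0, idom}) n = 0"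
  by (simp add: pochhammer_of_nat_eq_0_iff)

text \<open>The terms of a very well-poised hypergeometric series with upper parameters \<open>b\<close>, \<open>c\<close>, \<open>d\<close> besides \<open>a\<close>, after
division by \<open>b\<close> in the limit \<open>b \<rightarrow> 0\<close>; the first fraction is what remains of \<open>a\<close> and \<open>b\<close>.\<close>

definition wp_term :: "'a::field_char_0 \<Rightarrow> 'a \<Rightarrow> 'a \<Rightarrow> nat \<Rightarrow> 'a" where
  "wp_term a c d n = (2 * of_nat n + a) / (of_nat n * (of_nat n + a))
     * (pochhammer c n * pochhammer d n / (pochhammer (1 + a - c) n * pochhammer (1 + a - d) n))"

text \<open>The factor with upper parameters \<open>e\<close> and \<open>-N\<close> that makes the well-poised series terminate at \<open>N\<close> and
satisfy the balancing condition of Dougall's sum; in use, \<open>g = a - c - d\<close>. For fixed \<open>n\<close> it tends to 1 as \<open>N\<close> grows.\<close>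

definition wp_cutoff :: "'a::field_char_0 \<Rightarrow> 'a \<Rightarrow> nat \<Rightarrow> nat \<Rightarrow> 'a" where
  "wp_cutoff a g N n = (let e = 1 + a + g + of_nat N in
     pochhammer e n * pochhammer (- of_nat N) n / (pochhammer (1 + a - e) n * pochhammer (1 + a + of_nat N) n))"

text \<open>The rational function identity behind \<open>wp_sum_finite\<close>, after all common factors are removed.\<close>

lemma wp_certificate_core:
  fixes a c d e n P :: "'a::field"
  assumes e: "e = 2 * a - c - d + P"
    and nz: "n \<noteq> 0" "n + a \<noteq> 0" "a - e \<noteq> 0" "a - e + n \<noteq> 0" "a + P \<noteq> 0" "a + P + n \<noteq> 0" "a - d + P \<noteq> 0" "a - c + P \<noteq> 0"
  shows "(2 * n + a) / (n * (n + a)) * ((e + n) * (- P) / ((a - e) * (a + P + n)))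
         - (2 * n + a) / (n * (n + a)) * (e * (n - P) / ((a - e + n) * (a + P)))
       = (e + P) / ((a - d + P) * (a - c + P)) * ((c + n) * (d + n) * (e + n) * (n - P) / ((a - e) * (a - e + n) * (a + P) * (a + P + n)))
         - (e + P) / ((a - d + P) * (a - c + P)) * ((a - c + n) * (a - d + n) / ((a - e) * (a + P)))"
proof -
  define den where "den = (a - e) * (a - e + n) * (a + P) * (a + P + n)"
  define W where "W = P * (a + P) + e * (a - e)"
  have "(e + n) * (- P) / ((a - e) * (a + P + n)) - e * (n - P) / ((a - e + n) * (a + P))
      = ((e + n) * (- P) * (a - e + n) * (a + P) - e * (n - P) * (a - e) * (a + P + n)) / den"
    unfolding den_def using nz by (simp add: divide_simps)
  also have "(e + n) * (- P) * (a - e + n) * (a + P) - e * (n - P) * (a - e) * (a + P + n) = - (n * (n + a)) * W"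
    unfolding W_def by algebra
  finally have 1: "(2 * n + a) / (n * (n + a)) * ((e + n) * (- P) / ((a - e) * (a + P + n)))
         - (2 * n + a) / (n * (n + a)) * (e * (n - P) / ((a - e + n) * (a + P))) = - ((2 * n + a) * W) / den"
    unfolding right_diff_distrib[symmetric] using nz by simp
  have "(c + n) * (d + n) * (e + n) * (n - P) / ((a - e) * (a - e + n) * (a + P) * (a + P + n)) - (a - c + n) * (a - d + n) / ((a - e) * (a + P))
      = ((c + n) * (d + n) * (e + n) * (n - P) - (a - c + n) * (a - d + n) * (a - e + n) * (a + P + n)) / den"
    unfolding den_def using nz by (simp add: divide_simps)
  also have "(c + n) * (d + n) * (e + n) * (n - P) - (a - c + n) * (a - d + n) * (a - e + n) * (a + P + n)
      = (2 * n + a) * (e - a - P) * ((a - d + P) * (a - c + P))"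
    unfolding e by algebra
  finally have 2: "(e + P) / ((a - d + P) * (a - c + P)) * ((c + n) * (d + n) * (e + n) * (n - P) / ((a - e) * (a - e + n) * (a + P) * (a + P + n)))
         - (e + P) / ((a - d + P) * (a - c + P)) * ((a - c + n) * (a - d + n) / ((a - e) * (a + P)))
      = (e + P) * ((2 * n + a) * (e - a - P)) / den"
    unfolding right_diff_distrib[symmetric] using nz by simp
  have "(e + P) * ((2 * n + a) * (e - a - P)) = - ((2 * n + a) * W)"
    unfolding W_def by algebra
  then show ?thesis unfolding 1 2 by simp
qed

text \<open>A limiting case of Dougall's summation of a terminating well-poised series: differentiating at \<open>b = 0\<close>
replaces the product formula by a sum of partial fractions.\<close>

lemma wp_sum_finite:
  fixes a c d :: "'a::field_char_0"
  assumes nz: "\<And>i. i > 0 \<Longrightarrow> a + of_nat i \<noteq> 0" "\<And>i. i > 0 \<Longrightarrow> a - c + of_nat i \<noteq> 0"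
    "\<And>i. i > 0 \<Longrightarrow> a - d + of_nat i \<noteq> 0" "\<And>i. a - c - d + of_nat i \<noteq> 0"
  shows "(\<Sum>n=1..N. wp_term a c d n * wp_cutoff a (a - c - d) N n)
     = (\<Sum>i=1..N. 1 / (a + of_nat i) + 1 / (a - c - d + of_nat i) - 1 / (a - c + of_nat i) - 1 / (a - d + of_nat i))"
proof -
  define t where "t N n = wp_term a c d n * wp_cutoff a (a - c - d) N n" for N n
  define e where "e N = 1 + a + (a - c - d) + of_nat N" for N
  \<comment> \<open>The certificate: the ratio of \<open>G N n\<close> to the term is a rational function of \<open>n\<close> and \<open>N\<close>.\<close>
  define G where "G N n = (let P = of_nat (Suc N) in (e N + P) / ((a - d + P) * (a - c + P))
     * (pochhammer c (Suc n) * pochhammer d (Suc n) * pochhammer (e N + 1) n * pochhammer (- of_nat N) n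
        / (pochhammer (1 + a - c) n * pochhammer (1 + a - d) n * pochhammer (a - e N) (Suc n) * pochhammer (1 + a + of_nat N) (Suc n))))" for N n
  have "(\<Sum>m<N. t N (Suc m)) = (\<Sum>i<N. - G i 0)"
  proof (rule certified_sum)
    show "t N (Suc N) = 0" for N
      by (simp add: t_def wp_cutoff_def pochhammer_minus_of_nat Let_def)
    show "G N (Suc N) = 0" for N
      by (simp add: G_def pochhammer_minus_of_nat Let_def)
  next
    fix N m :: nat assume mN: "m \<le> N"
    define n P E where "n = (of_nat (Suc m) :: 'a)" and "P = (of_nat (Suc N) :: 'a)" and "E = e N"
    define X where "X = pochhammer c (Suc m) * pochhammer d (Suc m) * pochhammer (E + 1) m * pochhammer (- of_nat N) m
      / (pochhammer (1 + a - c) (Suc m) * pochhammer (1 + a - d) (Suc m) * pochhammer (1 + a - E) m * pochhammer (2 + a + of_nat N) m)"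
    have E: "E = 2 * a - c - d + P" by (simp add: E_def e_def P_def)
    have n: "of_nat m = n - 1" and P: "of_nat N = P - 1"
      by (simp_all add: n_def P_def)
    have "a - E + n = - (a - c - d + of_nat (N - m))"
      unfolding E using mN by (simp add: n P of_nat_diff)
    then have nz1: "a - E + n \<noteq> 0" using nz(4) by (metis neg_equal_0_iff_equal)
    have "a - E = - (a - c - d + P)" unfolding E by simp
    then have nz2: "a - E \<noteq> 0" using nz(4) unfolding P_def by (metis neg_equal_0_iff_equal)
    have "a + P + n = a + of_nat (Suc N + Suc m)" by (simp add: n_def P_def)
    then have "a + P + n \<noteq> 0" using nz(1)[of "Suc N + Suc m"] by (metis add_Suc zero_less_Suc)
    then have nz3: "n \<noteq> 0" "n + a \<noteq> 0" "a + P \<noteq> 0" "a + P + n \<noteq> 0" "a - d + P \<noteq> 0" "a - c + P \<noteq> 0"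
      "a - c + n \<noteq> 0" "a - d + n \<noteq> 0"
      using nz(1)[of "Suc m"] nz(1)[of "Suc N"] nz(2,3)[of "Suc N"] nz(2,3)[of "Suc m"]
      unfolding n_def P_def by (auto simp del: of_nat_Suc simp: add.commute)
    have t1: "t (Suc N) (Suc m) = X * ((2 * n + a) / (n * (n + a)) * ((E + n) * (- P) / ((a - E) * (a + P + n))))"
    proof -
      have p: "pochhammer (e (Suc N)) (Suc m) = pochhammer (E + 1) m * (E + n)"
        "pochhammer (- of_nat (Suc N)) (Suc m) = - P * pochhammer (- of_nat N :: 'a) m"
        "pochhammer (1 + a - e (Suc N)) (Suc m) = (a - E) * pochhammer (1 + a - E) m"
        "pochhammer (1 + a + of_nat (Suc N)) (Suc m) = pochhammer (2 + a + of_nat N) m * (a + P + n)"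
        unfolding pochhammer_rec[of "- of_nat (Suc N)"] pochhammer_rec[of "1 + a - e (Suc N)"]
        by (simp_all add: pochhammer_Suc e_def E_def n P algebra_simps)
      show ?thesis
        unfolding t_def wp_term_def wp_cutoff_def Let_def e_def[symmetric] p n_def[symmetric] X_def
        by (simp add: mult_ac)
    qed
    have t0: "t N (Suc m) = X * ((2 * n + a) / (n * (n + a)) * (E * (n - P) / ((a - E + n) * (a + P))))"
    proof -
      have p: "pochhammer (e N) (Suc m) = E * pochhammer (E + 1) m"
        "pochhammer (- of_nat N :: 'a) (Suc m) = pochhammer (- of_nat N) m * (n - P)"
        "pochhammer (1 + a - e N) (Suc m) = pochhammer (1 + a - E) m * (a - E + n)"
        "pochhammer (1 + a + of_nat N) (Suc m) = (a + P) * pochhammer (2 + a + of_nat N) m"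
        unfolding pochhammer_rec[of "e N"] pochhammer_rec[of "1 + a + of_nat N"]
        by (simp_all add: pochhammer_Suc E_def n P algebra_simps)
      show ?thesis
        unfolding t_def wp_term_def wp_cutoff_def Let_def e_def[symmetric] p n_def[symmetric] X_def
        by (simp add: mult_ac)
    qed
    have G1: "G N (Suc m) = X * ((E + P) / ((a - d + P) * (a - c + P)) * ((c + n) * (d + n) * (E + n) * (n - P) / ((a - E) * (a - E + n) * (a + P) * (a + P + n))))"
    proof -
      have p: "pochhammer c (Suc (Suc m)) = pochhammer c (Suc m) * (c + n)"
        "pochhammer d (Suc (Suc m)) = pochhammer d (Suc m) * (d + n)"
        "pochhammer (e N + 1) (Suc m) = pochhammer (E + 1) m * (E + n)"
        "pochhammer (- of_nat N :: 'a) (Suc m) = pochhammer (- of_nat N) m * (n - P)"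
        "pochhammer (a - e N) (Suc (Suc m)) = (a - E) * (pochhammer (1 + a - E) m * (a - E + n))"
        "pochhammer (1 + a + of_nat N) (Suc (Suc m)) = (a + P) * (pochhammer (2 + a + of_nat N) m * (a + P + n))"
        unfolding pochhammer_rec[of "a - e N"] pochhammer_rec[of "1 + a + of_nat N"] pochhammer_Suc[of _ "Suc m"]
        by (simp_all add: pochhammer_Suc E_def n P algebra_simps)
      show ?thesis
        unfolding G_def Let_def p
        unfolding P_def[symmetric] E_def[symmetric] X_def
        by (simp add: mult_ac)
    qed
    have G0: "G N m = X * ((E + P) / ((a - d + P) * (a - c + P)) * ((a - c + n) * (a - d + n) / ((a - E) * (a + P))))"
    proof -
      have p: "pochhammer (1 + a - c) (Suc m) = pochhammer (1 + a - c) m * (a - c + n)"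
        "pochhammer (1 + a - d) (Suc m) = pochhammer (1 + a - d) m * (a - d + n)"
        "pochhammer (a - e N) (Suc m) = (a - E) * pochhammer (1 + a - E) m"
        "pochhammer (1 + a + of_nat N) (Suc m) = (a + P) * pochhammer (2 + a + of_nat N) m"
        unfolding pochhammer_rec[of "a - e N"] pochhammer_rec[of "1 + a + of_nat N"]
        by (simp_all add: pochhammer_Suc E_def n P algebra_simps)
      show ?thesis
        unfolding G_def Let_def X_def p
        unfolding P_def[symmetric] E_def[symmetric]
        using nz3(7,8) by (simp add: mult_ac)
    qed
    show "t (Suc N) (Suc m) - t N (Suc m) = G N (Suc m) - G N m"
      using wp_certificate_core[OF E nz3(1,2) nz2 nz1 nz3(3,4,5,6)]
      unfolding t1 t0 G1 G0 right_diff_distrib[symmetric] by (simp only:)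
  qed
  moreover have "- G i 0 = 1 / (a + of_nat (Suc i)) + 1 / (a - c - d + of_nat (Suc i)) - 1 / (a - c + of_nat (Suc i)) - 1 / (a - d + of_nat (Suc i))" for i
  proof -
    define P where "P = (of_nat (Suc i) :: 'a)"
    have nz': "a + P \<noteq> 0" "a - c + P \<noteq> 0" "a - d + P \<noteq> 0" "a - c - d + P \<noteq> 0"
      using nz[of "Suc i"] unfolding P_def by auto
    define g where "g = a - c - d + P"
    have e: "e i + P = 2 * a - c - d + 2 * P" "1 + a + of_nat i = a + P" "a - e i = - g"
      by (simp_all add: e_def P_def g_def)
    have "- G i 0 = (2 * a - c - d + 2 * P) * (c * d) / ((a - d + P) * (a - c + P) * g * (a + P))"
      unfolding G_def Let_def P_def[symmetric] e by (simp add: e(2,3) mult_ac)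
    also have "\<dots> = 1 / (a + P) + 1 / g - 1 / (a - c + P) - 1 / (a - d + P)"
    proof -
      have "(2 * a - c - d + 2 * P) * (c * d) = g * (a - c + P) * (a - d + P) + (a + P) * (a - c + P) * (a - d + P)
        - (a + P) * g * (a - d + P) - (a + P) * g * (a - c + P)" unfolding g_def by algebra
      moreover have "g \<noteq> 0" using nz' by (simp add: g_def)
      ultimately show ?thesis using nz' by (simp add: divide_simps) (simp add: algebra_simps)
    qed
    finally show ?thesis unfolding P_def g_def .
  qed
  ultimately show ?thesis
    unfolding t_def by (simp add: sum.atLeast1_atMost_eq del: of_nat_Suc)
qed

text \<open>When the parameter \<open>c\<close> itself is a negative integer the series terminates without the extra factor. This form
supplies the values used for interpolation modulo a prime.\<close>

lemma wp_sum_terminating: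
  fixes a d :: "'a::field_char_0"
  assumes nz: "\<And>i. i > 0 \<Longrightarrow> a + of_nat i \<noteq> 0" "\<And>i. i > 0 \<Longrightarrow> a - d + of_nat i \<noteq> 0"
  shows "(\<Sum>n=1..N. wp_term a (- of_nat N) d n) = (\<Sum>i=1..N. 1 / (a + of_nat i) - 1 / (a - d + of_nat i))"
proof -
  define t where "t N n = wp_term a (- of_nat N) d n" for N n
  define G where "G N n = (let P = of_nat (Suc N) in 1 / (a - d + P)
     * (pochhammer d (Suc n) * pochhammer (- of_nat N) n / (pochhammer (1 + a - d) n * pochhammer (1 + a + of_nat N) (Suc n))))" for N n
  have "(\<Sum>m<N. t N (Suc m)) = (\<Sum>i<N. - G i 0)"
  proof (rule certified_sum)
    show "t N (Suc N) = 0" for N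
      by (simp add: t_def wp_term_def pochhammer_minus_of_nat)
    show "G N (Suc N) = 0" for N
      by (simp add: G_def pochhammer_minus_of_nat Let_def)
  next
    fix N m :: nat assume mN: "m \<le> N"
    define n P where "n = (of_nat (Suc m) :: 'a)" and "P = (of_nat (Suc N) :: 'a)"
    define X where "X = pochhammer d (Suc m) * pochhammer (- of_nat N) m
      / (pochhammer (1 + a - d) (Suc m) * pochhammer (2 + a + of_nat N) m)"
    have n: "of_nat m = n - 1" and P: "of_nat N = P - 1"
      by (simp_all add: n_def P_def)
    have "a + P + n = a + of_nat (Suc N + Suc m)" by (simp add: n_def P_def)
    then have "a + P + n \<noteq> 0" using nz(1)[of "Suc N + Suc m"] by (metis add_Suc zero_less_Suc)
    then have nz3: "n \<noteq> 0" "n + a \<noteq> 0" "a + P \<noteq> 0" "a + P + n \<noteq> 0" "a - d + P \<noteq> 0" "a - d + n \<noteq> 0"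
      using nz(1)[of "Suc m"] nz(1)[of "Suc N"] nz(2)[of "Suc N"] nz(2)[of "Suc m"]
      unfolding n_def P_def by (auto simp del: of_nat_Suc simp: add.commute)
    have t1: "t (Suc N) (Suc m) = X * ((2 * n + a) / (n * (n + a)) * (- P / (a + P + n)))"
    proof -
      have p: "pochhammer (- of_nat (Suc N)) (Suc m) = - P * pochhammer (- of_nat N :: 'a) m"
        "pochhammer (1 + a - - of_nat (Suc N)) (Suc m) = pochhammer (2 + a + of_nat N) m * (a + P + n)"
        unfolding pochhammer_rec[of "- of_nat (Suc N)"]
        by (simp_all add: pochhammer_Suc n P algebra_simps)
      show ?thesis
        unfolding t_def wp_term_def p n_def[symmetric] X_def by (simp add: mult_ac)
    qed
    have t0: "t N (Suc m) = X * ((2 * n + a) / (n * (n + a)) * ((n - P) / (a + P)))"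
    proof -
      have p: "pochhammer (- of_nat N :: 'a) (Suc m) = pochhammer (- of_nat N) m * (n - P)"
        "pochhammer (1 + a - - of_nat N) (Suc m) = (a + P) * pochhammer (2 + a + of_nat N) m"
        unfolding pochhammer_rec[of "1 + a - - of_nat N"]
        by (simp_all add: pochhammer_Suc n P algebra_simps)
      show ?thesis
        unfolding t_def wp_term_def p n_def[symmetric] X_def by (simp add: mult_ac)
    qed
    have G1: "G N (Suc m) = X * (1 / (a - d + P) * ((d + n) * (n - P) / ((a + P) * (a + P + n))))"
    proof -
      have p: "pochhammer d (Suc (Suc m)) = pochhammer d (Suc m) * (d + n)"
        "pochhammer (- of_nat N :: 'a) (Suc m) = pochhammer (- of_nat N) m * (n - P)"
        "pochhammer (1 + a + of_nat N) (Suc (Suc m)) = (a + P) * (pochhammer (2 + a + of_nat N) m * (a + P + n))"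
        unfolding pochhammer_rec[of "1 + a + of_nat N"] pochhammer_Suc[of _ "Suc m"]
        by (simp_all add: pochhammer_Suc n P algebra_simps)
      show ?thesis
        unfolding G_def Let_def p P_def[symmetric] X_def by (simp add: mult_ac)
    qed
    have G0: "G N m = X * (1 / (a - d + P) * ((a - d + n) / (a + P)))"
    proof -
      have p: "pochhammer (1 + a - d) (Suc m) = pochhammer (1 + a - d) m * (a - d + n)"
        "pochhammer (1 + a + of_nat N) (Suc m) = (a + P) * pochhammer (2 + a + of_nat N) m"
        unfolding pochhammer_rec[of "1 + a + of_nat N"]
        by (simp_all add: pochhammer_Suc n P algebra_simps)
      show ?thesis
        unfolding G_def Let_def X_def p P_def[symmetric] using nz3(6) by (simp add: mult_ac)
    qed
    have 1: "- P / (a + P + n) - (n - P) / (a + P) = - (n * (n + a)) / ((a + P) * (a + P + n))"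
      using nz3 by (simp add: divide_simps) algebra
    have 2: "(d + n) * (n - P) / ((a + P) * (a + P + n)) - (a - d + n) / (a + P) = - ((2 * n + a) * (a - d + P)) / ((a + P) * (a + P + n))"
      using nz3 by (simp add: divide_simps) algebra
    show "t (Suc N) (Suc m) - t N (Suc m) = G N (Suc m) - G N m"
      unfolding t1 t0 G1 G0 right_diff_distrib[symmetric] 1 2 using nz3 by simp
  qed
  moreover have "- G i 0 = 1 / (a + of_nat (Suc i)) - 1 / (a - d + of_nat (Suc i))" for i
  proof -
    define P where "P = (of_nat (Suc i) :: 'a)"
    have nz': "a + P \<noteq> 0" "a - d + P \<noteq> 0"
      using nz[of "Suc i"] unfolding P_def by auto
    have e: "1 + a + of_nat i = a + P" by (simp add: P_def)
    have "- G i 0 = - d / ((a - d + P) * (a + P))"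
      unfolding G_def Let_def P_def[symmetric] pochhammer_Suc0 pochhammer_0 e One_nat_def[symmetric]
      by (simp add: mult_ac)
    also have "\<dots> = 1 / (a + P) - 1 / (a - d + P)"
      using nz' by (simp add: divide_simps)
    finally show ?thesis unfolding P_def .
  qed
  ultimately show ?thesis
    unfolding t_def by (simp add: sum.atLeast1_atMost_eq del: of_nat_Suc)
qed

definition gauss_term :: "'a::field_char_0 \<Rightarrow> 'a \<Rightarrow> nat \<Rightarrow> 'a" where
  "gauss_term c h n = 1 / of_nat n * (pochhammer c n / pochhammer (1 + h) n)"

definition gauss_cutoff :: "'a::field_char_0 \<Rightarrow> nat \<Rightarrow> nat \<Rightarrow> 'a" where
  "gauss_cutoff g N n = pochhammer (- of_nat N) n / pochhammer (- g - of_nat N) n"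

text \<open>The corresponding evaluation for Gauss type series, with a factor that terminates them.\<close>

lemma gauss_sum_finite:
  fixes c h :: "'a::field_char_0"
  assumes nz: "\<And>i. i > 0 \<Longrightarrow> h + of_nat i \<noteq> 0" "\<And>i. h - c + of_nat i \<noteq> 0"
  shows "(\<Sum>n=1..N. gauss_term c h n * gauss_cutoff (h - c) N n)
     = (\<Sum>i=1..N. 1 / (h - c + of_nat i) - 1 / (h + of_nat i))"
proof -
  define t where "t N n = gauss_term c h n * gauss_cutoff (h - c) N n" for N n
  define f where "f N = - (h - c) - of_nat N" for N
  define G where "G N n = (let P = of_nat (Suc N) in 1 / (h + P)
     * (pochhammer c (Suc n) * pochhammer (- of_nat N) n / (pochhammer (1 + h) n * pochhammer (f N - 1) (Suc n))))" for N n
  have "(\<Sum>m<N. t N (Suc m)) = (\<Sum>i<N. - G i 0)"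
  proof (rule certified_sum)
    show "t N (Suc N) = 0" for N
      by (simp add: t_def gauss_cutoff_def pochhammer_minus_of_nat)
    show "G N (Suc N) = 0" for N
      by (simp add: G_def pochhammer_minus_of_nat Let_def)
  next
    fix N m :: nat assume mN: "m \<le> N"
    define n P F where "n = (of_nat (Suc m) :: 'a)" and "P = (of_nat (Suc N) :: 'a)" and "F = f N - 1"
    define X where "X = pochhammer c (Suc m) * pochhammer (- of_nat N) m / (pochhammer (1 + h) (Suc m) * pochhammer (1 + F) m)"
    have n: "of_nat m = n - 1" and P: "of_nat N = P - 1"
      by (simp_all add: n_def P_def)
    have F: "F = - (h - c + P)" "f N = 1 + F" "f (Suc N) = F" unfolding F_def f_def P_def by simp_all
    have "F + n = - (h - c + of_nat (N - m))"
      unfolding F using mN by (simp add: n P of_nat_diff)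
    then have nz1: "F + n \<noteq> 0" using nz(2) by (metis neg_equal_0_iff_equal)
    have nz2: "F \<noteq> 0" using nz(2) unfolding F P_def by (metis neg_equal_0_iff_equal)
    have nz3: "n \<noteq> 0" "h + P \<noteq> 0" "h + n \<noteq> 0"
      using nz(1)[of "Suc N"] nz(1)[of "Suc m"]
      unfolding n_def P_def by (auto simp del: of_nat_Suc simp: add.commute)
    have t1: "t (Suc N) (Suc m) = X * (1 / n * (- P / F))"
    proof -
      have p: "pochhammer (- of_nat (Suc N)) (Suc m) = - P * pochhammer (- of_nat N :: 'a) m"
        "pochhammer (f (Suc N)) (Suc m) = F * pochhammer (1 + F) m"
        unfolding pochhammer_rec[of "- of_nat (Suc N)"] F(3) pochhammer_rec[of F]
        by (simp_all add: n P algebra_simps)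
      show ?thesis
        unfolding t_def gauss_term_def gauss_cutoff_def f_def[symmetric] p n_def[symmetric] X_def by (simp add: mult_ac)
    qed
    have t0: "t N (Suc m) = X * (1 / n * ((n - P) / (F + n)))"
    proof -
      have p: "pochhammer (- of_nat N :: 'a) (Suc m) = pochhammer (- of_nat N) m * (n - P)"
        "pochhammer (f N) (Suc m) = pochhammer (1 + F) m * (F + n)"
        unfolding F(2) by (simp_all add: pochhammer_Suc n P algebra_simps)
      show ?thesis
        unfolding t_def gauss_term_def gauss_cutoff_def f_def[symmetric] p n_def[symmetric] X_def by (simp add: mult_ac)
    qed
    have G1: "G N (Suc m) = X * (1 / (h + P) * ((c + n) * (n - P) / (F * (F + n))))"
    proof -
      have p: "pochhammer c (Suc (Suc m)) = pochhammer c (Suc m) * (c + n)"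
        "pochhammer (- of_nat N :: 'a) (Suc m) = pochhammer (- of_nat N) m * (n - P)"
        "pochhammer F (Suc (Suc m)) = F * (pochhammer (1 + F) m * (F + n))"
        unfolding pochhammer_rec[of F] pochhammer_Suc[of _ "Suc m"]
        by (simp_all add: pochhammer_Suc n P algebra_simps)
      show ?thesis
        unfolding G_def Let_def F_def[symmetric] p P_def[symmetric] X_def by (simp add: mult_ac)
    qed
    have G0: "G N m = X * (1 / (h + P) * ((h + n) / F))"
    proof -
      have "pochhammer F (Suc m) = F * pochhammer (1 + F) m"
        using pochhammer_rec[of F m] by (simp only: add.commute)
      moreover have "pochhammer (1 + h) (Suc m) = pochhammer (1 + h) m * (h + n)"
        by (simp add: pochhammer_Suc n algebra_simps)
      ultimately have p: "pochhammer (1 + h) (Suc m) = pochhammer (1 + h) m * (h + n)"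
        "pochhammer F (Suc m) = F * pochhammer (1 + F) m" by blast+
      show ?thesis
        unfolding G_def Let_def F_def[symmetric] X_def p P_def[symmetric] using nz3(3) by (simp add: mult_ac)
    qed
    have 1: "1 / n * (- P / F) - 1 / n * ((n - P) / (F + n)) = - ((P + F) / (F * (F + n)))"
      using nz1 nz2 nz3 by (simp add: divide_simps) algebra
    have 2: "(c + n) * (n - P) / (F * (F + n)) - (h + n) / F = - ((P + F) * (h + P) / (F * (F + n)))"
      using nz1 nz2 by (simp add: divide_simps) (simp add: F(1), algebra)
    show "t (Suc N) (Suc m) - t N (Suc m) = G N (Suc m) - G N m"
      unfolding t1 t0 G1 G0 right_diff_distrib[symmetric]
      unfolding right_diff_distrib[symmetric, of "1 / (h + P)"] 2 1[unfolded right_diff_distrib[symmetric]]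
      using nz3 by simp
  qed
  moreover have "- G i 0 = 1 / (h - c + of_nat (Suc i)) - 1 / (h + of_nat (Suc i))" for i
  proof -
    define P where "P = (of_nat (Suc i) :: 'a)"
    have nz': "h + P \<noteq> 0" "h - c + P \<noteq> 0"
      using nz[of "Suc i"] unfolding P_def by auto
    define g where "g = h - c + P"
    have e: "f i - 1 = - g" by (simp add: P_def f_def g_def)
    have "- G i 0 = c / ((h + P) * g)"
      unfolding G_def Let_def P_def[symmetric] e by (simp add: e)
    also have "\<dots> = 1 / g - 1 / (h + P)"
      using nz' unfolding g_def by (simp add: divide_simps)
    finally show ?thesis unfolding P_def g_def .
  qed
  ultimately show ?thesis
    unfolding t_def by (simp add: sum.atLeast1_atMost_eq del: of_nat_Suc)
qed

lemma gauss_sum_terminating: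
  fixes h :: "'a::field_char_0"
  assumes nz: "\<And>i. i > 0 \<Longrightarrow> h + of_nat i \<noteq> 0"
  shows "(\<Sum>n=1..N. gauss_term (- of_nat N) h n) = (\<Sum>i=1..N. - (1 / (h + of_nat i)))"
proof -
  define t where "t N n = gauss_term (- of_nat N) h n" for N n
  define G where "G N n = 1 / (h + of_nat (Suc N)) * (pochhammer (- of_nat N) n / pochhammer (1 + h) n)" for N n
  have "(\<Sum>m<N. t N (Suc m)) = (\<Sum>i<N. - G i 0)"
  proof (rule certified_sum)
    show "t N (Suc N) = 0" for N
      by (simp add: t_def gauss_term_def pochhammer_minus_of_nat)
    show "G N (Suc N) = 0" for N
      by (simp add: G_def pochhammer_minus_of_nat)
  next
    fix N m :: nat assume mN: "m \<le> N"
    define n P where "n = (of_nat (Suc m) :: 'a)" and "P = (of_nat (Suc N) :: 'a)"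
    define X where "X = pochhammer (- of_nat N) m / pochhammer (1 + h) (Suc m)"
    have n: "of_nat m = n - 1" and P: "of_nat N = P - 1"
      by (simp_all add: n_def P_def)
    have nz3: "n \<noteq> 0" "h + P \<noteq> 0" "h + n \<noteq> 0"
      using nz(1)[of "Suc N"] nz(1)[of "Suc m"]
      unfolding n_def P_def by (auto simp del: of_nat_Suc simp: add.commute)
    have p: "pochhammer (- of_nat (Suc N)) (Suc m) = - P * pochhammer (- of_nat N :: 'a) m"
      "pochhammer (- of_nat N :: 'a) (Suc m) = pochhammer (- of_nat N) m * (n - P)"
      unfolding pochhammer_rec[of "- of_nat (Suc N)"]
      by (simp_all add: pochhammer_Suc n P algebra_simps)
    have q: "pochhammer (1 + h) (Suc m) = pochhammer (1 + h) m * (h + n)"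
      by (simp add: pochhammer_Suc n algebra_simps)
    have t1: "t (Suc N) (Suc m) = X * (1 / n * (- P))" and t0: "t N (Suc m) = X * (1 / n * (n - P))"
      and G1: "G N (Suc m) = X * (1 / (h + P) * (n - P))"
      unfolding t_def G_def gauss_term_def p unfolding n_def[symmetric] P_def[symmetric] X_def by (simp_all add: mult_ac)
    have G0: "G N m = X * (1 / (h + P) * (h + n))"
      unfolding G_def X_def q P_def[symmetric] using nz3 by (simp add: mult_ac)
    show "t (Suc N) (Suc m) - t N (Suc m) = G N (Suc m) - G N m"
      unfolding t1 t0 G1 G0 right_diff_distrib[symmetric] using nz3 by (simp add: divide_simps) algebra
  qed
  then show ?thesis
    unfolding t_def G_def by (simp add: sum.atLeast1_atMost_eq del: of_nat_Suc)
qed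

lemma fps_to_fls_inverse: "f $ 0 \<noteq> 0 \<Longrightarrow> fps_to_fls (inverse f) = inverse (fps_to_fls (f :: 'a::field fps))"
  by (metis fls_times_fps_to_fls fps_one_to_fls inverse_mult_eq_1 inverse_unique mult.commute)

lemma fps_to_fls_pochhammer: "fps_to_fls (pochhammer f n) = pochhammer (fps_to_fls (f :: 'a::field fps)) n"
  by (induction n) (simp_all add: pochhammer_Suc fls_times_fps_to_fls)

lemma fps_to_fls_sum: "fps_to_fls (\<Sum>x\<in>A. f x) = (\<Sum>x\<in>A. fps_to_fls (f x :: 'a::field fps))"
  by (induction A rule: infinite_finite_induct) simp_all

lemma pochhammer_fps_nth_0: "pochhammer f n $ 0 = pochhammer (f $ 0 :: 'a::field) n"
  by (induction n) (simp_all add: pochhammer_Suc flip: fps_of_nat)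

text \<open>The terms of the hypergeometric sums again, now as power series: with parameters that are multiples of \<open>X\<close>
the denominators are units, so \<open>inverse\<close> is the inverse of power series.\<close>

definition wp_fps :: "'a::field_char_0 fps \<Rightarrow> 'a fps \<Rightarrow> 'a fps \<Rightarrow> nat \<Rightarrow> 'a fps" where
  "wp_fps a c d n = (2 * of_nat n + a) * inverse (of_nat n * (of_nat n + a))
     * (pochhammer c n * pochhammer d n * (inverse (pochhammer (1 + a - c) n) * inverse (pochhammer (1 + a - d) n)))"

definition wp_cutoff_fps :: "'a::field_char_0 fps \<Rightarrow> 'a fps \<Rightarrow> nat \<Rightarrow> nat \<Rightarrow> 'a fps" where
  "wp_cutoff_fps a g N n = (pochhammer (1 + a + g + of_nat N) n * pochhammer (- of_nat N) n
      * (inverse (pochhammer (- g - of_nat N) n) * inverse (pochhammer (1 + a + of_nat N) n)))"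

definition gauss_fps :: "'a::field_char_0 fps \<Rightarrow> 'a fps \<Rightarrow> nat \<Rightarrow> 'a fps" where
  "gauss_fps c h n = inverse (of_nat n) * (pochhammer c n * inverse (pochhammer (1 + h) n))"

definition gauss_cutoff_fps :: "'a::field_char_0 fps \<Rightarrow> nat \<Rightarrow> nat \<Rightarrow> 'a fps" where
  "gauss_cutoff_fps g N n = pochhammer (- of_nat N) n * inverse (pochhammer (- g - of_nat N) n)"

abbreviation scaled_X :: "'a::field_char_0 \<Rightarrow> 'a fps" where
  "scaled_X u \<equiv> fps_const u * fps_X"

lemma lin_of_nat: "lin (of_nat m) u = of_nat m + scaled_X u"
  by (simp add: lin_def fps_of_nat)

lemma of_nat_fps_nth_0: "(of_nat m :: 'a::semiring_1 fps) $ 0 = of_nat m"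
  by (simp flip: fps_of_nat)

lemma pochhammer_1_nonzero: "pochhammer (1::'a::field_char_0) n \<noteq> 0"
  by (metis fact_nonzero pochhammer_fact)

lemma pochhammer_neg_nonzero: "n \<le> N \<Longrightarrow> pochhammer (- of_nat N :: 'a::field_char_0) n \<noteq> 0"
  by (simp add: pochhammer_of_nat_eq_0_iff)

lemma pochhammer_Suc_of_nat_nonzero: "pochhammer (1 + of_nat N :: 'a::field_char_0) n \<noteq> 0"
  by (metis add.commute of_nat_Suc of_nat_eq_0_iff of_nat_neq_0 pochhammer_eq_0_iff add_eq_0_iff of_nat_add neg_equal_0_iff_equal add_cancel_left_right nat.distinct(1) add_is_0)

text \<open>The evaluations above need a field. Laurent series are one, and the embedding turns inverses of power series
with nonzero constant term into true inverses.\<close>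

lemma to_fls_wp_fps:
  assumes "a $ 0 = 0" "pochhammer (1 - c $ 0) n \<noteq> 0" "d $ 0 = 0" "n > 0"
  shows "fps_to_fls (wp_fps a c d n) = wp_term (fps_to_fls a) (fps_to_fls c) (fps_to_fls d) n"
  unfolding wp_fps_def wp_term_def divide_inverse
  by (simp add: fls_times_fps_to_fls fps_to_fls_inverse fps_to_fls_pochhammer assms pochhammer_fps_nth_0 of_nat_fps_nth_0
      pochhammer_1_nonzero)

lemma to_fls_wp_cutoff_fps:
  assumes "a $ 0 = 0" "g $ 0 = 0" "n \<le> N"
  shows "fps_to_fls (wp_cutoff_fps a g N n) = wp_cutoff (fps_to_fls a) (fps_to_fls g) N n"
  unfolding wp_cutoff_fps_def wp_cutoff_def divide_inverse Let_def
  using pochhammer_neg_nonzero[where 'a = 'a, OF assms(3)]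
  by (simp add: fls_times_fps_to_fls fps_to_fls_inverse fps_to_fls_pochhammer assms pochhammer_fps_nth_0 of_nat_fps_nth_0
      pochhammer_Suc_of_nat_nonzero)

lemma to_fls_gauss_fps:
  assumes "h $ 0 = 0" "n > 0"
  shows "fps_to_fls (gauss_fps c h n) = gauss_term (fps_to_fls c) (fps_to_fls h) n"
  unfolding gauss_fps_def gauss_term_def divide_inverse
  using assms by (simp add: fls_times_fps_to_fls fps_to_fls_inverse fps_to_fls_pochhammer pochhammer_fps_nth_0 of_nat_fps_nth_0
      pochhammer_1_nonzero)

lemma to_fls_gauss_cutoff_fps:
  assumes "g $ 0 = 0" "n \<le> N"
  shows "fps_to_fls (gauss_cutoff_fps g N n) = gauss_cutoff (fps_to_fls g) N n"
  unfolding gauss_cutoff_fps_def gauss_cutoff_def divide_inverse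
  using pochhammer_neg_nonzero[where 'a = 'a, OF assms(2)]
  by (simp add: fls_times_fps_to_fls fps_to_fls_inverse fps_to_fls_pochhammer assms pochhammer_fps_nth_0 of_nat_fps_nth_0)

lemma to_fls_lin: "i > 0 \<Longrightarrow> fps_to_fls (inverse (lin (of_nat i) u)) = 1 / (fps_to_fls (scaled_X u) + of_nat i :: 'a::field_char_0 fls)"
  by (simp add: lin_of_nat fps_to_fls_inverse of_nat_fps_nth_0 divide_inverse add.commute)

lemma to_fls_scaled_X_nonzero: "i > 0 \<or> u \<noteq> 0 \<Longrightarrow> fps_to_fls (scaled_X u) + of_nat i \<noteq> (0 :: 'a::field_char_0 fls)"
proof -
  assume "i > 0 \<or> u \<noteq> 0"
  then have "lin (of_nat i) u $ 0 \<noteq> 0 \<or> lin (of_nat i) u $ 1 \<noteq> 0"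
    by (auto simp: lin_nth)
  then have "lin (of_nat i) u \<noteq> 0" by auto
  then have "fps_to_fls (lin (of_nat i) u) \<noteq> 0" by simp
  then show ?thesis by (simp add: lin_of_nat add.commute)
qed

lemma scaled_X_diff: "scaled_X (a - b) = scaled_X a - scaled_X b"
  by (simp add: fps_const_sub[symmetric] left_diff_distrib del: fps_const_sub)

lemma wp_fps_sum:
  fixes a c d :: "'a::field_char_0"
  assumes "a - c - d \<noteq> 0"
  shows "(\<Sum>n=1..N. wp_fps (scaled_X a) (scaled_X c) (scaled_X d) n * wp_cutoff_fps (scaled_X a) (scaled_X (a - c - d)) N n)
     = (\<Sum>i=1..N. inverse (lin (of_nat i) a) + inverse (lin (of_nat i) (a - c - d))
          - inverse (lin (of_nat i) (a - c)) - inverse (lin (of_nat i) (a - d)))"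
proof -
  define A C D where "A = fps_to_fls (scaled_X a)" and "C = fps_to_fls (scaled_X c)" and "D = fps_to_fls (scaled_X d)"
  have m: "fps_to_fls (scaled_X (a - c)) = A - C" "fps_to_fls (scaled_X (a - d)) = A - D" "fps_to_fls (scaled_X (a - c - d)) = A - C - D"
    unfolding A_def C_def D_def scaled_X_diff by simp_all
  have "fps_to_fls (\<Sum>n=1..N. wp_fps (scaled_X a) (scaled_X c) (scaled_X d) n * wp_cutoff_fps (scaled_X a) (scaled_X (a - c - d)) N n)
     = (\<Sum>n=1..N. wp_term A C D n * wp_cutoff A (A - C - D) N n)"
    unfolding fps_to_fls_sum fls_times_fps_to_fls unfolding m(3)[symmetric] unfolding A_def C_def D_def
    by (intro sum.cong refl arg_cong2[of _ _ _ _ "(*)"] to_fls_wp_fps to_fls_wp_cutoff_fps)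
       (simp_all add: pochhammer_1_nonzero)
  also have "\<dots> = (\<Sum>i=1..N. 1 / (A + of_nat i) + 1 / (A - C - D + of_nat i) - 1 / (A - C + of_nat i) - 1 / (A - D + of_nat i))"
    by (rule wp_sum_finite) (use assms in \<open>unfold m(3)[symmetric], unfold m(1,2)[symmetric], unfold A_def, (intro to_fls_scaled_X_nonzero, simp)+\<close>)
  also have "\<dots> = fps_to_fls (\<Sum>i=1..N. inverse (lin (of_nat i) a) + inverse (lin (of_nat i) (a - c - d))
          - inverse (lin (of_nat i) (a - c)) - inverse (lin (of_nat i) (a - d)))"
    unfolding fps_to_fls_sum m(3)[symmetric] unfolding m(1,2)[symmetric] unfolding A_def
    by (intro sum.cong refl) (simp add: to_fls_lin)
  finally show ?thesis by (simp only: fps_to_fls_eq_iff)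
qed

lemma wp_fps_sum_terminating:
  fixes a d :: "'a::field_char_0"
  shows "(\<Sum>n=1..N. wp_fps (scaled_X a) (- of_nat N) (scaled_X d) n)
     = (\<Sum>i=1..N. inverse (lin (of_nat i) a) - inverse (lin (of_nat i) (a - d)))"
proof -
  define A D where "A = fps_to_fls (scaled_X a)" and "D = fps_to_fls (scaled_X d)"
  have m: "fps_to_fls (scaled_X (a - d)) = A - D"
    unfolding A_def D_def scaled_X_diff by simp
  have "fps_to_fls (\<Sum>n=1..N. wp_fps (scaled_X a) (- of_nat N) (scaled_X d) n) = (\<Sum>n=1..N. wp_term A (- of_nat N) D n)"
    unfolding fps_to_fls_sum
    by (intro sum.cong refl, subst to_fls_wp_fps)
       (simp_all add: A_def D_def of_nat_fps_nth_0 pochhammer_Suc_of_nat_nonzero)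
  also have "\<dots> = (\<Sum>i=1..N. 1 / (A + of_nat i) - 1 / (A - D + of_nat i))"
    by (rule wp_sum_terminating) (unfold m[symmetric], unfold A_def, (intro to_fls_scaled_X_nonzero, simp)+)
  also have "\<dots> = fps_to_fls (\<Sum>i=1..N. inverse (lin (of_nat i) a) - inverse (lin (of_nat i) (a - d)))"
    unfolding fps_to_fls_sum m[symmetric] unfolding A_def
    by (intro sum.cong refl) (simp add: to_fls_lin)
  finally show ?thesis by (simp only: fps_to_fls_eq_iff)
qed

lemma gauss_fps_sum:
  fixes c h :: "'a::field_char_0"
  assumes "h - c \<noteq> 0"
  shows "(\<Sum>n=1..N. gauss_fps (scaled_X c) (scaled_X h) n * gauss_cutoff_fps (scaled_X (h - c)) N n)
     = (\<Sum>i=1..N. inverse (lin (of_nat i) (h - c)) - inverse (lin (of_nat i) h))"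
proof -
  define C H where "C = fps_to_fls (scaled_X c)" and "H = fps_to_fls (scaled_X h)"
  have m: "fps_to_fls (scaled_X (h - c)) = H - C"
    unfolding C_def H_def scaled_X_diff by simp
  have "fps_to_fls (\<Sum>n=1..N. gauss_fps (scaled_X c) (scaled_X h) n * gauss_cutoff_fps (scaled_X (h - c)) N n)
     = (\<Sum>n=1..N. gauss_term C H n * gauss_cutoff (H - C) N n)"
    unfolding fps_to_fls_sum fls_times_fps_to_fls unfolding m[symmetric] unfolding C_def H_def
    by (intro sum.cong refl arg_cong2[of _ _ _ _ "(*)"] to_fls_gauss_fps to_fls_gauss_cutoff_fps)
       simp_all
  also have "\<dots> = (\<Sum>i=1..N. 1 / (H - C + of_nat i) - 1 / (H + of_nat i))"
    by (rule gauss_sum_finite) (use assms in \<open>unfold m[symmetric], unfold H_def, (intro to_fls_scaled_X_nonzero, simp)+\<close>)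
  also have "\<dots> = fps_to_fls (\<Sum>i=1..N. inverse (lin (of_nat i) (h - c)) - inverse (lin (of_nat i) h))"
    unfolding fps_to_fls_sum m[symmetric] unfolding H_def
    by (intro sum.cong refl) (simp add: to_fls_lin)
  finally show ?thesis by (simp only: fps_to_fls_eq_iff)
qed

lemma gauss_fps_sum_terminating:
  fixes h :: "'a::field_char_0"
  shows "(\<Sum>n=1..N. gauss_fps (- of_nat N) (scaled_X h) n) = (\<Sum>i=1..N. - inverse (lin (of_nat i) h))"
proof -
  define H where "H = fps_to_fls (scaled_X h)"
  have "fps_to_fls (\<Sum>n=1..N. gauss_fps (- of_nat N) (scaled_X h) n) = (\<Sum>n=1..N. gauss_term (- of_nat N) H n)"
    unfolding fps_to_fls_sum
    by (intro sum.cong refl, subst to_fls_gauss_fps) (simp_all add: H_def)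
  also have "\<dots> = (\<Sum>i=1..N. - (1 / (H + of_nat i)))"
    by (rule gauss_sum_terminating) (unfold H_def, (intro to_fls_scaled_X_nonzero, simp)+)
  also have "\<dots> = fps_to_fls (\<Sum>i=1..N. - inverse (lin (of_nat i) h))"
    unfolding fps_to_fls_sum
    by (intro sum.cong refl) (simp add: to_fls_lin H_def)
  finally show ?thesis by (simp only: fps_to_fls_eq_iff)
qed

section \<open>Marked generating functions as hypergeometric sums\<close>

lemma pochhammer_scaled_X_Suc: "pochhammer (scaled_X u) (Suc n) = scaled_X u * pochhammer (1 + scaled_X u) n"
  by (simp add: pochhammer_rec add.commute del: pochhammer_Suc)

lemma pochhammer_lin: "pochhammer (1 + scaled_X u) n = (\<Prod>i<n. lin (of_nat (Suc i)) u)"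
proof (induction n)
  case (Suc n)
  have "1 + scaled_X u + of_nat n = lin (of_nat (Suc n)) u"
    unfolding lin_of_nat unfolding of_nat_Suc by (simp only: add_ac)
  then show ?case by (simp only: pochhammer_Suc prod.lessThan_Suc Suc)
qed simp

lemma inverse_prod_fps: "inverse (\<Prod>i\<in>A. f i) = (\<Prod>i\<in>A. inverse (f i :: 'a::field fps))"
  by (induction A rule: infinite_finite_induct) (simp_all add: fps_inverse_mult)

lemma wp_fps_Suc:
  "wp_fps (scaled_X a) (scaled_X c) (scaled_X d) (Suc n) = fps_const (c * d) * fps_X ^ 2
     * (\<Prod>i<n. lin_quot c (a - c) (of_nat (Suc i)) * lin_quot d (a - d) (of_nat (Suc i)))
     * (2 * lin (of_nat (Suc n)) (a / 2) * inverse (of_nat (Suc n)) * inverse (lin (of_nat (Suc n)) a)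
         * inverse (lin (of_nat (Suc n)) (a - c)) * inverse (lin (of_nat (Suc n)) (a - d)))"
proof -
  have 2: "2 * of_nat (Suc n) + scaled_X a = 2 * lin (of_nat (Suc n)) (a / 2)"
  proof -
    have "fps_const a = 2 * fps_const (a / 2)" by (simp add: numeral_fps_const)
    then show ?thesis unfolding lin_of_nat by (simp add: algebra_simps)
  qed
  have m: "1 + scaled_X a - scaled_X c = 1 + scaled_X (a - c)" "1 + scaled_X a - scaled_X d = 1 + scaled_X (a - d)"
    unfolding scaled_X_diff by simp_all
  show ?thesis
    unfolding wp_fps_def 2 m pochhammer_scaled_X_Suc pochhammer_lin lin_of_nat[symmetric] fps_inverse_mult inverse_prod_fps
      prod.lessThan_Suc lin_quot_def prod.distrib
    by (simp add: power2_eq_square mult_ac flip: fps_const_mult)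
qed

lemma gauss_fps_Suc:
  "gauss_fps (scaled_X c) (scaled_X h) (Suc n) = scaled_X c * (\<Prod>i<n. lin_quot c h (of_nat (Suc i)))
     * (inverse (of_nat (Suc n)) * inverse (lin (of_nat (Suc n)) h))"
  unfolding gauss_fps_def pochhammer_scaled_X_Suc pochhammer_lin inverse_prod_fps prod.lessThan_Suc lin_quot_def prod.distrib
    fps_inverse_mult by (simp only: mult_ac)

text \<open>The list \<open>1, \<dots>, N\<close>. Together, \<open>pos_list N @ neg_list N\<close> runs through \<open>1, \<dots>, N, -N, \<dots>, -1\<close>.\<close>

definition pos_list :: "nat \<Rightarrow> 'a::field_char_0 list" where
  "pos_list N = map of_nat [1..<Suc N]"

definition neg_list :: "nat \<Rightarrow> 'a::field_char_0 list" where
  "neg_list N = map uminus (rev (pos_list N))"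

lemma pos_list_nz: "0 \<notin> set (pos_list N)" and neg_list_nz: "0 \<notin> set (neg_list N)"
  by (auto simp: pos_list_def neg_list_def)

lemma pos_list_nth: "i < N \<Longrightarrow> pos_list N ! i = of_nat (Suc i)" and length_pos_list: "length (pos_list N) = N"
  by (simp_all add: pos_list_def nth_append del: upt_Suc of_nat_Suc)

lemma lin_uminus: "lin (- m) u = - lin m (- u)"
  by (simp add: lin_def fps_eq_iff)

lemma lin_quot_uminus: "lin_quot u v (- m) = lin_quot (- u) (- v) m"
  by (simp add: lin_quot_def lin_uminus fps_inverse_minus)

text \<open>The weight \<open>2 ^ (k - 2) - 1\<close> has generating function \<open>X ^ 3 / (m (m - X) (m - 2 X))\<close>; one factor \<open>m - X\<close> of
\<open>mark_factor\<close> cancels, and the other becomes the factor \<open>2 n + a\<close> of a well-poised series with \<open>a = -2 X\<close>.\<close>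

lemma mark_factor_main:
  fixes m :: "'a::field_char_0"
  assumes "m \<noteq> 0"
  shows "mark_factor y z w_main m = fps_X ^ 3 * lin m (-1) * inverse (fps_const m) * inverse (lin m (-2))
     * inverse (lin m (- 1 - y / 2)) * inverse (lin m (- 1 - z / 2))"
proof -
  have "letters (\<lambda>j. w_main j / m ^ j) * fps_const m * lin m (-2) * lin m (-1) = fps_X ^ 3"
    using letters_w_main[OF assms] by (simp add: mult_ac)
  from lin_cancel[OF assms this] have "letters (\<lambda>j. w_main j / m ^ j) * fps_const m * lin m (-2) = fps_X ^ 3 * inverse (lin m (-1))" .
  from lin_cancel[OF assms this] have "letters (\<lambda>j. w_main j / m ^ j) * lin m 0 = fps_X ^ 3 * inverse (lin m (-1)) * inverse (lin m (-2))"
    by (simp add: lin_def)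
  from lin_cancel[OF assms this] have "letters (\<lambda>j. w_main j / m ^ j) = fps_X ^ 3 * inverse (lin m (-1)) * inverse (lin m (-2)) * inverse (fps_const m)"
    by (simp add: lin_def)
  then have "mark_factor y z w_main m = fps_X ^ 3 * inverse (lin m (-2)) * inverse (fps_const m) * lin m (-1) * (lin m (-1) * inverse (lin m (-1)))
     * inverse (lin m (- 1 - y / 2)) * inverse (lin m (- 1 - z / 2))"
    unfolding mark_factor_def by (simp only: mult_ac)
  then show ?thesis unfolding lin_inverse[OF assms] by (simp only: mult_ac mult_1_right mult_1_left)
qed

lemma mark_factor_sum:
  fixes m :: "'a::field_char_0"
  assumes "m \<noteq> 0"
  shows "mark_factor y 0 w_sum m = fps_X ^ 2 * inverse (fps_const m) * inverse (lin m (- 1 - y / 2))"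
proof -
  have "letters (\<lambda>j. w_sum j / m ^ j) * fps_const m * lin m (-1) = fps_X ^ 2"
    using letters_w_sum[OF assms] by (simp add: mult_ac)
  from lin_cancel[OF assms this] have "letters (\<lambda>j. w_sum j / m ^ j) * lin m 0 = fps_X ^ 2 * inverse (lin m (-1))"
    by (simp add: lin_def)
  from lin_cancel[OF assms this] have "letters (\<lambda>j. w_sum j / m ^ j) = fps_X ^ 2 * inverse (lin m (-1)) * inverse (fps_const m)"
    by (simp add: lin_def)
  then have "mark_factor y 0 w_sum m = fps_X ^ 2 * inverse (fps_const m) * (lin m (-1) * inverse (lin m (-1))) * (lin m (-1) * inverse (lin m (-1)))
     * inverse (lin m (- 1 - y / 2))"
    unfolding mark_factor_def by (simp add: mult_ac)
  then show ?thesis unfolding lin_inverse[OF assms] by (simp only: mult_ac mult_1_right mult_1_left)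
qed

lemma transfer_sum_cong:
  "(\<And>m. m \<in> set M \<Longrightarrow> r m = r' m) \<Longrightarrow> (\<And>m. m \<in> set M \<Longrightarrow> s m = s' m) \<Longrightarrow> (\<And>m. m \<in> set M \<Longrightarrow> c m = c' m)
    \<Longrightarrow> transfer_sum r s c M = transfer_sum r' s' c' M"
  by (induction M) (simp_all cong: map_cong)

lemma mult_left_commute_eq: "k * s = t \<Longrightarrow> k * (p * s) = p * (t :: 'a::comm_monoid_mult)"
  by (metis mult.left_commute)

text \<open>After a common product over all numbers is taken out, the
quotients \<open>r m / s m\<close> are those of a well-poised series with \<open>a = -2\<close>, and the prefactor \<open>c d\<close> repairs
the shift of the two rising factorials by one.\<close>

lemma marked_main_pos:
  fixes y z :: "'a::field_char_0"
  defines "c \<equiv> y / 2 - 1" and "d \<equiv> - 1 - z / 2"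
  shows "fps_const (2 * (c * d)) * marked_gf y z w_main (pos_list N)
     = prod_list (map (lin_quot (- 1 + z / 2) (- 1 - z / 2)) (pos_list N)) * (fps_X * (\<Sum>n=1..N. wp_fps (scaled_X (-2)) (scaled_X c) (scaled_X d) n))"
proof -
  let ?s = "lin_quot (- 1 + z / 2) (- 1 - z / 2)" and ?s' = "lin_quot (- 1 - z / 2) (- 1 + z / 2)"
  let ?r = "lin_quot (- 1 + y / 2) (- 1 - y / 2)" and ?M = "pos_list N :: 'a list" and ?c = "mark_factor y z w_main"
  have "transfer_sum ?r ?s ?c ?M = prod_list (map ?s ?M) *
     (\<Sum>n<length ?M. (\<Prod>i<n. ?r (?M ! i) * ?s' (?M ! i)) * (?c (?M ! n) * ?s' (?M ! n)))"
    by (rule transfer_sum_factor) (metis pos_list_nz lin_quot_inverse)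
  also have "(\<Sum>n<length ?M. (\<Prod>i<n. ?r (?M ! i) * ?s' (?M ! i)) * (?c (?M ! n) * ?s' (?M ! n)))
      = (\<Sum>n<N. (\<Prod>i<n. ?r (of_nat (Suc i)) * ?s' (of_nat (Suc i))) * (?c (of_nat (Suc n)) * ?s' (of_nat (Suc n))))"
    unfolding length_pos_list by (intro sum.cong refl arg_cong2[of _ _ _ _ "(*)"] prod.cong) (simp_all add: pos_list_nth)
  finally have eq: "marked_gf y z w_main ?M = prod_list (map ?s ?M) * (\<Sum>n<N. (\<Prod>i<n. ?r (of_nat (Suc i)) * ?s' (of_nat (Suc i))) * (?c (of_nat (Suc n)) * ?s' (of_nat (Suc n))))"
    unfolding marked_gf_eq[OF pos_list_nz] .
  have "fps_const (2 * (c * d)) * ((\<Prod>i<n. ?r (of_nat (Suc i)) * ?s' (of_nat (Suc i))) * (?c (of_nat (Suc n)) * ?s' (of_nat (Suc n))))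
     = fps_X * wp_fps (scaled_X (-2)) (scaled_X c) (scaled_X d) (Suc n)" for n
  proof -
    define m where "m = (of_nat (Suc n) :: 'a)"
    have m: "m \<noteq> 0" unfolding m_def by (simp del: of_nat_Suc)
    have p: "lin_quot c (-2 - c) = ?r" "lin_quot d (-2 - d) = ?s'" by (simp_all add: c_def d_def add.commute)
    have l: "lin m (-2 - c) = lin m (- 1 - y / 2)" "lin m (-2 - d) = lin m (- 1 + z / 2)" by (simp_all add: c_def d_def)
    have cs: "?c m * ?s' m = fps_X ^ 3 * lin m (-1) * inverse (fps_const m) * inverse (lin m (-2))
     * inverse (lin m (- 1 - y / 2)) * inverse (lin m (- 1 + z / 2))"
    proof -
      have "?c m * ?s' m = fps_X ^ 3 * lin m (-1) * inverse (fps_const m) * inverse (lin m (-2))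
     * inverse (lin m (- 1 - y / 2)) * (lin m (- 1 - z / 2) * inverse (lin m (- 1 - z / 2))) * inverse (lin m (- 1 + z / 2))"
        unfolding mark_factor_main[OF m] lin_quot_def by (simp only: mult_ac)
      then show ?thesis unfolding lin_inverse[OF m] by simp
    qed
    show ?thesis
      unfolding wp_fps_Suc p fps_of_nat[symmetric] m_def[symmetric] cs l
      by (simp add: power3_eq_cube power2_eq_square mult_ac numeral_fps_const)
  qed
  then have "fps_const (2 * (c * d)) * (\<Sum>n<N. (\<Prod>i<n. ?r (of_nat (Suc i)) * ?s' (of_nat (Suc i))) * (?c (of_nat (Suc n)) * ?s' (of_nat (Suc n))))
     = fps_X * (\<Sum>n=1..N. wp_fps (scaled_X (-2)) (scaled_X c) (scaled_X d) n)"
    unfolding sum_distrib_left by (simp only: sum.atLeast1_atMost_eq One_nat_def)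
  then show ?thesis unfolding eq by (rule mult_left_commute_eq)
qed

text \<open>The list is decreasing in absolute value, so it is read backwards and the other product, the one for \<open>y\<close>, is
taken out; the change of sign turns \<open>a = -2\<close> into \<open>a = 2\<close>.\<close>

lemma marked_main_neg:
  fixes y z :: "'a::field_char_0"
  defines "c \<equiv> 1 + y / 2" and "d \<equiv> 1 - z / 2"
  shows "fps_const (2 * (c * d)) * marked_gf y z w_main (neg_list N)
     = - prod_list (map (lin_quot (- 1 + y / 2) (- 1 - y / 2)) (neg_list N)) * (fps_X * (\<Sum>n=1..N. wp_fps (scaled_X 2) (scaled_X c) (scaled_X d) n))"
proof -
  let ?r = "lin_quot (- 1 + z / 2) (- 1 - z / 2)" and ?s' = "lin_quot (- 1 - y / 2) (- 1 + y / 2)"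
  let ?s = "lin_quot (- 1 + y / 2) (- 1 - y / 2)" and ?M = "map uminus (pos_list N) :: 'a list" and ?c = "mark_factor y z w_main"
  have M: "neg_list N = rev ?M" by (simp add: neg_list_def rev_map)
  have nz: "m \<noteq> 0" if "m \<in> set ?M" for m using that by (auto simp: pos_list_def)
  have "transfer_sum ?r ?s ?c ?M = prod_list (map ?s ?M) *
     (\<Sum>n<length ?M. (\<Prod>i<n. ?r (?M ! i) * ?s' (?M ! i)) * (?c (?M ! n) * ?s' (?M ! n)))"
    by (rule transfer_sum_factor) (use nz lin_quot_inverse in blast)
  also have "(\<Sum>n<length ?M. (\<Prod>i<n. ?r (?M ! i) * ?s' (?M ! i)) * (?c (?M ! n) * ?s' (?M ! n)))
      = (\<Sum>n<N. (\<Prod>i<n. ?r (- of_nat (Suc i)) * ?s' (- of_nat (Suc i))) * (?c (- of_nat (Suc n)) * ?s' (- of_nat (Suc n))))"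
    unfolding length_map length_pos_list
    by (intro sum.cong refl arg_cong2[of _ _ _ _ "(*)"] prod.cong) (simp_all add: pos_list_nth length_pos_list)
  finally have eq: "marked_gf y z w_main (neg_list N) = prod_list (map ?s (neg_list N)) * (\<Sum>n<N. (\<Prod>i<n. ?r (- of_nat (Suc i)) * ?s' (- of_nat (Suc i))) * (?c (- of_nat (Suc n)) * ?s' (- of_nat (Suc n))))"
    unfolding marked_gf_eq[OF neg_list_nz] unfolding M transfer_sum_rev rev_map[symmetric] prod_list_rev .
  have "fps_const (2 * (c * d)) * ((\<Prod>i<n. ?r (- of_nat (Suc i)) * ?s' (- of_nat (Suc i))) * (?c (- of_nat (Suc n)) * ?s' (- of_nat (Suc n))))
     = - (fps_X * wp_fps (scaled_X 2) (scaled_X c) (scaled_X d) (Suc n))" for n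
  proof -
    define m where "m = (of_nat (Suc n) :: 'a)"
    have m: "m \<noteq> 0" "- m \<noteq> 0" unfolding m_def by (simp_all del: of_nat_Suc)
    have p: "lin_quot c (2 - c) k = ?s' (- k)" "lin_quot d (2 - d) k = ?r (- k)" for k
      by (simp_all add: lin_quot_uminus c_def d_def add.commute)
    have l: "lin m (2 - c) = lin m (1 - y / 2)" "lin m (2 - d) = lin m (1 + z / 2)" by (simp_all add: c_def d_def)
    have cs: "?c (- m) * ?s' (- m) = - (fps_X ^ 3 * lin m 1 * inverse (fps_const m) * inverse (lin m 2)
     * inverse (lin m (1 + z / 2)) * inverse (lin m (1 - y / 2)))"
    proof -
      have "?c (- m) * ?s' (- m) = - (fps_X ^ 3 * lin m 1 * inverse (fps_const m) * inverse (lin m 2)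
     * inverse (lin m (1 + z / 2)) * (lin m (1 + y / 2) * inverse (lin m (1 + y / 2))) * inverse (lin m (1 - y / 2)))"
        unfolding mark_factor_main[OF m(2)] lin_quot_def lin_uminus
        by (simp add: fps_inverse_minus fps_const_neg[symmetric] add.commute mult_ac del: fps_const_neg)
      then show ?thesis unfolding lin_inverse[OF m(1)] by simp
    qed
    show ?thesis
      unfolding wp_fps_Suc p fps_of_nat[symmetric] m_def[symmetric] cs l
      by (simp add: power3_eq_cube power2_eq_square mult_ac numeral_fps_const)
  qed
  then have "fps_const (2 * (c * d)) * (\<Sum>n<N. (\<Prod>i<n. ?r (- of_nat (Suc i)) * ?s' (- of_nat (Suc i))) * (?c (- of_nat (Suc n)) * ?s' (- of_nat (Suc n))))
     = - (fps_X * (\<Sum>n=1..N. wp_fps (scaled_X 2) (scaled_X c) (scaled_X d) n))"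
    unfolding sum_distrib_left by (simp only: sum.atLeast1_atMost_eq One_nat_def sum_negf)
  from mult_left_commute_eq[OF this] show ?thesis
    unfolding eq by (simp only: mult_minus_left mult_minus_right)
qed

lemma lin_quot_same: "m \<noteq> 0 \<Longrightarrow> lin_quot u u m = 1"
  by (simp add: lin_quot_def lin_inverse)

text \<open>With \<open>z = 0\<close> the factors of the numbers after the marked one are all 1, and the sum is of Gauss type.\<close>

lemma marked_sum_pos:
  fixes y :: "'a::field_char_0"
  defines "c \<equiv> y / 2 - 1"
  shows "fps_const c * marked_gf y 0 w_sum (pos_list N) = fps_X * (\<Sum>n=1..N. gauss_fps (scaled_X c) (scaled_X (- 1 - y / 2)) n)"
proof -
  let ?r = "lin_quot (- 1 + y / 2) (- 1 - y / 2)" and ?M = "pos_list N :: 'a list" and ?c = "mark_factor y 0 w_sum"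
  have "transfer_sum ?r (\<lambda>_. 1) ?c ?M = prod_list (map (\<lambda>_. 1) ?M) *
     (\<Sum>n<length ?M. (\<Prod>i<n. ?r (?M ! i) * 1) * (?c (?M ! n) * 1))"
    by (rule transfer_sum_factor) simp
  also have "\<dots> = (\<Sum>n<N. (\<Prod>i<n. ?r (of_nat (Suc i))) * ?c (of_nat (Suc n)))"
    unfolding length_pos_list
    by (simp add: map_replicate_const, intro sum.cong refl arg_cong2[of _ _ _ _ "(*)"] prod.cong) (simp_all add: pos_list_nth)
  also have "transfer_sum ?r (\<lambda>_. 1) ?c ?M = marked_gf y 0 w_sum ?M"
    unfolding marked_gf_eq[OF pos_list_nz]
  proof (intro transfer_sum_cong refl)
    fix m :: 'a assume "m \<in> set ?M"
    then have "m \<noteq> 0" using pos_list_nz by metis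
    then show "1 = lin_quot (- 1 + 0 / 2) (- 1 - 0 / 2) m" by (simp add: lin_quot_same)
  qed
  finally have eq: "marked_gf y 0 w_sum ?M = (\<Sum>n<N. (\<Prod>i<n. ?r (of_nat (Suc i))) * ?c (of_nat (Suc n)))" .
  have "fps_const c * ((\<Prod>i<n. ?r (of_nat (Suc i))) * ?c (of_nat (Suc n))) = fps_X * gauss_fps (scaled_X c) (scaled_X (- 1 - y / 2)) (Suc n)" for n
  proof -
    have "of_nat (Suc n) \<noteq> (0::'a)" by (simp del: of_nat_Suc)
    then show ?thesis
      unfolding gauss_fps_Suc mark_factor_sum[OF \<open>of_nat (Suc n) \<noteq> (0::'a)\<close>] fps_of_nat[symmetric]
      by (simp add: c_def power2_eq_square mult_ac del: of_nat_Suc)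
  qed
  then show ?thesis
    unfolding eq sum_distrib_left by (simp only: sum.atLeast1_atMost_eq One_nat_def)
qed

lemma marked_sum_neg:
  fixes y :: "'a::field_char_0"
  defines "c \<equiv> 1 + y / 2"
  shows "fps_const c * marked_gf y 0 w_sum (neg_list N)
     = prod_list (map (lin_quot (- 1 + y / 2) (- 1 - y / 2)) (neg_list N)) * (fps_X * (\<Sum>n=1..N. gauss_fps (scaled_X c) (scaled_X (1 - y / 2)) n))"
proof -
  let ?s = "lin_quot (- 1 + y / 2) (- 1 - y / 2)" and ?s' = "lin_quot (- 1 - y / 2) (- 1 + y / 2)"
  let ?M = "map uminus (pos_list N) :: 'a list" and ?c = "mark_factor y 0 w_sum"
  have M: "neg_list N = rev ?M" by (simp add: neg_list_def rev_map)
  have nz: "m \<noteq> 0" if "m \<in> set ?M" for m using that by (auto simp: pos_list_def)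
  have "transfer_sum (\<lambda>_. 1) ?s ?c ?M = prod_list (map ?s ?M) *
     (\<Sum>n<length ?M. (\<Prod>i<n. 1 * ?s' (?M ! i)) * (?c (?M ! n) * ?s' (?M ! n)))"
    by (rule transfer_sum_factor) (use nz lin_quot_inverse in blast)
  also have "(\<Sum>n<length ?M. (\<Prod>i<n. 1 * ?s' (?M ! i)) * (?c (?M ! n) * ?s' (?M ! n)))
      = (\<Sum>n<N. (\<Prod>i<n. ?s' (- of_nat (Suc i))) * (?c (- of_nat (Suc n)) * ?s' (- of_nat (Suc n))))"
    unfolding length_map length_pos_list
    by (intro sum.cong refl arg_cong2[of _ _ _ _ "(*)"] prod.cong) (simp_all add: pos_list_nth length_pos_list)
  also have "transfer_sum (\<lambda>_. 1) ?s ?c ?M = marked_gf y 0 w_sum (neg_list N)"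
    unfolding marked_gf_eq[OF neg_list_nz] unfolding M transfer_sum_rev
  proof (intro transfer_sum_cong refl)
    fix m :: 'a assume "m \<in> set ?M"
    then have "m \<noteq> 0" by (rule nz)
    then show "1 = lin_quot (- 1 + 0 / 2) (- 1 - 0 / 2) m" by (simp add: lin_quot_same)
  qed
  finally have eq: "marked_gf y 0 w_sum (neg_list N) = prod_list (map ?s (neg_list N)) * (\<Sum>n<N. (\<Prod>i<n. ?s' (- of_nat (Suc i))) * (?c (- of_nat (Suc n)) * ?s' (- of_nat (Suc n))))"
    unfolding M rev_map[symmetric] prod_list_rev .
  have "fps_const c * ((\<Prod>i<n. ?s' (- of_nat (Suc i))) * (?c (- of_nat (Suc n)) * ?s' (- of_nat (Suc n)))) = fps_X * gauss_fps (scaled_X c) (scaled_X (1 - y / 2)) (Suc n)" for n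
  proof -
    define m where "m = (of_nat (Suc n) :: 'a)"
    have m: "m \<noteq> 0" "- m \<noteq> 0" unfolding m_def by (simp_all del: of_nat_Suc)
    have p: "lin_quot c (1 - y / 2) k = ?s' (- k)" for k
      by (simp_all add: lin_quot_uminus c_def add.commute)
    have cs: "?c (- m) * ?s' (- m) = fps_X ^ 2 * inverse (fps_const m) * inverse (lin m (1 - y / 2))"
    proof -
      have "?c (- m) * ?s' (- m) = fps_X ^ 2 * inverse (fps_const m) * (lin m (1 + y / 2) * inverse (lin m (1 + y / 2))) * inverse (lin m (1 - y / 2))"
        unfolding mark_factor_sum[OF m(2)] lin_quot_def lin_uminus
        by (simp add: fps_inverse_minus fps_const_neg[symmetric] add.commute mult_ac del: fps_const_neg)
      then show ?thesis unfolding lin_inverse[OF m(1)] by simp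
    qed
    show ?thesis
      unfolding gauss_fps_Suc p fps_of_nat[symmetric] m_def[symmetric] cs
      by (simp add: power2_eq_square mult_ac)
  qed
  then have "fps_const c * (\<Sum>n<N. (\<Prod>i<n. ?s' (- of_nat (Suc i))) * (?c (- of_nat (Suc n)) * ?s' (- of_nat (Suc n))))
     = fps_X * (\<Sum>n=1..N. gauss_fps (scaled_X c) (scaled_X (1 - y / 2)) n)"
    unfolding sum_distrib_left by (simp only: sum.atLeast1_atMost_eq One_nat_def)
  then show ?thesis unfolding eq by (rule mult_left_commute_eq)
qed

section \<open>Multiple harmonic sums and their limits\<close>

lemma chain_sum_Nil: "chain_sum [] ks = (if ks = [] then 1 else 0)"
  by (cases ks) simp_all

lemma chain_sum_append:
  "chain_sum (M @ M') ks = (\<Sum>i\<le>length ks. chain_sum M (take i ks) * chain_sum M' (drop i ks))"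
proof (induction M arbitrary: ks)
  case Nil
  have "(\<Sum>i\<le>length ks. chain_sum [] (take i ks) * chain_sum M' (drop i ks)) = (\<Sum>i\<in>{0}. chain_sum [] (take i ks) * chain_sum M' (drop i ks))"
  proof (rule sum.mono_neutral_right)
    show "\<forall>i\<in>{..length ks} - {0}. chain_sum [] (take i ks) * chain_sum M' (drop i ks) = 0"
      by (cases ks) (auto simp: take_Cons' neq0_conv)
  qed auto
  then show ?case by simp
next
  case (Cons m M)
  show ?case
  proof (cases ks)
    case Nil
    then show ?thesis using Cons[of "[]"] by simp
  next
    case (Cons k l)
    have "chain_sum ((m # M) @ M') ks = chain_sum (M @ M') ks + chain_sum (M @ M') l / m ^ k"
      by (simp add: Cons)
    also have "\<dots> = (\<Sum>i\<le>length ks. chain_sum M (take i ks) * chain_sum M' (drop i ks))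
         + (\<Sum>i\<le>length l. chain_sum M (take i l) * chain_sum M' (drop i l)) / m ^ k"
      by (simp only: Cons.IH)
    also have "\<dots> = (\<Sum>i\<le>length ks. chain_sum (m # M) (take i ks) * chain_sum M' (drop i ks))"
      unfolding Cons length_Cons sum.atMost_Suc_shift
      by (simp add: sum_divide_distrib sum.distrib[symmetric] distrib_right add.assoc)
    finally show ?thesis .
  qed
qed

lemma chain_sum_single: "chain_sum [m] ks = (case ks of [] \<Rightarrow> 1 | [k] \<Rightarrow> 1 / m ^ k | _ \<Rightarrow> 0)"
  by (auto split: list.splits)

lemma chain_sum_snoc: "chain_sum (M @ [m]) (ks @ [k]) = chain_sum M (ks @ [k]) + chain_sum M ks / m ^ k"
proof -
  have "chain_sum (M @ [m]) (ks @ [k]) = (\<Sum>i\<in>{length ks, Suc (length ks)}. chain_sum M (take i (ks @ [k])) * chain_sum [m] (drop i (ks @ [k])))"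
    unfolding chain_sum_append
  proof (rule sum.mono_neutral_right)
    show "\<forall>i\<in>{..length (ks @ [k])} - {length ks, Suc (length ks)}. chain_sum M (take i (ks @ [k])) * chain_sum [m] (drop i (ks @ [k])) = 0"
    proof
      fix i assume "i \<in> {..length (ks @ [k])} - {length ks, Suc (length ks)}"
      then have "i < length ks" by auto
      then obtain a b where "drop i ks = a # b" by (cases "drop i ks") auto
      with \<open>i < length ks\<close> have "chain_sum [m] (drop i (ks @ [k])) = 0"
        by (cases b) (auto simp: chain_sum_single)
      then show "chain_sum M (take i (ks @ [k])) * chain_sum [m] (drop i (ks @ [k])) = 0" by simp
    qed
  qed auto
  then show ?thesis by simp
qed

lemma chain_sum_rev: "chain_sum (rev M) ks = chain_sum M (rev ks)"
proof (induction M arbitrary: ks)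
  case Nil
  show ?case by (simp add: chain_sum_Nil)
next
  case (Cons m M)
  then show ?case by (cases ks rule: rev_cases) (simp_all add: chain_sum_snoc)
qed

lemma chain_sum_uminus: "chain_sum (map uminus M) ks = (- 1) ^ sum_list ks * chain_sum M ks"
proof (induction M arbitrary: ks)
  case Nil
  then show ?case by (cases ks) auto
next
  case (Cons m M)
  note IH = Cons.IH
  show ?case
  proof (cases ks)
    case (Cons k l)
    have "a / (- m) ^ k = (- 1) ^ k * (a / m ^ k)" for a
      by (cases "even k") simp_all
    then show ?thesis
      using IH by (simp add: Cons power_add distrib_left mult.left_commute mult.assoc)
  qed simp
qed

lemma chain_sum_set:
  assumes "sorted_wrt (<) M"
  shows "chain_sum (map of_nat M :: 'a::field list) ks =
    (\<Sum>ns\<in>{ns. length ns = length ks \<and> sorted_wrt (<) ns \<and> set ns \<subseteq> set M}. \<Prod>i<length ks. (1::'a) / of_nat (ns ! i) ^ (ks ! i))"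
  using assms
proof (induction M arbitrary: ks)
  case Nil
  show ?case
  proof (cases ks)
    case Nil
    then have "{ns :: nat list. length ns = length ks \<and> sorted_wrt (<) ns \<and> set ns \<subseteq> set []} = {[]}" by auto
    then show ?thesis using Nil by simp
  next
    case (Cons k l)
    then have "{ns :: nat list. length ns = length ks \<and> sorted_wrt (<) ns \<and> set ns \<subseteq> set []} = {}" by auto
    then show ?thesis using Cons by (simp only: sum.empty list.map chain_sum.simps)
  qed
next
  case (Cons m M)
  let ?S = "\<lambda>M ks. {ns. length ns = length ks \<and> sorted_wrt (<) ns \<and> set ns \<subseteq> set M}"
  have fin: "finite (?S M ks)" for M and ks :: "nat list"
    by (rule finite_subset[OF _ finite_lists_length_eq[of "set M" "length ks"]]) auto
  show ?case
  proof (cases ks)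
    case Nil
    then have "?S (m # M) ks = {[]}" by auto
    then show ?thesis using Nil by simp
  next
    case (Cons k l)
    have m: "\<forall>x\<in>set M. m < x" using Cons.prems by simp
    have eq: "?S (m # M) ks = ?S M ks \<union> (#) m ` ?S M l"
    proof (intro equalityI subsetI)
      fix ns assume ns: "ns \<in> ?S (m # M) ks"
      then obtain a ns' where a: "ns = a # ns'" using Cons by (cases ns) auto
      have "m \<notin> set ns'" using ns m unfolding a by force
      then show "ns \<in> ?S M ks \<union> (#) m ` ?S M l"
        using ns Cons unfolding a by (cases "a = m") auto
    qed (use Cons m in \<open>auto simp: subset_iff\<close>)
    have disj: "?S M ks \<inter> (#) m ` ?S M l = {}" using m by auto
    have "(\<Sum>ns\<in>?S (m # M) ks. \<Prod>i<length ks. (1::'a) / of_nat (ns ! i) ^ (ks ! i))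
      = (\<Sum>ns\<in>?S M ks. \<Prod>i<length ks. (1::'a) / of_nat (ns ! i) ^ (ks ! i)) + (\<Sum>ns\<in>?S M l. (1::'a) / of_nat m ^ k * (\<Prod>i<length l. (1::'a) / of_nat (ns ! i) ^ (l ! i)))"
      unfolding eq
      by (subst sum.union_disjoint[OF fin finite_imageI[OF fin] disj])
         (simp add: sum.reindex Cons prod.lessThan_Suc_shift del: prod.lessThan_Suc)
    also have "\<dots> = chain_sum (map of_nat M) ks + chain_sum (map of_nat M) l / of_nat m ^ k"
      using Cons.IH Cons.prems by (simp add: sum_divide_distrib)
    finally show ?thesis using Cons by simp
  qed
qed

lemma chain_sum_pos_list:
  "chain_sum (pos_list N :: 'a::field_char_0 list) ks =
    (\<Sum>ns\<in>{ns. length ns = length ks \<and> sorted_wrt (<) ns \<and> set ns \<subseteq> {1..N}}. \<Prod>i<length ks. 1 / of_nat (ns ! i) ^ (ks ! i))"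
proof -
  have "set [1..<Suc N] = {1..N}" by auto
  moreover have "sorted_wrt (<) [1..<Suc N]" by (simp only: sorted_wrt_upt)
  ultimately show ?thesis
    using chain_sum_set[of "[1..<Suc N]" ks, where 'a = 'a] unfolding pos_list_def by simp
qed

lemma mult_harmonic_sum_eq: "mult_harmonic_sum N ks = chain_sum (pos_list N) ks"
  unfolding mult_harmonic_sum_def chain_sum_pos_list ..

definition hsum :: "nat \<Rightarrow> nat list \<Rightarrow> real" where "hsum N ks = chain_sum (pos_list N) ks"

lemma pos_list_Suc: "pos_list (Suc N) = pos_list N @ [of_nat (Suc N)]"
  by (simp add: pos_list_def)

lemma hsum_Nil: "hsum N [] = 1"
  by (simp add: hsum_def)

lemma hsum_0: "ks \<noteq> [] \<Longrightarrow> hsum 0 ks = 0"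
  by (cases ks) (simp_all add: hsum_def pos_list_def)

lemma hsum_Suc: "hsum (Suc N) (ks @ [k]) = hsum N (ks @ [k]) + hsum N ks / real (Suc N) ^ k"
  by (simp add: hsum_def pos_list_Suc chain_sum_snoc)

lemma hsum_nonneg: "hsum N ks \<ge> 0"
proof (induction N arbitrary: ks)
  case 0
  then show ?case by (cases "ks = []") (simp_all add: hsum_Nil hsum_0)
next
  case (Suc N)
  then show ?case by (cases ks rule: rev_cases) (simp_all add: hsum_Nil hsum_Suc del: of_nat_Suc)
qed

text \<open>This is the reason for the sign and the reversal in the definition of \<open>zeta_star_S\<close>: the part of a nested sum
placed on \<open>-N, \<dots>, -1\<close> is a sum over \<open>1, \<dots>, N\<close> read backwards.\<close>

lemma chain_sum_symmetric:
  "chain_sum (pos_list N @ neg_list N) ks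
     = (\<Sum>i\<le>length ks. (-1) ^ sum_list (drop i ks) * hsum N (take i ks) * hsum N (rev (drop i ks)))"
  unfolding chain_sum_append neg_list_def chain_sum_uminus chain_sum_rev hsum_def by (simp add: mult_ac)

text \<open>Linear extension to the harmonic algebra of a function on words, with rational scalars interpreted by \<open>\<phi>\<close>.\<close>

definition evalw :: "(rat \<Rightarrow> 'b) \<Rightarrow> (nat list \<Rightarrow> 'b) \<Rightarrow> hcomb \<Rightarrow> 'b::comm_ring_1" where
  "evalw \<phi> f x = (\<Sum>w\<in>Poly_Mapping.keys x. \<phi> (Poly_Mapping.lookup x w) * f w)"

locale rat_hom =
  fixes \<phi> :: "rat \<Rightarrow> 'b::comm_ring_1"
  assumes add: "\<phi> (a + b) = \<phi> a + \<phi> b" and mult: "\<phi> (a * b) = \<phi> a * \<phi> b" and one: "\<phi> 1 = 1"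
begin

lemma zero: "\<phi> 0 = 0"
  using add[of 0 0] by simp

lemma evalw_superset:
  assumes "finite S" "Poly_Mapping.keys x \<subseteq> S"
  shows "evalw \<phi> f x = (\<Sum>w\<in>S. \<phi> (Poly_Mapping.lookup x w) * f w)"
  unfolding evalw_def
  by (rule sum.mono_neutral_left) (use assms in \<open>auto simp: in_keys_iff zero\<close>)

lemma evalw_add: "evalw \<phi> f (x + y) = evalw \<phi> f x + evalw \<phi> f y"
proof -
  let ?S = "Poly_Mapping.keys x \<union> Poly_Mapping.keys y"
  have "evalw \<phi> f (x + y) = (\<Sum>w\<in>?S. \<phi> (Poly_Mapping.lookup (x + y) w) * f w)"
    by (rule evalw_superset) (use keys_add[of x y] in auto)
  also have "\<dots> = (\<Sum>w\<in>?S. \<phi> (Poly_Mapping.lookup x w) * f w) + (\<Sum>w\<in>?S. \<phi> (Poly_Mapping.lookup y w) * f w)"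
    by (simp add: lookup_add add distrib_right sum.distrib)
  also have "\<dots> = evalw \<phi> f x + evalw \<phi> f y"
    by (simp add: evalw_superset[of ?S])
  finally show ?thesis .
qed

lemma lookup_hscale: "Poly_Mapping.lookup (hscale q x) w = q * Poly_Mapping.lookup x w"
  unfolding hscale_def by (simp add: map.rep_eq when_def)

lemma evalw_hscale: "evalw \<phi> f (hscale q x) = \<phi> q * evalw \<phi> f x"
proof -
  have "Poly_Mapping.keys (hscale q x) \<subseteq> Poly_Mapping.keys x"
    by (auto simp: in_keys_iff lookup_hscale)
  then have "evalw \<phi> f (hscale q x) = (\<Sum>w\<in>Poly_Mapping.keys x. \<phi> (q * Poly_Mapping.lookup x w) * f w)"
    by (subst evalw_superset[of "Poly_Mapping.keys x"]) (simp_all add: lookup_hscale)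
  then show ?thesis by (simp add: evalw_def mult sum_distrib_left mult.assoc)
qed

lemma evalw_0: "evalw \<phi> f 0 = 0"
  by (simp add: evalw_def)

lemma evalw_sum: "evalw \<phi> f (\<Sum>i\<in>A. g i) = (\<Sum>i\<in>A. evalw \<phi> f (g i))"
  by (induction A rule: infinite_finite_induct) (simp_all add: evalw_0 evalw_add)

lemma evalw_word: "evalw \<phi> f (word w) = f w"
  by (simp add: evalw_def word_def one)

lemma evalw_lin_ext: "evalw \<phi> f (lin_ext g x) = evalw \<phi> (\<lambda>w. evalw \<phi> f (g w)) x"
  unfolding lin_ext_def evalw_sum evalw_hscale by (simp add: evalw_def)

lemma evalw_cong: "(\<And>w. w \<in> Poly_Mapping.keys x \<Longrightarrow> f w = g w) \<Longrightarrow> evalw \<phi> f x = evalw \<phi> g x"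
  by (simp add: evalw_def)

lemma evalw_fun_add: "evalw \<phi> (\<lambda>w. f w + g w) x = evalw \<phi> f x + evalw \<phi> g x"
  by (simp add: evalw_def distrib_left sum.distrib)

lemma evalw_fun_cmult: "evalw \<phi> (\<lambda>w. c * f w) x = c * evalw \<phi> f x"
  by (simp add: evalw_def sum_distrib_left mult.left_commute)

end

interpretation real_hom: rat_hom "of_rat :: rat \<Rightarrow> real"
  by unfold_locales (simp_all add: of_rat_add of_rat_mult)

interpretation poly_hom: rat_hom "\<lambda>q. [:of_rat q :: real:]"
  by unfold_locales (simp_all add: of_rat_add of_rat_mult pCons_one)

abbreviation hsum_ev :: "nat \<Rightarrow> hcomb \<Rightarrow> real" where "hsum_ev N \<equiv> evalw of_rat (hsum N)"

lemma hsum_ev_append_letter: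
  "hsum_ev (Suc N) (append_letter x k) = hsum_ev N (append_letter x k) + hsum_ev N x / real (Suc N) ^ k"
  unfolding append_letter_def real_hom.evalw_lin_ext real_hom.evalw_word hsum_Suc real_hom.evalw_fun_add divide_inverse
  by (simp add: mult.commute[of "hsum N _"] real_hom.evalw_fun_cmult)

lemma hsum_ev_0_append_letter: "hsum_ev 0 (append_letter x k) = 0"
  unfolding append_letter_def real_hom.evalw_lin_ext real_hom.evalw_word by (simp add: hsum_0 evalw_def)

text \<open>The recursion of the harmonic product is the case distinction whether the largest summation index of the first
factor, of the second, or of both, is the current one.\<close>

lemma hsum_harmonic_words: "hsum_ev N (harmonic_words u v) = hsum N u * hsum N v"
proof (induction N arbitrary: u v)
  case 0
  consider "u = []" | "v = []" | u' k v' l where "u = u' @ [k]" "v = v' @ [l]"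
    by (metis rev_exhaust)
  then show ?case
    by cases (simp_all add: harmonic_words_Nil harmonic_words_snoc real_hom.evalw_word hsum_Nil hsum_0 real_hom.evalw_add hsum_ev_0_append_letter)
next
  case (Suc N)
  consider "u = []" | "v = []" | u' k v' l where "u = u' @ [k]" "v = v' @ [l]"
    by (metis rev_exhaust)
  then show ?case
  proof cases
    case 3
    have IH: "hsum_ev N (append_letter (harmonic_words u' (v' @ [l])) k) + hsum_ev N (append_letter (harmonic_words (u' @ [k]) v') l)
       + hsum_ev N (append_letter (harmonic_words u' v') (k + l)) = hsum N (u' @ [k]) * hsum N (v' @ [l])"
      using Suc[of "u' @ [k]" "v' @ [l]"] unfolding harmonic_words_snoc real_hom.evalw_add .
    show ?thesis
      unfolding 3 harmonic_words_snoc real_hom.evalw_add hsum_ev_append_letter hsum_Suc Suc power_add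
      using IH by (simp add: algebra_simps divide_inverse)
  qed (simp_all add: harmonic_words_Nil real_hom.evalw_word hsum_Nil)
qed

lemma hsum_harmonic: "hsum_ev N (harmonic x y) = hsum_ev N x * hsum_ev N y"
  unfolding harmonic_def real_hom.evalw_lin_ext hsum_harmonic_words real_hom.evalw_fun_cmult
  by (simp add: mult.commute[of "hsum N _"] real_hom.evalw_fun_cmult)

definition hnum :: "nat \<Rightarrow> real" where "hnum N = hsum N [1]"

lemma hnum_eq: "hnum N = harm N"
proof (induction N)
  case (Suc N)
  then show ?case using hsum_Suc[of N "[]" 1]
    by (simp add: hnum_def hsum_Nil harm_Suc divide_inverse)
qed (simp add: hnum_def hsum_0 harm_def)

lemma hnum_Suc: "hnum (Suc N) = hnum N + 1 / real (Suc N)"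
  using hsum_Suc[of N "[]" 1] by (simp add: hnum_def hsum_Nil)

lemma hnum_nonneg: "hnum N \<ge> 0" by (simp add: hnum_def hsum_nonneg)

text \<open>Every nested sum is bounded by the power of the harmonic number in which all exponents are 1.\<close>

lemma hsum_le_hnum_power: "is_index ks \<Longrightarrow> hsum N ks \<le> hnum N ^ length ks"
proof (induction N arbitrary: ks)
  case 0
  then show ?case by (cases "ks = []") (simp_all add: hsum_Nil hsum_0 hnum_nonneg)
next
  case (Suc N)
  show ?case
  proof (cases ks rule: rev_cases)
    case (snoc l k)
    have l: "is_index l" "k \<ge> 1" using Suc.prems snoc by (auto simp: is_index_def)
    define r where "r = length l"
    define u where "u = 1 / real (Suc N)"
    have u: "0 \<le> u" by (simp add: u_def)
    have "hsum N l / real (Suc N) ^ k \<le> hnum N ^ r * u"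
    proof -
      have "hsum N l / real (Suc N) ^ k \<le> hsum N l / real (Suc N) ^ 1"
        using l by (intro divide_left_mono power_increasing hsum_nonneg) auto
      also have "\<dots> \<le> hnum N ^ r / real (Suc N) ^ 1"
        using Suc.IH[OF l(1)] unfolding r_def by (intro divide_right_mono) auto
      finally show ?thesis by (simp add: u_def)
    qed
    moreover have "hsum N (l @ [k]) \<le> hnum N ^ Suc r"
      using Suc.IH[of "l @ [k]"] Suc.prems snoc by (simp add: r_def)
    ultimately have "hsum (Suc N) ks \<le> hnum N ^ r * (hnum N + u)"
      unfolding snoc hsum_Suc by (simp add: algebra_simps)
    also have "\<dots> \<le> (hnum N + u) ^ r * (hnum N + u)"
      using u hnum_nonneg[of N] by (intro mult_right_mono power_mono) auto
    finally show ?thesis by (simp add: snoc hnum_Suc u_def r_def mult.commute)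
  qed (simp add: hsum_Nil)
qed

lemma hnum_bound: "hnum (Suc N) \<le> 1 + ln (real (Suc N))"
proof (induction N)
  case (Suc N)
  have "1 / real (Suc (Suc N)) \<le> ln (real (Suc (Suc N))) - ln (real (Suc N))"
  proof -
    have "ln (real (Suc N) / real (Suc (Suc N))) \<le> real (Suc N) / real (Suc (Suc N)) - 1"
      by (rule ln_le_minus_one) simp
    also have "\<dots> = - (1 / real (Suc (Suc N)))" by (simp add: field_simps)
    finally show ?thesis by (simp add: ln_div del: of_nat_Suc)
  qed
  then show ?case using Suc hnum_Suc[of "Suc N"] by linarith
qed (simp add: hnum_eq harm_def)

lemma hnum_at_top: "filterlim hnum at_top sequentially"
  using harm_at_top unfolding hnum_eq[abs_def] .

lemma summable_hnum_power: "summable (\<lambda>n. hnum (Suc n) ^ c / real (Suc n) ^ 2)"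
proof (rule summable_comparison_test)
  define e where "e = 1 / (2 * (real c + 1))"
  define K where "K = (1 + 1 / e) ^ c"
  have e: "e > 0" by (simp add: e_def)
  have "norm (hnum (Suc n) ^ c / real (Suc n) ^ 2) \<le> K * real (Suc n) powr (-3/2)" for n
  proof -
    define x where "x = real (Suc n)"
    have x: "x \<ge> 1" by (simp add: x_def)
    have "hnum (Suc n) \<le> 1 + ln x" using hnum_bound by (simp add: x_def)
    also have "\<dots> \<le> x powr e + x powr e / e"
      using x e ln_powr_bound[of x e] by (intro add_mono) (auto intro: ge_one_powr_ge_zero)
    also have "\<dots> = (1 + 1 / e) * x powr e" by (simp add: algebra_simps)
    finally have "hnum (Suc n) ^ c \<le> ((1 + 1 / e) * x powr e) ^ c"
      by (intro power_mono hnum_nonneg)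
    also have "\<dots> = K * x powr (e * c)"
      using x by (simp add: power_mult_distrib K_def powr_powr flip: powr_realpow)
    also have "\<dots> \<le> K * x powr (1/2)"
      using x e by (intro mult_left_mono powr_mono) (auto simp: K_def e_def field_simps)
    finally have "hnum (Suc n) ^ c / x ^ 2 \<le> K * x powr (1/2) / x ^ 2"
      by (rule divide_right_mono) simp
    also have "\<dots> = K * (x powr (1/2) * x powr (-2))"
    proof -
      have "x powr (-2) = 1 / x ^ 2" using x by (simp add: powr_minus divide_simps)
      then show ?thesis by simp
    qed
    also have "x powr (1/2) * x powr (-2) = x powr (-3/2)" by (simp flip: powr_add)
    finally show ?thesis using hnum_nonneg[of "Suc n"] by (simp add: x_def)
  qed
  then show "\<exists>M. \<forall>n\<ge>M. norm (hnum (Suc n) ^ c / real (Suc n) ^ 2) \<le> K * real (Suc n) powr (-3/2)"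
    by blast
  have "summable (\<lambda>n. real n powr (-3/2))" by (simp add: summable_real_powr_iff)
  then show "summable (\<lambda>n. K * real (Suc n) powr (-3/2))"
    using summable_Suc_iff[of "\<lambda>n. real n powr (-3/2)"] by (intro summable_mult) blast
qed

text \<open>The tails of a convergent nested sum are \<open>O(log N ^ r / N)\<close>, hence small even after multiplication by any power of a harmonic
number. This lets limits and polynomials in harmonic numbers be multiplied freely.\<close>

lemma hsum_tail:
  assumes "admissible ks"
  obtains L where "\<And>N. hsum N ks \<le> L" "\<And>c. (\<lambda>N. (hsum N ks - L) * hnum N ^ c) \<longlonglongrightarrow> 0"
proof (cases ks rule: rev_cases)
  case Nil
  show ?thesis by (rule that[of 1]) (simp_all add: Nil hsum_Nil)
next
  case (snoc l k)
  have k: "k \<ge> 2" and l: "is_index l" using assms snoc by (auto simp: admissible_def is_index_def)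
  define a where "a n = hsum n l / real (Suc n) ^ k" for n
  have a0: "a n \<ge> 0" for n by (simp add: a_def hsum_nonneg)
  have hs: "hsum N ks = (\<Sum>n<N. a n)" for N
    by (induction N) (simp_all add: snoc hsum_Suc hsum_0 a_def)
  have hm: "hnum n \<le> hnum (Suc n)" for n by (simp add: hnum_Suc)
  have ab: "a n * hnum (Suc n) ^ c \<le> hnum (Suc n) ^ (length l + c) / real (Suc n) ^ 2" for n c
  proof -
    have "a n \<le> hnum n ^ length l / real (Suc n) ^ 2"
      unfolding a_def using k l by (intro frac_le hsum_le_hnum_power power_increasing) (auto simp: hnum_nonneg)
    also have "\<dots> \<le> hnum (Suc n) ^ length l / real (Suc n) ^ 2"
      by (intro divide_right_mono power_mono hm hnum_nonneg) auto
    finally have "a n * hnum (Suc n) ^ c \<le> hnum (Suc n) ^ length l / real (Suc n) ^ 2 * hnum (Suc n) ^ c"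
      by (rule mult_right_mono) (simp add: hnum_nonneg)
    then show ?thesis by (simp add: power_add)
  qed
  have sb: "summable (\<lambda>n. a n * hnum (Suc n) ^ c)" for c
    by (rule summable_comparison_test'[OF summable_hnum_power[of "length l + c"], of 0])
       (use ab a0 hnum_nonneg in auto)
  have sa: "summable a" using sb[of 0] by simp
  show ?thesis
  proof (rule that[of "suminf a"])
    show "hsum N ks \<le> suminf a" for N
      unfolding hs by (rule sum_le_suminf[OF sa]) (auto simp: a0)
    fix c
    define b where "b n = a n * hnum (Suc n) ^ c" for n
    have "(\<lambda>N. suminf b - (\<Sum>n<N. b n)) \<longlonglongrightarrow> suminf b - suminf b"
      unfolding b_def by (intro tendsto_diff tendsto_const summable_LIMSEQ sb)
    have sbb: "summable b" using sb[of c] unfolding b_def .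
    from \<open>(\<lambda>N. suminf b - (\<Sum>n<N. b n)) \<longlonglongrightarrow> suminf b - suminf b\<close> have tail: "(\<lambda>N. suminf b - (\<Sum>n<N. b n)) \<longlonglongrightarrow> 0" by simp
    have bound: "norm ((hsum N ks - suminf a) * hnum N ^ c) \<le> suminf b - (\<Sum>n<N. b n)" for N
    proof -
      have 1: "suminf a - hsum N ks = suminf (\<lambda>n. a (n + N))"
        unfolding hs using suminf_split_initial_segment[OF sa, of N] by simp
      have 2: "suminf b - (\<Sum>n<N. b n) = suminf (\<lambda>n. b (n + N))"
        using suminf_split_initial_segment[OF sbb, of N] by simp
      have "suminf (\<lambda>n. a (n + N)) * hnum N ^ c = suminf (\<lambda>n. a (n + N) * hnum N ^ c)"
        by (rule suminf_mult2) (use sa in \<open>simp add: summable_iff_shift\<close>)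
      also have "\<dots> \<le> suminf (\<lambda>n. b (n + N))"
      proof (rule suminf_le)
        show "a (n + N) * hnum N ^ c \<le> b (n + N)" for n
          unfolding b_def
          by (intro mult_left_mono power_mono a0 hnum_nonneg) (simp add: hnum_eq harm_mono)
        show "summable (\<lambda>n. a (n + N) * hnum N ^ c)"
          by (intro summable_mult2) (use sa in \<open>simp add: summable_iff_shift\<close>)
        show "summable (\<lambda>n. b (n + N))"
          using sbb by (simp add: summable_iff_shift)
      qed
      finally have "(suminf a - hsum N ks) * hnum N ^ c \<le> suminf b - (\<Sum>n<N. b n)" using 1 2 by simp
      moreover have "suminf a - hsum N ks \<ge> 0"
        unfolding hs using sum_le_suminf[OF sa, of "{..<N}"] a0 by simp
      ultimately show ?thesis using hnum_nonneg[of N] by (simp add: abs_mult abs_minus_commute)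
    qed
    show "(\<lambda>N. (hsum N ks - suminf a) * hnum N ^ c) \<longlonglongrightarrow> 0"
      by (rule Lim_null_comparison[OF _ tail]) (use bound in auto)
  qed
qed

lemma mzv_tail:
  assumes "admissible ks"
  shows "(\<lambda>N. (hsum N ks - mzv ks) * hnum N ^ c) \<longlonglongrightarrow> 0"
proof -
  obtain L where L: "\<And>N. hsum N ks \<le> L" "\<And>c. (\<lambda>N. (hsum N ks - L) * hnum N ^ c) \<longlonglongrightarrow> 0"
    using hsum_tail[OF assms] by blast
  let ?A = "{ns :: nat list. length ns = length ks \<and> sorted_wrt (<) ns \<and> 0 \<notin> set ns}"
  let ?A' = "\<lambda>N. {ns :: nat list. length ns = length ks \<and> sorted_wrt (<) ns \<and> set ns \<subseteq> {1..N}}"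
  define f where "f ns = (\<Prod>i<length ks. 1 / real (ns ! i) ^ (ks ! i))" for ns
  have f0: "f ns \<ge> 0" for ns by (simp add: f_def prod_nonneg)
  have hf: "hsum N ks = sum f (?A' N)" for N
    unfolding hsum_def chain_sum_pos_list f_def ..
  have finA: "finite (?A' N)" for N
    by (rule finite_subset[OF _ finite_lists_length_eq[of "{1..N}" "length ks"]]) auto
  have sub: "?A' N \<subseteq> ?A" for N by auto
  have fin_le: "sum f F \<le> L" if F: "finite F" "F \<subseteq> ?A" for F
  proof -
    define N where "N = Max (insert 0 (\<Union> (set ` F)))"
    have "F \<subseteq> ?A' N"
    proof
      fix ns assume ns: "ns \<in> F"
      have "x \<in> {1..N}" if "x \<in> set ns" for x
      proof -
        have "x \<le> N" unfolding N_def using F(1) ns that by (intro Max_ge) auto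
        moreover have "x \<noteq> 0" using F(2) ns that by (metis (mono_tags, lifting) mem_Collect_eq subsetD)
        ultimately show ?thesis by simp
      qed
      then show "ns \<in> ?A' N" using F(2) ns by auto
    qed
    then have "sum f F \<le> sum f (?A' N)" by (intro sum_mono2 finA) (auto simp: f0)
    also have "\<dots> \<le> L" using L(1)[of N] hf by simp
    finally show ?thesis .
  qed
  have summ: "f summable_on ?A"
    by (rule nonneg_bdd_above_summable_on) (auto simp: f0 bdd_above_def intro!: exI[of _ L] fin_le)
  have mz: "mzv ks = infsum f ?A" unfolding mzv_def f_def ..
  have "mzv ks \<le> L" unfolding mz by (rule infsum_le_finite_sums[OF summ]) (rule fin_le)
  moreover have "L \<le> mzv ks"
  proof (rule LIMSEQ_le_const2)
    have "(\<lambda>N. hsum N ks - L) \<longlonglongrightarrow> 0" using L(2)[of 0] by simp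
    then show "(\<lambda>N. hsum N ks) \<longlonglongrightarrow> L" by (simp add: LIM_zero_iff)
    have "hsum N ks \<le> mzv ks" for N
      unfolding mz hf by (rule finite_sum_le_infsum[OF summ finA sub]) (simp add: f0)
    then show "\<exists>M. \<forall>N\<ge>M. hsum N ks \<le> mzv ks" by blast
  qed
  ultimately show ?thesis using L(2)[of c] by simp
qed

section \<open>Harmonic regularization as an asymptotic expansion\<close>

text \<open>The polynomial \<open>P\<close> is the expansion of \<open>A\<close> in the harmonic numbers \<open>hnum N\<close>. Requiring the error to tend
to 0 after multiplication by every power of \<open>hnum N\<close> makes the notion compatible with products.\<close>

definition asymptotic :: "(nat \<Rightarrow> real) \<Rightarrow> real poly \<Rightarrow> bool" where
  "asymptotic A P \<longleftrightarrow> (\<forall>c. (\<lambda>N. (A N - poly P (hnum N)) * hnum N ^ c) \<longlonglongrightarrow> 0)"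

lemma asymptoticD: "asymptotic A P \<Longrightarrow> (\<lambda>N. A N - poly P (hnum N)) \<longlonglongrightarrow> 0"
  unfolding asymptotic_def by (drule spec[of _ 0]) simp

lemma asymptotic_poly: "asymptotic (\<lambda>N. poly P (hnum N)) P"
  by (simp add: asymptotic_def)

lemma asymptotic_add: "asymptotic A P \<Longrightarrow> asymptotic B Q \<Longrightarrow> asymptotic (\<lambda>N. A N + B N) (P + Q)"
  unfolding asymptotic_def
proof
  fix c assume "\<forall>c. (\<lambda>N. (A N - poly P (hnum N)) * hnum N ^ c) \<longlonglongrightarrow> 0" "\<forall>c. (\<lambda>N. (B N - poly Q (hnum N)) * hnum N ^ c) \<longlonglongrightarrow> 0"
  then have "(\<lambda>N. (A N - poly P (hnum N)) * hnum N ^ c + (B N - poly Q (hnum N)) * hnum N ^ c) \<longlonglongrightarrow> 0 + 0"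
    by (intro tendsto_add) auto
  then show "(\<lambda>N. (A N + B N - poly (P + Q) (hnum N)) * hnum N ^ c) \<longlonglongrightarrow> 0"
    by (simp add: algebra_simps)
qed

lemma poly_expand: "poly Q x = (\<Sum>i\<le>degree Q. coeff Q i * x ^ i)" for x :: real
  by (rule poly_altdef)

lemma asymptotic_mult_poly:
  assumes "asymptotic A P"
  shows "(\<lambda>N. (A N - poly P (hnum N)) * (poly Q (hnum N) * hnum N ^ c)) \<longlonglongrightarrow> 0"
proof -
  have "(\<lambda>N. \<Sum>i\<le>degree Q. coeff Q i * ((A N - poly P (hnum N)) * hnum N ^ (i + c))) \<longlonglongrightarrow> (\<Sum>i\<le>degree Q. coeff Q i * 0)"
    using assms unfolding asymptotic_def by (intro tendsto_sum tendsto_mult tendsto_const) auto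
  then show ?thesis
    by (simp add: poly_expand[of Q] sum_distrib_left sum_distrib_right power_add mult_ac)
qed

lemma asymptotic_mult:
  assumes "asymptotic A P" "asymptotic B Q"
  shows "asymptotic (\<lambda>N. A N * B N) (P * Q)"
  unfolding asymptotic_def
proof
  fix c
  let ?a = "\<lambda>N. A N - poly P (hnum N)" and ?b = "\<lambda>N. B N - poly Q (hnum N)"
  have "(\<lambda>N. ?a N * (poly Q (hnum N) * hnum N ^ c) + ?b N * (poly P (hnum N) * hnum N ^ c) + (?a N * hnum N ^ c) * ?b N) \<longlonglongrightarrow> 0 + 0 + 0 * 0"
    using assms(1) by (intro tendsto_add tendsto_mult asymptotic_mult_poly asymptoticD assms) (simp add: asymptotic_def)
  then show "(\<lambda>N. (A N * B N - poly (P * Q) (hnum N)) * hnum N ^ c) \<longlonglongrightarrow> 0"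
    by (simp add: algebra_simps)
qed

lemma asymptotic_const_mult: "asymptotic A P \<Longrightarrow> asymptotic (\<lambda>N. r * A N) (smult r P)"
  using asymptotic_mult[OF asymptotic_poly[of "[:r:]"], of A P] by simp

lemma asymptotic_0: "asymptotic (\<lambda>N. 0) 0"
  using asymptotic_poly[of 0] by simp

lemma asymptotic_sum: "(\<And>i. i \<in> S \<Longrightarrow> asymptotic (A i) (P i)) \<Longrightarrow> asymptotic (\<lambda>N. \<Sum>i\<in>S. A i N) (\<Sum>i\<in>S. P i)"
  by (induction S rule: infinite_finite_induct) (auto intro: asymptotic_0 asymptotic_add)

text \<open>Harmonic numbers tend to infinity, so a nonconstant polynomial in them diverges.\<close>

lemma poly_hnum_limit:
  assumes "(\<lambda>N. poly Q (hnum N)) \<longlonglongrightarrow> L"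
  shows "Q = [:L:]"
proof -
  obtain a p where Q: "Q = pCons a p" by (cases Q)
  show ?thesis
  proof (cases "p = 0")
    case True
    then have "(\<lambda>N::nat. a) \<longlonglongrightarrow> L" using assms Q by simp
    then have "a = L" by (simp add: LIMSEQ_const_iff)
    then show ?thesis using Q True by simp
  next
    case False
    obtain r where r: "\<forall>z. r \<le> norm z \<longrightarrow> \<bar>L\<bar> + 1 \<le> norm (poly Q z)"
      using poly_infinity[OF False, of "\<bar>L\<bar> + 1" a] Q by auto
    have "eventually (\<lambda>N. \<bar>poly Q (hnum N) - L\<bar> < 1) sequentially"
      using tendstoD[OF assms, of 1] by (simp add: dist_real_def)
    moreover have "eventually (\<lambda>N. hnum N \<ge> max r 0) sequentially"
      using hnum_at_top by (simp add: filterlim_at_top hnum_nonneg)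
    ultimately have "eventually (\<lambda>N. False) sequentially"
    proof eventually_elim
      case (elim N)
      then have "\<bar>L\<bar> + 1 \<le> \<bar>poly Q (hnum N)\<bar>" using r by simp
      then show ?case using elim(1) by linarith
    qed
    then show ?thesis by simp
  qed
qed

lemma asymptotic_unique: "asymptotic A P \<Longrightarrow> asymptotic A Q \<Longrightarrow> P = Q"
proof -
  assume "asymptotic A P" "asymptotic A Q"
  then have "(\<lambda>N. (A N - poly Q (hnum N)) - (A N - poly P (hnum N))) \<longlonglongrightarrow> 0 - 0"
    by (intro tendsto_diff asymptoticD)
  then have "(\<lambda>N. poly (P - Q) (hnum N)) \<longlonglongrightarrow> 0" by simp
  from poly_hnum_limit[OF this] show "P = Q" by simp
qed

lemma asymptotic_const: "asymptotic A P \<Longrightarrow> A \<longlonglongrightarrow> L \<Longrightarrow> P = [:L:]"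
proof -
  assume "asymptotic A P" "A \<longlonglongrightarrow> L"
  then have "(\<lambda>N. A N - (A N - poly P (hnum N))) \<longlonglongrightarrow> L - 0"
    by (intro tendsto_diff asymptoticD)
  then show ?thesis by (intro poly_hnum_limit) simp
qed

text \<open>The number of final entries 1 measures how far a word is from being admissible; it is the induction parameter
for everything about regularization.\<close>

definition final_ones :: "nat list \<Rightarrow> nat" where
  "final_ones w = length (takeWhile ((=) 1) (rev w))"

lemma final_ones_snoc: "final_ones (w @ [k]) = (if k = 1 then Suc (final_ones w) else 0)"
  by (simp add: final_ones_def)

lemma final_ones_Nil: "final_ones [] = 0"
  by (simp add: final_ones_def)

lemma final_ones_split: "\<exists>v. w = v @ replicate (final_ones w) 1 \<and> (v = [] \<or> last v \<noteq> 1)"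
proof (induction w rule: rev_induct)
  case (snoc k w)
  then obtain v where v: "w = v @ replicate (final_ones w) 1" "v = [] \<or> last v \<noteq> 1" by blast
  show ?case
  proof (cases "k = 1")
    case True
    then have "w @ [k] = v @ replicate (final_ones (w @ [k])) 1"
      using v(1) by (simp add: final_ones_snoc) (metis append.assoc replicate_append_same)
    then show ?thesis using v(2) by blast
  qed (auto simp: final_ones_snoc)
qed (simp add: final_ones_Nil)

definition bounded_words :: "nat \<Rightarrow> hcomb set" where
  "bounded_words m = {x. \<forall>w\<in>Poly_Mapping.keys x. is_index w \<and> final_ones w \<le> m}"

lemma bounded_words_0: "0 \<in> bounded_words m"
  by (simp add: bounded_words_def)

lemma bounded_words_add: "x \<in> bounded_words m \<Longrightarrow> y \<in> bounded_words m \<Longrightarrow> x + y \<in> bounded_words m"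
  using keys_add[of x y] by (fastforce simp: bounded_words_def)

lemma keys_hscale: "Poly_Mapping.keys (hscale q x) \<subseteq> Poly_Mapping.keys x"
  by (auto simp: in_keys_iff real_hom.lookup_hscale)

lemma bounded_words_hscale: "x \<in> bounded_words m \<Longrightarrow> hscale q x \<in> bounded_words m"
  using keys_hscale[of q x] by (fastforce simp: bounded_words_def)

lemma bounded_words_sum: "(\<And>i. i \<in> S \<Longrightarrow> f i \<in> bounded_words m) \<Longrightarrow> sum f S \<in> bounded_words m"
  by (induction S rule: infinite_finite_induct) (auto intro: bounded_words_0 bounded_words_add)

lemma bounded_words_word: "is_index w \<Longrightarrow> final_ones w \<le> m \<Longrightarrow> word w \<in> bounded_words m"
  by (simp add: bounded_words_def word_def)

lemma bounded_words_append_letter: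
  assumes "x \<in> bounded_words m" "k \<ge> 1"
  shows "append_letter x k \<in> bounded_words (if k = 1 then Suc m else 0)"
  unfolding append_letter_def lin_ext_def
  by (intro bounded_words_sum bounded_words_hscale bounded_words_word)
     (use assms in \<open>auto simp: bounded_words_def is_index_def final_ones_snoc\<close>)

lemma H1_eq: "x \<in> H1 \<longleftrightarrow> (\<exists>m. x \<in> bounded_words m)"
proof
  assume x: "x \<in> H1"
  have "x \<in> bounded_words (Max (insert 0 (final_ones ` Poly_Mapping.keys x)))"
    using x by (auto simp: bounded_words_def H1_def)
  then show "\<exists>m. x \<in> bounded_words m" ..
qed (auto simp: H1_def bounded_words_def)

lemma H1_closed: "x \<in> H1 \<Longrightarrow> y \<in> H1 \<Longrightarrow> x + y \<in> H1" "x \<in> H1 \<Longrightarrow> hscale q x \<in> H1" "0 \<in> H1"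
  "(\<And>i. i \<in> S \<Longrightarrow> f i \<in> H1) \<Longrightarrow> sum f S \<in> H1" "is_index w \<Longrightarrow> word w \<in> H1"
  "x \<in> H1 \<Longrightarrow> k \<ge> 1 \<Longrightarrow> append_letter x k \<in> H1"
proof -
  show add: "x + y \<in> H1" if "x \<in> H1" "y \<in> H1" for x y
    using that keys_add[of x y] by (fastforce simp: H1_def)
  show "0 \<in> H1" by (simp add: H1_def)
  then show "sum f S \<in> H1" if "\<And>i. i \<in> S \<Longrightarrow> f i \<in> H1"
    using that by (induction S rule: infinite_finite_induct) (auto intro: add)
  show "hscale q x \<in> H1" if "x \<in> H1"
    using that keys_hscale[of q x] by (fastforce simp: H1_def)
  show "is_index w \<Longrightarrow> word w \<in> H1" by (simp add: H1_def word_def)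
  show "x \<in> H1 \<Longrightarrow> k \<ge> 1 \<Longrightarrow> append_letter x k \<in> H1"
    unfolding H1_eq using bounded_words_append_letter by blast
qed

lemma lin_ext_H1: "(\<And>w. w \<in> Poly_Mapping.keys x \<Longrightarrow> f w \<in> H1) \<Longrightarrow> lin_ext f x \<in> H1"
  unfolding lin_ext_def by (intro H1_closed)

lemma harmonic_words_H1: "is_index u \<Longrightarrow> is_index v \<Longrightarrow> harmonic_words u v \<in> H1"
proof (induction "length u + length v" arbitrary: u v rule: less_induct)
  case less
  consider "u = []" | "v = []" | u' k v' l where "u = u' @ [k]" "v = v' @ [l]"
    by (metis rev_exhaust)
  then show ?case
  proof cases
    case 3
    have "k \<ge> 1" "l \<ge> 1" "is_index u'" "is_index v'" using less.prems 3 by (auto simp: is_index_def)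
    then show ?thesis
      unfolding 3 harmonic_words_snoc using less.prems 3
      by (intro H1_closed less.hyps) auto
  qed (use less.prems in \<open>auto simp: harmonic_words_Nil intro: H1_closed\<close>)
qed

lemma harmonic_H1: "x \<in> H1 \<Longrightarrow> y \<in> H1 \<Longrightarrow> harmonic x y \<in> H1"
  unfolding harmonic_def by (intro lin_ext_H1 harmonic_words_H1) (auto simp: H1_def)

lemma hscale_add_left: "hscale (a + b) x = hscale a x + hscale b x"
  by (rule poly_mapping_eqI) (simp add: real_hom.lookup_hscale lookup_add distrib_right)

lemma hscale_1: "hscale 1 x = x"
  by (rule poly_mapping_eqI) (simp add: real_hom.lookup_hscale)

lemma lin_ext_superset:
  assumes "finite S" "Poly_Mapping.keys x \<subseteq> S"
  shows "lin_ext f x = (\<Sum>w\<in>S. hscale (Poly_Mapping.lookup x w) (f w))"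
  unfolding lin_ext_def
proof (rule sum.mono_neutral_left)
  show "\<forall>w\<in>S - Poly_Mapping.keys x. hscale (Poly_Mapping.lookup x w) (f w) = 0"
    by (auto simp: in_keys_iff intro!: poly_mapping_eqI simp: real_hom.lookup_hscale)
qed (use assms in auto)

lemma append_letter_add: "append_letter (x + y) k = append_letter x k + append_letter y k"
proof -
  let ?S = "Poly_Mapping.keys x \<union> Poly_Mapping.keys y"
  have "append_letter z k = (\<Sum>w\<in>?S. hscale (Poly_Mapping.lookup z w) (word (w @ [k])))" if "Poly_Mapping.keys z \<subseteq> ?S" for z
    unfolding append_letter_def by (rule lin_ext_superset) (use that in auto)
  then show ?thesis
    using keys_add[of x y] by (simp add: lookup_add hscale_add_left sum.distrib)
qed

lemma append_letter_word: "append_letter (hscale q (word w)) k = hscale q (word (w @ [k]))"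
proof -
  have "append_letter (hscale q (word w)) k = (\<Sum>u\<in>{w}. hscale (Poly_Mapping.lookup (hscale q (word w)) u) (word (u @ [k])))"
    unfolding append_letter_def
    by (rule lin_ext_superset) (use keys_hscale[of q "word w"] in \<open>auto simp: word_def\<close>)
  then show ?thesis by (simp add: real_hom.lookup_hscale word_def)
qed

text \<open>Multiplying by \<open>e\<^sub>1\<close> adds a final 1 with a nonzero multiplicity, up to words with fewer final ones. So the values on
admissible words and on \<open>e\<^sub>1\<close> determine a homomorphism.\<close>

lemma harmonic_words_one:
  assumes "is_index v" "v = [] \<or> last v \<noteq> 1"
  shows "\<exists>y\<in>bounded_words m. harmonic_words (v @ replicate m 1) [1] = hscale (of_nat (Suc m)) (word (v @ replicate (Suc m) 1)) + y"
proof (induction m)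
  case 0
  show ?case
  proof (cases v rule: rev_cases)
    case Nil
    then show ?thesis by (intro bexI[of _ 0]) (simp_all add: harmonic_words_Nil hscale_1 bounded_words_0)
  next
    case (snoc u k)
    then have k: "k \<noteq> 1" "k \<ge> 1" "is_index u" using assms by (auto simp: is_index_def)
    have "harmonic_words u [1] \<in> H1" using k by (intro harmonic_words_H1) (auto simp: is_index_def)
    then obtain m where "harmonic_words u [1] \<in> bounded_words m" unfolding H1_eq ..
    from bounded_words_append_letter[OF this k(2)] k(1)
    have "append_letter (harmonic_words u [1]) k \<in> bounded_words 0" by simp
    moreover have "word (u @ [k + 1]) \<in> bounded_words 0"
      using k by (intro bounded_words_word) (auto simp: is_index_def final_ones_snoc)
    ultimately have "append_letter (harmonic_words u [1]) k + word (u @ [k + 1]) \<in> bounded_words 0"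
      by (rule bounded_words_add)
    moreover have "harmonic_words (v @ replicate 0 1) [1] = hscale (of_nat (Suc 0)) (word (v @ replicate (Suc 0) 1)) + (append_letter (harmonic_words u [1]) k + word (u @ [k + 1]))"
      using harmonic_words_snoc[of u k "[]" 1]
      by (simp add: snoc hscale_1 harmonic_words_Nil append_letter_word[of 1, unfolded hscale_1] add_ac)
    ultimately show ?thesis by blast
  qed
next
  case (Suc m)
  then obtain y where y: "y \<in> bounded_words m"
    "harmonic_words (v @ replicate m 1) [1] = hscale (of_nat (Suc m)) (word (v @ replicate (Suc m) 1)) + y" by blast
  let ?u = "v @ replicate m 1"
  have r: "v @ replicate (Suc m) 1 = ?u @ [1]" "v @ replicate (Suc (Suc m)) 1 = (?u @ [1]) @ [1]"
    by (simp_all add: replicate_append_same)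
  have "append_letter y 1 \<in> bounded_words (Suc m)"
    using bounded_words_append_letter[OF y(1), of 1] by simp
  moreover have "word (?u @ [2]) \<in> bounded_words (Suc m)"
  proof (rule bounded_words_word)
    show "is_index (?u @ [2])" using assms(1) by (auto simp: is_index_def)
    show "final_ones (?u @ [2]) \<le> Suc m" unfolding final_ones_snoc by simp
  qed
  ultimately have "append_letter y 1 + word (?u @ [2]) \<in> bounded_words (Suc m)"
    by (rule bounded_words_add)
  moreover have "harmonic_words (v @ replicate (Suc m) 1) [1]
      = hscale (of_nat (Suc (Suc m))) (word (v @ replicate (Suc (Suc m)) 1)) + (append_letter y 1 + word (?u @ [2]))"
  proof -
    have "harmonic_words (?u @ [1]) ([] @ [1])
       = append_letter (harmonic_words ?u [1]) 1 + word ((?u @ [1]) @ [1]) + word (?u @ [2])"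
      unfolding harmonic_words_snoc by (simp add: harmonic_words_Nil append_letter_word[of 1, unfolded hscale_1] numeral_2_eq_2)
    also have "append_letter (harmonic_words ?u [1]) 1 = hscale (of_nat (Suc m)) (word ((?u @ [1]) @ [1])) + append_letter y 1"
      unfolding y(2) append_letter_add append_letter_word r(1) ..
    also have "hscale (of_nat (Suc m)) (word ((?u @ [1]) @ [1])) + append_letter y 1 + word ((?u @ [1]) @ [1]) + word (?u @ [2])
       = hscale (of_nat (Suc m) + 1) (word ((?u @ [1]) @ [1])) + (append_letter y 1 + word (?u @ [2]))"
      unfolding hscale_add_left hscale_1 by (simp add: add_ac)
    finally show ?thesis unfolding r by (simp add: add.commute)
  qed
  ultimately show ?case by blast
qed

text \<open>Polynomials whose coefficients are multiple zeta values or rational combinations of products of them.\<close>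

definition zpoly :: "real poly \<Rightarrow> bool" where "zpoly P \<longleftrightarrow> (\<forall>i. coeff P i \<in> mzv_algebra)"

lemma mzv_algebra_sum: "(\<And>i. i \<in> S \<Longrightarrow> f i \<in> mzv_algebra) \<Longrightarrow> sum f S \<in> mzv_algebra"
  by (induction S rule: infinite_finite_induct) (auto intro: mzv_algebra_01 mzv_algebra.add)

lemma zpoly_closed: "zpoly P \<Longrightarrow> zpoly Q \<Longrightarrow> zpoly (P + Q)" "zpoly P \<Longrightarrow> zpoly Q \<Longrightarrow> zpoly (P * Q)"
  "r \<in> mzv_algebra \<Longrightarrow> zpoly P \<Longrightarrow> zpoly (smult r P)" "zpoly 0" "r \<in> mzv_algebra \<Longrightarrow> zpoly [:r:]" "zpoly [:0, 1:]"
  by (auto simp: zpoly_def coeff_mult coeff_pCons mzv_algebra_01 split: nat.splits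
      intro: mzv_algebra.add mzv_algebra.mult mzv_algebra_sum)

lemma zpoly_sum: "(\<And>i. i \<in> S \<Longrightarrow> zpoly (f i)) \<Longrightarrow> zpoly (sum f S)"
  by (induction S rule: infinite_finite_induct) (auto intro: zpoly_closed)

lemma asymptotic_evalw:
  assumes "\<And>w. w \<in> Poly_Mapping.keys x \<Longrightarrow> asymptotic (\<lambda>N. hsum N w) (P w)"
  shows "asymptotic (\<lambda>N. hsum_ev N x) (evalw (\<lambda>q. [:of_rat q:]) P x)"
  unfolding evalw_def using assms by (intro asymptotic_sum) (simp add: asymptotic_const_mult)

text \<open>Induction on the number of final ones: solve \<open>harmonic_words_one\<close> for the word with one more final 1. The base
case is convergence with small tails.\<close>

lemma word_asymptotic_exists: "is_index w \<Longrightarrow> \<exists>P. asymptotic (\<lambda>N. hsum N w) P \<and> zpoly P"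
proof (induction "final_ones w" arbitrary: w rule: less_induct)
  case less
  obtain v where v: "w = v @ replicate (final_ones w) 1" "v = [] \<or> last v \<noteq> 1"
    using final_ones_split by blast
  show ?case
  proof (cases "final_ones w")
    case 0
    then have "admissible w"
      using v less.prems by (auto simp: admissible_def is_index_def) (metis last_in_set less_2_cases not_less)
    then have "asymptotic (\<lambda>N. hsum N w) [:mzv w:]" "zpoly [:mzv w:]"
      by (auto simp: asymptotic_def mzv_tail intro: zpoly_closed mzv_algebra.mzv)
    then show ?thesis by blast
  next
    case (Suc m)
    have iv: "is_index v" using v(1) less.prems by (metis Un_iff is_index_def set_append)
    let ?u = "v @ replicate m 1"
    have w: "w = v @ replicate (Suc m) 1" using v(1) Suc by simp
    obtain y where y: "y \<in> bounded_words m" "harmonic_words ?u [1] = hscale (of_nat (Suc m)) (word w) + y"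
      using harmonic_words_one[OF iv v(2), of m] unfolding w by blast
    have "\<exists>P. asymptotic (\<lambda>N. hsum N u) P \<and> zpoly P" if "u \<in> Poly_Mapping.keys y" for u
      using y(1) that Suc by (intro less.hyps) (auto simp: bounded_words_def)
    then obtain Q where Q: "\<And>u. u \<in> Poly_Mapping.keys y \<Longrightarrow> asymptotic (\<lambda>N. hsum N u) (Q u) \<and> zpoly (Q u)" by metis
    have fo: "final_ones ?u = m"
    proof -
      have "final_ones (?u @ [1]) = Suc m" using Suc w by (simp add: replicate_append_same)
      then show ?thesis unfolding final_ones_snoc by simp
    qed
    have "is_index ?u" using iv by (auto simp: is_index_def)
    then obtain R where R: "asymptotic (\<lambda>N. hsum N ?u) R" "zpoly R" using less.hyps[of ?u] fo Suc by auto
    define S where "S = smult (1 / real (Suc m)) (R * [:0, 1:] + smult (-1) (evalw (\<lambda>q. [:of_rat q:]) Q y))"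
    have "hsum N w = 1 / real (Suc m) * (hsum N ?u * hnum N + (-1) * hsum_ev N y)" for N
    proof -
      have "hsum N ?u * hnum N = hsum_ev N (harmonic_words ?u [1])"
        by (simp add: hsum_harmonic_words hnum_def)
      also have "\<dots> = real (Suc m) * hsum N w + hsum_ev N y"
        unfolding y(2) real_hom.evalw_add real_hom.evalw_hscale real_hom.evalw_word by (simp del: of_nat_Suc)
      finally show ?thesis by (simp add: field_simps)
    qed
    moreover have "asymptotic (\<lambda>N. 1 / real (Suc m) * (hsum N ?u * hnum N + (-1) * hsum_ev N y)) S"
      unfolding S_def
      by (intro asymptotic_const_mult asymptotic_add asymptotic_mult R asymptotic_evalw) (use asymptotic_poly[of "[:0, 1:]"] Q in auto)
    moreover have "zpoly S"
    proof -
      have "1 / real (Suc m) = of_rat (1 / of_nat (Suc m))" by (simp add: of_rat_divide del: of_nat_Suc)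
      moreover have "(-1 :: real) \<in> mzv_algebra" using mzv_algebra.rat[of "-1"] by simp
      ultimately show ?thesis
        unfolding S_def evalw_def
        by (intro zpoly_closed zpoly_sum R) (use Q in \<open>auto intro: mzv_algebra.rat zpoly_closed\<close>)
    qed
    ultimately show ?thesis by auto
  qed
qed

definition word_poly :: "nat list \<Rightarrow> real poly" where
  "word_poly w = (SOME P. asymptotic (\<lambda>N. hsum N w) P \<and> zpoly P)"

lemma word_poly: "is_index w \<Longrightarrow> asymptotic (\<lambda>N. hsum N w) (word_poly w)" "is_index w \<Longrightarrow> zpoly (word_poly w)"
  using someI_ex[OF word_asymptotic_exists] unfolding word_poly_def by blast+

text \<open>The linear extension of the asymptotic expansion of nested sums; it turns out to be the regularization.\<close>

definition reg :: "hcomb \<Rightarrow> real poly" where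
  "reg x = (if x \<in> H1 then evalw (\<lambda>q. [:of_rat q:]) word_poly x else undefined)"

lemma reg_asymptotic: "x \<in> H1 \<Longrightarrow> asymptotic (\<lambda>N. hsum_ev N x) (reg x)"
  unfolding reg_def by (auto simp: H1_def intro!: asymptotic_evalw word_poly)

lemma reg_word: "is_index w \<Longrightarrow> reg (word w) = word_poly w"
  by (simp add: reg_def H1_closed poly_hom.evalw_word)

text \<open>Expansions are unique, and finite nested sums satisfy the harmonic product exactly.\<close>

lemma reg_is_regularization: "is_harmonic_regularization reg"
  unfolding is_harmonic_regularization_def
proof (intro conjI ballI allI impI)
  show "reg (x + y) = reg x + reg y" if "x \<in> H1" "y \<in> H1" for x y
    using that by (simp add: reg_def H1_closed poly_hom.evalw_add)
  show "reg (hscale q x) = smult (of_rat q) (reg x)" if "x \<in> H1" for q x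
    using that by (simp add: reg_def H1_closed poly_hom.evalw_hscale)
  show "reg (harmonic x y) = reg x * reg y" if "x \<in> H1" "y \<in> H1" for x y
  proof (rule asymptotic_unique)
    show "asymptotic (\<lambda>N. hsum_ev N (harmonic x y)) (reg (harmonic x y))"
      using that by (intro reg_asymptotic harmonic_H1)
    show "asymptotic (\<lambda>N. hsum_ev N (harmonic x y)) (reg x * reg y)"
      unfolding hsum_harmonic using that by (intro asymptotic_mult reg_asymptotic)
  qed
  have i: "is_index []" "is_index [1]" by (simp_all add: is_index_def)
  have "asymptotic (\<lambda>N. hsum N []) 1" using asymptotic_poly[of 1] by (simp add: hsum_Nil)
  then show "reg (word []) = 1" using asymptotic_unique word_poly(1)[OF i(1)] reg_word[OF i(1)] by metis
  have "asymptotic (\<lambda>N. hsum N [1]) [:0, 1:]" using asymptotic_poly[of "[:0, 1:]"] by (simp add: hnum_def)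
  then show "reg (word [1]) = [:0, 1:]" using asymptotic_unique word_poly(1)[OF i(2)] reg_word[OF i(2)] by metis
  show "reg (word ks) = [:mzv ks:]" if "admissible ks" for ks
  proof -
    have "is_index ks" using that by (simp add: admissible_def)
    moreover have "asymptotic (\<lambda>N. hsum N ks) [:mzv ks:]" using mzv_tail[OF that] by (simp add: asymptotic_def)
    ultimately show ?thesis using asymptotic_unique word_poly(1) reg_word by metis
  qed
qed

lemma hcomb_expand: "x = (\<Sum>w\<in>Poly_Mapping.keys x. hscale (Poly_Mapping.lookup x w) (word w))"
proof (rule poly_mapping_eqI)
  fix u
  have "Poly_Mapping.lookup (\<Sum>w\<in>S. hscale (Poly_Mapping.lookup x w) (word w)) u
      = (\<Sum>w\<in>S. if w = u then Poly_Mapping.lookup x w else 0)" for S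
    by (induction S rule: infinite_finite_induct)
       (auto simp: lookup_add real_hom.lookup_hscale word_def lookup_single when_def)
  then show "Poly_Mapping.lookup x u = Poly_Mapping.lookup (\<Sum>w\<in>Poly_Mapping.keys x. hscale (Poly_Mapping.lookup x w) (word w)) u"
    by (simp add: in_keys_iff)
qed

lemma regularization_determined:
  assumes "is_harmonic_regularization Z" "x \<in> H1"
  shows "Z x = evalw (\<lambda>q. [:of_rat q:]) (\<lambda>w. Z (word w)) x"
proof -
  have Z: "\<And>x y. x \<in> H1 \<Longrightarrow> y \<in> H1 \<Longrightarrow> Z (x + y) = Z x + Z y" "\<And>q x. x \<in> H1 \<Longrightarrow> Z (hscale q x) = smult (of_rat q) (Z x)"
    using assms(1) unfolding is_harmonic_regularization_def by blast+
  have "hscale 0 0 = (0 :: hcomb)" by (rule poly_mapping_eqI) (simp add: real_hom.lookup_hscale)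
  then have Z0: "Z 0 = 0" using Z(2)[OF H1_closed(3), of 0] by simp
  have "Z (\<Sum>w\<in>S. hscale (q w) (word w)) = (\<Sum>w\<in>S. smult (of_rat (q w)) (Z (word w)))"
    if "\<And>w. w \<in> S \<Longrightarrow> is_index w" for S q
    using that
  proof (induction S rule: infinite_finite_induct)
    case (insert w S)
    then have "(\<Sum>w\<in>S. hscale (q w) (word w)) \<in> H1" by (intro H1_closed) auto
    then show ?case using insert by (simp add: Z H1_closed)
  qed (simp_all add: Z0)
  from this[of "Poly_Mapping.keys x" "Poly_Mapping.lookup x"] show ?thesis
    using assms(2) hcomb_expand[of x] by (simp add: H1_def evalw_def)
qed

lemma regularization_word:
  assumes "is_harmonic_regularization Z" "is_index w"
  shows "Z (word w) = word_poly w"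
  using assms(2)
proof (induction "final_ones w" arbitrary: w rule: less_induct)
  case less
  have Z: "\<And>x y. x \<in> H1 \<Longrightarrow> y \<in> H1 \<Longrightarrow> Z (x + y) = Z x + Z y" "\<And>q x. x \<in> H1 \<Longrightarrow> Z (hscale q x) = smult (of_rat q) (Z x)"
    "\<And>x y. x \<in> H1 \<Longrightarrow> y \<in> H1 \<Longrightarrow> Z (harmonic x y) = Z x * Z y" "Z (word [1]) = [:0, 1:]" "\<And>ks. admissible ks \<Longrightarrow> Z (word ks) = [:mzv ks:]"
    using assms(1) unfolding is_harmonic_regularization_def by blast+
  have R: "\<And>x y. x \<in> H1 \<Longrightarrow> y \<in> H1 \<Longrightarrow> reg (x + y) = reg x + reg y" "\<And>q x. x \<in> H1 \<Longrightarrow> reg (hscale q x) = smult (of_rat q) (reg x)"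
    "\<And>x y. x \<in> H1 \<Longrightarrow> y \<in> H1 \<Longrightarrow> reg (harmonic x y) = reg x * reg y" "reg (word [1]) = [:0, 1:]" "\<And>ks. admissible ks \<Longrightarrow> reg (word ks) = [:mzv ks:]"
    using reg_is_regularization unfolding is_harmonic_regularization_def by blast+
  obtain v where v: "w = v @ replicate (final_ones w) 1" "v = [] \<or> last v \<noteq> 1"
    using final_ones_split by blast
  show ?case
  proof (cases "final_ones w")
    case 0
    then have "admissible w"
      using v less.prems by (auto simp: admissible_def is_index_def) (metis last_in_set less_2_cases not_less)
    then show ?thesis using Z(5) R(5) reg_word[OF less.prems] by metis
  next
    case (Suc m)
    have iv: "is_index v" using v(1) less.prems by (metis Un_iff is_index_def set_append)
    let ?u = "v @ replicate m 1"
    have w: "w = v @ replicate (Suc m) 1" using v(1) Suc by simp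
    obtain y where y: "y \<in> bounded_words m" "harmonic_words ?u [1] = hscale (of_nat (Suc m)) (word w) + y"
      using harmonic_words_one[OF iv v(2), of m] unfolding w by blast
    have yH: "y \<in> H1" using y(1) H1_eq by blast
    have "final_ones (?u @ [1]) = Suc m" using Suc w by (simp add: replicate_append_same)
    then have fo: "final_ones ?u = m" unfolding final_ones_snoc by simp
    have iu: "is_index ?u" using iv by (auto simp: is_index_def)
    have i1: "is_index [1]" by (simp add: is_index_def)
    have h: "harmonic (word ?u) (word [1]) = harmonic_words ?u [1]"
      by (simp add: harmonic_def lin_ext_def word_def hscale_1)
    have Zy: "Z y = reg y"
      unfolding regularization_determined[OF assms(1) yH] regularization_determined[OF reg_is_regularization yH]
    proof (rule poly_hom.evalw_cong)
      fix u assume "u \<in> Poly_Mapping.keys y"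
      then have "is_index u" "final_ones u \<le> m" using y(1) by (auto simp: bounded_words_def)
      then show "Z (word u) = reg (word u)" using less.hyps[of u] Suc reg_word by simp
    qed
    have Zu: "Z (word ?u) = reg (word ?u)" using less.hyps[of ?u] fo Suc iu reg_word by simp
    have "Z (harmonic_words ?u [1]) = reg (harmonic_words ?u [1])"
      unfolding h[symmetric] using Z(3,4) R(3,4) Zu iu i1 H1_closed(5) by metis
    then have "smult (of_rat (of_nat (Suc m))) (Z (word w)) + Z y = smult (of_rat (of_nat (Suc m))) (reg (word w)) + reg y"
      unfolding y(2) using yH less.prems by (simp only: Z R H1_closed)
    then have "smult (real (Suc m)) (Z (word w)) = smult (real (Suc m)) (reg (word w))"
      using Zy by (simp del: of_nat_Suc)
    then have "smult (real (Suc m)) (Z (word w) - reg (word w)) = 0"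
      by (simp add: smult_diff_right del: of_nat_Suc)
    then have "Z (word w) = reg (word w)" unfolding smult_eq_0_iff by simp
    then show ?thesis using reg_word[OF less.prems] by simp
  qed
qed

text \<open>The definite description in the definition is resolved by existence (\<open>reg_is_regularization\<close>) and uniqueness
(\<open>regularization_word\<close>).\<close>

lemma harmonic_regularization_eq: "harmonic_regularization = reg"
  unfolding harmonic_regularization_def
proof (rule the_equality)
  show "is_harmonic_regularization reg \<and> reg \<in> extensional H1"
    using reg_is_regularization by (simp add: extensional_def reg_def)
  fix Z assume Z: "is_harmonic_regularization Z \<and> Z \<in> extensional H1"
  show "Z = reg"
  proof
    fix x
    show "Z x = reg x"
    proof (cases "x \<in> H1")
      case True
      have "Z x = evalw (\<lambda>q. [:of_rat q:]) word_poly x"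
        using regularization_determined[of Z x] Z True regularization_word[of Z]
        by (simp add: poly_hom.evalw_cong[of x "\<lambda>w. Z (word w)" word_poly] H1_def)
      then show ?thesis by (simp add: reg_def True)
    next
      case False
      then show ?thesis using Z by (simp add: reg_def extensional_def)
    qed
  qed
qed

lemma zeta_star_asymptotic: "is_index ks \<Longrightarrow> asymptotic (\<lambda>N. hsum N ks) (zeta_star ks)" "is_index ks \<Longrightarrow> zpoly (zeta_star ks)"
  using word_poly[of ks] by (simp_all add: zeta_star_def harmonic_regularization_eq reg_word)

text \<open>A sum over \<open>1, \<dots>, N, -N, \<dots>, -1\<close> has the polynomial \<open>zeta_star_S ks\<close> as its expansion. In
particular, wherever a combination of such sums converges, the combination of the polynomials is constant.\<close>

lemma zeta_star_S_asymptotic: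
  assumes "is_index ks"
  shows "asymptotic (\<lambda>N. chain_sum (pos_list N @ neg_list N) ks) (zeta_star_S ks)" and "zpoly (zeta_star_S ks)"
proof -
  have i: "is_index (take i ks)" "is_index (rev (drop i ks))" for i
    using assms by (auto simp: is_index_def dest: in_set_takeD in_set_dropD)
  have m1: "[:- 1:] ^ n = [: (- 1) ^ n :]" "(-1 :: real poly) = [:-1:]" for n :: nat
    by (simp_all add: poly_const_pow one_pCons)
  have s: "(- 1) ^ n * P * Q = smult ((-1) ^ n) P * Q" for n and P Q :: "real poly"
    unfolding m1 by simp
  show "asymptotic (\<lambda>N. chain_sum (pos_list N @ neg_list N) ks) (zeta_star_S ks)"
    unfolding chain_sum_symmetric zeta_star_S_def s
    by (intro asymptotic_sum asymptotic_mult asymptotic_const_mult zeta_star_asymptotic i)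
  have "(-1 :: real) ^ n \<in> mzv_algebra" for n
    using mzv_algebra.rat[of "(-1) ^ n"] by (simp add: of_rat_power)
  then show "zpoly (zeta_star_S ks)"
    unfolding zeta_star_S_def s by (intro zpoly_sum zpoly_closed zeta_star_asymptotic i)
qed

section \<open>Limits of the hypergeometric sums\<close>

definition fps_tendsto :: "(nat \<Rightarrow> real fps) \<Rightarrow> real fps \<Rightarrow> bool" where
  "fps_tendsto F L \<longleftrightarrow> (\<forall>k. (\<lambda>N. F N $ k) \<longlonglongrightarrow> L $ k)"

lemma fps_tendsto_const: "fps_tendsto (\<lambda>_. f) f"
  by (simp add: fps_tendsto_def)

lemma fps_tendsto_add: "fps_tendsto F f \<Longrightarrow> fps_tendsto G g \<Longrightarrow> fps_tendsto (\<lambda>N. F N + G N) (f + g)"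
  by (auto simp: fps_tendsto_def intro!: tendsto_add)

lemma fps_tendsto_diff: "fps_tendsto F f \<Longrightarrow> fps_tendsto G g \<Longrightarrow> fps_tendsto (\<lambda>N. F N - G N) (f - g)"
  by (auto simp: fps_tendsto_def intro!: tendsto_diff)

lemma fps_tendsto_mult: "fps_tendsto F f \<Longrightarrow> fps_tendsto G g \<Longrightarrow> fps_tendsto (\<lambda>N. F N * G N) (f * g)"
  by (auto simp: fps_tendsto_def fps_mult_nth intro!: tendsto_sum tendsto_mult)

lemma fps_tendsto_prod: "(\<And>i. i \<in> A \<Longrightarrow> fps_tendsto (F i) (f i)) \<Longrightarrow> fps_tendsto (\<lambda>N. \<Prod>i\<in>A. F i N) (\<Prod>i\<in>A. f i)"
  by (induction A rule: infinite_finite_induct) (auto intro: fps_tendsto_const fps_tendsto_mult)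

text \<open>A weighted sum norm on truncated power series. It is submultiplicative, and the weight \<open>80\<close> makes
\<open>u X\<close> with \<open>\<bar>u\<bar> \<le> 4\<close> have norm at most \<open>1/20\<close>, so that quotients of rising factorials grow slowly.\<close>

definition fnorm :: "nat \<Rightarrow> real fps \<Rightarrow> real" where
  "fnorm D f = (\<Sum>l<D. \<bar>f $ l\<bar> * (1/80) ^ l)"

lemma fnorm_nonneg: "fnorm D f \<ge> 0"
  by (simp add: fnorm_def sum_nonneg)

lemma fnorm_nth: assumes "k < D" shows "\<bar>f $ k\<bar> \<le> fnorm D f * 80 ^ k"
proof -
  have "\<bar>f $ k\<bar> * (1/80) ^ k \<le> fnorm D f"
    unfolding fnorm_def by (rule member_le_sum) (use assms in auto)
  then show ?thesis by (simp add: power_divide divide_simps)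
qed

lemma fnorm_add: "fnorm D (f + g) \<le> fnorm D f + fnorm D g"
  unfolding fnorm_def sum.distrib[symmetric]
  by (intro sum_mono) (simp add: distrib_right[symmetric] mult_right_mono abs_triangle_ineq)

lemma fnorm_mult: "fnorm D (f * g) \<le> fnorm D f * fnorm D g"
proof -
  define a b where "a i = \<bar>f $ i\<bar> * (1/80) ^ i" and "b i = \<bar>g $ i\<bar> * (1/80) ^ i" for i
  have ab: "a i \<ge> 0" "b i \<ge> 0" for i by (simp_all add: a_def b_def)
  have "\<bar>(f * g) $ l\<bar> * (1/80) ^ l \<le> (\<Sum>i\<le>l. a i * b (l - i))" for l
  proof -
    have "\<bar>(f * g) $ l\<bar> \<le> (\<Sum>i\<le>l. \<bar>f $ i * g $ (l - i)\<bar>)"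
      unfolding fps_mult_nth atLeast0AtMost by (rule sum_abs)
    then have "\<bar>(f * g) $ l\<bar> * (1/80) ^ l \<le> (\<Sum>i\<le>l. \<bar>f $ i * g $ (l - i)\<bar>) * (1/80) ^ l"
      by (rule mult_right_mono) simp
    also have "\<dots> = (\<Sum>i\<le>l. a i * b (l - i))"
      unfolding sum_distrib_right
    proof (intro sum.cong refl)
      fix i assume "i \<in> {..l}"
      then have "(1/80 :: real) ^ l = (1/80) ^ i * (1/80) ^ (l - i)" by (simp flip: power_add)
      then show "\<bar>f $ i * g $ (l - i)\<bar> * (1/80) ^ l = a i * b (l - i)"
        by (simp add: a_def b_def abs_mult)
    qed
    finally show ?thesis .
  qed
  then have "fnorm D (f * g) \<le> (\<Sum>l<D. \<Sum>i\<le>l. a i * b (l - i))"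
    unfolding fnorm_def by (intro sum_mono)
  also have "\<dots> = (\<Sum>(i,j)\<in>{(i,j). i + j < D}. a i * b j)"
    by (rule sum.triangle_reindex[symmetric])
  also have "\<dots> \<le> (\<Sum>(i,j)\<in>{..<D} \<times> {..<D}. a i * b j)"
    by (rule sum_mono2) (auto simp: ab)
  also have "\<dots> = fnorm D f * fnorm D g"
    by (simp add: fnorm_def a_def b_def sum_product sum.cartesian_product)
  finally show ?thesis .
qed

lemma fnorm_mult_le: "fnorm D f \<le> a \<Longrightarrow> fnorm D g \<le> b \<Longrightarrow> fnorm D (f * g) \<le> a * b"
  using fnorm_mult[of D f g] mult_mono[of "fnorm D f" a "fnorm D g" b] fnorm_nonneg[of D f] fnorm_nonneg[of D g] by linarith

lemma fnorm_const: "fnorm D (fps_const c) \<le> \<bar>c\<bar>"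
proof (cases D)
  case (Suc D')
  show ?thesis unfolding Suc fnorm_def by (simp add: sum.lessThan_Suc_shift del: sum.lessThan_Suc)
qed (simp add: fnorm_def)

lemma fnorm_X: "fnorm D fps_X \<le> 1/80"
proof -
  have "fnorm D fps_X = (\<Sum>l\<in>{..<D} \<inter> {1}. 1/80)"
    unfolding fnorm_def by (intro sum.mono_neutral_cong_right) (auto simp: fps_X_def)
  also have "\<dots> \<le> 1/80" by (cases "1 < D") auto
  finally show ?thesis .
qed

lemma fnorm_scaled_X: "\<bar>u\<bar> \<le> 4 \<Longrightarrow> fnorm D (scaled_X u) \<le> 1/20"
  using fnorm_mult[of D "fps_const u" fps_X] fnorm_const[of D u] fnorm_X[of D] fnorm_nonneg[of D fps_X]
    mult_mono[of "fnorm D (fps_const u)" 4 "fnorm D fps_X" "1/80"] by simp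

lemma fnorm_lin: "\<bar>u\<bar> \<le> 4 \<Longrightarrow> m \<ge> 0 \<Longrightarrow> fnorm D (lin m u) \<le> m + 1/20"
  unfolding lin_def using fnorm_add[of D "fps_const m" "scaled_X u"] fnorm_const[of D m] fnorm_scaled_X[of u D] by simp

lemma inverse_lin_nth: "m \<noteq> 0 \<Longrightarrow> inverse (lin m u) $ l = (- u) ^ l / (m :: 'a::field) ^ Suc l"
proof -
  assume m: "m \<noteq> 0"
  define g where "g = Abs_fps (\<lambda>l. (- u) ^ l / m ^ Suc l)"
  have "lin m u * g = 1"
  proof (rule fps_ext)
    fix n show "(lin m u * g) $ n = 1 $ n"
      using m by (cases n) (simp_all add: lin_mult_nth lin_nth g_def field_simps)
  qed
  have "inverse (lin m u) = inverse (lin m u) * (lin m u * g)"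
    unfolding \<open>lin m u * g = 1\<close> by simp
  also have "\<dots> = (lin m u * inverse (lin m u)) * g"
    by (simp only: mult_ac)
  finally have "inverse (lin m u) = g"
    unfolding lin_inverse[OF m] by simp
  then show ?thesis by (simp add: g_def)
qed

lemma fnorm_inverse_lin:
  assumes "\<bar>u\<bar> \<le> 4" "m \<ge> 1"
  shows "fnorm D (inverse (lin m u)) \<le> 1 / (m - 1/20)"
proof -
  define q where "q = \<bar>u\<bar> / 80 / m"
  have q: "0 \<le> q" "q \<le> 1/20 / m" using assms unfolding q_def by (simp_all add: divide_simps)
  have "1/20 / m < 1" using assms by (simp add: divide_simps)
  then have q1: "q < 1" using q by linarith
  have "fnorm D (inverse (lin m u)) = (\<Sum>l<D. (1 / m) * q ^ l)"
    unfolding fnorm_def using assms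
    by (intro sum.cong refl) (simp add: inverse_lin_nth q_def power_divide power_abs abs_mult)
  also have "\<dots> = (1 / m) * (\<Sum>l<D. q ^ l)" by (simp add: sum_distrib_left)
  also have "(\<Sum>l<D. q ^ l) \<le> suminf (\<lambda>l. q ^ l)"
    by (rule sum_le_suminf) (use q q1 in \<open>auto intro: summable_geometric\<close>)
  also have "suminf (\<lambda>l. q ^ l) = 1 / (1 - q)" using q q1 by (simp add: suminf_geometric)
  also have "1 / (1 - q) \<le> 1 / (1 - 1/20 / m)"
    using q \<open>1/20 / m < 1\<close> by (intro divide_left_mono) auto
  finally have "fnorm D (inverse (lin m u)) \<le> (1 / m) * (1 / (1 - 1/20 / m))"
    using assms by (simp add: mult_left_mono divide_right_mono)
  also have "\<dots> = 1 / (m - 1/20)" using assms by (simp add: field_simps)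
  finally show ?thesis .
qed

definition lin_quot_bound :: "real \<Rightarrow> real" where "lin_quot_bound m = (m + 1/20) / (m - 1/20)"

lemma lin_quot_bound_nonneg: "m \<ge> 1 \<Longrightarrow> lin_quot_bound m \<ge> 0" by (simp add: lin_quot_bound_def)

text \<open>Products of these bounds over \<open>m = 1, \<dots>, n\<close> grow at most like the fourth root of \<open>n\<close>, since the fourth powers
telescope.\<close>

lemma lin_quot_bound_power4: assumes "m \<ge> 1" shows "lin_quot_bound m ^ 4 \<le> (m + 1) / m"
proof -
  have "(m + 1) * (m - 1/20) ^ 4 - m * (m + 1/20) ^ 4
      = 3/5 * m ^ 4 - 1/5 * m ^ 3 + 7/500 * m ^ 2 - 1/2000 * m + 1/160000"
  proof -
    have "(m + 1) * (m - e) ^ 4 - m * (m + e) ^ 4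
      = (1 - 8 * e) * m ^ 4 - 4 * e * m ^ 3 + (6 * e ^ 2 - 8 * e ^ 3) * m ^ 2 - 4 * e ^ 3 * m + e ^ 4" for e
      by algebra
    from this[of "1/20"] show ?thesis by (simp add: power_divide)
  qed
  moreover have "m ^ 3 \<le> m ^ 4" "m \<le> m ^ 2" "0 \<le> m ^ 4" "0 \<le> m ^ 2"
    using assms by (auto intro: power_increasing simp: self_le_power)
  ultimately have "m * (m + 1/20) ^ 4 \<le> (m + 1) * (m - 1/20) ^ 4" by linarith
  then show ?thesis using assms unfolding lin_quot_bound_def power_divide by (simp add: divide_simps mult.commute)
qed

lemma fnorm_lin_quot: "\<bar>u\<bar> \<le> 4 \<Longrightarrow> \<bar>v\<bar> \<le> 4 \<Longrightarrow> m \<ge> 1 \<Longrightarrow> fnorm D (lin_quot u v m) \<le> lin_quot_bound m"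
  unfolding lin_quot_def lin_quot_bound_def
  using order_trans[OF fnorm_mult mult_mono[OF fnorm_lin fnorm_inverse_lin]] fnorm_nonneg by simp

lemma fnorm_prod: "(\<And>i. i \<in> A \<Longrightarrow> fnorm D (f i) \<le> b i) \<Longrightarrow> fnorm D (\<Prod>i\<in>A. f i) \<le> (\<Prod>i\<in>A. b i)"
proof (induction A rule: infinite_finite_induct)
  case (insert x A)
  have "fnorm D (\<Prod>i\<in>insert x A. f i) \<le> fnorm D (f x) * fnorm D (\<Prod>i\<in>A. f i)"
    using insert.hyps fnorm_mult by simp
  also have "\<dots> \<le> b x * (\<Prod>i\<in>A. b i)"
    using insert by (intro mult_mono) (auto simp: fnorm_nonneg intro: order_trans[OF fnorm_nonneg])
  finally show ?case using insert.hyps by simp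
qed (use fnorm_const[of D 1] in simp_all)

lemma fnorm_prod_power4:
  assumes "\<And>i. i < n \<Longrightarrow> fnorm D (f i) \<le> lin_quot_bound (g i)" "\<And>i. i < n \<Longrightarrow> g i \<ge> 1"
  shows "fnorm D (\<Prod>i<n. f i) ^ 4 \<le> (\<Prod>i<n. (g i + 1) / g i)"
proof -
  have "fnorm D (\<Prod>i<n. f i) \<le> (\<Prod>i<n. lin_quot_bound (g i))"
    by (rule fnorm_prod) (use assms in auto)
  then have "fnorm D (\<Prod>i<n. f i) ^ 4 \<le> (\<Prod>i<n. lin_quot_bound (g i)) ^ 4"
    by (rule power_mono) (rule fnorm_nonneg)
  also have "\<dots> \<le> (\<Prod>i<n. (g i + 1) / g i)"
    unfolding prod_power_distrib using assms by (intro prod_mono) (auto simp: lin_quot_bound_power4 lin_quot_bound_nonneg)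
  finally show ?thesis .
qed

lemma fnorm_rising:
  assumes "\<bar>u\<bar> \<le> 4" "\<bar>v\<bar> \<le> 4"
  shows "fnorm D (\<Prod>i<n. lin_quot u v (real (Suc i))) ^ 4 \<le> real (Suc n)"
proof -
  have "fnorm D (\<Prod>i<n. lin_quot u v (real (Suc i))) ^ 4 \<le> (\<Prod>i<n. (real (Suc i) + 1) / real (Suc i))"
    by (rule fnorm_prod_power4) (use assms in \<open>auto intro!: fnorm_lin_quot\<close>)
  also have "\<dots> = real (Suc n)"
    by (induction n) (simp_all add: field_simps)
  finally show ?thesis .
qed

lemma fnorm_falling:
  assumes "\<bar>u\<bar> \<le> 4" "\<bar>v\<bar> \<le> 4" "n \<le> N"
  shows "fnorm D (\<Prod>i<n. lin_quot u v (real (N - i))) ^ 4 \<le> real (Suc n)"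
proof -
  have "fnorm D (\<Prod>i<n. lin_quot u v (real (N - i))) ^ 4 \<le> (\<Prod>i<n. (real (N - i) + 1) / real (N - i))"
    by (rule fnorm_prod_power4) (use assms in \<open>auto intro!: fnorm_lin_quot\<close>)
  also have "\<dots> = (real N + 1) / (real (N - n) + 1)"
    using assms(3)
  proof (induction n)
    case (Suc n)
    then have *: "real (N - n) = real (N - Suc n) + 1" by (simp add: of_nat_diff)
    show ?case using Suc by (simp add: * field_simps)
  qed simp
  also have "\<dots> \<le> real (Suc n)"
  proof -
    have "(real n + 1) * (real (N - n) + 1) - (real N + 1) = real n * real (N - n)"
      using assms(3) by (simp add: of_nat_diff algebra_simps)
    then have "real N + 1 \<le> real (Suc n) * (real (N - n) + 1)"
      by (simp add: add.commute) (metis add.commute diff_ge_0_iff_ge of_nat_0_le_iff of_nat_mult)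
    then show ?thesis by (simp add: divide_simps)
  qed
  finally show ?thesis .
qed

text \<open>The factors with numbers beyond \<open>N\<close> are controlled in the same way as those up to \<open>N\<close>.\<close>

lemma fnorm_shifted:
  assumes "\<bar>u\<bar> \<le> 4" "\<bar>v\<bar> \<le> 4"
  shows "fnorm D (\<Prod>i<n. lin_quot u v (real (Suc (N + i)))) ^ 4 \<le> real (Suc n)"
proof -
  have "fnorm D (\<Prod>i<n. lin_quot u v (real (Suc (N + i)))) ^ 4 \<le> (\<Prod>i<n. (real (Suc (N + i)) + 1) / real (Suc (N + i)))"
    by (rule fnorm_prod_power4) (use assms in \<open>auto intro!: fnorm_lin_quot\<close>)
  also have "\<dots> = real (Suc (N + n)) / real (Suc N)"
    by (induction n) (simp_all add: field_simps)
  also have "\<dots> \<le> real (Suc n)"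
    by (simp add: divide_simps algebra_simps)
  finally show ?thesis .
qed

lemma pochhammer_prod_nat: "pochhammer x n = (\<Prod>i<n. x + of_nat i)"
  by (simp add: pochhammer_prod atLeast0LessThan)

lemma neg_cutoff_eq:
  fixes g :: "'a::field_char_0"
  assumes "n \<le> N"
  shows "pochhammer (- of_nat N) n * inverse (pochhammer (- scaled_X g - of_nat N) n) = (\<Prod>i<n. lin_quot 0 g (of_nat (N - i)))"
  unfolding pochhammer_prod_nat inverse_prod_fps prod.distrib[symmetric]
proof (intro prod.cong refl)
  fix i assume "i \<in> {..<n}"
  then have i: "of_nat N = of_nat (N - i) + (of_nat i :: 'a fps)" using assms by (simp flip: of_nat_add)
  have "- of_nat N + of_nat i = - lin (of_nat (N - i)) (0 :: 'a)" "- scaled_X g - of_nat N + of_nat i = - lin (of_nat (N - i)) g"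
    unfolding lin_of_nat i by simp_all
  then show "(- of_nat N + of_nat i) * inverse (- scaled_X g - of_nat N + of_nat i) = lin_quot 0 g (of_nat (N - i))"
    by (simp add: lin_quot_def)
qed

lemma wp_cutoff_eq:
  assumes "n \<le> N"
  shows "wp_cutoff_fps (scaled_X a) (scaled_X g) N n
     = (\<Prod>i<n. lin_quot (a + g) a (of_nat (Suc (N + i)))) * (\<Prod>i<n. lin_quot 0 g (of_nat (N - i)))"
proof -
  have "pochhammer (1 + scaled_X a + scaled_X g + of_nat N) n * inverse (pochhammer (1 + scaled_X a + of_nat N) n)
     = (\<Prod>i<n. lin_quot (a + g) a (of_nat (Suc (N + i))))"
    unfolding pochhammer_prod_nat inverse_prod_fps prod.distrib[symmetric]
  proof (intro prod.cong refl)
    fix i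
    have "1 + scaled_X a + scaled_X g + of_nat N + of_nat i = lin (of_nat (Suc (N + i))) (a + g)"
      "1 + scaled_X a + of_nat N + of_nat i = lin (of_nat (Suc (N + i))) a"
      unfolding lin_of_nat by (simp_all add: fps_const_add[symmetric] algebra_simps del: fps_const_add)
    then show "(1 + scaled_X a + scaled_X g + of_nat N + of_nat i) * inverse (1 + scaled_X a + of_nat N + of_nat i) = lin_quot (a + g) a (of_nat (Suc (N + i)))"
      unfolding lin_quot_def by simp
  qed
  then show ?thesis unfolding wp_cutoff_fps_def neg_cutoff_eq[OF assms, symmetric] by (simp only: mult_ac)
qed

lemma lin_quot_tendsto_1:
  assumes "filterlim f at_top sequentially"
  shows "fps_tendsto (\<lambda>N. lin_quot u v (real (f N))) 1"
  unfolding fps_tendsto_def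
proof
  fix k
  have ev: "eventually (\<lambda>N. f N > 0) sequentially"
    using assms eventually_gt_at_top[of "0::nat"] by (auto simp: filterlim_iff)
  have inv: "(\<lambda>N. 1 / real (f N) ^ j) \<longlonglongrightarrow> 0" if "j > 0" for j
  proof -
    have "filterlim (\<lambda>N. real (f N)) at_top sequentially"
      using filterlim_compose[OF filterlim_real_sequentially assms] .
    then have "(\<lambda>N. inverse (real (f N)) ^ j) \<longlonglongrightarrow> 0 ^ j"
      by (intro tendsto_power tendsto_inverse_0_at_top)
    then show ?thesis using that by (simp add: power_0_left power_inverse divide_inverse)
  qed
  show "(\<lambda>N. lin_quot u v (real (f N)) $ k) \<longlonglongrightarrow> 1 $ k"
  proof (cases k)
    case 0
    have "eventually (\<lambda>N. lin_quot u v (real (f N)) $ k = 1 $ k) sequentially"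
      using ev by eventually_elim (simp add: lin_quot_def lin_mult_nth inverse_lin_nth lin_nth 0)
    then show ?thesis by (rule tendsto_eventually)
  next
    case (Suc j)
    have "eventually (\<lambda>N. (- v) ^ Suc j * (1 / real (f N) ^ Suc j) + u * (- v) ^ j * (1 / real (f N) ^ Suc j) = lin_quot u v (real (f N)) $ k) sequentially"
      using ev by eventually_elim (simp add: lin_quot_def lin_mult_nth inverse_lin_nth lin_nth Suc field_simps)
    moreover have "(\<lambda>N. (- v) ^ Suc j * (1 / real (f N) ^ Suc j) + u * (- v) ^ j * (1 / real (f N) ^ Suc j)) \<longlonglongrightarrow> 1 $ k"
      using tendsto_add[OF tendsto_mult_left[OF inv[of "Suc j"], of "(- v) ^ Suc j"] tendsto_mult_left[OF inv[of "Suc j"], of "u * (- v) ^ j"]]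
      by (simp add: Suc)
    ultimately show ?thesis by (rule Lim_transform_eventually[rotated])
  qed
qed

lemma cutoffs_tendsto_1:
  "fps_tendsto (\<lambda>N. \<Prod>i<n. lin_quot u v (real (Suc (N + i)))) 1"
  "fps_tendsto (\<lambda>N. \<Prod>i<n. lin_quot u v (real (N - i))) 1"
proof -
  have "filterlim (\<lambda>N. Suc (N + i)) at_top sequentially" for i
    using filterlim_compose[OF filterlim_Suc filterlim_add_const_nat_at_top] by simp
  from fps_tendsto_prod[OF lin_quot_tendsto_1[OF this], where A = "{..<n}"] show "fps_tendsto (\<lambda>N. \<Prod>i<n. lin_quot u v (real (Suc (N + i)))) 1"
    by simp
  from fps_tendsto_prod[OF lin_quot_tendsto_1[OF filterlim_minus_const_nat_at_top], where A = "{..<n}"]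
  show "fps_tendsto (\<lambda>N. \<Prod>i<n. lin_quot u v (real (N - i))) 1"
    by simp
qed

text \<open>Tannery's theorem coefficient by coefficient: the factors \<open>h N n\<close> tend to 1 for fixed \<open>n\<close>, and the terms have a
summable bound independent of \<open>N\<close>.\<close>

lemma cutoff_removal:
  assumes lim: "\<And>n. fps_tendsto (\<lambda>N. h N n) 1"
    and bound: "\<And>D N n. 0 < n \<Longrightarrow> n \<le> N \<Longrightarrow> fnorm D (t n * h N n) \<le> C * n powr (-3/2)"
    and bound': "\<And>D n. 0 < n \<Longrightarrow> fnorm D (t n) \<le> C * n powr (-3/2)"
    and sum: "fps_tendsto (\<lambda>N. \<Sum>n=1..N. t n * h N n) L"
  shows "fps_tendsto (\<lambda>N. \<Sum>n=1..N. t n) L"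
proof -
  have "fps_tendsto (\<lambda>N. \<Sum>n=1..N. t n * (1 - h N n)) 0"
    unfolding fps_tendsto_def
  proof
    fix k
    define a where "a n N = (if n \<in> {1..N} then (t n * (1 - h N n)) $ k else 0)" for n N
    define M where "M n = 2 * C * 80 ^ k * real n powr (-3/2)" for n
    have "(\<lambda>N. suminf (\<lambda>n. a n N)) \<longlonglongrightarrow> suminf (\<lambda>n. 0)"
    proof (rule conjunct2[OF conjunct2[OF tannerys_theorem[where b = "\<lambda>_. 0" and M = M]]])
      fix n
      have "fps_tendsto (\<lambda>N. t n * (1 - h N n)) (t n * (1 - 1))"
        by (intro fps_tendsto_mult fps_tendsto_diff fps_tendsto_const lim)
      then have *: "(\<lambda>N. (t n * (1 - h N n)) $ k) \<longlonglongrightarrow> 0" by (simp add: fps_tendsto_def)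
      show "(\<lambda>N. a n N) \<longlonglongrightarrow> 0"
      proof (cases "n = 0")
        case False
        have "eventually (\<lambda>N. (t n * (1 - h N n)) $ k = a n N) sequentially"
          using eventually_ge_at_top[of n] by eventually_elim (use False in \<open>simp add: a_def\<close>)
        from Lim_transform_eventually[OF * this] show ?thesis .
      qed (simp add: a_def)
    next
      have "norm (a n N) \<le> M n" for n N
      proof (cases "n \<in> {1..N}")
        case True
        have "\<bar>(t n * (1 - h N n)) $ k\<bar> \<le> \<bar>t n $ k\<bar> + \<bar>(t n * h N n) $ k\<bar>"
          by (simp add: right_diff_distrib)
        also have "\<dots> \<le> C * n powr (-3/2) * 80 ^ k + C * n powr (-3/2) * 80 ^ k"
          using True
          by (intro add_mono order_trans[OF fnorm_nth[of k "Suc k"]] mult_right_mono bound bound') auto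
        finally show ?thesis using True by (simp add: a_def M_def)
      next
        case False
        have "0 \<le> C * 1 powr (-3/2)" using bound'[of 1] fnorm_nonneg order_trans by (metis of_nat_1 zero_less_one)
        then show ?thesis using False by (auto simp: a_def M_def)
      qed
      then show "eventually (\<lambda>(n, N). norm (a n N) \<le> M n) (sequentially \<times>\<^sub>F sequentially)"
        by (intro always_eventually) auto
      show "summable M" unfolding M_def by (intro summable_mult) (simp add: summable_real_powr_iff)
    qed auto
    moreover have "suminf (\<lambda>n. a n N) = (\<Sum>n=1..N. t n * (1 - h N n)) $ k" for N
      by (subst suminf_finite[of "{1..N}"]) (auto simp: a_def fps_sum_nth)
    ultimately show "(\<lambda>N. (\<Sum>n=1..N. t n * (1 - h N n)) $ k) \<longlonglongrightarrow> 0 $ k" by simp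
  qed
  from fps_tendsto_add[OF this sum] show ?thesis
    by (simp add: sum.distrib[symmetric] right_diff_distrib)
qed

definition zeta_nat :: "nat \<Rightarrow> real" where "zeta_nat k = suminf (\<lambda>n. 1 / real (Suc n) ^ k)"

lemma zeta_nat_tendsto: assumes "k \<ge> 2" shows "(\<lambda>N. \<Sum>i=1..N. 1 / real i ^ k) \<longlonglongrightarrow> zeta_nat k"
proof -
  have "summable (\<lambda>n. 1 / real (Suc n) ^ k)"
    using inverse_power_summable[OF assms, where 'a = real] summable_Suc_iff[of "\<lambda>n. inverse (real n ^ k)"]
    by (simp add: divide_inverse)
  then have "(\<lambda>N. \<Sum>i<N. 1 / real (Suc i) ^ k) \<longlonglongrightarrow> zeta_nat k"
    unfolding zeta_nat_def by (rule summable_LIMSEQ)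
  then show ?thesis by (simp add: sum.atLeast1_atMost_eq)
qed

text \<open>The expansion of a combination of digamma functions: a weighted sum of \<open>\<Sum>\<^sub>i 1 / (i + u X)\<close> in which the divergent constant
terms cancel. \<open>p l\<close> is the weighted \<open>l\<close>-th power sum of the parameters \<open>u\<close>.\<close>

definition psi_series :: "(nat \<Rightarrow> real) \<Rightarrow> real fps" where
  "psi_series p = Abs_fps (\<lambda>l. if l = 0 then 0 else (- 1) ^ l * p l * zeta_nat (Suc l))"

lemma psi_series_tendsto:
  assumes "\<And>l. (\<Sum>j<J. s j * u j ^ l) = p l" "p 0 = 0"
  shows "fps_tendsto (\<lambda>N. \<Sum>i=1..N. \<Sum>j<J. fps_const (s j) * inverse (lin (real i) (u j))) (psi_series p)"
  unfolding fps_tendsto_def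
proof
  fix l
  have "(\<Sum>i=1..N. \<Sum>j<J. fps_const (s j) * inverse (lin (real i) (u j))) $ l = (- 1) ^ l * p l * (\<Sum>i=1..N. 1 / real i ^ Suc l)" for N
  proof -
    have "(\<Sum>j<J. s j * ((- u j) ^ l / real i ^ Suc l)) = (-1) ^ l * p l * (1 / real i ^ Suc l)" for i
      unfolding assms(1)[symmetric] sum_distrib_left sum_distrib_right
      by (intro sum.cong refl) (simp add: power_minus[of "u _"] mult_ac)
    then show ?thesis
      by (simp add: fps_sum_nth inverse_lin_nth sum_distrib_left del: power_Suc)
  qed
  moreover have "(\<lambda>N. (- 1) ^ l * p l * (\<Sum>i=1..N. 1 / real i ^ Suc l)) \<longlonglongrightarrow> psi_series p $ l"
  proof (cases "l = 0")
    case False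
    then show ?thesis unfolding psi_series_def by (auto intro!: tendsto_mult tendsto_const zeta_nat_tendsto simp del: power_Suc One_nat_def)
  qed (simp add: psi_series_def assms(2))
  ultimately show "(\<lambda>N. (\<Sum>i=1..N. \<Sum>j<J. fps_const (s j) * inverse (lin (real i) (u j))) $ l) \<longlonglongrightarrow> psi_series p $ l"
    by simp
qed

text \<open>Each term is a product of a constant number of rising and falling factors, which grow so slowly that the terms stay summable; so the terminating factor can be removed in the limit of
\<open>wp_fps_sum\<close>.\<close>

lemma wp_sum_tendsto:
  fixes a c d :: real
  assumes small: "\<bar>a\<bar> \<le> 4" "\<bar>c\<bar> \<le> 4" "\<bar>d\<bar> \<le> 4" "\<bar>a - c\<bar> \<le> 4" "\<bar>a - d\<bar> \<le> 4" "\<bar>a - c - d\<bar> \<le> 4"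
      "\<bar>2 * a - c - d\<bar> \<le> 4" "a - c - d \<noteq> 0"
  shows "fps_tendsto (\<lambda>N. \<Sum>n=1..N. wp_fps (scaled_X a) (scaled_X c) (scaled_X d) n)
     (psi_series (\<lambda>l. a ^ l + (a - c - d) ^ l - (a - c) ^ l - (a - d) ^ l))"
proof (rule cutoff_removal)
  let ?T = "wp_fps (scaled_X a) (scaled_X c) (scaled_X d)" and ?g = "a - c - d"
  define h where "h N n = (\<Prod>i<n. lin_quot (a + ?g) a (real (Suc (N + i)))) * (\<Prod>i<n. lin_quot 0 ?g (real (N - i)))" for N n
  show "fps_tendsto (\<lambda>N. h N n) 1" for n
    unfolding h_def using fps_tendsto_mult[OF cutoffs_tendsto_1] by simp
  show "fps_tendsto (\<lambda>N. \<Sum>n=1..N. ?T n * h N n) (psi_series (\<lambda>l. a ^ l + (a - c - d) ^ l - (a - c) ^ l - (a - d) ^ l))"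
  proof -
    define s u where "s = (!) [1, 1, -1, -1 :: real]" and "u = (!) [a, a - c - d, a - c, a - d]"
    have eq: "(\<Sum>n=1..N. ?T n * h N n) = (\<Sum>i=1..N. \<Sum>j<4. fps_const (s j) * inverse (lin (real i) (u j)))" for N
    proof -
      have "(\<Sum>n=1..N. ?T n * h N n) = (\<Sum>n=1..N. ?T n * wp_cutoff_fps (scaled_X a) (scaled_X ?g) N n)"
        by (intro sum.cong refl) (simp add: wp_cutoff_eq h_def)
      also have "\<dots> = (\<Sum>i=1..N. \<Sum>j<4. fps_const (s j) * inverse (lin (real i) (u j)))"
        unfolding wp_fps_sum[OF small(8)] s_def u_def
        by (intro sum.cong refl) (simp add: eval_nat_numeral fps_const_neg[symmetric] del: fps_const_neg)
      finally show ?thesis .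
    qed
    show ?thesis unfolding eq
      by (rule psi_series_tendsto) (simp_all add: s_def u_def eval_nat_numeral)
  qed
  have T: "fnorm D (?T (Suc n)) \<le> 32 / real (Suc n) ^ 3 *
      (fnorm D (\<Prod>i<n. lin_quot c (a - c) (real (Suc i))) * fnorm D (\<Prod>i<n. lin_quot d (a - d) (real (Suc i))))" for D n
  proof -
    define m where "m = real (Suc n)"
    have m: "m \<ge> 1" by (simp add: m_def)
    let ?P = "\<Prod>i<n. lin_quot c (a - c) (real (Suc i))" and ?Q = "\<Prod>i<n. lin_quot d (a - d) (real (Suc i))"
    have "?T (Suc n) = scaled_X c * (scaled_X d * (?P * (?Q * (fps_const (2 / m) * (lin m (a/2) * (inverse (lin m a) * (inverse (lin m (a - c)) * inverse (lin m (a - d)))))))))"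
    proof -
      have 1: "scaled_X c * scaled_X d = fps_const (c * d) * fps_X ^ 2"
        by (simp only: fps_const_mult[symmetric] power2_eq_square mult_ac)
      have 2: "fps_const (2 / m) = 2 * inverse (fps_const m)"
        by (simp add: numeral_fps_const divide_inverse fps_const_inverse)
      have "?T (Suc n) = scaled_X c * scaled_X d * (?P * ?Q) * (fps_const (2 / m) * lin m (a/2) * inverse (lin m a) * inverse (lin m (a - c)) * inverse (lin m (a - d)))"
        unfolding wp_fps_Suc prod.distrib 1 2 unfolding m_def fps_of_nat[symmetric] by (simp only: mult_ac)
      then show ?thesis by (simp only: mult_ac)
    qed
    then have "fnorm D (?T (Suc n)) \<le> 1/20 * (1/20 * (fnorm D ?P * (fnorm D ?Q * (2 / m * ((m + 1/20) * (1 / (m - 1/20) * (1 / (m - 1/20) * (1 / (m - 1/20)))))))))"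
      using small m
      by (simp only:) (intro fnorm_mult_le order_refl fnorm_scaled_X fnorm_lin fnorm_inverse_lin order_trans[OF fnorm_const]; simp)
    also have "\<dots> = 1/200 * ((m + 1/20) / m * ((1 / (m - 1/20)) ^ 3)) * (fnorm D ?P * fnorm D ?Q)"
    proof -
      have "1/20 * (1/20 * (p * (q * (2 / m * (w * (r * (r * r))))))) = 1/200 * (w / m * r ^ 3) * (p * q)" for p q w r :: real
        by (simp add: power3_eq_cube mult_ac)
      then show ?thesis .
    qed
    also have "\<dots> \<le> 1/200 * (2 * (2 / m) ^ 3) * (fnorm D ?P * fnorm D ?Q)"
      using m by (intro mult_right_mono mult_left_mono mult_mono power_mono) (auto simp: fnorm_nonneg divide_simps)
    also have "\<dots> \<le> 32 / m ^ 3 * (fnorm D ?P * fnorm D ?Q)"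
      using m by (intro mult_right_mono) (auto simp: fnorm_nonneg divide_simps power3_eq_cube)
    finally show ?thesis by (simp only: m_def)
  qed
  have PQ: "fnorm D (\<Prod>i<n. lin_quot c (a - c) (real (Suc i))) ^ 4 \<le> real (Suc n)"
    "fnorm D (\<Prod>i<n. lin_quot d (a - d) (real (Suc i))) ^ 4 \<le> real (Suc n)" for D n
    using small by (auto intro!: fnorm_rising simp del: of_nat_Suc)
  have final: "32 / m ^ 3 * x \<le> 128 * m powr (-3/2)" if "m \<ge> 1" "x \<ge> 0" "x ^ 4 \<le> (4 * m) ^ 4" for m x :: real
  proof -
    have "x \<le> 4 * m" using that by (intro power_le_imp_le_base[of x 3]) auto
    then have "32 / m ^ 3 * x \<le> 32 / m ^ 3 * (4 * m)" using that by (intro mult_left_mono) auto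
    also have "\<dots> = 128 * m powr (-2)" using that by (simp add: powr_minus divide_simps power3_eq_cube power2_eq_square)
    also have "\<dots> \<le> 128 * m powr (-3/2)" using that by (intro mult_left_mono powr_mono) auto
    finally show ?thesis .
  qed
  show "fnorm D (?T n) \<le> 128 * n powr (-3/2)" if n0: "0 < n" for D n
  proof -
    obtain k where k: "n = Suc k" using n0 by (cases n) auto
    let ?P = "fnorm D (\<Prod>i<k. lin_quot c (a - c) (real (Suc i)))" and ?Q = "fnorm D (\<Prod>i<k. lin_quot d (a - d) (real (Suc i)))"
    have "(?P * ?Q) ^ 4 \<le> real n * real n"
      unfolding power_mult_distrib k by (intro mult_mono PQ) auto
    also have "\<dots> \<le> (4 * real n) ^ 4"
    proof -
      have "1 \<le> real n" using that by simp
      then have "real n ^ 2 \<le> real n ^ 4" by (intro power_increasing) auto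
      also have "\<dots> \<le> (4 * real n) ^ 4" by (intro power_mono) auto
      finally show ?thesis by (simp add: power2_eq_square)
    qed
    finally have "32 / real n ^ 3 * (?P * ?Q) \<le> 128 * n powr (-3/2)"
      using that by (intro final) (auto intro!: mult_nonneg_nonneg fnorm_nonneg)
    then show ?thesis using T[of D k] unfolding k by linarith
  qed
  show "fnorm D (?T n * h N n) \<le> 128 * n powr (-3/2)" if n0: "0 < n" and nN: "n \<le> N" for D N n
  proof -
    obtain k where k: "n = Suc k" using n0 by (cases n) auto
    let ?P = "fnorm D (\<Prod>i<k. lin_quot c (a - c) (real (Suc i)))" and ?Q = "fnorm D (\<Prod>i<k. lin_quot d (a - d) (real (Suc i)))"
    let ?U = "fnorm D (\<Prod>i<n. lin_quot (a + ?g) a (real (Suc (N + i))))" and ?V = "fnorm D (\<Prod>i<n. lin_quot 0 ?g (real (N - i)))"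
    have "?U ^ 4 \<le> real (Suc n)"
      using small by (auto intro!: fnorm_shifted simp del: of_nat_Suc)
    moreover have "?V ^ 4 \<le> real (Suc n)"
      by (rule fnorm_falling) (use small nN in simp_all)
    ultimately have UV: "?U ^ 4 \<le> 2 * real n" "?V ^ 4 \<le> 2 * real n" using that by simp_all
    have "(?P * ?Q * (?U * ?V)) ^ 4 \<le> real n * real n * ((2 * real n) * (2 * real n))"
      unfolding power_mult_distrib by (intro mult_mono UV PQ[of D k, folded k]) (auto intro!: mult_nonneg_nonneg)
    also have "\<dots> \<le> (4 * real n) ^ 4"
      by (simp add: power4_eq_xxxx)
    finally have "32 / real n ^ 3 * (?P * ?Q * (?U * ?V)) \<le> 128 * n powr (-3/2)"
      using that by (intro final) (auto intro!: mult_nonneg_nonneg fnorm_nonneg)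
    moreover have "fnorm D (?T n * h N n) \<le> (32 / real n ^ 3 * (?P * ?Q)) * (?U * ?V)"
      using T[of D k] unfolding k h_def
      by (intro fnorm_mult_le order_refl)
    ultimately show ?thesis by (simp add: mult.assoc)
  qed
qed

lemma gauss_sum_tendsto:
  fixes c h :: real
  assumes small: "\<bar>c\<bar> \<le> 4" "\<bar>h\<bar> \<le> 4" "\<bar>h - c\<bar> \<le> 4" "h - c \<noteq> 0"
  shows "fps_tendsto (\<lambda>N. \<Sum>n=1..N. gauss_fps (scaled_X c) (scaled_X h) n) (psi_series (\<lambda>l. (h - c) ^ l - h ^ l))"
proof (rule cutoff_removal)
  let ?T = "gauss_fps (scaled_X c) (scaled_X h)"
  define v where "v N n = (\<Prod>i<n. lin_quot 0 (h - c) (real (N - i)))" for N n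
  show "fps_tendsto (\<lambda>N. v N n) 1" for n
    unfolding v_def by (rule cutoffs_tendsto_1)
  show "fps_tendsto (\<lambda>N. \<Sum>n=1..N. ?T n * v N n) (psi_series (\<lambda>l. (h - c) ^ l - h ^ l))"
  proof -
    define s u where "s = (!) [1, -1 :: real]" and "u = (!) [h - c, h]"
    have eq: "(\<Sum>n=1..N. ?T n * v N n) = (\<Sum>i=1..N. \<Sum>j<2. fps_const (s j) * inverse (lin (real i) (u j)))" for N
    proof -
      have "(\<Sum>n=1..N. ?T n * v N n) = (\<Sum>n=1..N. ?T n * gauss_cutoff_fps (scaled_X (h - c)) N n)"
        by (intro sum.cong refl) (simp add: gauss_cutoff_fps_def neg_cutoff_eq v_def)
      also have "\<dots> = (\<Sum>i=1..N. \<Sum>j<2. fps_const (s j) * inverse (lin (real i) (u j)))"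
        unfolding gauss_fps_sum[OF small(4)] s_def u_def
        by (intro sum.cong refl) (simp add: eval_nat_numeral fps_const_neg[symmetric] del: fps_const_neg)
      finally show ?thesis .
    qed
    show ?thesis unfolding eq
      by (rule psi_series_tendsto) (simp_all add: s_def u_def eval_nat_numeral)
  qed
  have T: "fnorm D (?T (Suc n)) \<le> 2 / real (Suc n) ^ 2 * fnorm D (\<Prod>i<n. lin_quot c h (real (Suc i)))" for D n
  proof -
    define m where "m = real (Suc n)"
    have m: "m \<ge> 1" by (simp add: m_def)
    let ?P = "\<Prod>i<n. lin_quot c h (real (Suc i))"
    have "?T (Suc n) = scaled_X c * (?P * (fps_const (1 / m) * inverse (lin m h)))"
    proof -
      have 2: "fps_const (1 / m) = inverse (fps_const m)"
        by (simp add: divide_inverse fps_const_inverse)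
      show ?thesis
        unfolding gauss_fps_Suc 2 unfolding m_def fps_of_nat[symmetric] by (simp only: mult_ac)
    qed
    then have "fnorm D (?T (Suc n)) \<le> 1/20 * (fnorm D ?P * (1 / m * (1 / (m - 1/20))))"
      using small m
      by (simp only:) (intro fnorm_mult_le order_refl fnorm_scaled_X fnorm_inverse_lin order_trans[OF fnorm_const]; simp)
    also have "\<dots> \<le> 1 * (fnorm D ?P * (1 / m * (2 / m)))"
      using m by (intro mult_mono mult_left_mono) (auto simp: fnorm_nonneg divide_simps)
    finally show ?thesis by (simp add: m_def power2_eq_square mult.commute)
  qed
  have P: "fnorm D (\<Prod>i<n. lin_quot c h (real (Suc i))) ^ 4 \<le> real (Suc n)" for D n
    using small by (auto intro!: fnorm_rising simp del: of_nat_Suc)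
  have final: "2 / m ^ 2 * x \<le> 4 * m powr (-3/2)" if "m \<ge> 1" "x \<ge> 0" "x ^ 4 \<le> 2 * (m * m)" for m x :: real
  proof -
    have "x ^ 4 \<le> (2 * sqrt m) ^ 4" using that by (simp add: power4_eq_xxxx) (use zero_le_square[of m] in linarith)
    then have "x \<le> 2 * sqrt m" using that by (intro power_le_imp_le_base[of x 3]) auto
    then have "2 / m ^ 2 * x \<le> 2 / m ^ 2 * (2 * sqrt m)" using that by (intro mult_left_mono) auto
    also have "\<dots> = 4 * (m powr (-2) * m powr (1/2))" using that by (simp add: powr_minus powr_half_sqrt divide_simps)
    also have "m powr (-2) * m powr (1/2) = m powr (-3/2)" by (simp flip: powr_add)
    finally show ?thesis .
  qed
  show "fnorm D (?T n) \<le> 4 * n powr (-3/2)" if n0: "0 < n" for D n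
  proof -
    obtain k where k: "n = Suc k" using n0 by (cases n) auto
    let ?P = "fnorm D (\<Prod>i<k. lin_quot c h (real (Suc i)))"
    have "?P ^ 4 \<le> 2 * (real n * real n)"
proof -
      have "real n * 1 \<le> real n * real n" using n0 by (intro mult_left_mono) auto
      then show ?thesis using P[of D k] unfolding k[symmetric] by linarith
    qed
    then have "2 / real n ^ 2 * ?P \<le> 4 * n powr (-3/2)"
      using that by (intro final) (auto intro!: fnorm_nonneg)
    then show ?thesis using T[of D k] unfolding k by linarith
  qed
  show "fnorm D (?T n * v N n) \<le> 4 * n powr (-3/2)" if n0: "0 < n" and nN: "n \<le> N" for D N n
  proof -
    obtain k where k: "n = Suc k" using n0 by (cases n) auto
    let ?P = "fnorm D (\<Prod>i<k. lin_quot c h (real (Suc i)))"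
    let ?V = "fnorm D (\<Prod>i<n. lin_quot 0 (h - c) (real (N - i)))"
    have "?V ^ 4 \<le> real (Suc n)"
      by (rule fnorm_falling) (use small nN in simp_all)
    then have V: "?V ^ 4 \<le> 2 * real n" using that by simp
    have "(?P * ?V) ^ 4 \<le> 2 * (real n * real n)"
      using mult_mono[OF P[of D k, folded k] V] unfolding power_mult_distrib by simp
    then have "2 / real n ^ 2 * (?P * ?V) \<le> 4 * n powr (-3/2)"
      using that by (intro final) (auto intro!: mult_nonneg_nonneg fnorm_nonneg)
    moreover have "fnorm D (?T n * v N n) \<le> (2 / real n ^ 2 * ?P) * ?V"
      using T[of D k] unfolding k v_def
      by (intro fnorm_mult_le order_refl)
    ultimately show ?thesis by (simp add: mult.assoc)
  qed
qed

section \<open>Power series modulo an ideal of coefficients; even zeta values\<close>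

text \<open>Congruences of power series coefficientwise, up to a given degree, modulo an ideal \<open>I\<close> of a subring \<open>R\<close>
of a field. It is used with multiple zeta values modulo \<open>\<zeta>(2)\<close>, and with \<open>p\<close>-integral rational numbers
modulo \<open>p\<close>.\<close>

locale coefficient_ideal =
  fixes R I :: "'a::field_char_0 set"
  assumes R0: "0 \<in> R" and R1: "1 \<in> R" and R_add: "x \<in> R \<Longrightarrow> y \<in> R \<Longrightarrow> x + y \<in> R"
    and R_uminus: "x \<in> R \<Longrightarrow> - x \<in> R" and R_mult: "x \<in> R \<Longrightarrow> y \<in> R \<Longrightarrow> x * y \<in> R"
    and I0: "0 \<in> I" and I_add: "x \<in> I \<Longrightarrow> y \<in> I \<Longrightarrow> x + y \<in> I" and I_mult: "x \<in> R \<Longrightarrow> y \<in> I \<Longrightarrow> x * y \<in> I"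
    and I_R: "x \<in> I \<Longrightarrow> x \<in> R"
begin

lemma I_uminus: "x \<in> I \<Longrightarrow> - x \<in> I"
  using I_mult[OF R_uminus[OF R1]] by simp

lemma I_diff: "x \<in> I \<Longrightarrow> y \<in> I \<Longrightarrow> x - y \<in> I"
  using I_add[OF _ I_uminus, of x y] by simp

lemma R_diff: "x \<in> R \<Longrightarrow> y \<in> R \<Longrightarrow> x - y \<in> R"
  using R_add[OF _ R_uminus, of x y] by simp

lemma R_sum: "(\<And>i. i \<in> S \<Longrightarrow> f i \<in> R) \<Longrightarrow> sum f S \<in> R"
  by (induction S rule: infinite_finite_induct) (auto intro: R0 R_add)

lemma R_prod: "(\<And>i. i \<in> S \<Longrightarrow> f i \<in> R) \<Longrightarrow> prod f S \<in> R"
  by (induction S rule: infinite_finite_induct) (auto intro: R1 R_mult)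

lemma R_power: "x \<in> R \<Longrightarrow> x ^ n \<in> R"
  by (induction n) (auto intro: R1 R_mult)

lemma I_sum: "(\<And>i. i \<in> S \<Longrightarrow> f i \<in> I) \<Longrightarrow> sum f S \<in> I"
  by (induction S rule: infinite_finite_induct) (auto intro: I0 I_add)

definition fps_R :: "nat \<Rightarrow> 'a fps \<Rightarrow> bool" where "fps_R D f \<longleftrightarrow> (\<forall>l<D. f $ l \<in> R)"
definition fps_I :: "nat \<Rightarrow> 'a fps \<Rightarrow> bool" where "fps_I D f \<longleftrightarrow> (\<forall>l<D. f $ l \<in> I)"

lemma fps_R_add: "fps_R D f \<Longrightarrow> fps_R D g \<Longrightarrow> fps_R D (f + g)" by (simp add: fps_R_def R_add)
lemma fps_R_uminus: "fps_R D f \<Longrightarrow> fps_R D (- f)" by (simp add: fps_R_def R_uminus)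
lemma fps_R_diff: "fps_R D f \<Longrightarrow> fps_R D g \<Longrightarrow> fps_R D (f - g)" by (simp add: fps_R_def R_diff)
lemma fps_R_mult: "fps_R D f \<Longrightarrow> fps_R D g \<Longrightarrow> fps_R D (f * g)"
  by (auto simp: fps_R_def fps_mult_nth intro!: R_sum R_mult)
lemma fps_R_const: "c \<in> R \<Longrightarrow> fps_R D (fps_const c)" by (simp add: fps_R_def R0)
lemma fps_R_X: "fps_R D fps_X" by (simp add: fps_R_def fps_X_def R0 R1)
lemma fps_R_1: "fps_R D 1" using fps_R_const[OF R1] by simp
lemma fps_R_prod: "(\<And>i. i \<in> S \<Longrightarrow> fps_R D (f i)) \<Longrightarrow> fps_R D (prod f S)"
  by (induction S rule: infinite_finite_induct) (auto intro: fps_R_1 fps_R_mult)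
lemma fps_R_sum: "(\<And>i. i \<in> S \<Longrightarrow> fps_R D (f i)) \<Longrightarrow> fps_R D (sum f S)"
  by (auto simp: fps_R_def fps_sum_nth intro!: R_sum)
lemma fps_R_lin: "m \<in> R \<Longrightarrow> u \<in> R \<Longrightarrow> fps_R D (lin m u)"
  unfolding lin_def by (intro fps_R_add fps_R_mult fps_R_const fps_R_X)
lemma fps_I_R: "fps_I D f \<Longrightarrow> fps_R D f" by (simp add: fps_I_def fps_R_def I_R)
lemma fps_I_0: "fps_I D 0" by (simp add: fps_I_def I0)
lemma fps_I_add: "fps_I D f \<Longrightarrow> fps_I D g \<Longrightarrow> fps_I D (f + g)" by (simp add: fps_I_def I_add)
lemma fps_I_diff: "fps_I D f \<Longrightarrow> fps_I D g \<Longrightarrow> fps_I D (f - g)" by (simp add: fps_I_def I_diff)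
lemma fps_I_mult: "fps_R D f \<Longrightarrow> fps_I D g \<Longrightarrow> fps_I D (f * g)"
  by (auto simp: fps_R_def fps_I_def fps_mult_nth intro!: I_sum I_mult)
lemma fps_I_mult_right: "fps_I D f \<Longrightarrow> fps_R D g \<Longrightarrow> fps_I D (f * g)"
  using fps_I_mult[of D g f] by (simp add: mult.commute)
lemma fps_I_sum: "(\<And>i. i \<in> S \<Longrightarrow> fps_I D (f i)) \<Longrightarrow> fps_I D (sum f S)"
  by (auto simp: fps_I_def fps_sum_nth intro!: I_sum)

lemma fps_R_inverse:
  assumes "fps_R D f" "f $ 0 = 1"
  shows "fps_R D (inverse f)"
proof -
  have "inverse f $ n \<in> R" if "n < D" for n
    using that
  proof (induction n rule: less_induct)
    case (less n)
    show ?case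
    proof (cases "n = 0")
      case False
      have "(f * inverse f) $ n = 0"
        using assms(2) False by (subst mult.commute) (simp add: inverse_mult_eq_1)
      then have "(\<Sum>i=0..n. f $ i * inverse f $ (n - i)) = 0" by (simp add: fps_mult_nth)
      moreover have "{0..n} = insert 0 {1..n}" by auto
      ultimately have "inverse f $ n = - (\<Sum>i=1..n. f $ i * inverse f $ (n - i))"
        using assms(2) by (simp add: eq_neg_iff_add_eq_0)
      also have "\<dots> \<in> R"
        using less assms(1) by (intro R_uminus R_sum R_mult) (auto simp: fps_R_def)
      finally show ?thesis .
    qed (use assms(2) R1 in simp)
  qed
  then show ?thesis by (simp add: fps_R_def)
qed

end

lemma fps_tendsto_inverse:
  assumes "fps_tendsto F f" "\<And>N. F N $ 0 = 1" "f $ 0 = 1"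
  shows "fps_tendsto (\<lambda>N. inverse (F N)) (inverse f)"
proof -
  have rec: "inverse g $ n = - (\<Sum>i=1..n. g $ i * inverse g $ (n - i))" if "g $ 0 = 1" "n > 0" for g :: "real fps" and n
  proof -
    have "(g * inverse g) $ n = 0"
      using that by (subst mult.commute) (simp add: inverse_mult_eq_1)
    then have "(\<Sum>i=0..n. g $ i * inverse g $ (n - i)) = 0" by (simp add: fps_mult_nth)
    moreover have "{0..n} = insert 0 {1..n}" by auto
    ultimately show ?thesis using that by (simp add: eq_neg_iff_add_eq_0)
  qed
  have "(\<lambda>N. inverse (F N) $ n) \<longlonglongrightarrow> inverse f $ n" for n
  proof (induction n rule: less_induct)
    case (less n)
    show ?case
    proof (cases "n = 0")
      case False
      then have "n > 0" by simp
      show ?thesis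
        unfolding rec[OF assms(2) \<open>n > 0\<close>] rec[OF assms(3) \<open>n > 0\<close>]
        using assms(1) less by (intro tendsto_minus tendsto_sum tendsto_mult) (auto simp: fps_tendsto_def)
    qed (use assms in simp)
  qed
  then show ?thesis by (simp add: fps_tendsto_def)
qed

text \<open>Elementary symmetric functions of \<open>1, 1/4, \<dots>, 1 / N\<^sup>2\<close>; their limits are the coefficients of the sine product.\<close>

definition esym :: "nat \<Rightarrow> nat \<Rightarrow> real" where
  "esym N j = (\<Prod>m=1..N. lin 1 (1 / real m ^ 2)) $ j"

lemma esym_0: "esym 0 j = (if j = 0 then 1 else 0)"
  by (simp add: esym_def)

lemma esym_Suc: "esym (Suc N) j = esym N j + (if j = 0 then 0 else esym N (j - 1) / real (Suc N) ^ 2)"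
  unfolding esym_def by (simp add: mult.commute[of _ "lin 1 _"] lin_mult_nth del: of_nat_Suc)

lemma esym_nonneg: "esym N j \<ge> 0"
  by (induction N arbitrary: j) (simp_all add: esym_0 esym_Suc del: of_nat_Suc)

lemma power_add_ge: "0 \<le> s \<Longrightarrow> 0 \<le> a \<Longrightarrow> s ^ Suc j + real (Suc j) * a * s ^ j \<le> (s + a) ^ Suc j"
proof (induction j)
  case (Suc j)
  have "s ^ Suc (Suc j) + real (Suc (Suc j)) * a * s ^ Suc j \<le> (s + a) * (s ^ Suc j + real (Suc j) * a * s ^ j)"
    using Suc.prems by (simp add: algebra_simps)
  also have "\<dots> \<le> (s + a) * (s + a) ^ Suc j"
    using Suc by (intro mult_left_mono) auto
  finally show ?case by simp
qed simp

lemma esym_bound: "esym N j * fact j \<le> 2 ^ j"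
proof -
  define s where "s N = (\<Sum>m=1..N. 1 / real m ^ 2)" for N
  have s0: "s N \<ge> 0" for N by (simp add: s_def sum_nonneg)
  have "esym N j * fact j \<le> s N ^ j" for N
  proof (induction N arbitrary: j)
    case (Suc N)
    show ?case
    proof (cases j)
      case (Suc i)
      let ?a = "1 / real (Suc N) ^ 2"
      have "esym (Suc N) (Suc i) * fact (Suc i) = esym N (Suc i) * fact (Suc i) + real (Suc i) * ?a * (esym N i * fact i)"
        unfolding esym_Suc by (simp add: algebra_simps del: of_nat_Suc)
      also have "\<dots> \<le> s N ^ Suc i + real (Suc i) * ?a * s N ^ i"
        by (intro add_mono Suc.IH mult_left_mono) auto
      also have "\<dots> \<le> (s N + ?a) ^ Suc i"
        by (rule power_add_ge) (use s0 in auto)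
      finally show ?thesis by (simp add: s_def Suc)
    qed (use Suc.IH[of 0] in \<open>simp add: esym_Suc\<close>)
  qed (simp add: esym_0 s_def)
  also have "s N ^ j \<le> 2 ^ j"
  proof (rule power_mono[OF _ s0])
    have "s (Suc n) \<le> 2 - 1 / real (Suc n)" for n
    proof (induction n)
      case (Suc n)
      have "1 / real (Suc (Suc n)) ^ 2 \<le> 1 / real (Suc n) - 1 / real (Suc (Suc n))"
        by (simp add: divide_simps power2_eq_square)
      then show ?case using Suc by (simp add: s_def del: of_nat_Suc)
    qed (simp add: s_def)
    note le = this
    show "s N \<le> 2"
    proof (cases N)
      case (Suc n)
      have "1 / real (Suc n) \<ge> 0" by simp
      then show ?thesis using le[of n] unfolding Suc by linarith
    qed (simp add: s_def)
  qed
  finally show ?thesis .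
qed

lemma esym_sums: "(\<lambda>j. of_real (esym N j) * t ^ j) sums (\<Prod>m=1..N. 1 + t / of_nat m ^ 2 :: complex)"
proof (induction N)
  case 0
  have "(\<lambda>j. of_real (esym 0 j) * t ^ j) = (\<lambda>j. if j = 0 then 1 else 0)" by (auto simp: esym_0)
  then show ?case using sums_single[of 0 "\<lambda>_. 1 :: complex"] by simp
next
  case (Suc N)
  have "(\<lambda>j. t / of_nat (Suc N) ^ 2 * (of_real (esym N j) * t ^ j)) sums (t / of_nat (Suc N) ^ 2 * (\<Prod>m=1..N. 1 + t / of_nat m ^ 2))"
    by (rule sums_mult[OF Suc])
  note step = this
  define g where "g j = (if j = 0 then 0 else t / of_nat (Suc N) ^ 2 * (of_real (esym N (j - 1)) * t ^ (j - 1)))" for j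
  from step have "(\<lambda>j. g (Suc j)) sums (t / of_nat (Suc N) ^ 2 * (\<Prod>m=1..N. 1 + t / of_nat m ^ 2))"
    by (simp add: g_def del: of_nat_Suc)
  then have "g sums (t / of_nat (Suc N) ^ 2 * (\<Prod>m=1..N. 1 + t / of_nat m ^ 2))"
    using sums_Suc_iff[of g] by (simp add: g_def del: of_nat_Suc)
  from sums_add[OF Suc this] have "(\<lambda>j. of_real (esym N j) * t ^ j + g j) sums (\<Prod>m=1..Suc N. 1 + t / of_nat m ^ 2)"
    by (simp add: algebra_simps)
  moreover have "of_real (esym N j) * t ^ j + g j = of_real (esym (Suc N) j) * t ^ j" for j
    by (cases j) (simp_all add: g_def esym_Suc algebra_simps del: of_nat_Suc)
  ultimately show ?case by simp
qed

text \<open>The limit exists by monotonicity and \<open>esym_bound\<close>. It is identified by letting \<open>N\<close> tend to infinity in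
\<open>esym_sums\<close> and comparing with Euler's product for the sine.\<close>

lemma esym_tendsto: "(\<lambda>N. esym N j) \<longlonglongrightarrow> pi ^ (2 * j) / fact (2 * j + 1)"
proof -
  have bound: "esym N j \<le> 2 ^ j / fact j" for N j
    using esym_bound[of N j] by (simp add: divide_simps)
  have "convergent (\<lambda>N. esym N j)" for j
  proof (rule Bseq_mono_convergent)
    show "Bseq (\<lambda>N. esym N j)"
      by (rule BseqI'[of _ "2 ^ j / fact j"]) (use bound esym_nonneg in auto)
    have "esym N j \<le> esym (Suc N) j" for N
      unfolding esym_Suc using esym_nonneg[of N "j - 1"] by simp
    then show "\<forall>m n. m \<le> n \<longrightarrow> esym m j \<le> esym n j"
      using lift_Suc_mono_le[of "\<lambda>N. esym N j"] by blast
  qed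
  then obtain E where E: "\<And>j. (\<lambda>N. esym N j) \<longlonglongrightarrow> E j" unfolding convergent_def by metis
  have E0: "0 \<le> E j" for j by (rule LIMSEQ_le_const[OF E]) (use esym_nonneg in blast)
  have Eb: "E j \<le> 2 ^ j / fact j" for j by (rule LIMSEQ_le_const2[OF E]) (use bound in blast)
  have sumM: "summable (\<lambda>j. 2 ^ j / fact j * norm t ^ j)" for t :: complex
    using summable_norm_exp[of "2 * norm t"] by (simp add: power_mult_distrib divide_inverse mult_ac)
  define f where "f = Abs_fps (\<lambda>j. of_real (E j) * (- 1) ^ j :: complex)"
  define g where "g = Abs_fps (\<lambda>j. of_real (pi ^ (2 * j) / fact (2 * j + 1)) * (- 1) ^ j :: complex)"
  have fb: "norm (f $ j * t ^ j) \<le> 2 ^ j / fact j * norm t ^ j" for j t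
  proof -
    have "norm (f $ j * t ^ j) = E j * norm t ^ j"
      using E0[of j] by (simp add: f_def norm_mult norm_power)
    then show ?thesis using mult_right_mono[OF Eb[of j], of "norm t ^ j"] by simp
  qed
  have sumf: "summable (\<lambda>j. f $ j * t ^ j)" for t
    by (rule summable_comparison_test'[OF sumM[of t], of 0]) (rule fb)
  have prod_f: "(\<lambda>N. \<Prod>m=1..N. 1 - t / of_nat m ^ 2) \<longlonglongrightarrow> eval_fps f t" for t
  proof -
    have "(\<lambda>N. suminf (\<lambda>j. of_real (esym N j) * (- t) ^ j)) \<longlonglongrightarrow> suminf (\<lambda>j. of_real (E j) * (- t) ^ j)"
    proof (rule conjunct2[OF conjunct2[OF tannerys_theorem[where M = "\<lambda>j. 2 ^ j / fact j * norm t ^ j"]]])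
      show "(\<lambda>N. of_real (esym N j) * (- t) ^ j) \<longlonglongrightarrow> of_real (E j) * (- t) ^ j" for j
        by (intro tendsto_mult tendsto_of_real E tendsto_const)
      show "eventually (\<lambda>(j, N). norm (of_real (esym N j) * (- t) ^ j) \<le> 2 ^ j / fact j * norm t ^ j) (sequentially \<times>\<^sub>F sequentially)"
      proof (intro always_eventually allI, clarify)
        fix j N :: nat
        have "norm (of_real (esym N j) * (- t) ^ j) = esym N j * norm t ^ j"
          using esym_nonneg[of N j] by (simp add: norm_mult norm_power)
        then show "norm (of_real (esym N j) * (- t) ^ j) \<le> 2 ^ j / fact j * norm t ^ j"
          using mult_right_mono[OF bound[of N j], of "norm t ^ j"] by simp
      qed
    qed (use sumM in auto)
    moreover have "suminf (\<lambda>j. of_real (esym N j) * (- t) ^ j) = (\<Prod>m=1..N. 1 - t / of_nat m ^ 2)" for N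
      using esym_sums[of N "- t"] by (simp add: sums_iff)
    moreover have "suminf (\<lambda>j. of_real (E j) * (- t) ^ j) = eval_fps f t"
      by (simp add: eval_fps_def f_def power_minus[of t] mult.assoc)
    ultimately show ?thesis by simp
  qed
  have sing: "(\<lambda>j. g $ j * (z ^ 2) ^ j * (of_real pi * z)) sums sin (of_real pi * z)" for z
  proof -
    let ?h = "\<lambda>n. sin_coeff n *\<^sub>R (of_real pi * z) ^ n"
    have "(\<lambda>j. ?h (2 * j + 1)) sums sin (of_real pi * z) \<longleftrightarrow> ?h sums sin (of_real pi * z)"
    proof (rule sums_mono_reindex)
      show "strict_mono (\<lambda>j. 2 * j + 1 :: nat)" by (auto simp: strict_mono_def)
      show "?h n = 0" if "n \<notin> range (\<lambda>j. 2 * j + 1)" for n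
      proof -
        have "even n" using that by (metis oddE rangeI)
        then show ?thesis by (simp add: sin_coeff_def)
      qed
    qed
    then have "(\<lambda>j. ?h (2 * j + 1)) sums sin (of_real pi * z)" using sin_converges by blast
    moreover have "?h (2 * j + 1) = g $ j * (z ^ 2) ^ j * (of_real pi * z)" for j
      by (simp add: sin_coeff_def g_def power_mult_distrib power_mult scaleR_conv_of_real power_add del: fact_Suc)
    ultimately show ?thesis by simp
  qed
  have sumg: "summable (\<lambda>j. g $ j * t ^ j)" for t
  proof (cases "t = 0")
    case False
    define c where "c = of_real pi * csqrt t"
    have "summable (\<lambda>j. g $ j * t ^ j * c)"
      using sums_summable[OF sing[of "csqrt t"]] by (simp add: c_def)
    from summable_mult2[OF this, of "inverse c"] have "summable (\<lambda>j. g $ j * t ^ j * (c * inverse c))"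
      by (simp only: mult.assoc)
    moreover have "c \<noteq> 0" using False by (simp add: c_def)
    ultimately show ?thesis by simp
  qed simp
  have "f = g"
  proof (rule eval_fps_eqD)
    have "fps_conv_radius f = \<infinity>" "fps_conv_radius g = \<infinity>"
      unfolding fps_conv_radius_def by (rule conv_radius_inftyI'', use sumf sumg in simp)+
    then show "fps_conv_radius f > 0" "fps_conv_radius g > 0" by simp_all
    have "eval_fps f t = eval_fps g t" for t
    proof (cases "t = 0")
      case True
      have "(\<lambda>N. esym N 0) = (\<lambda>_. 1)"
      proof
        fix N show "esym N 0 = 1" by (induction N) (simp_all add: esym_0 esym_Suc)
      qed
      then have "E 0 = 1" using E[of 0] LIMSEQ_unique tendsto_const by metis
      then show ?thesis by (simp add: True eval_fps_at_0 f_def g_def)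
    next
      case False
      define z where "z = csqrt t"
      have z: "z ^ 2 = t" "z \<noteq> 0" using False by (auto simp: z_def)
      have "(\<lambda>N. of_real pi * z * (\<Prod>m=1..N. 1 - z ^ 2 / of_nat m ^ 2)) \<longlonglongrightarrow> of_real pi * z * eval_fps f t"
        unfolding z by (intro tendsto_mult tendsto_const prod_f)
      then have "of_real pi * z * eval_fps f t = sin (of_real pi * z)"
        using sin_product_formula_complex[of z] LIMSEQ_unique by blast
      moreover have "eval_fps g t * (of_real pi * z) = sin (of_real pi * z)"
      proof -
        have "(\<lambda>j. g $ j * t ^ j) sums eval_fps g t" unfolding eval_fps_def using sumg by (rule summable_sums)
        from sums_mult2[OF this, of "of_real pi * z"] show ?thesis
          using sing[of z] unfolding z by (rule sums_unique2)
      qed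
      ultimately have "of_real pi * z * eval_fps f t = of_real pi * z * eval_fps g t" by (simp add: mult.commute)
      then show ?thesis using z by simp
    qed
    then show "eventually (\<lambda>z. eval_fps f z = eval_fps g z) (nhds 0)" by simp
  qed
  then have "f $ j = g $ j" by simp
  then have "of_real (E j) = (of_real (pi ^ (2 * j) / fact (2 * j + 1)) :: complex)"
    unfolding f_def g_def by (cases "even j") simp_all
  then have "E j = pi ^ (2 * j) / fact (2 * j + 1)" by (simp only: of_real_eq_iff)
  then show ?thesis using E[of j] by simp
qed

text \<open>The Taylor series of \<open>sin (\<pi> u X) / (\<pi> u X)\<close>.\<close>

definition sinc_fps :: "real \<Rightarrow> real fps" where
  "sinc_fps u = Abs_fps (\<lambda>n. if even n then (- (u ^ 2)) ^ (n div 2) * (pi ^ n / fact (n + 1)) else 0)"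

definition sinc_prod :: "real \<Rightarrow> nat \<Rightarrow> real fps" where
  "sinc_prod u N = (\<Prod>m=1..N. 1 - fps_const (u ^ 2 / real m ^ 2) * fps_X ^ 2)"

lemma sinc_prod_nth: "sinc_prod u N $ n = (if even n then (- (u ^ 2)) ^ (n div 2) * esym N (n div 2) else 0)"
proof (induction N arbitrary: n)
  case 0
  have "n div 2 = 0 \<Longrightarrow> n > 0 \<Longrightarrow> odd n" by presburger
  then show ?case by (auto simp: sinc_prod_def esym_0)
next
  case (Suc N)
  have "sinc_prod u (Suc N) = sinc_prod u N - fps_const (u ^ 2 / real (Suc N) ^ 2) * (fps_X ^ 2 * sinc_prod u N)"
    by (simp add: sinc_prod_def algebra_simps del: of_nat_Suc)
  then have eq: "sinc_prod u (Suc N) $ n = sinc_prod u N $ n - u ^ 2 / real (Suc N) ^ 2 * (if n < 2 then 0 else sinc_prod u N $ (n - 2))"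
    by (simp add: fps_X_power_mult_nth del: of_nat_Suc)
  consider "n = 0" | "n = 1" | k where "n = Suc (Suc k)" by (metis One_nat_def not0_implies_Suc)
  then show ?case
    unfolding eq by cases (simp_all add: Suc esym_Suc algebra_simps del: of_nat_Suc)
qed

lemma sinc_prod_tendsto: "fps_tendsto (sinc_prod u) (sinc_fps u)"
  unfolding fps_tendsto_def
proof
  fix n
  show "(\<lambda>N. sinc_prod u N $ n) \<longlonglongrightarrow> sinc_fps u $ n"
  proof (cases "even n")
    case True
    then obtain b where n: "n = 2 * b" by (elim evenE)
    have "(\<lambda>N. (- (u ^ 2)) ^ b * esym N b) \<longlonglongrightarrow> (- (u ^ 2)) ^ b * (pi ^ (2 * b) / fact (2 * b + 1))"
      by (intro tendsto_mult tendsto_const esym_tendsto)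
    then show ?thesis by (simp add: n sinc_prod_nth sinc_fps_def del: fact_Suc)
  qed (simp add: sinc_prod_nth sinc_fps_def)
qed

lemma mzv_single: "k \<ge> 2 \<Longrightarrow> mzv [k] = zeta_nat k"
proof -
  assume k: "k \<ge> 2"
  have "admissible [k]" using k by (simp add: admissible_def is_index_def)
  from mzv_tail[OF this, of 0] have "(\<lambda>N. hsum N [k]) \<longlonglongrightarrow> mzv [k]" by (simp add: LIM_zero_iff)
  moreover have "hsum N [k] = (\<Sum>i=1..N. 1 / real i ^ k)" for N
  proof (induction N)
    case (Suc N)
    then show ?case using hsum_Suc[of N "[]" k] by (simp add: hsum_Nil del: of_nat_Suc)
  qed (simp add: hsum_0)
  ultimately show ?thesis using zeta_nat_tendsto[OF k] LIMSEQ_unique by auto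
qed

abbreviation zeta2_ideal :: "real set" where "zeta2_ideal \<equiv> (\<lambda>z. mzv [2] * z) ` mzv_algebra"

lemma zeta_nat_in: "k \<ge> 2 \<Longrightarrow> zeta_nat k \<in> mzv_algebra"
  using mzv_algebra.mzv[of "[k]"] mzv_single[of k] by (simp add: admissible_def is_index_def)

interpretation mz: coefficient_ideal mzv_algebra zeta2_ideal
proof
  show "0 \<in> zeta2_ideal" using mzv_algebra_01 by force
  show "x + y \<in> zeta2_ideal" if "x \<in> zeta2_ideal" "y \<in> zeta2_ideal" for x y
    using that by (auto simp: distrib_left[symmetric] intro!: imageI mzv_algebra.add)
  show "x * y \<in> zeta2_ideal" if "x \<in> mzv_algebra" "y \<in> zeta2_ideal" for x y
    using that by (auto simp: mult.left_commute[of x] intro!: imageI mzv_algebra.mult)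
  show "x \<in> mzv_algebra" if "x \<in> zeta2_ideal" for x
    using that zeta_nat_in[of 2] mzv_single[of 2] by (auto intro: mzv_algebra.mult)
qed (auto intro: mzv_algebra_01 mzv_algebra.add mzv_algebra.mult mzv_algebra_uminus)

lemma pi_squared: "pi ^ 2 = 6 * mzv [2]"
proof -
  have "zeta_nat 2 = pi ^ 2 / 6"
    using inverse_squares_sums unfolding zeta_nat_def by (simp add: sums_iff add.commute)
  then show ?thesis using mzv_single[of 2] by simp
qed

lemma sinc_coeff: "sinc_fps (of_rat u) $ (2 * j) = of_rat ((- (u ^ 2) * 6) ^ j / fact (2 * j + 1)) * mzv [2] ^ j"
proof -
  have "pi ^ (2 * j) = 6 ^ j * mzv [2] ^ j"
    by (simp add: power_mult pi_squared power_mult_distrib)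
  moreover have "of_rat (fact n) = (fact n :: real)" for n
    by (metis of_nat_fact of_rat_of_nat_eq)
  then have "of_rat ((- (u ^ 2) * 6) ^ j / fact (2 * j + 1)) = (- (of_rat u ^ 2) * 6) ^ j / (fact (2 * j + 1) :: real)"
    by (simp only: of_rat_divide of_rat_power of_rat_mult of_rat_minus of_rat_numeral_eq)
  moreover have "(- (of_rat u ^ 2) * 6) ^ j = (- (of_rat u ^ 2)) ^ j * (6 :: real) ^ j"
    by (rule power_mult_distrib)
  moreover have "sinc_fps (of_rat u) $ (2 * j) = (- (of_rat u ^ 2)) ^ j * (pi ^ (2 * j) / fact (2 * j + 1))"
    by (simp add: sinc_fps_def del: fact_Suc)
  ultimately show ?thesis by (simp del: fact_Suc)
qed

lemma mzv2_power_in: "mzv [2] ^ j \<in> mzv_algebra"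
  using zeta_nat_in[of 2] mzv_single[of 2] by (intro mz.R_power) auto

lemma sinc_R: "mz.fps_R D (sinc_fps (of_rat u))"
  unfolding mz.fps_R_def
proof (intro allI impI)
  fix n
  show "sinc_fps (of_rat u) $ n \<in> mzv_algebra"
  proof (cases "even n")
    case True
    then obtain j where "n = 2 * j" by (elim evenE)
    then show ?thesis unfolding \<open>n = 2 * j\<close> sinc_coeff by (intro mzv_algebra.mult mzv_algebra.rat mzv2_power_in)
  qed (simp add: sinc_fps_def mzv_algebra_01)
qed

lemma sinc_I: "n > 0 \<Longrightarrow> sinc_fps (of_rat u) $ n \<in> zeta2_ideal"
proof (cases "even n")
  case True
  assume "n > 0"
  then obtain j where j: "n = 2 * Suc j" using True by (metis evenE gr0_implies_Suc nat_0_less_mult_iff)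
  have "sinc_fps (of_rat u) $ n = mzv [2] * (of_rat ((- (u ^ 2) * 6) ^ Suc j / fact (2 * Suc j + 1)) * mzv [2] ^ j)"
    unfolding j sinc_coeff by (simp only: power_Suc mult_ac)
  moreover have "of_rat ((- (u ^ 2) * 6) ^ Suc j / fact (2 * Suc j + 1)) * mzv [2] ^ j \<in> mzv_algebra"
    by (intro mzv_algebra.mult mzv_algebra.rat mzv2_power_in)
  ultimately show ?thesis by blast
qed (simp add: sinc_fps_def mz.I0)

lemma sinc_0: "sinc_fps u $ 0 = 1"
  by (simp add: sinc_fps_def)

text \<open>The coefficient of \<open>X ^ (2 * j)\<close> is a rational multiple of \<open>\<pi> ^ (2 * j)\<close>, hence of \<open>\<zeta>(2) ^ j\<close>.\<close>

lemma sinc_quot_I: "mz.fps_I D (sinc_fps (of_rat u) * inverse (sinc_fps (of_rat v)) - 1)"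
proof -
  have "mz.fps_I D (sinc_fps (of_rat u) - sinc_fps (of_rat v))"
    unfolding mz.fps_I_def
  proof (intro allI impI)
    fix l show "(sinc_fps (of_rat u) - sinc_fps (of_rat v)) $ l \<in> zeta2_ideal"
      by (cases "l = 0") (auto simp: sinc_0 mz.I0 intro!: mz.I_diff sinc_I)
  qed
  then have "mz.fps_I D ((sinc_fps (of_rat u) - sinc_fps (of_rat v)) * inverse (sinc_fps (of_rat v)))"
    by (intro mz.fps_I_mult_right mz.fps_R_inverse sinc_R sinc_0)
  moreover have "sinc_fps (of_rat v) * inverse (sinc_fps (of_rat v)) = 1"
    by (subst mult.commute, rule inverse_mult_eq_1) (simp add: sinc_0)
  ultimately show ?thesis by (simp add: left_diff_distrib)
qed

text \<open>Euler's evaluation in the form needed: the logarithmic derivative of the sine product has the even zeta values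
as coefficients, and it is the quotient of a series with all coefficients in the ideal by one with constant term 1.\<close>

lemma even_zeta: assumes "even k" "k \<ge> 2" shows "zeta_nat k \<in> zeta2_ideal"
proof -
  \<comment> \<open>The logarithmic derivative of \<open>1 - X\<^sup>2 / m\<^sup>2\<close>.\<close>
  define G where "G m = Abs_fps (\<lambda>n. if odd n then - 2 / real m ^ (n + 1) else 0)" for m
  define L where "L = Abs_fps (\<lambda>n. if odd n then - 2 * zeta_nat (n + 1) else 0)"
  have G: "(1 - fps_const (1 / real m ^ 2) * fps_X ^ 2) * G m = - fps_const (2 / real m ^ 2) * fps_X" if "m \<ge> 1" for m
  proof (rule fps_ext)
    fix n
    have eq: "((1 - fps_const (1 / real m ^ 2) * fps_X ^ 2) * G m) $ n = G m $ n - 1 / real m ^ 2 * (if n < 2 then 0 else G m $ (n - 2))"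
      by (simp add: left_diff_distrib mult.assoc fps_X_power_mult_nth)
    consider "n = 0" | "n = 1" | k where "n = Suc (Suc k)" by (metis One_nat_def not0_implies_Suc)
    then show "((1 - fps_const (1 / real m ^ 2) * fps_X ^ 2) * G m) $ n = (- fps_const (2 / real m ^ 2) * fps_X) $ n"
      unfolding eq using that by cases (auto simp: G_def power2_eq_square)
  qed
  have deriv: "fps_deriv (sinc_prod 1 N) = sinc_prod 1 N * (\<Sum>m=1..N. G m)" for N
  proof (induction N)
    case (Suc N)
    let ?q = "1 - fps_const (1 / real (Suc N) ^ 2) * fps_X ^ 2"
    have S: "sinc_prod 1 (Suc N) = ?q * sinc_prod 1 N"
      by (simp add: sinc_prod_def mult.commute del: of_nat_Suc)
    have "fps_deriv ?q = - fps_const (2 / real (Suc N) ^ 2) * fps_X"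
      by (simp add: fps_deriv_power' numeral_fps_const del: of_nat_Suc)
    also have "\<dots> = ?q * G (Suc N)" using G[of "Suc N"] by simp
    finally have d: "fps_deriv ?q = ?q * G (Suc N)" .
    show ?case
      unfolding S fps_deriv_mult d Suc by (simp add: algebra_simps)
  qed (simp add: sinc_prod_def)
  have "fps_tendsto (\<lambda>N. \<Sum>m=1..N. G m) L"
    unfolding fps_tendsto_def
  proof
    fix n
    have "(\<lambda>N. - 2 * (\<Sum>m=1..N. 1 / real m ^ (n + 1))) \<longlonglongrightarrow> - 2 * zeta_nat (n + 1)" if "odd n"
      using that by (intro tendsto_mult tendsto_const zeta_nat_tendsto) (auto elim!: oddE)
    then show "(\<lambda>N. (\<Sum>m=1..N. G m) $ n) \<longlonglongrightarrow> L $ n"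
      by (cases "odd n") (simp_all add: fps_sum_nth G_def L_def sum_distrib_left del: power_Suc)
  qed
  then have "fps_tendsto (\<lambda>N. fps_deriv (sinc_prod 1 N)) (sinc_fps 1 * L)"
    unfolding deriv by (intro fps_tendsto_mult sinc_prod_tendsto)
  moreover have "fps_tendsto (\<lambda>N. fps_deriv (sinc_prod 1 N)) (fps_deriv (sinc_fps 1))"
    using sinc_prod_tendsto[of 1] by (auto simp: fps_tendsto_def intro!: tendsto_mult tendsto_const)
  ultimately have "sinc_fps 1 * L = fps_deriv (sinc_fps 1)"
    by (intro fps_ext) (auto simp: fps_tendsto_def intro: LIMSEQ_unique)
  then have "inverse (sinc_fps 1) * sinc_fps 1 * L = inverse (sinc_fps 1) * fps_deriv (sinc_fps 1)"
    by (simp add: mult.assoc)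
  moreover have "inverse (sinc_fps 1) * sinc_fps 1 = 1" by (rule inverse_mult_eq_1) (simp add: sinc_0)
  ultimately have L: "L = inverse (sinc_fps (of_rat 1)) * fps_deriv (sinc_fps (of_rat 1))" by simp
  have "mz.fps_I k L"
    unfolding L
  proof (intro mz.fps_I_mult mz.fps_R_inverse sinc_R sinc_0)
    show "mz.fps_I k (fps_deriv (sinc_fps (of_rat 1)))"
      unfolding mz.fps_I_def fps_deriv_nth
    proof (intro allI impI mz.I_mult sinc_I)
      fix n show "of_nat n \<in> mzv_algebra" for n using mzv_algebra.rat[of "of_nat n"] by simp
    qed simp
  qed
  then have "L $ (k - 1) \<in> zeta2_ideal" using assms by (simp add: mz.fps_I_def)
  then have "- 2 * zeta_nat k \<in> zeta2_ideal" using assms by (simp add: L_def)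
  moreover have "(-1/2::real) \<in> mzv_algebra"
    using mzv_algebra.rat[of "-1/2"] by (simp add: of_rat_divide of_rat_minus)
  ultimately have "(-1/2) * (- 2 * zeta_nat k) \<in> zeta2_ideal" by (rule mz.I_mult[rotated])
  then show ?thesis by simp
qed

section \<open>Marked generating functions of symmetric sums\<close>

lemma marked_gf_append:
  fixes M :: "'a::field_char_0 list"
  assumes "0 \<notin> set M" "0 \<notin> set M'"
  shows "marked_gf y z w (M @ M') = marked_gf y z w M * prod_list (map (lin_quot (- 1 + z / 2) (- 1 - z / 2)) M')
     + prod_list (map (lin_quot (- 1 + y / 2) (- 1 - y / 2)) M) * marked_gf y z w M'"
  using assms by (simp add: marked_gf_eq transfer_sum_append)

lemma prod_pos_list: "prod_list (map f (pos_list N)) = (\<Prod>m=1..N. f (of_nat m :: 'a::field_char_0) :: 'b::comm_monoid_mult)"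
  by (induction N) (simp_all add: pos_list_Suc, simp add: pos_list_def)

lemma prod_neg_list: "prod_list (map f (neg_list N)) = (\<Prod>m=1..N. f (- of_nat m :: 'a::field_char_0) :: 'b::comm_monoid_mult)"
proof -
  have "prod_list (map f (neg_list N)) = prod_list (rev (map (\<lambda>m. f (- m)) (pos_list N)))"
    by (simp add: neg_list_def rev_map comp_def)
  then show ?thesis unfolding prod_list_rev prod_pos_list .
qed

text \<open>Pairing \<open>m\<close> with \<open>-m\<close> makes the product even in \<open>X\<close>, a quotient of factors of the sine product.\<close>

lemma lin_quot_symmetric:
  fixes m :: real
  assumes "m \<noteq> 0"
  shows "lin_quot u v m * lin_quot u v (- m) = (1 - fps_const (u ^ 2 / m ^ 2) * fps_X ^ 2) * inverse (1 - fps_const (v ^ 2 / m ^ 2) * fps_X ^ 2)"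
proof -
  have q: "lin m u * lin m (- u) = fps_const (m ^ 2) * (1 - fps_const (u ^ 2 / m ^ 2) * fps_X ^ 2)" for u
  proof (rule fps_ext)
    fix n
    consider "n = 0" | "n = 1" | k where "n = Suc (Suc k)" by (metis One_nat_def not0_implies_Suc)
    then show "(lin m u * lin m (- u)) $ n = (fps_const (m ^ 2) * (1 - fps_const (u ^ 2 / m ^ 2) * fps_X ^ 2)) $ n"
      using assms by cases (auto simp: lin_mult_nth lin_nth fps_X_power_nth power2_eq_square)
  qed
  have "lin_quot u v m * lin_quot u v (- m) = (lin m u * lin m (- u)) * inverse (lin m v * lin m (- v))"
    unfolding lin_quot_uminus unfolding lin_quot_def fps_inverse_mult by (simp only: mult_ac minus_minus)
  also have "\<dots> = (1 - fps_const (u ^ 2 / m ^ 2) * fps_X ^ 2) * inverse (1 - fps_const (v ^ 2 / m ^ 2) * fps_X ^ 2) * (fps_const (m ^ 2) * inverse (fps_const (m ^ 2)))"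
    unfolding q fps_inverse_mult by (simp only: mult_ac)
  also have "fps_const (m ^ 2) * inverse (fps_const (m ^ 2)) = 1"
    using assms by (simp add: fps_const_inverse)
  finally show ?thesis by simp
qed

lemma prod_symmetric_list:
  "prod_list (map (lin_quot u v) (pos_list N)) * prod_list (map (lin_quot u v) (neg_list N))
     = sinc_prod u N * inverse (sinc_prod v N)"
  unfolding prod_pos_list prod_neg_list sinc_prod_def inverse_prod_fps prod.distrib[symmetric]
  by (intro prod.cong refl lin_quot_symmetric) auto

lemma sinc_quot_tendsto:
  "fps_tendsto (\<lambda>N. sinc_prod u N * inverse (sinc_prod v N)) (sinc_fps u * inverse (sinc_fps v))"
proof -
  have "esym N 0 = 1" for N
    by (induction N) (simp_all add: esym_0 esym_Suc)
  then show ?thesis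
    by (intro fps_tendsto_mult fps_tendsto_inverse sinc_prod_tendsto) (simp_all add: sinc_prod_nth sinc_0)
qed

text \<open>For odd \<open>k\<close>, with \<open>K = k - 1\<close>, \<open>a = y / 2\<close> and \<open>b = z / 2\<close>, half of this is the coefficient of \<open>\<zeta>(k)\<close> in the
contribution of the positive numbers.\<close>

definition bracket :: "'a::field \<Rightarrow> 'a \<Rightarrow> nat \<Rightarrow> 'a" where
  "bracket a b K = (2 ^ K + (a - b) ^ K - (1 + a) ^ K - (1 - b) ^ K) / ((1 - a) * (1 + b))"

text \<open>The two terms are the contributions of the positive and of the negative numbers.\<close>

definition kappa_main :: "'a::field \<Rightarrow> 'a \<Rightarrow> nat \<Rightarrow> 'a" where
  "kappa_main a b k = (bracket a b (k - 1) - bracket (- a) (- b) (k - 1)) / 2"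

definition kappa_sum :: "'a::field \<Rightarrow> nat \<Rightarrow> 'a" where
  "kappa_sum a k = ((1 + a) ^ (k - 1) - (2 * a) ^ (k - 1)) / (1 - a) + ((2 * a) ^ (k - 1) - (1 - a) ^ (k - 1)) / (1 + a)"

lemma psi_series_R: "(\<And>l. p l \<in> mzv_algebra) \<Longrightarrow> mz.fps_R D (psi_series p)"
  unfolding mz.fps_R_def psi_series_def
proof (intro allI impI)
  fix l assume p: "\<And>l. p l \<in> mzv_algebra"
  have "(- 1 :: real) ^ l \<in> mzv_algebra" using mzv_algebra.rat[of "(-1) ^ l"] by (simp add: of_rat_power)
  then show "Abs_fps (\<lambda>l. if l = 0 then 0 else (- 1) ^ l * p l * zeta_nat (Suc l)) $ l \<in> mzv_algebra"
    using p zeta_nat_in[of "Suc l"] by (auto intro!: mzv_algebra.mult mzv_algebra_01)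
qed

lemma of_rat_in: "of_rat q \<in> mzv_algebra" by (rule mzv_algebra.rat)

text \<open>The ranges of \<open>y\<close> and \<open>z\<close> keep \<open>a = y / 2\<close> and \<open>b = z / 2\<close> distinct and away from 1, so that no denominator and no
excess parameter \<open>a - c - d\<close> of the hypergeometric sums vanishes. Comparing coefficients later needs
only infinitely many values of each.\<close>

lemma symmetric_main_limit:
  fixes y z :: rat
  assumes yz: "0 < y" "y < 1/2" "1/2 < z" "z < 1" and k: "k \<ge> 2"
  shows "\<exists>L. (\<lambda>N. marked_gf (of_rat y) (of_rat z) w_main (pos_list N @ neg_list N) $ k) \<longlonglongrightarrow> L
     \<and> L - (if odd k then of_rat (kappa_main (y / 2) (z / 2) k) * zeta_nat k else 0) \<in> zeta2_ideal"
proof -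
  define ar br where "ar = y / 2" and "br = z / 2"
  define a b :: real where "a = of_rat ar" and "b = of_rat br"
  have ab0: "0 < ar" "ar < 1/4" "1/4 < br" "br < 1/2" using yz by (simp_all add: ar_def br_def)
  have ab: "0 < a" "a < 1/4" "1/4 < b" "b < 1/2"
  proof -
    have "of_rat (1/4) = (1/4 :: real)" "of_rat (1/2) = (1/2::real)" by (simp_all add: of_rat_divide)
    then show "0 < a" "a < 1/4" "1/4 < b" "b < 1/2"
      using ab0 of_rat_less[of 0 ar, where 'a = real] of_rat_less[of ar "1/4", where 'a = real]
        of_rat_less[of "1/4" br, where 'a = real] of_rat_less[of br "1/2", where 'a = real]
      by (simp_all add: a_def b_def)
  qed
  have y2: "of_rat y / 2 = a" "of_rat z / 2 = b" by (simp_all add: a_def b_def ar_def br_def of_rat_divide)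
  let ?y = "of_rat y :: real" and ?z = "of_rat z :: real"
  define P where "P u v N = sinc_prod u N * inverse (sinc_prod v N)" for u v N
  define U where "U u v = sinc_fps u * inverse (sinc_fps v)" for u v
  have PU: "fps_tendsto (P u v) (U u v)" for u v
    unfolding P_def U_def by (rule sinc_quot_tendsto)
  define p1 where "p1 l = (-2) ^ l + (b - a) ^ l - (- 1 - a) ^ l - (b - 1) ^ l" for l
  define p2 where "p2 l = 2 ^ l + (b - a) ^ l - (1 - a) ^ l - (1 + b) ^ l" for l
  define c1 where "c1 = 2 * ((a - 1) * (- 1 - b))"
  define c2 where "c2 = 2 * ((1 + a) * (1 - b))"
  have c: "c1 \<noteq> 0" "c2 \<noteq> 0" using ab by (simp_all add: c1_def c2_def)
  have t1: "fps_tendsto (\<lambda>N. \<Sum>n=1..N. wp_fps (scaled_X (-2)) (scaled_X (a - 1)) (scaled_X (- 1 - b)) n) (psi_series p1)"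
  proof -
    have e: "- 2 - (a - 1) - (- 1 - b) = b - a" "- 2 - (a - 1) = - 1 - a" "- 2 - (- 1 - b) = b - 1" by simp_all
    show ?thesis unfolding p1_def e[symmetric]
      by (rule wp_sum_tendsto) (use ab in \<open>simp_all add: abs_if\<close>)
  qed
  have t2: "fps_tendsto (\<lambda>N. \<Sum>n=1..N. wp_fps (scaled_X 2) (scaled_X (1 + a)) (scaled_X (1 - b)) n) (psi_series p2)"
  proof -
    have e: "2 - (1 + a) - (1 - b) = b - a" "2 - (1 + a) = 1 - a" "2 - (1 - b) = 1 + b" by simp_all
    show ?thesis unfolding p2_def e[symmetric]
      by (rule wp_sum_tendsto) (use ab in \<open>simp_all add: abs_if\<close>)
  qed
  define F where "F = fps_const (1 / c1) * (U (- 1 + b) (- 1 - b) * (fps_X * psi_series p1)) - fps_const (1 / c2) * (U (- 1 + a) (- 1 - a) * (fps_X * psi_series p2))"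
  have eq: "marked_gf ?y ?z w_main (pos_list N @ neg_list N)
     = fps_const (1 / c1) * (P (- 1 + b) (- 1 - b) N * (fps_X * (\<Sum>n=1..N. wp_fps (scaled_X (-2)) (scaled_X (a - 1)) (scaled_X (- 1 - b)) n)))
     - fps_const (1 / c2) * (P (- 1 + a) (- 1 - a) N * (fps_X * (\<Sum>n=1..N. wp_fps (scaled_X 2) (scaled_X (1 + a)) (scaled_X (1 - b)) n)))" for N
  proof -
    let ?T1 = "fps_X * (\<Sum>n=1..N. wp_fps (scaled_X (-2)) (scaled_X (a - 1)) (scaled_X (- 1 - b)) n)"
    let ?T2 = "fps_X * (\<Sum>n=1..N. wp_fps (scaled_X 2) (scaled_X (1 + a)) (scaled_X (1 - b)) n)"
    let ?A = "prod_list (map (lin_quot (- 1 + a) (- 1 - a)) (pos_list N))" and ?A' = "prod_list (map (lin_quot (- 1 + a) (- 1 - a)) (neg_list N))"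
    let ?B = "prod_list (map (lin_quot (- 1 + b) (- 1 - b)) (pos_list N))" and ?B' = "prod_list (map (lin_quot (- 1 + b) (- 1 - b)) (neg_list N))"
    have div: "f = fps_const (1 / c) * g" if "fps_const c * f = g" "c \<noteq> 0" for c and f g :: "real fps"
      using that by (simp add: fps_eq_iff) (metis mult.commute nonzero_mult_div_cancel_left)
    have m1: "marked_gf ?y ?z w_main (pos_list N) = fps_const (1 / c1) * (?B * ?T1)"
      using marked_main_pos[of ?y ?z N, unfolded y2] by (intro div c) (simp add: c1_def)
    have m2: "marked_gf ?y ?z w_main (neg_list N) = fps_const (1 / c2) * (- ?A' * ?T2)"
      using marked_main_neg[of ?y ?z N, unfolded y2] by (intro div c) (simp add: c2_def)
    show ?thesis
      unfolding marked_gf_append[OF pos_list_nz neg_list_nz] m1 m2 y2 P_def prod_symmetric_list[symmetric]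
      by (simp add: mult_ac)
  qed
  have "fps_tendsto (\<lambda>N. marked_gf ?y ?z w_main (pos_list N @ neg_list N)) F"
    unfolding eq F_def by (intro fps_tendsto_diff fps_tendsto_mult fps_tendsto_const PU t1 t2)
  then have lim: "(\<lambda>N. marked_gf ?y ?z w_main (pos_list N @ neg_list N) $ k) \<longlonglongrightarrow> F $ k"
    by (simp add: fps_tendsto_def)
  have rat: "1 / c1 = of_rat (1 / (2 * ((ar - 1) * (- 1 - br))))" "1 / c2 = of_rat (1 / (2 * ((1 + ar) * (1 - br))))"
    by (simp_all add: c1_def c2_def a_def b_def of_rat_divide of_rat_mult of_rat_add of_rat_diff of_rat_minus)
  have pr: "p1 l \<in> mzv_algebra" "p2 l \<in> mzv_algebra" for l
    using of_rat_in[of "(-2) ^ l + (br - ar) ^ l - (- 1 - ar) ^ l - (br - 1) ^ l"] of_rat_in[of "2 ^ l + (br - ar) ^ l - (1 - ar) ^ l - (1 + br) ^ l"]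
    by (simp_all add: p1_def p2_def a_def b_def of_rat_add of_rat_diff of_rat_minus of_rat_power)
  have UI: "mz.fps_I D (U (- 1 + b) (- 1 - b) - 1)" "mz.fps_I D (U (- 1 + a) (- 1 - a) - 1)" for D
    using sinc_quot_I[of D "- 1 + br" "- 1 - br"] sinc_quot_I[of D "- 1 + ar" "- 1 - ar"]
    by (simp_all add: U_def a_def b_def of_rat_add of_rat_diff of_rat_minus)
  define F0 where "F0 = fps_const (1 / c1) * (fps_X * psi_series p1) - fps_const (1 / c2) * (fps_X * psi_series p2)"
  have "F - F0 = fps_const (1 / c1) * ((U (- 1 + b) (- 1 - b) - 1) * (fps_X * psi_series p1)) - fps_const (1 / c2) * ((U (- 1 + a) (- 1 - a) - 1) * (fps_X * psi_series p2))"
    unfolding F_def F0_def by (simp add: algebra_simps)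
  moreover have "mz.fps_I (Suc k) \<dots>"
    by (intro mz.fps_I_diff mz.fps_I_mult mz.fps_I_mult_right UI mz.fps_R_mult mz.fps_R_X psi_series_R pr mz.fps_R_const)
       (simp_all add: rat of_rat_in)
  ultimately have "(F - F0) $ k \<in> zeta2_ideal" by (simp add: mz.fps_I_def)
  then have FF0: "F $ k - F0 $ k \<in> zeta2_ideal" by simp
  have F0k: "F0 $ k = (- 1) ^ (k - 1) * (p1 (k - 1) / c1 - p2 (k - 1) / c2) * zeta_nat k"
  proof -
    have "k - 1 \<noteq> 0" "Suc (k - 1) = k" using k by auto
    then show ?thesis unfolding F0_def by (simp add: psi_series_def algebra_simps)
  qed
  have "F0 $ k - (if odd k then of_rat (kappa_main ar br k) * zeta_nat k else 0) \<in> zeta2_ideal"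
  proof (cases "odd k")
    case True
    then have ev: "even (k - 1)" using k by simp
    have pw: "(-2) ^ (k - 1) = (2 :: real) ^ (k - 1)" "(- 1 - a) ^ (k - 1) = (1 + a) ^ (k - 1)" "(b - 1) ^ (k - 1) = (1 - b) ^ (k - 1)"
      "(b - a) ^ (k - 1) = (a - b) ^ (k - 1)" "(-1) ^ (k - 1) = (1 :: real)"
      using power_minus_even[OF ev, of "1 + a"] power_minus_even[OF ev, of "1 - b"] power_minus_even[OF ev, of "a - b"] ev
      by simp_all
    have pw2: "(- a - - b) ^ (k - 1) = (a - b) ^ (k - 1)"
      using pw(4) by simp
    have "(of_rat (kappa_main ar br k) :: real) = kappa_main a b k"
      by (simp add: kappa_main_def bracket_def a_def b_def of_rat_divide of_rat_mult of_rat_add of_rat_diff of_rat_minus of_rat_power)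
    also have "kappa_main a b k = p1 (k - 1) / c1 - p2 (k - 1) / c2"
      unfolding kappa_main_def bracket_def p1_def p2_def pw pw2 c1_def c2_def using ab
      by (simp add: diff_divide_distrib mult_ac) (simp add: divide_simps; simp add: algebra_simps)
    finally show ?thesis unfolding F0k pw using True mz.I0 by simp
  next
    case False
    then have "zeta_nat k \<in> zeta2_ideal" using k by (intro even_zeta) auto
    moreover have "(- 1) ^ (k - 1) * (p1 (k - 1) / c1 - p2 (k - 1) / c2) \<in> mzv_algebra"
    proof -
      have "p1 (k - 1) * (1 / c1) - p2 (k - 1) * (1 / c2) \<in> mzv_algebra"
        unfolding rat by (intro mz.R_diff mzv_algebra.mult pr of_rat_in)
      moreover have "(- 1 :: real) ^ (k - 1) \<in> mzv_algebra" using of_rat_in[of "(-1) ^ (k - 1)"] by (simp add: of_rat_power)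
      ultimately show ?thesis using mzv_algebra.mult by simp
    qed
    ultimately show ?thesis unfolding F0k using False by (simp add: mz.I_mult)
  qed
  from mz.I_add[OF FF0 this] have "F $ k - (if odd k then of_rat (kappa_main ar br k) * zeta_nat k else 0) \<in> zeta2_ideal"
    by (simp only: add_diff_eq diff_add_cancel)
  with lim show ?thesis unfolding ar_def br_def by blast
qed

lemma symmetric_sum_limit:
  fixes y :: rat
  assumes yz: "0 < y" "y < 1/2" and k: "k \<ge> 2"
  shows "\<exists>L. (\<lambda>N. marked_gf (of_rat y) 0 w_sum (pos_list N @ neg_list N) $ k) \<longlonglongrightarrow> L
     \<and> L - (if odd k then of_rat (kappa_sum (y / 2) k) * zeta_nat k else 0) \<in> zeta2_ideal"
proof -
  define ar where "ar = y / 2"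
  define a :: real where "a = of_rat ar"
  have ab0: "0 < ar" "ar < 1/4" using yz by (simp_all add: ar_def)
  have ab: "0 < a" "a < 1/4"
  proof -
    have "of_rat (1/4) = (1/4 :: real)" by (simp add: of_rat_divide)
    then show "0 < a" "a < 1/4"
      using ab0 of_rat_less[of 0 ar, where 'a = real] of_rat_less[of ar "1/4", where 'a = real]
      by (simp_all add: a_def)
  qed
  have y2: "of_rat y / 2 = a" by (simp add: a_def ar_def of_rat_divide)
  let ?y = "of_rat y :: real"
  define P where "P u v N = sinc_prod u N * inverse (sinc_prod v N)" for u v N
  define U where "U u v = sinc_fps u * inverse (sinc_fps v)" for u v
  have PU: "fps_tendsto (P u v) (U u v)" for u v
    unfolding P_def U_def by (rule sinc_quot_tendsto)
  define p1 where "p1 l = (- 2 * a) ^ l - (- 1 - a) ^ l" for l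
  define p2 where "p2 l = (- 2 * a) ^ l - (1 - a) ^ l" for l
  define c1 where "c1 = a - 1"
  define c2 where "c2 = 1 + a"
  have c: "c1 \<noteq> 0" "c2 \<noteq> 0" using ab by (simp_all add: c1_def c2_def)
  have t1: "fps_tendsto (\<lambda>N. \<Sum>n=1..N. gauss_fps (scaled_X c1) (scaled_X (- 1 - a)) n) (psi_series p1)"
  proof -
    have e: "- 2 * a = - 1 - a - c1" by (simp add: c1_def)
    show ?thesis unfolding p1_def e
      by (rule gauss_sum_tendsto) (use ab in \<open>simp_all add: abs_if c1_def\<close>)
  qed
  have t2: "fps_tendsto (\<lambda>N. \<Sum>n=1..N. gauss_fps (scaled_X c2) (scaled_X (1 - a)) n) (psi_series p2)"
  proof -
    have e: "- 2 * a = 1 - a - c2" by (simp add: c2_def)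
    show ?thesis unfolding p2_def e
      by (rule gauss_sum_tendsto) (use ab in \<open>simp_all add: abs_if c2_def\<close>)
  qed
  define F where "F = fps_const (1 / c1) * (fps_X * psi_series p1) + fps_const (1 / c2) * (U (- 1 + a) (- 1 - a) * (fps_X * psi_series p2))"
  have eq: "marked_gf ?y 0 w_sum (pos_list N @ neg_list N)
     = fps_const (1 / c1) * (fps_X * (\<Sum>n=1..N. gauss_fps (scaled_X c1) (scaled_X (- 1 - a)) n))
     + fps_const (1 / c2) * (P (- 1 + a) (- 1 - a) N * (fps_X * (\<Sum>n=1..N. gauss_fps (scaled_X c2) (scaled_X (1 - a)) n)))" for N
  proof -
    let ?T1 = "fps_X * (\<Sum>n=1..N. gauss_fps (scaled_X c1) (scaled_X (- 1 - a)) n)"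
    let ?T2 = "fps_X * (\<Sum>n=1..N. gauss_fps (scaled_X c2) (scaled_X (1 - a)) n)"
    let ?A = "prod_list (map (lin_quot (- 1 + a) (- 1 - a)) (pos_list N))" and ?A' = "prod_list (map (lin_quot (- 1 + a) (- 1 - a)) (neg_list N))"
    have div: "f = fps_const (1 / c) * g" if "fps_const c * f = g" "c \<noteq> 0" for c and f g :: "real fps"
      using that by (simp add: fps_eq_iff) (metis mult.commute nonzero_mult_div_cancel_left)
    have m1: "marked_gf ?y 0 w_sum (pos_list N) = fps_const (1 / c1) * ?T1"
      using marked_sum_pos[of ?y N, unfolded y2] by (intro div c) (simp add: c1_def)
    have m2: "marked_gf ?y 0 w_sum (neg_list N) = fps_const (1 / c2) * (?A' * ?T2)"
      using marked_sum_neg[of ?y N, unfolded y2] by (intro div c) (simp add: c2_def)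
    have "prod_list (map (lin_quot (- 1 + 0 / 2) (- 1 - 0 / 2)) (neg_list N)) = (1 :: real fps)"
      unfolding prod_neg_list by (intro prod.neutral) (simp add: lin_quot_same)
    then show ?thesis
      unfolding marked_gf_append[OF pos_list_nz neg_list_nz] m1 m2 y2 P_def prod_symmetric_list[symmetric]
      by (simp add: mult_ac)
  qed
  have "fps_tendsto (\<lambda>N. marked_gf ?y 0 w_sum (pos_list N @ neg_list N)) F"
    unfolding eq F_def by (intro fps_tendsto_add fps_tendsto_mult fps_tendsto_const PU t1 t2)
  then have lim: "(\<lambda>N. marked_gf ?y 0 w_sum (pos_list N @ neg_list N) $ k) \<longlonglongrightarrow> F $ k"
    by (simp add: fps_tendsto_def)
  have rat: "1 / c1 = of_rat (1 / (ar - 1))" "1 / c2 = of_rat (1 / (1 + ar))"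
    by (simp_all add: c1_def c2_def a_def of_rat_divide of_rat_add of_rat_diff)
  have pr: "p1 l \<in> mzv_algebra" "p2 l \<in> mzv_algebra" for l
    using of_rat_in[of "(- 2 * ar) ^ l - (- 1 - ar) ^ l"] of_rat_in[of "(- 2 * ar) ^ l - (1 - ar) ^ l"]
    by (simp_all add: p1_def p2_def a_def of_rat_add of_rat_diff of_rat_minus of_rat_power of_rat_mult)
  have UI: "mz.fps_I D (U (- 1 + a) (- 1 - a) - 1)" for D
    using sinc_quot_I[of D "- 1 + ar" "- 1 - ar"]
    by (simp add: U_def a_def of_rat_add of_rat_diff of_rat_minus)
  define F0 where "F0 = fps_const (1 / c1) * (fps_X * psi_series p1) + fps_const (1 / c2) * (fps_X * psi_series p2)"
  have "F - F0 = fps_const (1 / c2) * ((U (- 1 + a) (- 1 - a) - 1) * (fps_X * psi_series p2))"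
    unfolding F_def F0_def by (simp add: algebra_simps)
  moreover have "mz.fps_I (Suc k) \<dots>"
    by (intro mz.fps_I_mult mz.fps_I_mult_right UI mz.fps_R_mult mz.fps_R_X psi_series_R pr mz.fps_R_const)
       (simp_all add: rat of_rat_in)
  ultimately have "(F - F0) $ k \<in> zeta2_ideal" by (simp add: mz.fps_I_def)
  then have FF0: "F $ k - F0 $ k \<in> zeta2_ideal" by simp
  have F0k: "F0 $ k = (- 1) ^ (k - 1) * (p1 (k - 1) / c1 + p2 (k - 1) / c2) * zeta_nat k"
  proof -
    have "k - 1 \<noteq> 0" "Suc (k - 1) = k" using k by auto
    then show ?thesis unfolding F0_def by (simp add: psi_series_def algebra_simps)
  qed
  have "F0 $ k - (if odd k then of_rat (kappa_sum ar k) * zeta_nat k else 0) \<in> zeta2_ideal"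
  proof (cases "odd k")
    case True
    then have ev: "even (k - 1)" using k by simp
    have pw: "(- 2 * a) ^ (k - 1) = (2 * a) ^ (k - 1)" "(- 1 - a) ^ (k - 1) = (1 + a) ^ (k - 1)" "(-1) ^ (k - 1) = (1 :: real)"
      using power_minus_even[OF ev, of "1 + a"] power_minus_even[OF ev, of "2 * a"] ev
      by simp_all
    have "(of_rat (kappa_sum ar k) :: real) = kappa_sum a k"
      by (simp add: kappa_sum_def a_def of_rat_divide of_rat_mult of_rat_add of_rat_diff of_rat_power)
    also have "kappa_sum a k = p1 (k - 1) / c1 + p2 (k - 1) / c2"
    proof -
      have "(u - v) / (1 - a) = (v - u) / (a - 1)" for u v :: real
        using ab by (simp add: divide_simps) (simp add: algebra_simps)
      then show ?thesis unfolding kappa_sum_def p1_def p2_def pw c1_def c2_def by simp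
    qed
    finally show ?thesis unfolding F0k pw using True mz.I0 by simp
  next
    case False
    then have "zeta_nat k \<in> zeta2_ideal" using k by (intro even_zeta) auto
    moreover have "(- 1) ^ (k - 1) * (p1 (k - 1) / c1 + p2 (k - 1) / c2) \<in> mzv_algebra"
    proof -
      have "p1 (k - 1) * (1 / c1) + p2 (k - 1) * (1 / c2) \<in> mzv_algebra"
        unfolding rat by (intro mzv_algebra.add mzv_algebra.mult pr of_rat_in)
      moreover have "(- 1 :: real) ^ (k - 1) \<in> mzv_algebra" using of_rat_in[of "(-1) ^ (k - 1)"] by (simp add: of_rat_power)
      ultimately show ?thesis using mzv_algebra.mult by simp
    qed
    ultimately show ?thesis unfolding F0k using False by (simp add: mz.I_mult)
  qed
  from mz.I_add[OF FF0 this] have "F $ k - (if odd k then of_rat (kappa_sum ar k) * zeta_nat k else 0) \<in> zeta2_ideal"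
    by (simp only: add_diff_eq diff_add_cancel)
  with lim show ?thesis unfolding ar_def by blast
qed

section \<open>Arithmetic modulo a prime\<close>

text \<open>The localization of the integers at \<open>p\<close>, as a subring of the rational numbers.\<close>

definition p_integral :: "nat \<Rightarrow> rat set" where
  "p_integral p = {of_int a / of_int b | a b. \<not> int p dvd b}"

definition p_ideal :: "nat \<Rightarrow> rat set" where
  "p_ideal p = (\<lambda>q. of_nat p * q) ` p_integral p"

locale prime_modulus =
  fixes p :: nat
  assumes prime: "prime p"
begin

lemma p_integralI: "\<not> int p dvd b \<Longrightarrow> of_int a / of_int b \<in> p_integral p"
  unfolding p_integral_def by blast

lemma of_int_integral: "of_int a \<in> p_integral p"
  using p_integralI[of 1 a] prime by (simp add: prime_gt_1_nat zdvd1_eq not_le) (metis One_nat_def not_prime_1 of_nat_1 of_nat_eq_iff)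

lemma p_integral_add_mult:
  assumes "x \<in> p_integral p" "y \<in> p_integral p"
  shows "x + y \<in> p_integral p" "x * y \<in> p_integral p"
proof -
  obtain a b c d where ab: "x = of_int a / of_int b" "\<not> int p dvd b" "y = of_int c / of_int d" "\<not> int p dvd d"
    using assms unfolding p_integral_def by auto
  have bd: "\<not> int p dvd b * d" using ab prime by (simp add: prime_dvd_mult_iff)
  have nz: "(of_int b :: rat) \<noteq> 0" "(of_int d :: rat) \<noteq> 0" using ab by (auto intro: notI)
  have "x + y = of_int (a * d + c * b) / of_int (b * d)" "x * y = of_int (a * c) / of_int (b * d)"
    using ab(1,3) nz by (simp_all add: field_simps)
  then show "x + y \<in> p_integral p" "x * y \<in> p_integral p"
    by (simp_all only: p_integralI[OF bd])
qed

sublocale coefficient_ideal "p_integral p" "p_ideal p"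
proof
  show "(0::rat) \<in> p_integral p" "(1::rat) \<in> p_integral p"
    using of_int_integral[of 0] of_int_integral[of 1] by simp_all
  show "x + y \<in> p_integral p" "x * y \<in> p_integral p" if "x \<in> p_integral p" "y \<in> p_integral p" for x y
    using p_integral_add_mult that by blast+
  show "- x \<in> p_integral p" if "x \<in> p_integral p" for x
    using p_integral_add_mult(2)[OF of_int_integral[of "-1"] that] by simp
  show "0 \<in> p_ideal p" unfolding p_ideal_def using of_int_integral[of 0] by force
  show "x + y \<in> p_ideal p" if "x \<in> p_ideal p" "y \<in> p_ideal p" for x y
    using that unfolding p_ideal_def by (auto simp: distrib_left[symmetric] p_integral_add_mult)
  show "x * y \<in> p_ideal p" if "x \<in> p_integral p" "y \<in> p_ideal p" for x y
    using that unfolding p_ideal_def by (auto simp: mult.left_commute p_integral_add_mult)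
  show "x \<in> p_integral p" if "x \<in> p_ideal p" for x
    using that p_integral_add_mult(2)[OF of_int_integral[of "int p"]] unfolding p_ideal_def by auto
qed

lemma of_nat_integral: "of_nat n \<in> p_integral p"
  using of_int_integral[of "int n"] by simp

lemma of_nat_ideal: "p dvd n \<Longrightarrow> of_nat n \<in> p_ideal p"
  unfolding p_ideal_def by (elim dvdE) (auto simp: of_nat_integral)

lemma inverse_integral: "0 < m \<Longrightarrow> m < p \<Longrightarrow> 1 / of_nat m \<in> p_integral p"
  using p_integralI[of "int m" 1] by (simp add: nat_dvd_not_less)

lemma ideal_cancel:
  assumes "0 < m" "m < p" "of_nat m * q \<in> p_ideal p"
  shows "q \<in> p_ideal p"
  using I_mult[OF inverse_integral[OF assms(1,2)] assms(3)] assms(1) by simp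

lemma fermat:
  assumes "0 < m" "m < p"
  shows "of_nat m ^ (p - 1) - 1 \<in> p_ideal p"
proof (rule ideal_cancel[OF assms])
  have "of_nat n ^ p - of_nat n \<in> p_ideal p" for n
  proof (induction n)
    case 0
    show ?case using prime by (simp add: I0 prime_gt_0_nat zero_power)
  next
    case (Suc n)
    have "(of_nat n + 1) ^ p = (\<Sum>k\<le>p. of_nat (p choose k) * of_nat n ^ k :: rat)"
      by (subst binomial_ring) simp
    also have "{..p} = insert 0 (insert p {1..<p})" using prime by (auto simp: prime_gt_0_nat)
    also have "(\<Sum>k\<in>\<dots>. of_nat (p choose k) * of_nat n ^ k :: rat) = 1 + (of_nat n ^ p + (\<Sum>k=1..<p. of_nat (p choose k) * of_nat n ^ k))"
      using prime by (simp add: prime_gt_0_nat)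
    finally have "of_nat (Suc n) ^ p - of_nat (Suc n) = (of_nat n ^ p - of_nat n) + (\<Sum>k=1..<p. of_nat n ^ k * of_nat (p choose k) :: rat)"
      by (simp add: algebra_simps)
    moreover have "(\<Sum>k=1..<p. of_nat n ^ k * of_nat (p choose k) :: rat) \<in> p_ideal p"
      using prime by (intro I_sum I_mult R_power of_nat_integral of_nat_ideal dvd_choose_prime) auto
    ultimately show ?case using Suc by (simp only: I_add)
  qed
  from this[of m] show "of_nat m * (of_nat m ^ (p - 1) - 1) \<in> p_ideal p"
    using prime by (simp add: right_diff_distrib prime_gt_0_nat power_eq_if split: if_splits)
qed

text \<open>Telescoping \<open>(j + 1) ^ (s + 1) - j ^ (s + 1)\<close> over all residues expresses \<open>s + 1\<close> times the power sum by lower ones, and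
\<open>s + 1\<close> is invertible.\<close>

lemma power_sum_nat:
  assumes "0 < s" "s < p - 1"
  shows "(\<Sum>j=1..p-1. of_nat j ^ s) \<in> p_ideal p"
proof -
  have "s < p - 1 \<longrightarrow> (\<Sum>j<p. of_nat j ^ s) \<in> p_ideal p" for s
  proof (induction s rule: less_induct)
    case (less s)
    show ?case
    proof
      assume s: "s < p - 1"
      define S where "S l = (\<Sum>j<p. of_nat j ^ l :: rat)" for l
      have "(of_nat j + 1) ^ Suc s - of_nat j ^ Suc s = (\<Sum>l\<le>s. of_nat (Suc s choose l) * of_nat j ^ l :: rat)" for j
        by (subst binomial_ring) simp
      then have "(\<Sum>j<p. (of_nat (Suc j)) ^ Suc s - of_nat j ^ Suc s :: rat) = (\<Sum>j<p. \<Sum>l\<le>s. of_nat (Suc s choose l) * of_nat j ^ l)"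
        by (simp add: add.commute)
      also have "\<dots> = (\<Sum>l\<le>s. of_nat (Suc s choose l) * S l)"
        unfolding S_def sum_distrib_left by (rule sum.swap)
      also have "(\<Sum>j<p. (of_nat (Suc j)) ^ Suc s - of_nat j ^ Suc s :: rat) = of_nat p ^ Suc s"
        by (subst sum_lessThan_telescope) simp
      also have "(\<Sum>l\<le>s. of_nat (Suc s choose l) * S l) = (\<Sum>l<s. of_nat (Suc s choose l) * S l) + of_nat (Suc s) * S s"
        by (simp add: lessThan_Suc_atMost[symmetric])
      finally have "of_nat (Suc s) * S s = of_nat p ^ s * of_nat p - (\<Sum>l<s. of_nat (Suc s choose l) * S l)"
        by (simp add: mult.commute)
      moreover have "\<dots> \<in> p_ideal p"
        using less s by (intro I_diff I_sum I_mult R_power of_nat_integral of_nat_ideal) (auto simp: S_def)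
      ultimately have "of_nat (Suc s) * S s \<in> p_ideal p" by (simp only:)
      then show "(\<Sum>j<p. of_nat j ^ s) \<in> p_ideal p"
        using s ideal_cancel[of "Suc s" "S s"] unfolding S_def by simp
    qed
  qed
  moreover have "{..<p} = insert 0 {1..p-1}" using prime by (auto simp: prime_gt_0_nat)
  ultimately have "(\<Sum>j\<in>insert 0 {1..p-1}. of_nat j ^ s) \<in> p_ideal p" using assms(2) by metis
  then show ?thesis using assms(1) by (simp add: zero_power)
qed

lemma power_sum:
  assumes "\<bar>e\<bar> < int (p - 1)"
  shows "(\<Sum>j=1..p-1. of_nat j powi e) + (if e = 0 then 1 else 0) \<in> p_ideal p"
proof -
  consider "e = 0" | s where "e = int s" "0 < s" | s where "e = - int s" "0 < s"
    by (metis gr0I int_cases2 of_nat_0 add.inverse_neutral)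
  then show ?thesis
  proof cases
    case 1
    have "(\<Sum>j=1..p-1. of_nat j powi e) + (if e = 0 then 1 else 0) = (of_nat p :: rat)"
      using prime 1 by (simp flip: of_nat_Suc add: prime_gt_0_nat add.commute)
    then show ?thesis using of_nat_ideal[of p] by simp
  next
    case (2 s)
    then show ?thesis using power_sum_nat[of s] assms by simp
  next
    case (3 s)
    let ?t = "p - 1 - s"
    have t: "0 < ?t" "?t < p - 1" using 3 assms by auto
    have "(\<Sum>j=1..p-1. of_nat j ^ ?t) - (\<Sum>j=1..p-1. of_nat j powi e :: rat) = (\<Sum>j=1..p-1. (1 / of_nat j) ^ s * (of_nat j ^ (p - 1) - 1))"
      unfolding sum_subtractf[symmetric]
    proof (intro sum.cong refl)
      fix j assume "j \<in> {1..p-1}"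
      then have j: "(of_nat j :: rat) \<noteq> 0" by simp
      have "(of_nat j :: rat) ^ (p - 1) = of_nat j ^ ?t * of_nat j ^ s"
        using t unfolding power_add[symmetric] by simp
      then show "of_nat j ^ ?t - of_nat j powi e = (1 / of_nat j :: rat) ^ s * (of_nat j ^ (p - 1) - 1)"
        using j 3 by (simp add: power_int_minus field_simps)
    qed
    also have "\<dots> \<in> p_ideal p"
      by (intro I_sum I_mult R_power inverse_integral fermat) auto
    finally show ?thesis using I_diff[OF power_sum_nat[OF t]] 3 by force
  qed
qed

lemma inverse_lin_integral: "0 < m \<Longrightarrow> m < p \<Longrightarrow> u \<in> p_integral p \<Longrightarrow> fps_R D (inverse (lin (of_nat m) u))"
proof -
  assume m: "0 < m" "m < p" and u: "u \<in> p_integral p"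
  show ?thesis unfolding fps_R_def
  proof (intro allI impI)
    fix l
    have "inverse (lin (of_nat m) u) $ l = (- u) ^ l * (1 / of_nat m) ^ Suc l"
      using m by (simp add: inverse_lin_nth power_one_over)
    then show "inverse (lin (of_nat m) u) $ l \<in> p_integral p"
      by (simp only:) (intro R_mult R_power R_uminus u inverse_integral m)
  qed
qed

lemma fps_deriv_prod_lin:
  "fps_deriv (\<Prod>m=1..N. lin (of_nat m) u) = (\<Prod>m=1..N. lin (of_nat m) u) * (fps_const u * (\<Sum>m=1..N. inverse (lin (of_nat m :: rat) u)))"
proof (induction N)
  case (Suc N)
  have d: "fps_deriv (lin m u) = fps_const u" for m
    by (rule fps_ext) (simp add: lin_nth)
  have i: "lin (of_nat (Suc N)) u * inverse (lin (of_nat (Suc N)) u) = (1 :: rat fps)"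
    by (rule lin_inverse) (simp del: of_nat_Suc)
  let ?P = "\<Prod>m=1..N. lin (of_nat m) u :: rat fps" and ?S = "\<Sum>m=1..N. inverse (lin (of_nat m :: rat) u)"
  let ?l = "lin (of_nat (Suc N)) u :: rat fps"
  have "(\<Prod>m=1..Suc N. lin (of_nat m) u) = ?P * ?l" "(\<Sum>m=1..Suc N. inverse (lin (of_nat m) u)) = ?S + inverse ?l"
    by (simp_all del: of_nat_Suc)
  then have "fps_deriv (\<Prod>m=1..Suc N. lin (of_nat m) u) = ?P * fps_const u + ?P * (fps_const u * ?S) * ?l"
    by (simp only: fps_deriv_mult Suc.IH d)
  also have "?P * fps_const u = ?P * fps_const u * (?l * inverse ?l)" unfolding i by simp
  finally show ?case using \<open>(\<Prod>m=1..Suc N. lin (of_nat m) u) = ?P * ?l\<close> \<open>(\<Sum>m=1..Suc N. inverse (lin (of_nat m) u)) = ?S + inverse ?l\<close>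
    by (simp only: algebra_simps)
qed simp

text \<open>The polynomial \<open>\<Prod> (m + u X)\<close> over the nonzero residues is constant modulo \<open>p\<close> below degree \<open>p - 1\<close>, because
its logarithmic derivative has power sums as coefficients.\<close>

lemma prod_lin:
  assumes "u \<in> p_integral p"
  shows "fps_I (p - 1) ((\<Prod>m=1..p-1. lin (of_nat m) u) - fps_const (fact (p - 1)))"
proof -
  let ?F = "\<Prod>m=1..p-1. lin (of_nat m) u :: rat fps"
  let ?S = "\<Sum>m=1..p-1. inverse (lin (of_nat m :: rat) u)"
  have "fps_I (p - 2) ?S"
    unfolding fps_I_def
  proof (intro allI impI)
    fix l assume l: "l < p - 2"
    have "?S $ l = (- u) ^ l * (\<Sum>m=1..p-1. of_nat m powi (- int (Suc l)))"
      unfolding fps_sum_nth sum_distrib_left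
      by (intro sum.cong refl) (simp add: inverse_lin_nth power_int_minus divide_inverse del: of_nat_Suc power_Suc)
    also have "\<dots> \<in> p_ideal p"
      using power_sum[of "- int (Suc l)"] l assms by (intro I_mult R_power R_uminus) auto
    finally show "?S $ l \<in> p_ideal p" .
  qed
  moreover have "fps_R (p - 2) ?F"
    by (intro fps_R_prod fps_R_lin of_nat_integral assms)
  ultimately have d: "fps_I (p - 2) (fps_deriv ?F)"
    unfolding fps_deriv_prod_lin by (intro fps_I_mult fps_R_const assms)
  have "(\<Prod>m=1..N. lin (of_nat m) u :: rat fps) $ 0 = fact N" for N
    by (induction N) (simp_all add: lin_nth mult.commute)
  then have c: "?F $ 0 = fact (p - 1)" .
  show ?thesis unfolding fps_I_def
  proof (intro allI impI)
    fix l assume l: "l < p - 1"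
    show "(?F - fps_const (fact (p - 1))) $ l \<in> p_ideal p"
    proof (cases l)
      case 0
      then show ?thesis using c by (simp add: I0)
    next
      case (Suc l')
      have "fps_deriv ?F $ l' \<in> p_ideal p" using d Suc l by (simp add: fps_I_def)
      then have "of_nat (Suc l') * ?F $ Suc l' \<in> p_ideal p" by simp
      then have "?F $ Suc l' \<in> p_ideal p" by (rule ideal_cancel[rotated 2]) (use l Suc in auto)
      then show ?thesis using Suc by simp
    qed
  qed
qed

lemma fact_unit: "1 / fact (p - 1) \<in> p_integral p"
proof -
  have "1 / fact (p - 1) = (\<Prod>m=1..p-1. 1 / of_nat m :: rat)"
    by (simp add: fact_prod prod_dividef)
  also have "\<dots> \<in> p_integral p" by (intro R_prod inverse_integral) auto
  finally show ?thesis .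
qed

text \<open>Functions on power series that are polynomial of degree at most \<open>n\<close> with coefficients integral at \<open>p\<close>.\<close>

definition pol :: "nat \<Rightarrow> (rat fps \<Rightarrow> rat fps) \<Rightarrow> bool" where
  "pol n F \<longleftrightarrow> (\<exists>q. (\<forall>s. fps_R (p - 1) (q s)) \<and> (\<forall>C. F C = (\<Sum>s\<le>n. q s * C ^ s)))"

lemma pol_const: "fps_R (p - 1) f \<Longrightarrow> pol 0 (\<lambda>_. f)"
  unfolding pol_def by (intro exI[of _ "\<lambda>_. f"]) simp

lemma pol_mult_linear:
  assumes "pol n F" "fps_R (p - 1) u" "fps_R (p - 1) v"
  shows "pol (Suc n) (\<lambda>C. F C * (u + v * C))"
proof -
  from assms(1) obtain q where q: "\<And>s. fps_R (p - 1) (q s)" "\<And>C. F C = (\<Sum>s\<le>n. q s * C ^ s)"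
    unfolding pol_def by blast
  define q' where "q' s = (if s \<le> n then q s * u else 0) + (if s = 0 then 0 else q (s - 1) * v)" for s
  have z: "fps_R (p - 1) 0" by (rule fps_I_R[OF fps_I_0])
  have "fps_R (p - 1) (q' s)" for s
    unfolding q'_def using q(1) assms(2,3) z by (auto intro!: fps_R_add fps_R_mult)
  moreover have "F C * (u + v * C) = (\<Sum>s\<le>Suc n. q' s * C ^ s)" for C
  proof -
    have "(\<Sum>s\<le>Suc n. q' s * C ^ s) = (\<Sum>s\<le>Suc n. (if s \<le> n then q s * u else 0) * C ^ s) + (\<Sum>s\<le>Suc n. (if s = 0 then 0 else q (s - 1) * v) * C ^ s)"
      unfolding q'_def distrib_right sum.distrib ..
    also have "(\<Sum>s\<le>Suc n. (if s \<le> n then q s * u else 0) * C ^ s) = (\<Sum>s\<le>n. q s * u * C ^ s)"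
      by simp
    also have "(\<Sum>s\<le>Suc n. (if s = 0 then 0 else q (s - 1) * v) * C ^ s) = (\<Sum>s\<le>n. q s * v * C ^ Suc s)"
      by (subst sum.atMost_Suc_shift) simp
    finally show ?thesis unfolding q(2) distrib_left sum_distrib_right by (simp add: mult_ac)
  qed
  ultimately show ?thesis unfolding pol_def by blast
qed

lemma pol_sum: "(\<And>i. i \<in> S \<Longrightarrow> pol n (F i)) \<Longrightarrow> pol n (\<lambda>C. \<Sum>i\<in>S. F i C)"
proof -
  assume "\<And>i. i \<in> S \<Longrightarrow> pol n (F i)"
  then obtain q where q: "\<And>i s. i \<in> S \<Longrightarrow> fps_R (p - 1) (q i s)" "\<And>i C. i \<in> S \<Longrightarrow> F i C = (\<Sum>s\<le>n. q i s * C ^ s)"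
    unfolding pol_def by metis
  show ?thesis unfolding pol_def
  proof (intro exI[of _ "\<lambda>s. \<Sum>i\<in>S. q i s"] conjI allI fps_R_sum q(1))
    show "(\<Sum>i\<in>S. F i C) = (\<Sum>s\<le>n. (\<Sum>i\<in>S. q i s) * C ^ s)" for C
      unfolding sum_distrib_right by (subst sum.swap) (simp add: q(2))
  qed
qed

lemma pol_mono:
  assumes "pol n F" "n \<le> m"
  shows "pol m F"
proof -
  from assms(1) obtain q where q: "\<And>s. fps_R (p - 1) (q s)" "\<And>C. F C = (\<Sum>s\<le>n. q s * C ^ s)"
    unfolding pol_def by blast
  have "F C = (\<Sum>s\<le>m. (if s \<le> n then q s else 0) * C ^ s)" for C
    unfolding q(2) using assms(2) by (intro sum.mono_neutral_cong_left) auto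
  then show ?thesis unfolding pol_def
    using q(1) fps_I_R[OF fps_I_0] by (intro exI[of _ "\<lambda>s. if s \<le> n then q s else 0"]) auto
qed

lemma pol_pochhammer:
  assumes "pol n F" "fps_R (p - 1) v" "fps_R (p - 1) u"
  shows "pol (n + l) (\<lambda>C. F C * pochhammer (u + v * C) l)"
proof (induction l)
  case (Suc l)
  have "pol (Suc (n + l)) (\<lambda>C. (F C * pochhammer (u + v * C) l) * ((u + of_nat l) + v * C))"
    using fps_R_const[OF of_nat_integral] assms by (intro pol_mult_linear Suc fps_R_add) (simp_all add: fps_of_nat)
  moreover have "(\<lambda>C. (F C * pochhammer (u + v * C) l) * ((u + of_nat l) + v * C)) = (\<lambda>C. F C * pochhammer (u + v * C) (Suc l))"
    by (simp add: fun_eq_iff pochhammer_Suc algebra_simps)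
  ultimately show ?case by simp
qed (use assms in simp)

text \<open>Lagrange interpolation at all residues modulo \<open>p\<close>. For a monomial \<open>C ^ s\<close> the right-hand side expands into power sums of
the exponents \<open>s - l\<close>, and only \<open>l = s\<close> survives.\<close>

lemma interpolation:
  assumes F: "pol (p - 1) F" and c: "c \<in> p_integral p"
  shows "fps_I (p - 1) (F (scaled_X c) - F 0 - (\<Sum>j=1..p-1. F (- of_nat j) * (scaled_X c * inverse (lin (of_nat j) c))))"
proof -
  let ?M = "scaled_X c"
  from F obtain q where q: "\<And>s. fps_R (p - 1) (q s)" "\<And>C. F C = (\<Sum>s\<le>p-1. q s * C ^ s)"
    unfolding pol_def by blast
  have "F ?M - F 0 - (\<Sum>j=1..p-1. F (- of_nat j) * (?M * inverse (lin (of_nat j) c)))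
      = (\<Sum>s\<le>p-1. q s * (?M ^ s - 0 ^ s - (\<Sum>j=1..p-1. (- of_nat j) ^ s * (?M * inverse (lin (of_nat j) c)))))"
    unfolding q(2) sum_distrib_right right_diff_distrib sum_subtractf sum_distrib_left
    by (subst sum.swap) (simp only: mult_ac)
  moreover have "fps_I (p - 1) (?M ^ s - 0 ^ s - (\<Sum>j=1..p-1. (- of_nat j) ^ s * (?M * inverse (lin (of_nat j) c))))" if "s \<le> p - 1" for s
    unfolding fps_I_def
  proof (intro allI impI)
    fix l assume l: "l < p - 1"
    have pw: "(- of_nat j :: rat fps) ^ s = fps_const ((- of_nat j) ^ s)" for j
      by (simp flip: fps_of_nat fps_const_neg fps_const_power)
    have Ml: "(?M ^ s) $ l = (if l = s then c ^ s else 0)"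
      by (simp add: power_mult_distrib fps_const_power fps_X_power_nth)
    show "(?M ^ s - 0 ^ s - (\<Sum>j=1..p-1. (- of_nat j) ^ s * (?M * inverse (lin (of_nat j) c)))) $ l \<in> p_ideal p"
    proof (cases l)
      case 0
      have "((- of_nat j :: rat fps) ^ s * (?M * inverse (lin (of_nat j) c))) $ 0 = 0" for j
        by simp
      then show ?thesis using Ml 0 by (simp add: fps_sum_nth I0 power_0_left)
    next
      case (Suc l')
      have "((- of_nat j :: rat fps) ^ s * (?M * inverse (lin (of_nat j) c))) $ l = - ((-1) ^ s * (- c) ^ l * of_nat j powi (int s - int l))" if "j \<in> {1..p-1}" for j
      proof -
        have j: "(of_nat j :: rat) \<noteq> 0" using that by simp
        have "((- of_nat j :: rat fps) ^ s * (?M * inverse (lin (of_nat j) c))) $ l = (- of_nat j) ^ s * (c * ((- c) ^ l' / of_nat j ^ Suc l'))"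
          unfolding pw Suc using j by (simp add: inverse_lin_nth mult.assoc)
        also have "(- of_nat j :: rat) ^ s = (-1) ^ s * of_nat j ^ s" by (rule power_minus)
        finally show ?thesis using j unfolding Suc
          by (simp add: power_int_diff mult_ac del: of_nat_Suc)
      qed
      then have "(?M ^ s - 0 ^ s - (\<Sum>j=1..p-1. (- of_nat j) ^ s * (?M * inverse (lin (of_nat j) c)))) $ l
          = (if l = s then c ^ s else 0) + (-1) ^ s * (- c) ^ l * (\<Sum>j=1..p-1. of_nat j powi (int s - int l))"
        using Ml Suc by (simp add: fps_sum_nth sum_negf sum_distrib_left power_0_left)
      also have "\<dots> = (-1) ^ s * (- c) ^ l * ((\<Sum>j=1..p-1. of_nat j powi (int s - int l)) + (if int s - int l = 0 then 1 else 0))"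
        by (auto simp: distrib_left power_mult_distrib[symmetric])
      also have "\<dots> \<in> p_ideal p"
        using R_power[OF R_uminus[OF R1]] that l Suc by (intro I_mult R_mult R_power R_uminus R1 c power_sum) auto
      finally show ?thesis .
    qed
  qed
  ultimately show ?thesis by (simp only:) (intro fps_I_sum fps_I_mult q(1); simp)
qed

end

section \<open>Bernoulli numbers and double sums modulo a prime\<close>

text \<open>Multiply the exponential generating function of both sides by \<open>exp X - 1\<close>; the left side is a geometric sum.\<close>

lemma faulhaber:
  "of_nat (Suc n) * (\<Sum>i=1..j. of_nat i ^ n) = (\<Sum>l\<le>n. of_nat (Suc n choose l) * bernoulli l * of_nat j ^ (Suc n - l))"
proof -
  let ?B = "Abs_fps (\<lambda>n. bernoulli n / fact n)" and ?E = "fps_exp 1 :: rat fps"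
  have "(\<Sum>i=1..j. fps_exp (of_nat i)) * (?E - 1) = ?E * (fps_exp (of_nat j) - 1)"
  proof (induction j)
    case (Suc j)
    have "fps_exp (of_nat (Suc j)) = ?E * fps_exp (of_nat j)" by (simp flip: fps_exp_add_mult)
    then show ?case using Suc by (simp add: distrib_right algebra_simps del: of_nat_Suc)
  qed simp
  then have "?B * (fps_exp (of_nat j) - 1) * (?E - 1) = fps_X * (\<Sum>i=1..j. fps_exp (of_nat i)) * (?E - 1)"
    using bernoulli_egf by (metis (no_types, lifting) mult.assoc mult.commute)
  moreover have "?E - 1 \<noteq> 0"
  proof
    assume "?E - 1 = 0"
    then have "(?E - 1) $ 1 = 0" by simp
    then show False by simp
  qed
  ultimately have "fps_X * (\<Sum>i=1..j. fps_exp (of_nat i)) = ?B * (fps_exp (of_nat j) - 1)" by simp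
  then have "(fps_X * (\<Sum>i=1..j. fps_exp (of_nat i))) $ Suc n = (?B * (fps_exp (of_nat j) - 1)) $ Suc n" by simp
  moreover have "(fps_X * (\<Sum>i=1..j. fps_exp (of_nat i))) $ Suc n = (\<Sum>i=1..j. of_nat i ^ n / fact n :: rat)"
    by (simp add: fps_sum_nth)
  moreover have "(?B * (fps_exp (of_nat j) - 1)) $ Suc n = (\<Sum>l\<le>n. bernoulli l / fact l * (of_nat j ^ (Suc n - l) / fact (Suc n - l)))"
    by (simp add: fps_mult_nth atLeast0AtMost) (simp add: mult.commute)
  ultimately have "(\<Sum>i=1..j. of_nat i ^ n / fact n) = (\<Sum>l\<le>n. bernoulli l / fact l * (of_nat j ^ (Suc n - l) / fact (Suc n - l)))"
    by simp
  then have "(\<Sum>i=1..j. of_nat i ^ n / fact n) * fact (Suc n) = (\<Sum>l\<le>n. bernoulli l / fact l * (of_nat j ^ (Suc n - l) / fact (Suc n - l))) * fact (Suc n)"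
    by (simp only:)
  moreover have "(\<Sum>i=1..j. of_nat i ^ n / fact n) * fact (Suc n) = of_nat (Suc n) * (\<Sum>i=1..j. of_nat i ^ n :: rat)"
    by (simp add: sum_divide_distrib[symmetric] del: of_nat_Suc)
  moreover have "(\<Sum>l\<le>n. bernoulli l / fact l * (of_nat j ^ (Suc n - l) / fact (Suc n - l))) * fact (Suc n)
      = (\<Sum>l\<le>n. of_nat (Suc n choose l) * bernoulli l * of_nat j ^ (Suc n - l))"
    unfolding sum_distrib_right
    by (intro sum.cong refl) (simp add: binomial_fact del: fact_Suc)
  ultimately show ?thesis by (simp only:)
qed

lemma triangle_sum_swap:
  fixes f g :: "nat \<Rightarrow> 'a::comm_ring_1"
  shows "(\<Sum>j=1..N. \<Sum>i=1..j. f i * g j) + (\<Sum>j=1..N. \<Sum>i=1..j. g i * f j)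
    = (\<Sum>j=1..N. f j) * (\<Sum>j=1..N. g j) + (\<Sum>j=1..N. f j * g j)"
  by (induction N) (simp_all add: algebra_simps sum_distrib_left sum_distrib_right)

context prime_modulus
begin

text \<open>Faulhaber's formula for the one-term sum \<open>1 ^ n\<close> is a recursion whose only denominator is \<open>n + 1 < p\<close>.\<close>

lemma bernoulli_integral: "n < p - 1 \<Longrightarrow> bernoulli n \<in> p_integral p"
proof (induction n rule: less_induct)
  case (less n)
  have "{..n} = insert n {..<n}" by auto
  then have "of_nat (Suc n) * bernoulli n = of_nat (Suc n) - (\<Sum>l<n. of_nat (Suc n choose l) * bernoulli l)"
    using faulhaber[of n 1] by (simp add: of_nat_Suc[of 0] del: of_nat_Suc)
  moreover have "\<dots> \<in> p_integral p"
    using less by (intro R_diff R_sum R_mult of_nat_integral) auto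
  ultimately have "(1 / of_nat (Suc n)) * (of_nat (Suc n) * bernoulli n) \<in> p_integral p"
    using less.prems R_mult[OF inverse_integral[of "Suc n"]] by auto
  then show ?case by (simp del: of_nat_Suc)
qed

lemma inverse_power_cong:
  assumes "0 < m" "m < p" "s \<le> p - 1"
  shows "(1 / of_nat m) ^ s - of_nat m ^ (p - 1 - s) \<in> p_ideal p"
proof -
  have m: "(of_nat m :: rat) \<noteq> 0" using assms by simp
  have "(of_nat m :: rat) ^ (p - 1) = of_nat m ^ (p - 1 - s) * of_nat m ^ s"
    using assms unfolding power_add[symmetric] by simp
  then have "(1 / of_nat m) ^ s - of_nat m ^ (p - 1 - s) = - ((1 / of_nat m) ^ s * (of_nat m ^ (p - 1) - 1 :: rat))"
    using m by (simp add: field_simps)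
  also have "\<dots> \<in> p_ideal p"
    using assms by (intro I_uminus I_mult R_power inverse_integral fermat) auto
  finally show ?thesis .
qed

text \<open>Modulo \<open>p\<close> the number \<open>p - 1 - a\<close> is \<open>-(a + 1)\<close>, and this is reflection of the upper index.\<close>

lemma choose_reflect:
  "a + m < p \<Longrightarrow> of_nat ((p - 1 - a) choose m) - (-1) ^ m * of_nat ((a + m) choose m) \<in> p_ideal p"
proof (induction m)
  case (Suc m)
  let ?N = "p - 1 - a"
  let ?x = "\<lambda>m. of_nat (?N choose m) :: rat" and ?y = "\<lambda>m. of_nat ((a + m) choose m) :: rat"
  have "Suc m * (?N choose Suc m) = (?N - m) * (?N choose m)"
    using binomial_absorption[of m ?N] binomial_absorb_comp[of ?N m] by simp
  then have "of_nat (Suc m) * ?x (Suc m) = of_nat (?N - m) * ?x m"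
    by (metis of_nat_mult)
  also have "of_nat (?N - m) = (of_nat p - of_nat (Suc (a + m)) :: rat)"
    using Suc.prems by (subst of_nat_diff[symmetric]) auto
  finally have x: "of_nat (Suc m) * ?x (Suc m) = (of_nat p - of_nat (Suc (a + m))) * ?x m" .
  have "Suc m * ((a + Suc m) choose Suc m) = Suc (a + m) * ((a + m) choose m)"
    by (metis Suc_times_binomial add_Suc_right)
  then have y: "of_nat (Suc m) * ?y (Suc m) = of_nat (Suc (a + m)) * ?y m"
    by (metis of_nat_mult)
  have "of_nat (Suc m) * (?x (Suc m) - (-1) ^ Suc m * ?y (Suc m)) = of_nat (Suc m) * ?x (Suc m) + (-1) ^ m * (of_nat (Suc m) * ?y (Suc m))"
    by (simp add: algebra_simps)
  also have "\<dots> = ?x m * of_nat p - of_nat (Suc (a + m)) * (?x m - (-1) ^ m * ?y m)"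
    unfolding x y by (simp add: algebra_simps)
  also have "\<dots> \<in> p_ideal p"
    using Suc.prems by (intro I_diff[OF I_mult[OF of_nat_integral of_nat_ideal] I_mult[OF of_nat_integral Suc.IH]]) auto
  finally have F: "of_nat (Suc m) * (?x (Suc m) - (-1) ^ Suc m * ?y (Suc m)) \<in> p_ideal p" .
  show ?case by (rule ideal_cancel[OF _ _ F]) (use Suc.prems in simp_all)
qed (simp add: I0)

text \<open>The component at \<open>p\<close> of \<open>frakZ_A k\<close>.\<close>

definition Z :: "nat \<Rightarrow> rat" where "Z k = bernoulli (p - k) / of_nat k"

lemma Z_integral: "2 \<le> k \<Longrightarrow> k < p \<Longrightarrow> Z k \<in> p_integral p"
  using R_mult[OF bernoulli_integral[of "p - k"] inverse_integral[of k]] by (simp add: Z_def)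

text \<open>By Fermat the inner sum is a sum of positive powers, to which Faulhaber's formula applies. Summing over \<open>j\<close> then
kills all powers of \<open>j\<close> except the exponent 0, which picks out \<open>B\<^bsub>p-k\<^esub>\<close>.\<close>

lemma double_sum:
  assumes "0 < k1" "0 < k2" "k1 + k2 < p - 1"
  shows "(\<Sum>j=1..p-1. \<Sum>i=1..j. (1 / of_nat i) ^ k1 * (1 / of_nat j) ^ k2) - (-1) ^ k2 * of_nat ((k1 + k2) choose k2) * Z (k1 + k2) \<in> p_ideal p"
proof -
  define n where "n = p - 1 - k1"
  have sn: "Suc n = p - k1" "Suc n < p" using assms by (auto simp: n_def)
  let ?T = "\<Sum>j=1..p-1. \<Sum>i=1..j. (1 / of_nat i) ^ k1 * (1 / of_nat j) ^ k2 :: rat"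
  let ?T' = "\<Sum>j=1..p-1. \<Sum>i=1..j. of_nat i ^ n * (1 / of_nat j) ^ k2 :: rat"
  let ?C = "of_nat (Suc n choose (p - (k1 + k2))) * bernoulli (p - (k1 + k2)) :: rat"
  have "?T - ?T' = (\<Sum>j=1..p-1. \<Sum>i=1..j. (1 / of_nat j) ^ k2 * ((1 / of_nat i) ^ k1 - of_nat i ^ n))"
    by (simp add: sum_subtractf[symmetric] algebra_simps)
  also have "\<dots> \<in> p_ideal p"
    unfolding n_def using assms by (intro I_sum I_mult R_power inverse_integral inverse_power_cong) auto
  finally have 1: "?T - ?T' \<in> p_ideal p" .
  define e where "e l = int (p - (k1 + k2)) - int l" for l
  have "of_nat (Suc n) * ?T' = (\<Sum>j=1..p-1. (1 / of_nat j) ^ k2 * (of_nat (Suc n) * (\<Sum>i=1..j. of_nat i ^ n)))"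
    by (simp only: sum_distrib_left sum_distrib_right mult_ac)
  also have "\<dots> = (\<Sum>j=1..p-1. \<Sum>l\<le>n. of_nat (Suc n choose l) * bernoulli l * of_nat j powi e l)"
    unfolding faulhaber unfolding sum_distrib_left
  proof (intro sum.cong refl)
    fix j l assume j: "j \<in> {1..p-1}" and l: "l \<in> {..n}"
    have "e l = int (Suc n - l) - int k2" using l assms sn unfolding e_def by auto
    then show "(1 / of_nat j) ^ k2 * (of_nat (Suc n choose l) * bernoulli l * of_nat j ^ (Suc n - l)) = of_nat (Suc n choose l) * bernoulli l * (of_nat j powi e l :: rat)"
      using j by (simp add: power_int_diff power_inverse divide_inverse mult_ac)
  qed
  also have "\<dots> = (\<Sum>l\<le>n. of_nat (Suc n choose l) * bernoulli l * (\<Sum>j=1..p-1. of_nat j powi e l))"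
    unfolding sum_distrib_left by (rule sum.swap)
  finally have T': "of_nat (Suc n) * ?T' = \<dots>" .
  have "of_nat (Suc n) * ?T' + ?C = (\<Sum>l\<le>n. of_nat (Suc n choose l) * bernoulli l * ((\<Sum>j=1..p-1. of_nat j powi e l) + (if e l = 0 then 1 else 0)))"
  proof -
    have "(\<Sum>l\<le>n. of_nat (Suc n choose l) * bernoulli l * (if e l = 0 then 1 else 0)) = (\<Sum>l\<le>n. if l = p - (k1 + k2) then of_nat (Suc n choose l) * bernoulli l else 0)"
      by (intro sum.cong refl) (auto simp: e_def)
    also have "\<dots> = ?C" using assms by (simp add: n_def)
    finally show ?thesis unfolding T' by (simp add: distrib_left sum.distrib)
  qed
  also have "\<dots> \<in> p_ideal p"
    using sn assms by (intro I_sum I_mult R_mult of_nat_integral bernoulli_integral power_sum) (auto simp: e_def n_def)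
  finally have "(1 / of_nat (Suc n)) * (of_nat (Suc n) * ?T' + ?C) \<in> p_ideal p"
    using sn by (intro I_mult inverse_integral) auto
  then have 2: "?T' + ?C / of_nat (Suc n) \<in> p_ideal p"
    by (simp add: distrib_left del: of_nat_Suc)
  obtain m where m: "k2 = Suc m" using assms(2) gr0_implies_Suc by blast
  let ?B = "bernoulli (p - (k1 + k2))"
  have "(Suc n choose (p - (k1 + k2))) = Suc n choose k2"
    using assms sn by (subst binomial_symmetric) auto
  moreover have "Suc m * (Suc n choose Suc m) = Suc n * (n choose m)" by (rule Suc_times_binomial)
  then have "of_nat (Suc m) * of_nat (Suc n choose Suc m) = (of_nat (Suc n) * of_nat (n choose m) :: rat)"
    by (metis of_nat_mult)
  ultimately have c: "?C / of_nat (Suc n) = (1 / of_nat k2) * (?B * of_nat (n choose m))"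
    unfolding m by (simp add: field_simps del: of_nat_Suc binomial_Suc_Suc)
  have "Suc m * ((k1 + Suc m) choose Suc m) = Suc (k1 + m) * ((k1 + m) choose m)"
    by (metis Suc_times_binomial add_Suc_right)
  then have "of_nat (Suc m) * of_nat ((k1 + Suc m) choose Suc m) = (of_nat (Suc (k1 + m)) * of_nat ((k1 + m) choose m) :: rat)"
    by (metis of_nat_mult)
  then have d: "(-1) ^ k2 * of_nat ((k1 + k2) choose k2) * Z (k1 + k2) = - ((1 / of_nat k2) * (?B * ((-1) ^ m * of_nat ((k1 + m) choose m))))"
    unfolding m Z_def by (simp add: field_simps del: of_nat_Suc binomial_Suc_Suc)
  have 3: "(1 / of_nat k2) * (?B * (of_nat (n choose m) - (-1) ^ m * of_nat ((k1 + m) choose m))) \<in> p_ideal p"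
    using assms m unfolding n_def by (intro I_mult inverse_integral bernoulli_integral choose_reflect) auto
  have "?T - (-1) ^ k2 * of_nat ((k1 + k2) choose k2) * Z (k1 + k2)
     = (?T - ?T') + (?T' + ?C / of_nat (Suc n)) - (1 / of_nat k2) * (?B * (of_nat (n choose m) - (-1) ^ m * of_nat ((k1 + m) choose m)))"
    unfolding c d by (simp add: algebra_simps)
  also have "\<dots> \<in> p_ideal p" by (intro I_diff I_add 1 2 3)
  finally show ?thesis .
qed

text \<open>The two double sums with exponents 1 and \<open>k - 1\<close> add up to products and sums of power sums, which vanish. By
\<open>double_sum\<close> the total is also \<open>-2 k Z k\<close> when \<open>k\<close> is even.\<close>

lemma Z_even:
  assumes "even k" "2 \<le> k" "k < p - 1"
  shows "Z k \<in> p_ideal p"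
proof -
  define f g :: "nat \<Rightarrow> rat" where "f j = 1 / of_nat j" and "g j = (1 / of_nat j) ^ (k - 1)" for j
  let ?S = "\<Sum>j=1..p-1. \<Sum>i=1..j. f i * g j" and ?S' = "\<Sum>j=1..p-1. \<Sum>i=1..j. g i * f j"
  have k: "1 + (k - 1) = k" "k - 1 + 1 = k" "(-1) ^ (k - 1) = (-1::rat)" "k choose (k - 1) = k" "k choose 1 = k"
    using assms binomial_symmetric[of 1 k] by auto
  have s: "?S - (-1) ^ (k - 1) * of_nat (k choose (k - 1)) * Z k \<in> p_ideal p"
    using double_sum[of 1 "k - 1"] assms unfolding f_def g_def k(1) by simp
  have s': "?S' - (-1) ^ 1 * of_nat (k choose 1) * Z k \<in> p_ideal p"
    using double_sum[of "k - 1" 1] assms unfolding f_def g_def k(2) by simp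
  have h: "(\<Sum>j=1..p-1. (1 / of_nat j) ^ s) \<in> p_ideal p" if "0 < s" "s < p - 1" for s
    using power_sum[of "- int s"] that by (simp add: power_int_minus power_inverse divide_inverse)
  have "?S + ?S' = (\<Sum>j=1..p-1. f j) * (\<Sum>j=1..p-1. g j) + (\<Sum>j=1..p-1. f j * g j)"
    by (rule triangle_sum_swap)
  also have "(\<Sum>j=1..p-1. f j * g j) = (\<Sum>j=1..p-1. (1 / of_nat j) ^ k)"
  proof (intro sum.cong refl)
    show "f j * g j = (1 / of_nat j) ^ k" for j
      unfolding f_def g_def using assms by (metis Suc_diff_1 less_le_trans pos2 power_Suc)
  qed
  also have "(\<Sum>j=1..p-1. f j) * (\<Sum>j=1..p-1. g j) + \<dots> \<in> p_ideal p"
    using h[of 1] h[of "k - 1"] h[of k] assms unfolding f_def g_def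
    by (intro I_add I_mult I_R) auto
  finally have "(?S + ?S') - (?S - (-1) ^ (k - 1) * of_nat (k choose (k - 1)) * Z k) - (?S' - (-1) ^ 1 * of_nat (k choose 1) * Z k) \<in> p_ideal p"
    by (intro I_diff s s')
  then have "- (of_nat 2 * (of_nat k * Z k)) \<in> p_ideal p" unfolding k by simp
  from I_uminus[OF this] show ?thesis
    using assms by (intro ideal_cancel[of k "Z k"] ideal_cancel[of 2 "of_nat k * Z k"]) auto
qed

text \<open>The double sums that the interpolated hypergeometric sums produce.\<close>

definition corner :: "rat \<Rightarrow> rat \<Rightarrow> rat fps" where
  "corner s t = (\<Sum>j=1..p-1. \<Sum>i=1..j. inverse (lin (of_nat j) s) * inverse (lin (of_nat i) t))"

lemma corner_integral: "s \<in> p_integral p \<Longrightarrow> t \<in> p_integral p \<Longrightarrow> fps_R D (corner s t)"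
  unfolding corner_def by (intro fps_R_sum fps_R_mult inverse_lin_integral) auto

lemma corner_nth:
  assumes s: "s \<in> p_integral p" and t: "t \<in> p_integral p" and k: "2 \<le> k" "k < p - 1"
  shows "s * t * corner s t $ (k - 2) - ((s - t) ^ k - s ^ k - (- t) ^ k) * Z k \<in> p_ideal p"
proof -
  define T where "T k1 k2 = (\<Sum>j=1..p-1. \<Sum>i=1..j. (1 / of_nat i) ^ k1 * (1 / of_nat j) ^ k2 :: rat)" for k1 k2
  let ?u = "\<lambda>l. (- s) ^ l * (- t) ^ (k - l)"
  have "corner s t $ (k - 2) = (\<Sum>j=1..p-1. \<Sum>i=1..j. \<Sum>l\<le>k-2. (- s) ^ l * (- t) ^ (k - 2 - l) * ((1 / of_nat i) ^ Suc (k - 2 - l) * (1 / of_nat j) ^ Suc l))"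
    unfolding corner_def fps_sum_nth fps_mult_nth atLeast0AtMost
    by (intro sum.cong refl) (simp add: inverse_lin_nth power_inverse divide_inverse mult_ac)
  also have "\<dots> = (\<Sum>l\<le>k-2. (- s) ^ l * (- t) ^ (k - 2 - l) * T (Suc (k - 2 - l)) (Suc l))"
    unfolding T_def sum_distrib_left by (subst sum.swap, subst sum.swap) (intro sum.cong refl sum.swap)
  finally have "s * t * corner s t $ (k - 2) = (\<Sum>l\<le>k-2. s * t * ((- s) ^ l * (- t) ^ (k - 2 - l)) * T (Suc (k - 2 - l)) (Suc l))"
    by (simp only: sum_distrib_left mult.assoc)
  also have "\<dots> = (\<Sum>l\<le>k-2. ?u (Suc l) * T (k - Suc l) (Suc l))"
  proof (intro sum.cong refl)
    fix l assume "l \<in> {..k-2}"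
    then have "Suc (k - 2 - l) = k - Suc l" using k by auto
    moreover have "s * t * ((- s) ^ l * (- t) ^ (k - 2 - l)) = (- s) ^ Suc l * (- t) ^ Suc (k - 2 - l)" by simp
    ultimately show "s * t * ((- s) ^ l * (- t) ^ (k - 2 - l)) * T (Suc (k - 2 - l)) (Suc l) = ?u (Suc l) * T (k - Suc l) (Suc l)" by metis
  qed
  finally have e1: "s * t * corner s t $ (k - 2) = \<dots>" .
  have "(s - t) ^ k - s ^ k - (- t) ^ k = (\<Sum>l\<le>k-2. s ^ Suc l * (- t) ^ (k - Suc l) * of_nat (k choose Suc l))"
  proof -
    obtain k' where k': "k = Suc (Suc k')" using k by (metis add_2_eq_Suc le_Suc_ex)
    have "(s - t) ^ k = (\<Sum>l\<le>k. of_nat (k choose l) * s ^ l * (- t) ^ (k - l))"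
      using binomial_ring[of s "- t" k] by simp
    also have "\<dots> = (- t) ^ k + (\<Sum>l\<le>k'. of_nat (k choose Suc l) * s ^ Suc l * (- t) ^ (k - Suc l)) + s ^ k"
      unfolding k' by (subst sum.atMost_Suc_shift, subst sum.atMost_Suc) simp
    finally show ?thesis unfolding k' by (simp add: mult_ac del: power_Suc binomial_Suc_Suc)
  qed
  also have "\<dots> = (\<Sum>l\<le>k-2. ?u (Suc l) * ((-1) ^ Suc l * of_nat (k choose Suc l)))"
  proof (intro sum.cong refl)
    fix l
    have "s ^ Suc l = (- s) ^ Suc l * (-1) ^ Suc l" unfolding power_mult_distrib[symmetric] by simp
    then show "s ^ Suc l * (- t) ^ (k - Suc l) * of_nat (k choose Suc l) = ?u (Suc l) * ((-1) ^ Suc l * of_nat (k choose Suc l))"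
      by (simp only: mult_ac)
  qed
  finally have e2: "((s - t) ^ k - s ^ k - (- t) ^ k) * Z k = (\<Sum>l\<le>k-2. ?u (Suc l) * ((-1) ^ Suc l * of_nat (k choose Suc l) * Z k))"
    by (simp only: sum_distrib_right mult.assoc)
  have "s * t * corner s t $ (k - 2) - ((s - t) ^ k - s ^ k - (- t) ^ k) * Z k
     = (\<Sum>l\<le>k-2. ?u (Suc l) * (T (k - Suc l) (Suc l) - (-1) ^ Suc l * of_nat (k choose Suc l) * Z k))"
    unfolding e1 e2 sum_subtractf[symmetric] right_diff_distrib ..
  also have "\<dots> \<in> p_ideal p"
  proof (intro I_sum I_mult R_mult R_power R_uminus s t)
    fix l assume "l \<in> {..k-2}"
    then have "k - Suc l + Suc l = k" "0 < k - Suc l" using k by auto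
    with double_sum[of "k - Suc l" "Suc l"] k
    show "T (k - Suc l) (Suc l) - (-1) ^ Suc l * of_nat (k choose Suc l) * Z k \<in> p_ideal p"
      unfolding T_def by (simp only: zero_less_Suc)
  qed
  finally show ?thesis .
qed

end

section \<open>Hypergeometric sums modulo a prime\<close>

context prime_modulus
begin

lemma fps_I_trans: "fps_I D (f - g) \<Longrightarrow> fps_I D (g - h) \<Longrightarrow> fps_I D (f - h)"
  using fps_I_add[of D "f - g" "g - h"] by simp

lemma pochhammer_of_nat_zero: "j < n \<Longrightarrow> pochhammer (- of_nat j :: rat fps) n = 0"
  by (rule pochhammer_of_nat_eq_0_lemma)

lemma truncate_sum:
  fixes f :: "nat \<Rightarrow> 'a::comm_monoid_add"
  assumes "j \<le> N" "\<And>n. j < n \<Longrightarrow> f n = 0"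
  shows "(\<Sum>n=1..N. f n) = (\<Sum>n=1..j. f n)"
  using assms by (intro sum.mono_neutral_right) auto

text \<open>The sum is a polynomial in the upper parameter \<open>C\<close> that vanishes at 0, and at \<open>C = -j\<close> it is the terminating
evaluation.\<close>

lemma gauss_sum_mod:
  assumes c: "c \<in> p_integral p" and h: "h \<in> p_integral p"
  shows "fps_I (p - 1) ((\<Sum>n=1..p-1. gauss_fps (scaled_X c) (scaled_X h) n) + scaled_X c * corner c h)"
proof -
  define F where "F C = (\<Sum>n=1..p-1. gauss_fps C (scaled_X h) n)" for C
  have "pol (p - 1) F"
    unfolding F_def
  proof (rule pol_sum)
    fix n assume n: "n \<in> {1..p-1}"
    have "inverse (of_nat n :: rat fps) = fps_const (1 / of_nat n)"
      using n by (simp add: fps_const_inverse divide_inverse flip: fps_of_nat)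
    then have "fps_R (p - 1) (inverse (of_nat n))"
      using n by (simp only:) (intro fps_R_const inverse_integral; auto)
    moreover have "fps_R (p - 1) (inverse (pochhammer (1 + scaled_X h) n))"
      unfolding pochhammer_lin inverse_prod_fps using n by (intro fps_R_prod inverse_lin_integral h) auto
    ultimately have "pol (0 + n) (\<lambda>C. inverse (of_nat n) * inverse (pochhammer (1 + scaled_X h) n) * pochhammer (0 + 1 * C) n)"
      by (intro pol_pochhammer pol_const fps_R_mult fps_R_1 fps_I_R[OF fps_I_0])
    then have "pol n (\<lambda>C. gauss_fps C (scaled_X h) n)"
      by (simp add: gauss_fps_def mult_ac)
    then show "pol (p - 1) (\<lambda>C. gauss_fps C (scaled_X h) n)" by (rule pol_mono) (use n in auto)
  qed
  then have "fps_I (p - 1) (F (scaled_X c) - F 0 - (\<Sum>j=1..p-1. F (- of_nat j) * (scaled_X c * inverse (lin (of_nat j) c))))"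
    by (rule interpolation) (rule c)
  moreover have "F 0 = 0" by (simp add: F_def gauss_fps_def pochhammer_0_left)
  moreover have "(\<Sum>j=1..p-1. F (- of_nat j) * (scaled_X c * inverse (lin (of_nat j) c))) = - (scaled_X c * corner c h)"
  proof -
    have "F (- of_nat j) = - (\<Sum>i=1..j. inverse (lin (of_nat i) h))" if "j \<in> {1..p-1}" for j
    proof -
      have "F (- of_nat j) = (\<Sum>n=1..j. gauss_fps (- of_nat j) (scaled_X h) n)"
        unfolding F_def by (rule truncate_sum) (use that in \<open>auto simp: gauss_fps_def pochhammer_of_nat_zero\<close>)
      then show ?thesis by (simp only: gauss_fps_sum_terminating sum_negf)
    qed
    then have "(\<Sum>j=1..p-1. F (- of_nat j) * (scaled_X c * inverse (lin (of_nat j) c)))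
        = (\<Sum>j=1..p-1. - (\<Sum>i=1..j. inverse (lin (of_nat i) h)) * (scaled_X c * inverse (lin (of_nat j) c)))"
      by (intro sum.cong refl) simp
    also have "\<dots> = - (scaled_X c * corner c h)"
      unfolding corner_def sum_distrib_left sum_distrib_right sum_negf[symmetric]
      by (intro sum.cong refl) (simp add: sum_distrib_right sum_negf[symmetric] mult_ac)
    finally show ?thesis .
  qed
  ultimately show ?thesis unfolding F_def by simp
qed

text \<open>The product of \<open>m + a X\<close> over a full residue system is, modulo \<open>p\<close>, independent of where the system starts;
starting at 0 it is \<open>(p - 1)! a X\<close>.\<close>

lemma pochhammer_lin_full:
  assumes a: "a \<in> p_integral p" and j: "j \<in> {1..p-1}"
  shows "fps_I (p - 1) (pochhammer (1 + scaled_X a + of_nat j) (p - 1) - fps_const (fact (p - 1)) * (scaled_X a * inverse (lin (of_nat j) a)))"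
proof -
  define Q where "Q i = pochhammer (of_nat i + scaled_X a) p" for i
  have sp: "p = Suc (p - 1)" using prime by (simp add: prime_gt_0_nat)
  have R: "fps_R (p - 1) (pochhammer (of_nat i + scaled_X a) n)" for i n
    unfolding pochhammer_prod
    by (intro fps_R_prod fps_R_add fps_R_mult fps_R_const a fps_R_X) (use of_nat_integral fps_R_const in \<open>metis fps_of_nat\<close>)+
  have step: "fps_I (p - 1) (Q (Suc i) - Q i)" for i
  proof -
    let ?P = "pochhammer (of_nat (Suc i) + scaled_X a) (p - 1)"
    have "Q (Suc i) = ?P * (of_nat (Suc i) + scaled_X a + of_nat (p - 1))"
      unfolding Q_def by (subst sp, subst pochhammer_Suc) simp
    moreover have "of_nat (Suc i) + scaled_X a + of_nat (p - 1) = (of_nat i + scaled_X a) + of_nat (Suc (p - 1))"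
      by simp
    ultimately have "Q (Suc i) = ?P * ((of_nat i + scaled_X a) + of_nat p)"
      by (simp only: sp[symmetric])
    moreover have "Q i = (of_nat i + scaled_X a) * ?P"
      unfolding Q_def by (subst sp, subst pochhammer_rec) (simp add: add_ac)
    ultimately have "Q (Suc i) - Q i = ?P * fps_const (of_nat p)"
      by (simp add: algebra_simps fps_of_nat)
    moreover have "fps_I (p - 1) (fps_const (of_nat p))"
      using of_nat_ideal[of p] by (simp add: fps_I_def I0)
    ultimately show ?thesis using R[of "Suc i" "p - 1"] by (simp add: fps_I_mult)
  qed
  have "fps_I (p - 1) (Q i - Q 0)" for i
  proof (induction i)
    case (Suc i)
    show ?case by (rule fps_I_trans[OF step Suc])
  qed (simp add: fps_I_0)
  then have Qj: "fps_I (p - 1) (Q j - Q 0)" .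
  have Q0: "Q 0 = scaled_X a * (\<Prod>m=1..p-1. lin (of_nat m) a)"
  proof -
    have "Q 0 = pochhammer (scaled_X a) (Suc (p - 1))" unfolding Q_def by (subst sp) simp
    then show ?thesis by (simp only: pochhammer_scaled_X_Suc pochhammer_lin One_nat_def prod.atLeast1_atMost_eq)
  qed
  have jl: "(of_nat j :: rat) \<noteq> 0" using j by simp
  have Qj': "Q j = lin (of_nat j) a * pochhammer (1 + scaled_X a + of_nat j) (p - 1)"
    unfolding Q_def by (subst sp, subst pochhammer_rec) (simp add: lin_of_nat add_ac)
  have "inverse (lin (of_nat j) a) * Q j = (lin (of_nat j) a * inverse (lin (of_nat j) a)) * pochhammer (1 + scaled_X a + of_nat j) (p - 1)"
    unfolding Qj' by (simp only: mult_ac)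
  then have "pochhammer (1 + scaled_X a + of_nat j) (p - 1) = inverse (lin (of_nat j) a) * Q j"
    unfolding lin_inverse[OF jl] by simp
  then have "pochhammer (1 + scaled_X a + of_nat j) (p - 1) - fps_const (fact (p - 1)) * (scaled_X a * inverse (lin (of_nat j) a))
     = inverse (lin (of_nat j) a) * ((Q j - Q 0) + scaled_X a * ((\<Prod>m=1..p-1. lin (of_nat m) a) - fps_const (fact (p - 1))))"
    unfolding Q0 by (simp only:) (simp add: algebra_simps)
  also have "fps_I (p - 1) \<dots>"
    using j by (intro fps_I_mult inverse_lin_integral fps_I_add Qj prod_lin fps_R_mult fps_R_const fps_R_X a) auto
  finally show ?thesis .
qed

text \<open>As for Gauss type sums, after multiplication by the denominator \<open>pochhammer (1 + a - C) (p - 1)\<close> to make the sum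
polynomial in \<open>C\<close>. That denominator is \<open>(p - 1)!\<close> modulo \<open>p\<close> at the point of interest, and is
handled by \<open>pochhammer_lin_full\<close> at the interpolation points. Finally
the product of two partial fractions in \<open>j\<close> is split.\<close>

lemma wp_sum_mod:
  assumes a: "a \<in> p_integral p" and c: "c \<in> p_integral p" and d: "d \<in> p_integral p"
  shows "fps_I (p - 1) (fps_const (a - c) * (\<Sum>n=1..p-1. wp_fps (scaled_X a) (scaled_X c) (scaled_X d) n)
    - scaled_X (a * c) * (corner c a - corner c (a - d) - corner a a + corner a (a - d)))"
proof -
  define K where "K n = (2 * of_nat n + scaled_X a) * inverse (of_nat n * (of_nat n + scaled_X a)) * pochhammer (scaled_X d) n
      * inverse (pochhammer (1 + scaled_X a - scaled_X d) n)" for n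
  define F where "F C = (\<Sum>n=1..p-1. K n * pochhammer C n * pochhammer (1 + scaled_X a + of_nat n - C) (p - 1 - n))" for C
  define S where "S j = (\<Sum>i=1..j. inverse (lin (of_nat i) a) - inverse (lin (of_nat i) (a - d)))" for j
  let ?w = "fps_const (fact (p - 1)) :: rat fps"
  let ?L = "\<Sum>n=1..p-1. wp_fps (scaled_X a) (scaled_X c) (scaled_X d) n"
  have Rn: "fps_R (p - 1) (of_nat n)" for n
    using fps_R_const[OF of_nat_integral] by (simp add: fps_of_nat)
  have Ra: "fps_R (p - 1) (scaled_X a)" "fps_R (p - 1) (scaled_X c)" "fps_R (p - 1) (scaled_X d)"
    by (intro fps_R_mult fps_R_const fps_R_X a c d)+
  have "pol (p - 1) F"
    unfolding F_def
  proof (rule pol_sum)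
    fix n assume n: "n \<in> {1..p-1}"
    have "inverse (of_nat n :: rat fps) = fps_const (1 / of_nat n)"
      using n by (simp add: fps_const_inverse divide_inverse flip: fps_of_nat)
    then have 1: "fps_R (p - 1) (inverse (of_nat n))"
      using n by (simp only:) (intro fps_R_const inverse_integral; auto)
    have 2: "fps_R (p - 1) (inverse (of_nat n + scaled_X a))"
      unfolding lin_of_nat[symmetric] using n by (intro inverse_lin_integral a) auto
    have m: "1 + scaled_X a - scaled_X d = 1 + scaled_X (a - d)" by (simp add: scaled_X_diff)
    have 3: "fps_R (p - 1) (inverse (pochhammer (1 + scaled_X a - scaled_X d) n))"
      unfolding m pochhammer_lin inverse_prod_fps using n by (intro fps_R_prod inverse_lin_integral R_diff a d) auto
    have "fps_R (p - 1) (2 * of_nat n + scaled_X a)"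
      using fps_R_add[OF fps_R_mult[OF Rn[of 2] Rn[of n]] Ra(1)] by simp
    moreover have "fps_R (p - 1) (pochhammer (scaled_X d) n)"
      unfolding pochhammer_prod by (intro fps_R_prod fps_R_add Rn Ra)
    ultimately have "fps_R (p - 1) (K n)"
      unfolding K_def fps_inverse_mult by (intro fps_R_mult 1 2 3)
    then have "pol (0 + n + (p - 1 - n)) (\<lambda>C. K n * pochhammer (0 + 1 * C) n * pochhammer ((1 + scaled_X a + of_nat n) + (- 1) * C) (p - 1 - n))"
      by (intro pol_pochhammer pol_const fps_R_1 fps_R_add fps_R_uminus Rn Ra fps_I_R[OF fps_I_0])
    moreover have "0 + n + (p - 1 - n) = p - 1" using n by auto
    ultimately show "pol (p - 1) (\<lambda>C. K n * pochhammer C n * pochhammer (1 + scaled_X a + of_nat n - C) (p - 1 - n))"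
      by (simp only:) simp
  qed
  then have 1: "fps_I (p - 1) (F (scaled_X c) - F 0 - (\<Sum>j=1..p-1. F (- of_nat j) * (scaled_X c * inverse (lin (of_nat j) c))))"
    by (rule interpolation) (rule c)
  have F0: "F 0 = 0" by (simp add: F_def pochhammer_0_left)
  have F: "F C = pochhammer (1 + scaled_X a - C) (p - 1) * (\<Sum>n=1..p-1. wp_fps (scaled_X a) C (scaled_X d) n)"
    if nz: "\<And>n. pochhammer (1 - C $ 0) n \<noteq> 0" for C
    unfolding F_def sum_distrib_left
  proof (intro sum.cong refl)
    fix n assume n: "n \<in> {1..p-1}"
    have "pochhammer (1 + scaled_X a - C) (p - 1) = pochhammer (1 + scaled_X a - C) n * pochhammer (1 + scaled_X a + of_nat n - C) (p - 1 - n)"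
      using pochhammer_product[of n "p - 1" "1 + scaled_X a - C"] n by (simp add: algebra_simps)
    moreover have "pochhammer (1 + scaled_X a - C) n * inverse (pochhammer (1 + scaled_X a - C) n) = 1"
      using nz[of n] by (intro inverse_mult_eq_1') (simp add: pochhammer_fps_nth_0)
    moreover have "x * y * inverse x = (x * inverse x) * y" for x y :: "rat fps" by (simp only: mult_ac)
    ultimately have E1: "pochhammer (1 + scaled_X a - C) (p - 1) * inverse (pochhammer (1 + scaled_X a - C) n) = pochhammer (1 + scaled_X a + of_nat n - C) (p - 1 - n)"
      by (simp only: mult_1_left)
    show "K n * pochhammer C n * pochhammer (1 + scaled_X a + of_nat n - C) (p - 1 - n) = pochhammer (1 + scaled_X a - C) (p - 1) * wp_fps (scaled_X a) C (scaled_X d) n"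
      unfolding E1[symmetric] K_def wp_fps_def by (simp only: mult_ac)
  qed
  have Fc: "F (scaled_X c) = (\<Prod>m=1..p-1. lin (of_nat m) (a - c)) * ?L"
  proof -
    have "F (scaled_X c) = pochhammer (1 + scaled_X (a - c)) (p - 1) * ?L"
      using F[of "scaled_X c"] by (simp add: pochhammer_1_nonzero scaled_X_diff add_diff_eq)
    then show ?thesis by (simp only: pochhammer_lin One_nat_def prod.atLeast1_atMost_eq)
  qed
  have Fj: "F (- of_nat j) = pochhammer (1 + scaled_X a + of_nat j) (p - 1) * S j" if "j \<in> {1..p-1}" for j
  proof -
    have "F (- of_nat j) = pochhammer (1 + scaled_X a - - of_nat j) (p - 1) * (\<Sum>n=1..p-1. wp_fps (scaled_X a) (- of_nat j) (scaled_X d) n)"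
      by (rule F) (simp add: of_nat_fps_nth_0 pochhammer_Suc_of_nat_nonzero)
    also have "(\<Sum>n=1..p-1. wp_fps (scaled_X a) (- of_nat j) (scaled_X d) n) = (\<Sum>n=1..j. wp_fps (scaled_X a) (- of_nat j) (scaled_X d) n)"
      by (rule truncate_sum) (use that in \<open>auto simp: wp_fps_def pochhammer_of_nat_zero\<close>)
    also have "\<dots> = S j" unfolding S_def by (rule wp_fps_sum_terminating)
    finally show ?thesis by simp
  qed
  define W where "W = (\<Sum>j=1..p-1. (scaled_X a * inverse (lin (of_nat j) a)) * S j * (scaled_X c * inverse (lin (of_nat j) c)))"
  have RS: "fps_R (p - 1) (S j)" if "j \<in> {1..p-1}" for j
    unfolding S_def using that by (intro fps_R_sum fps_R_diff inverse_lin_integral R_diff a d) auto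
  have 2: "fps_I (p - 1) ((\<Sum>j=1..p-1. F (- of_nat j) * (scaled_X c * inverse (lin (of_nat j) c))) - ?w * W)"
  proof -
    have "(\<Sum>j=1..p-1. F (- of_nat j) * (scaled_X c * inverse (lin (of_nat j) c))) - ?w * W
      = (\<Sum>j=1..p-1. (pochhammer (1 + scaled_X a + of_nat j) (p - 1) - ?w * (scaled_X a * inverse (lin (of_nat j) a))) * (S j * (scaled_X c * inverse (lin (of_nat j) c))))"
      unfolding W_def sum_distrib_left sum_subtractf[symmetric] by (intro sum.cong refl) (simp add: Fj algebra_simps)
    also have "fps_I (p - 1) \<dots>"
      by (intro fps_I_sum fps_I_mult_right pochhammer_lin_full a fps_R_mult[of _ "S _"] RS fps_R_mult[OF Ra(2)] inverse_lin_integral c) auto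
    finally show ?thesis .
  qed
  have RL: "fps_R (p - 1) ?L"
  proof (intro fps_R_sum)
    fix n assume n: "n \<in> {1..p-1}"
    then obtain m where m: "n = Suc m" by (cases n) auto
    have i: "inverse (of_nat (Suc m) :: rat fps) = fps_const (1 / of_nat (Suc m))"
      by (simp add: fps_const_inverse divide_inverse del: of_nat_Suc flip: fps_of_nat)
    have "fps_R (p - 1) (2 * of_nat n + scaled_X a)"
      using fps_R_add[OF fps_R_mult[OF Rn[of 2] Rn[of n]] Ra(1)] by simp
    moreover have "fps_R (p - 1) (inverse (of_nat n * (of_nat n + scaled_X a)))"
      unfolding fps_inverse_mult lin_of_nat[symmetric] using n inverse_integral[of n] 
      unfolding m i by (intro fps_R_mult fps_R_const inverse_lin_integral a) auto
    moreover have "fps_R (p - 1) (inverse (pochhammer (1 + scaled_X (a - u)) n))" if "u \<in> p_integral p" for u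
      unfolding pochhammer_lin inverse_prod_fps using n that by (intro fps_R_prod inverse_lin_integral R_diff a) auto
    moreover have "fps_R (p - 1) (pochhammer (scaled_X u) n)" if "u \<in> p_integral p" for u
      unfolding pochhammer_prod by (intro fps_R_prod fps_R_add Rn fps_R_mult[OF fps_R_const[OF that] fps_R_X])
    moreover have m: "1 + scaled_X a - scaled_X u = 1 + scaled_X (a - u)" for u by (simp add: scaled_X_diff)
    ultimately show "fps_R (p - 1) (wp_fps (scaled_X a) (scaled_X c) (scaled_X d) n)"
      unfolding wp_fps_def m using c d by (intro fps_R_mult; simp only:)
  qed
  have "fps_I (p - 1) ((\<Prod>m=1..p-1. lin (of_nat m) (a - c)) * ?L - ?w * W)"
    using fps_I_trans[OF 1[unfolded F0 diff_zero] 2] unfolding Fc .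
  moreover have "fps_I (p - 1) (((\<Prod>m=1..p-1. lin (of_nat m) (a - c)) - ?w) * ?L)"
    by (intro fps_I_mult_right prod_lin R_diff a c RL)
  ultimately have "fps_I (p - 1) (((\<Prod>m=1..p-1. lin (of_nat m) (a - c)) * ?L - ?w * W) - (((\<Prod>m=1..p-1. lin (of_nat m) (a - c)) - ?w) * ?L))"
    by (rule fps_I_diff)
  then have "fps_I (p - 1) (?w * (?L - W))" by (simp add: algebra_simps)
  from fps_I_mult[OF fps_R_const[OF fact_unit] this]
  have "fps_I (p - 1) ((fps_const (1 / fact (p - 1)) * ?w) * (?L - W))" by (simp only: mult.assoc)
  then have "fps_I (p - 1) (?L - W)" by simp
  then have "fps_I (p - 1) (fps_const (a - c) * (?L - W))"
    by (rule fps_I_mult[OF fps_R_const[OF R_diff[OF a c]]])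
  moreover have "fps_const (a - c) * W = scaled_X (a * c) * (corner c a - corner c (a - d) - corner a a + corner a (a - d))"
  proof -
    have pf: "scaled_X (a - c) * (inverse (lin (of_nat j) a) * inverse (lin (of_nat j) c)) = inverse (lin (of_nat j) c) - inverse (lin (of_nat j) a)"
      if "j \<in> {1..p-1}" for j
    proof -
      have j: "(of_nat j :: rat) \<noteq> 0" using that by simp
      let ?A = "lin (of_nat j) a :: rat fps" and ?C = "lin (of_nat j) c :: rat fps"
      have "scaled_X (a - c) = ?A - ?C" unfolding lin_of_nat scaled_X_diff by simp
      then have "scaled_X (a - c) * (inverse ?A * inverse ?C) = (?A * inverse ?A) * inverse ?C - inverse ?A * (?C * inverse ?C)"
        by (simp only:) (simp add: algebra_simps)
      then show ?thesis by (simp add: lin_inverse[OF j])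
    qed
    have "fps_const (a - c) * W = scaled_X (a * c) * (\<Sum>j=1..p-1. (scaled_X (a - c) * (inverse (lin (of_nat j) a) * inverse (lin (of_nat j) c))) * S j)"
    proof -
      have "scaled_X (a * c) = fps_const a * scaled_X c" by (simp flip: fps_const_mult add: mult_ac)
      then show ?thesis unfolding W_def sum_distrib_left by (intro sum.cong refl) (simp only: mult_ac)
    qed
    also have "(\<Sum>j=1..p-1. (scaled_X (a - c) * (inverse (lin (of_nat j) a) * inverse (lin (of_nat j) c))) * S j)
        = (\<Sum>j=1..p-1. (inverse (lin (of_nat j) c) - inverse (lin (of_nat j) a)) * S j)"
      by (intro sum.cong refl) (simp only: pf)
    also have "\<dots> = corner c a - corner c (a - d) - corner a a + corner a (a - d)"
      unfolding S_def corner_def sum_distrib_left sum_subtractf[symmetric] sum.distrib[symmetric]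
      by (intro sum.cong refl) (simp add: algebra_simps)
    finally show ?thesis .
  qed
  ultimately show ?thesis by (simp add: right_diff_distrib)
qed

end

section \<open>Marked generating functions modulo a prime\<close>

context prime_modulus
begin

lemma prod_lin_quot_mod:
  assumes u: "u \<in> p_integral p" and v: "v \<in> p_integral p"
  shows "fps_I (p - 1) (prod_list (map (lin_quot u v) (pos_list (p - 1))) - 1)"
proof -
  let ?P = "\<lambda>u. \<Prod>m=1..p-1. lin (of_nat m :: rat) u"
  have "?P v * (\<Prod>m=1..p-1. inverse (lin (of_nat m) v)) = 1"
    unfolding prod.distrib[symmetric] by (intro prod.neutral ballI lin_inverse) auto
  then have "prod_list (map (lin_quot u v) (pos_list (p - 1))) - 1 = ((?P u - fps_const (fact (p - 1))) - (?P v - fps_const (fact (p - 1)))) * (\<Prod>m=1..p-1. inverse (lin (of_nat m) v))"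
    unfolding prod_pos_list lin_quot_def prod.distrib by (simp add: algebra_simps)
  also have "fps_I (p - 1) \<dots>"
    by (intro fps_I_mult_right fps_I_diff prod_lin u v fps_R_prod inverse_lin_integral) auto
  finally show ?thesis .
qed

text \<open>The product over all nonzero residues is 1 modulo \<open>p\<close>, so only the hypergeometric sum matters. Its coefficient is
a combination of four corner sums; for odd \<open>k\<close> this combination is \<open>kappa_main\<close>, and for even \<open>k\<close>
everything vanishes with \<open>Z k\<close>.\<close>

lemma marked_main_mod:
  assumes al: "\<alpha> \<in> p_integral p" "1 / (1 - \<alpha>) \<in> p_integral p" "1 / (1 + \<alpha>) \<in> p_integral p"
    and be: "\<beta> \<in> p_integral p" "1 / (1 - \<beta>) \<in> p_integral p" "1 / (1 + \<beta>) \<in> p_integral p"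
    and nz: "1 - \<alpha> \<noteq> 0" "1 + \<alpha> \<noteq> 0" "1 - \<beta> \<noteq> 0" "1 + \<beta> \<noteq> 0"
    and k: "2 \<le> k" "k < p - 1"
  shows "marked_gf (2 * \<alpha>) (2 * \<beta>) w_main (pos_list (p - 1)) $ k - (if odd k then kappa_main \<alpha> \<beta> k else 0) * Z k \<in> p_ideal p"
proof -
  define a c d where "a = (-2 :: rat)" and "c = \<alpha> - 1" and "d = - 1 - \<beta>"
  have R2: "2 \<in> p_integral p" "1/2 \<in> p_integral p"
    using of_nat_integral[of 2] inverse_integral[of 2] k by simp_all
  have R: "a \<in> p_integral p" "c \<in> p_integral p" "d \<in> p_integral p" "a - d \<in> p_integral p" "a - c \<in> p_integral p" "a * c \<in> p_integral p"
    unfolding a_def c_def d_def by (intro R_uminus R_diff R_mult R1 R2 al be)+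
  let ?M = "marked_gf (2 * \<alpha>) (2 * \<beta>) w_main (pos_list (p - 1))"
  let ?P = "prod_list (map (lin_quot (- 1 + \<beta>) (- 1 - \<beta>)) (pos_list (p - 1)))"
  let ?L = "\<Sum>n=1..p-1. wp_fps (scaled_X a) (scaled_X c) (scaled_X d) n"
  define G where "G = corner c a - corner c (a - d) - corner a a + corner a (a - d)"
  have M: "fps_const (2 * (c * d)) * ?M = ?P * (fps_X * ?L)"
    using marked_main_pos[of "2 * \<alpha>" "2 * \<beta>" "p - 1"] by (simp add: a_def c_def d_def)
  have P: "fps_I (p - 1) (?P - 1)"
    by (intro prod_lin_quot_mod R_diff R_add R_uminus R1 be)
  have PR: "fps_R (p - 1) ?P"
    using fps_R_add[OF fps_I_R[OF P] fps_R_1] by simp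
  have G: "fps_R (p - 1) (scaled_X (a * c) * G)"
    unfolding G_def by (intro fps_R_mult fps_R_const fps_R_X fps_R_add fps_R_diff corner_integral R)
  have "fps_const (a - c) * (fps_const (2 * (c * d)) * ?M) - fps_X * (scaled_X (a * c) * G)
     = ?P * (fps_X * (fps_const (a - c) * ?L - scaled_X (a * c) * G)) + (?P - 1) * (fps_X * (scaled_X (a * c) * G))"
    unfolding M by (simp add: algebra_simps)
  also have "fps_I (p - 1) \<dots>"
    unfolding G_def
    by (intro fps_I_add fps_I_mult[OF PR] fps_I_mult[OF fps_R_X] wp_sum_mod R fps_I_mult_right[OF P] fps_R_mult[OF fps_R_X] G[unfolded G_def])
  finally have "(fps_const (a - c) * (fps_const (2 * (c * d)) * ?M) - fps_X * (scaled_X (a * c) * G)) $ k \<in> p_ideal p"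
    using k(2) unfolding fps_I_def by blast
  moreover have "(fps_X * (scaled_X (a * c) * G)) $ k = a * c * G $ (k - 2)"
    using k by (simp add: mult.assoc numeral_2_eq_2)
  ultimately have m: "(a - c) * (2 * (c * d)) * ?M $ k - a * c * G $ (k - 2) \<in> p_ideal p"
    by (simp add: mult.assoc)
  define E where "E s t = (s - t) ^ k - s ^ k - (- t) ^ k" for s t :: rat
  define e where "e s t = s * t * corner s t $ (k - 2) - E s t * Z k" for s t
  have e: "e s t \<in> p_ideal p" if "s \<in> p_integral p" "t \<in> p_integral p" for s t
    unfolding e_def E_def using that k by (intro corner_nth)
  define u where "u = 1 / ((a - c) * (2 * (c * d)))"
  have nz': "a - c \<noteq> 0" "c \<noteq> 0" "d \<noteq> 0" "a \<noteq> 0" "a - d \<noteq> 0"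
    using nz by (auto simp: a_def c_def d_def)
  have uR: "u \<in> p_integral p"
  proof -
    have "u = - ((1 / 2) * ((1 / (1 + \<alpha>)) * ((1 / (1 - \<alpha>)) * (1 / (1 + \<beta>)))))"
      using nz unfolding u_def a_def c_def d_def by (simp add: divide_simps) (simp add: algebra_simps)
    also have "\<dots> \<in> p_integral p" by (intro R_uminus R_mult R2 al be)
    finally show ?thesis .
  qed
  have q: "a / (a - d) \<in> p_integral p" "c / a \<in> p_integral p" "c / (a - d) \<in> p_integral p"
  proof -
    have "a / (a - d) = 2 * (1 / (1 - \<beta>))" "c / a = (1 - \<alpha>) * (1 / 2)" "c / (a - d) = (1 - \<alpha>) * (1 / (1 - \<beta>))"
      using nz nz' unfolding a_def c_def d_def by (simp_all add: divide_simps) (simp_all add: algebra_simps)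
    then show "a / (a - d) \<in> p_integral p" "c / a \<in> p_integral p" "c / (a - d) \<in> p_integral p"
      by (simp_all only: R_mult R_diff R1 R2 al be)
  qed
  define \<kappa> where "\<kappa> = u * (E c a - a / (a - d) * E c (a - d) - c / a * E a a + c / (a - d) * E a (a - d))"
  have "?M $ k - \<kappa> * Z k = u * (((a - c) * (2 * (c * d)) * ?M $ k - a * c * G $ (k - 2))
      + (e c a - a / (a - d) * e c (a - d) - c / a * e a a + c / (a - d) * e a (a - d)))"
  proof -
    have "u * ((a - c) * (2 * (c * d)) * ?M $ k) = ?M $ k" using nz' unfolding u_def by simp
    moreover have "a / (a - d) * e c (a - d) = a * c * corner c (a - d) $ (k - 2) - a / (a - d) * E c (a - d) * Z k"
      "c / a * e a a = a * c * corner a a $ (k - 2) - c / a * E a a * Z k"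
      "c / (a - d) * e a (a - d) = a * c * corner a (a - d) $ (k - 2) - c / (a - d) * E a (a - d) * Z k"
      "e c a = a * c * corner c a $ (k - 2) - E c a * Z k"
      using nz' unfolding e_def by (simp_all add: field_simps)
    moreover have "G $ (k - 2) = corner c a $ (k - 2) - corner c (a - d) $ (k - 2) - corner a a $ (k - 2) + corner a (a - d) $ (k - 2)"
      by (simp add: G_def)
    ultimately show ?thesis unfolding \<kappa>_def by (simp only:) (simp add: algebra_simps)
  qed
  also have "\<dots> \<in> p_ideal p"
    by (intro I_mult[OF uR] I_add m I_diff e R I_mult[OF q(1)] I_mult[OF q(2)] I_mult[OF q(3)])
  finally have main: "?M $ k - \<kappa> * Z k \<in> p_ideal p" .
  show ?thesis
  proof (cases "odd k")
    case True
    then obtain K where K: "k = Suc K" "even K" using k by (metis One_nat_def even_Suc odd_pos Suc_pred)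
    have pw: "(\<alpha> - 1) ^ K = (1 - \<alpha>) ^ K" "(- 1 - \<beta>) ^ K = (1 + \<beta>) ^ K" "(- 2) ^ K = (2 :: rat) ^ K" "(\<beta> - \<alpha>) ^ K = (\<alpha> - \<beta>) ^ K"
      using power_minus_even[OF K(2), of "1 - \<alpha>"] power_minus_even[OF K(2), of "1 + \<beta>"] power_minus_even[OF K(2), of 2]
        power_minus_even[OF K(2), of "\<alpha> - \<beta>"] K(2) by simp_all
    have E: "E c a = (1 + \<alpha>) * (1 + \<alpha>) ^ K + (1 - \<alpha>) * (1 - \<alpha>) ^ K - 2 * 2 ^ K"
      "E c (a - d) = (\<alpha> - \<beta>) * (\<alpha> - \<beta>) ^ K + (1 - \<alpha>) * (1 - \<alpha>) ^ K - (1 - \<beta>) * (1 - \<beta>) ^ K"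
      "E a a = 0" "E a (a - d) = - (1 + \<beta>) * (1 + \<beta>) ^ K + 2 * 2 ^ K - (1 - \<beta>) * (1 - \<beta>) ^ K"
    proof -
      have r: "c - a = 1 + \<alpha>" "- a = 2" "c - (a - d) = \<alpha> - \<beta>" "- (a - d) = 1 - \<beta>" "a - (a - d) = - 1 - \<beta>" "a - a = 0"
        unfolding a_def c_def d_def by simp_all
      show "E c a = (1 + \<alpha>) * (1 + \<alpha>) ^ K + (1 - \<alpha>) * (1 - \<alpha>) ^ K - 2 * 2 ^ K"
        "E c (a - d) = (\<alpha> - \<beta>) * (\<alpha> - \<beta>) ^ K + (1 - \<alpha>) * (1 - \<alpha>) ^ K - (1 - \<beta>) * (1 - \<beta>) ^ K"
        "E a a = 0" "E a (a - d) = - (1 + \<beta>) * (1 + \<beta>) ^ K + 2 * 2 ^ K - (1 - \<beta>) * (1 - \<beta>) ^ K"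
        unfolding E_def r K(1) power_Suc unfolding a_def c_def pw by (simp_all add: algebra_simps)
    qed
    have pw2: "(- \<alpha> - - \<beta>) ^ K = (\<alpha> - \<beta>) ^ K" using pw(4) by simp
    have "\<kappa> = kappa_main \<alpha> \<beta> k"
    proof -
      define T P' Q S U V where "T = (2 :: rat) ^ K" and "P' = (1 + \<alpha>) ^ K" and "Q = (1 - \<alpha>) ^ K" and "S = (1 - \<beta>) ^ K" and "U = (1 + \<beta>) ^ K" and "V = (\<alpha> - \<beta>) ^ K"
      have e1: "a / (a - d) = 2 / (1 - \<beta>)" "c / (a - d) = (1 - \<alpha>) / (1 - \<beta>)" "u = - 1 / (2 * (1 + \<alpha>) * (1 - \<alpha>) * (1 + \<beta>))"
        using nz nz' unfolding u_def a_def c_def d_def by (simp_all add: divide_simps) (simp_all add: algebra_simps)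
      have "kappa_main \<alpha> \<beta> k = ((T + V - P' - S) / ((1 - \<alpha>) * (1 + \<beta>)) - (T + V - Q - U) / ((1 + \<alpha>) * (1 - \<beta>))) / 2"
        unfolding kappa_main_def bracket_def K(1) diff_Suc_1 pw2 T_def P'_def Q_def S_def U_def V_def by simp
      moreover have "\<kappa> = - 1 / (2 * (1 + \<alpha>) * (1 - \<alpha>) * (1 + \<beta>)) * ((1 + \<alpha>) * P' + (1 - \<alpha>) * Q - 2 * T
         - 2 / (1 - \<beta>) * ((\<alpha> - \<beta>) * V + (1 - \<alpha>) * Q - (1 - \<beta>) * S)
         + (1 - \<alpha>) / (1 - \<beta>) * (- (1 + \<beta>) * U + 2 * T - (1 - \<beta>) * S))"
        unfolding \<kappa>_def E e1 T_def P'_def Q_def S_def U_def V_def by simp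
      moreover have "\<dots> = ((T + V - P' - S) / ((1 - \<alpha>) * (1 + \<beta>)) - (T + V - Q - U) / ((1 + \<alpha>) * (1 - \<beta>))) / 2"
        using nz by (simp add: divide_simps) (simp add: algebra_simps)
      ultimately show ?thesis by (simp only:)
    qed
    with main True show ?thesis by simp
  next
    case False
    have "\<kappa> \<in> p_integral p"
      unfolding \<kappa>_def E_def by (intro R_mult R_add R_diff R_power R_uminus uR q R)
    then have "\<kappa> * Z k \<in> p_ideal p" using False k by (intro I_mult Z_even) auto
    from I_add[OF main this] show ?thesis using False by simp
  qed
qed

lemma marked_sum_mod:
  assumes al: "\<alpha> \<in> p_integral p" "1 / (1 - \<alpha>) \<in> p_integral p" "1 / (1 + \<alpha>) \<in> p_integral p"
    and nz: "1 - \<alpha> \<noteq> 0" "1 + \<alpha> \<noteq> 0"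
    and k: "2 \<le> k" "k < p - 1"
  shows "marked_gf (2 * \<alpha>) 0 w_sum (pos_list (p - 1)) $ k - (if odd k then kappa_sum \<alpha> k else 0) * Z k \<in> p_ideal p"
proof -
  define c h where "c = \<alpha> - 1" and "h = - 1 - \<alpha>"
  have R2: "2 \<in> p_integral p" using of_nat_integral[of 2] by simp
  have R: "c \<in> p_integral p" "h \<in> p_integral p"
    unfolding c_def h_def by (intro R_uminus R_diff R1 al)+
  let ?M = "marked_gf (2 * \<alpha>) 0 w_sum (pos_list (p - 1))"
  let ?L = "\<Sum>n=1..p-1. gauss_fps (scaled_X c) (scaled_X h) n"
  have M: "fps_const c * ?M = fps_X * ?L"
    using marked_sum_pos[of "2 * \<alpha>" "p - 1"] by (simp add: c_def h_def)
  have "fps_const c * ?M + fps_X * (scaled_X c * corner c h) = fps_X * (?L + scaled_X c * corner c h)"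
    unfolding M by (simp add: algebra_simps)
  also have "fps_I (p - 1) \<dots>" by (intro fps_I_mult fps_R_X gauss_sum_mod R)
  finally have "(fps_const c * ?M + fps_X * (scaled_X c * corner c h)) $ k \<in> p_ideal p"
    using k(2) unfolding fps_I_def by blast
  moreover have "(fps_X * (scaled_X c * corner c h)) $ k = c * corner c h $ (k - 2)"
    using k by (simp add: mult.assoc numeral_2_eq_2)
  ultimately have m: "c * ?M $ k + c * corner c h $ (k - 2) \<in> p_ideal p" by simp
  define E where "E = (c - h) ^ k - c ^ k - (- h) ^ k"
  have e: "c * h * corner c h $ (k - 2) - E * Z k \<in> p_ideal p"
    unfolding E_def using k by (intro corner_nth R)
  have nz': "c \<noteq> 0" "h \<noteq> 0" using nz by (auto simp: c_def h_def)
  have inv: "1 / c = - (1 / (1 - \<alpha>))" "1 / h = - (1 / (1 + \<alpha>))"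
    using nz nz' unfolding c_def h_def by (simp_all add: divide_simps)
  have uR: "1 / c \<in> p_integral p" "1 / h \<in> p_integral p"
    unfolding inv by (intro R_uminus al)+
  define \<kappa> where "\<kappa> = - ((1 / c) * ((1 / h) * E))"
  have "?M $ k - \<kappa> * Z k = (1 / c) * ((c * ?M $ k + c * corner c h $ (k - 2)) - (1 / h) * (c * h * corner c h $ (k - 2) - E * Z k))"
    using nz' unfolding \<kappa>_def by (simp add: field_simps)
  also have "\<dots> \<in> p_ideal p"
    by (intro I_mult[OF uR(1)] I_diff m I_mult[OF uR(2)] e)
  finally have main: "?M $ k - \<kappa> * Z k \<in> p_ideal p" .
  show ?thesis
  proof (cases "odd k")
    case True
    then obtain K where K: "k = Suc K" "even K" using k by (metis One_nat_def even_Suc odd_pos Suc_pred)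
    have pw: "(\<alpha> - 1) ^ K = (1 - \<alpha>) ^ K"
      using power_minus_even[OF K(2), of "1 - \<alpha>"] by simp
    have r: "c - h = 2 * \<alpha>" "- h = 1 + \<alpha>" unfolding c_def h_def by simp_all
    have E: "E = 2 * \<alpha> * (2 * \<alpha>) ^ K + (1 - \<alpha>) * (1 - \<alpha>) ^ K - (1 + \<alpha>) * (1 + \<alpha>) ^ K"
      unfolding E_def r K(1) power_Suc unfolding c_def pw by (simp add: algebra_simps)
    have "\<kappa> = kappa_sum \<alpha> k"
    proof -
      define P' Q Y where "P' = (1 + \<alpha>) ^ K" and "Q = (1 - \<alpha>) ^ K" and "Y = (2 * \<alpha>) ^ K"
      have "kappa_sum \<alpha> k = (P' - Y) / (1 - \<alpha>) + (Y - Q) / (1 + \<alpha>)"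
        unfolding kappa_sum_def K(1) diff_Suc_1 P'_def Q_def Y_def by simp
      moreover have "\<kappa> = - ((1 / (1 - \<alpha>)) * ((1 / (1 + \<alpha>)) * (2 * \<alpha> * Y + (1 - \<alpha>) * Q - (1 + \<alpha>) * P')))"
        unfolding \<kappa>_def E inv P'_def Q_def Y_def by simp
      moreover have "\<dots> = (P' - Y) / (1 - \<alpha>) + (Y - Q) / (1 + \<alpha>)"
        using nz by (simp add: divide_simps) (simp add: algebra_simps)
      ultimately show ?thesis by (simp only:)
    qed
    with main True show ?thesis by simp
  next
    case False
    have "\<kappa> \<in> p_integral p"
      unfolding \<kappa>_def E_def by (intro R_mult R_add R_diff R_power R_uminus uR R)
    then have "\<kappa> * Z k \<in> p_ideal p" using False k by (intro I_mult Z_even) auto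
    from I_add[OF main this] show ?thesis using False by simp
  qed
qed

lemma chain_sum_integral: "chain_sum (pos_list (p - 1)) ks \<in> p_integral p"
proof -
  have *: "chain_sum M ks \<in> p_integral p" if "\<And>m. m \<in> set M \<Longrightarrow> 1 / m \<in> p_integral p" for M :: "rat list" and ks
    using that
  proof (induction M ks rule: chain_sum.induct)
    case (3 m M k ks)
    have "chain_sum M ks / m ^ k = chain_sum M ks * (1 / m) ^ k" by (simp add: power_one_over)
    moreover have "\<dots> \<in> p_integral p" using 3 by (intro R_mult R_power) auto
    ultimately show ?case using 3 by (simp add: R_add)
  qed (simp_all add: R0 R1)
  show ?thesis
  proof (rule *)
    fix m :: rat assume "m \<in> set (pos_list (p - 1))"
    then obtain n where "m = of_nat n" "0 < n" "n < p" by (auto simp: pos_list_def simp del: upt_Suc)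
    then show "1 / m \<in> p_integral p" by (simp add: inverse_integral)
  qed
qed

lemma p_integral_denominator: "q \<in> p_integral p \<Longrightarrow> \<not> int p dvd snd (quotient_of q)"
proof -
  assume "q \<in> p_integral p"
  then obtain a b where ab: "q = of_int a / of_int b" "\<not> int p dvd b" unfolding p_integral_def by auto
  obtain n d where nd: "quotient_of q = (n, d)" by fastforce
  have d: "d > 0" "coprime n d" "q = of_int n / of_int d"
    using quotient_of_denom_pos[OF nd] quotient_of_coprime[OF nd] quotient_of_div[OF nd] by auto
  have b: "b \<noteq> 0" using ab by auto
  have "(of_int (n * b) :: rat) = of_int (a * d)"
    using ab(1) d b by (simp add: field_simps)
  then have "n * b = a * d" by (simp only: of_int_eq_iff)
  then have "d dvd b"
    using d(2) by (metis coprime_commute coprime_dvd_mult_right_iff dvd_triv_right)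
  then show ?thesis using ab(2) dvd_trans nd by auto
qed

lemma rat_mod_cong:
  assumes "x - y \<in> p_ideal p" "y \<in> p_integral p"
  shows "[rat_mod p x = rat_mod p y] (mod int p)"
proof -
  obtain r where r: "x - y = of_nat p * r" "r \<in> p_integral p" using assms(1) unfolding p_ideal_def by auto
  have d: "\<not> int p dvd snd (quotient_of y)" "\<not> int p dvd snd (quotient_of r)" "\<not> int p dvd snd (quotient_of (of_nat p))"
    "\<not> int p dvd snd (quotient_of (of_nat p * r))"
    by (intro p_integral_denominator assms r of_nat_integral R_mult)+
  have "[rat_mod p (of_nat p) = 0] (mod int p)"
    by (rule rat_mod_unique[OF prime, of _ "int p" 1]) (use prime in \<open>auto simp: cong_def dest: prime_gt_1_nat\<close>)
  then have "[rat_mod p (of_nat p) * rat_mod p r = 0 * rat_mod p r] (mod int p)" by (intro cong_mult cong_refl)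
  then have "[rat_mod p (of_nat p * r) = 0] (mod int p)"
    using rat_mod_add_mult(2)[OF prime d(3,2)] cong_trans by fastforce
  then have "[rat_mod p y + rat_mod p (of_nat p * r) = rat_mod p y + 0] (mod int p)" by (intro cong_add cong_refl)
  moreover have "x = y + of_nat p * r" using r(1) by (simp add: algebra_simps)
  ultimately show ?thesis using rat_mod_add_mult(1)[OF prime d(1,4)] cong_trans by fastforce
qed

end

section \<open>From generating functions to weighted sums\<close>

lemma scaleQ_0_left [simp]: "0 *\<^sub>Q (x :: 'v::rat_algebra) = 0"
  using scaleQ_add_left[of 0 0 x] by simp

lemma scaleQ_0_right [simp]: "a *\<^sub>Q (0 :: 'v::rat_algebra) = 0"
  using scaleQ_add_right[of a 0 "0::'v"] by simp

lemma scaleQ_diff_right: "a *\<^sub>Q (x - y :: 'v::rat_algebra) = a *\<^sub>Q x - a *\<^sub>Q y"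
  using scaleQ_add_right[of a "x - y" y] by (simp add: eq_diff_eq)

lemma scaleQ_diff_left: "(a - b) *\<^sub>Q (x :: 'v::rat_algebra) = a *\<^sub>Q x - b *\<^sub>Q x"
  using scaleQ_add_left[of "a - b" b x] by (simp add: eq_diff_eq)

lemma scaleQ_sum_right: "a *\<^sub>Q (\<Sum>i\<in>S. f i :: 'v::rat_algebra) = (\<Sum>i\<in>S. a *\<^sub>Q f i)"
  by (induction S rule: infinite_finite_induct) (simp_all add: scaleQ_add_right)

lemma scaleQ_sum_left: "(\<Sum>i\<in>S. f i) *\<^sub>Q (x :: 'v::rat_algebra) = (\<Sum>i\<in>S. f i *\<^sub>Q x)"
  by (induction S rule: infinite_finite_induct) (simp_all add: scaleQ_add_left)

lemma scaleQ_eq_0: "a *\<^sub>Q (x :: 'v::rat_algebra) = 0 \<Longrightarrow> a \<noteq> 0 \<Longrightarrow> x = 0"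
  using scaleQ_scaleQ[of "1 / a" a x] by (simp add: scaleQ_one)

text \<open>Vandermonde's argument in a rational vector space: subtracting the value at one point and dividing
by \<open>y - y0\<close> lowers the degree, and keeps the top coefficient.\<close>

lemma coefficients_unique:
  fixes v :: "nat \<Rightarrow> 'v::rat_algebra"
  assumes "infinite Y" "\<And>y. y \<in> Y \<Longrightarrow> (\<Sum>i<D. y ^ i *\<^sub>Q v i) = 0" "i < D"
  shows "v i = 0"
  using assms
proof (induction D arbitrary: v Y i)
  case (Suc D)
  obtain y0 where y0: "y0 \<in> Y" using Suc.prems(1) by (metis finite.emptyI all_not_in_conv)
  have "v D = 0"
  proof (cases "D = 0")
    case True
    then show ?thesis using Suc.prems(2)[OF y0] by (simp add: scaleQ_one)
  next
    case False
    then obtain D' where D': "D = Suc D'" using not0_implies_Suc by blast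
    define u where "u m = (\<Sum>i=Suc m..D. y0 ^ (i - Suc m) *\<^sub>Q v i)" for m
    have S0: "(\<Sum>m<D. y ^ m *\<^sub>Q u m) = 0" if y: "y \<in> Y - {y0}" for y
    proof -
      have "(y - y0) *\<^sub>Q (\<Sum>m<D. y ^ m *\<^sub>Q u m) = (y - y0) *\<^sub>Q (\<Sum>i\<le>D. \<Sum>m<i. (y0 ^ (i - Suc m) * y ^ m) *\<^sub>Q v i)"
        unfolding u_def scaleQ_sum_right sum.nested_swap' by (simp add: scaleQ_scaleQ scaleQ_sum_right mult_ac)
      also have "\<dots> = (\<Sum>i\<le>D. (y ^ i - y0 ^ i) *\<^sub>Q v i)"
        unfolding power_diff_sumr2 by (simp add: scaleQ_sum_right scaleQ_sum_left scaleQ_scaleQ sum_distrib_left)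
      also have "\<dots> = 0"
        using Suc.prems(2)[of y] Suc.prems(2)[OF y0] y by (simp add: scaleQ_diff_left sum_subtractf lessThan_Suc_atMost)
      finally show ?thesis using y by (auto dest: scaleQ_eq_0)
    qed
    have "u D' = 0"
    proof (rule Suc.IH[of "Y - {y0}"])
      show "infinite (Y - {y0})" using Suc.prems(1) by simp
      show "(\<Sum>m<D. y ^ m *\<^sub>Q u m) = 0" if "y \<in> Y - {y0}" for y by (rule S0[OF that])
      show "D' < D" using D' by simp
    qed
    then show ?thesis using D' by (simp add: u_def scaleQ_one)
  qed
  moreover have "v i = 0" if "i < D"
  proof (rule Suc.IH[OF Suc.prems(1) _ that])
    show "(\<Sum>i<D. y ^ i *\<^sub>Q v i) = 0" if "y \<in> Y" for y
      using Suc.prems(2)[OF that] \<open>v D = 0\<close> by simp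
  qed
  ultimately show ?case using Suc.prems(3) by (cases "i = D") auto
qed simp

definition marked_sum :: "rat \<Rightarrow> rat \<Rightarrow> (nat \<Rightarrow> rat) \<Rightarrow> nat \<Rightarrow> (nat list \<Rightarrow> 'v::rat_algebra) \<Rightarrow> 'v" where
  "marked_sum y z w k f = (\<Sum>ks\<in>indices k. \<Sum>i<length ks. (y ^ i * z ^ (length ks - 1 - i) * w (ks ! i)) *\<^sub>Q f ks)"

text \<open>The sum over the indices with \<open>i\<close> entries before and \<open>s\<close> entries after the marked one.\<close>

definition slot_sum :: "(nat \<Rightarrow> rat) \<Rightarrow> nat \<Rightarrow> (nat list \<Rightarrow> 'v::rat_algebra) \<Rightarrow> nat \<Rightarrow> nat \<Rightarrow> 'v" where
  "slot_sum w k f i s = (\<Sum>ks\<in>{ks \<in> indices k. length ks = i + s + 1}. w (ks ! i) *\<^sub>Q f ks)"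

lemma length_le_weight: "ks \<in> indices k \<Longrightarrow> length ks \<le> k"
proof -
  have "is_index ks \<Longrightarrow> length ks \<le> sum_list ks"
    by (induction ks) (auto simp: is_index_def)
  then show "ks \<in> indices k \<Longrightarrow> length ks \<le> k" by (simp add: indices_def)
qed

lemma marked_sum_slots: "marked_sum y z w k f = (\<Sum>i<k. y ^ i *\<^sub>Q (\<Sum>s<k. z ^ s *\<^sub>Q slot_sum w k f i s))"
proof -
  have "(\<Sum>i<k. y ^ i *\<^sub>Q (\<Sum>s<k. z ^ s *\<^sub>Q slot_sum w k f i s))
     = (\<Sum>i<k. \<Sum>s<k. \<Sum>ks\<in>indices k. if length ks = i + s + 1 then (y ^ i * z ^ s * w (ks ! i)) *\<^sub>Q f ks else 0)"
    unfolding slot_sum_def sum.inter_filter[OF finite_indices] scaleQ_sum_right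
    by (intro sum.cong refl) (simp add: scaleQ_scaleQ mult.assoc)
  also have "\<dots> = (\<Sum>ks\<in>indices k. \<Sum>i<k. \<Sum>s<k. if length ks = i + s + 1 then (y ^ i * z ^ s * w (ks ! i)) *\<^sub>Q f ks else 0)"
    by (subst sum.swap, subst sum.swap) (intro sum.cong refl sum.swap)
  also have "\<dots> = (\<Sum>ks\<in>indices k. \<Sum>i<length ks. (y ^ i * z ^ (length ks - 1 - i) * w (ks ! i)) *\<^sub>Q f ks)"
  proof (rule sum.cong[OF refl])
    fix ks assume "ks \<in> indices k"
    then have l: "length ks \<le> k" by (rule length_le_weight)
    have "(\<Sum>s<k. if length ks = i + s + 1 then (y ^ i * z ^ s * w (ks ! i)) *\<^sub>Q f ks else 0)
        = (if i < length ks then (y ^ i * z ^ (length ks - 1 - i) * w (ks ! i)) *\<^sub>Q f ks else 0)" if "i < k" for i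
    proof -
      have "(\<Sum>s<k. if length ks = i + s + 1 then (y ^ i * z ^ s * w (ks ! i)) *\<^sub>Q f ks else 0)
         = (\<Sum>s<k. if s = length ks - 1 - i then (if i < length ks then (y ^ i * z ^ s * w (ks ! i)) *\<^sub>Q f ks else 0) else 0)"
        by (intro sum.cong refl) auto
      then show ?thesis using l that by (simp add: less_diff_conv2) 
    qed
    then have "(\<Sum>i<k. \<Sum>s<k. if length ks = i + s + 1 then (y ^ i * z ^ s * w (ks ! i)) *\<^sub>Q f ks else 0)
       = (\<Sum>i<k. if i < length ks then (y ^ i * z ^ (length ks - 1 - i) * w (ks ! i)) *\<^sub>Q f ks else 0)"
      by (intro sum.cong refl) simp
    also have "\<dots> = (\<Sum>i<length ks. (y ^ i * z ^ (length ks - 1 - i) * w (ks ! i)) *\<^sub>Q f ks)"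
      using l by (intro sum.mono_neutral_cong_right) auto
    finally show "(\<Sum>i<k. \<Sum>s<k. if length ks = i + s + 1 then (y ^ i * z ^ s * w (ks ! i)) *\<^sub>Q f ks else 0)
       = (\<Sum>i<length ks. (y ^ i * z ^ (length ks - 1 - i) * w (ks ! i)) *\<^sub>Q f ks)" .
  qed
  finally show ?thesis unfolding marked_sum_def ..
qed

definition choose_sum :: "nat \<Rightarrow> nat \<Rightarrow> rat" where
  "choose_sum K n = (\<Sum>u<n. of_nat (K choose u))"

text \<open>Summation by parts.\<close>

lemma abel_sum:
  fixes x :: "'a::comm_ring_1"
  shows "(1 - x) * (\<Sum>i<Suc n. x ^ i * g i) = g 0 + (\<Sum>i<n. x ^ Suc i * (g (Suc i) - g i)) - x ^ Suc n * g n"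
proof (induction n)
  case (Suc n)
  have "(1 - x) * (\<Sum>i<Suc (Suc n). x ^ i * g i) = (1 - x) * (\<Sum>i<Suc n. x ^ i * g i) + (1 - x) * (x ^ Suc n * g (Suc n))"
    by (simp only: sum.lessThan_Suc distrib_left)
  moreover have "g 0 + A - x ^ Suc n * g n + (1 - x) * (x ^ Suc n * g (Suc n)) = g 0 + (A + x ^ Suc n * (g (Suc n) - g n)) - x ^ Suc (Suc n) * g (Suc n)" for A
    by (simp add: algebra_simps)
  ultimately have "(1 - x) * (\<Sum>i<Suc (Suc n). x ^ i * g i) = g 0 + ((\<Sum>i<n. x ^ Suc i * (g (Suc i) - g i)) + x ^ Suc n * (g (Suc n) - g n)) - x ^ Suc (Suc n) * g (Suc n)"
    unfolding Suc.IH by (simp only:)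
  then show ?case by (simp only: sum.lessThan_Suc)
qed (simp add: algebra_simps)

lemma choose_sum_Suc: "choose_sum K (Suc n) = choose_sum K n + of_nat (K choose n)"
  by (simp add: choose_sum_def)

lemma choose_sum_complement:
  assumes "n + m = Suc K"
  shows "choose_sum K n + choose_sum K m = 2 ^ K"
  using assms
proof (induction n arbitrary: m)
  case 0
  have "(2 :: rat) ^ K = (\<Sum>u\<le>K. of_nat (K choose u))"
    using binomial_ring[of 1 "1::rat" K] by simp
  then show ?case using 0 by (simp add: choose_sum_def lessThan_Suc_atMost)
next
  case (Suc n)
  then have "K choose n = K choose m" by (metis add_Suc binomial_symmetric diff_add_inverse le_add1 nat.inject)
  moreover have "choose_sum K n + choose_sum K (Suc m) = 2 ^ K" using Suc by simp
  ultimately show ?case by (simp add: choose_sum_Suc)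
qed

text \<open>The factor in braces of the first formula, with \<open>i\<close> and \<open>s\<close> counting from 0.\<close>

definition gap :: "nat \<Rightarrow> nat \<Rightarrow> nat \<Rightarrow> rat" where
  "gap K i s = 2 ^ K - choose_sum K (Suc i) - choose_sum K (Suc s)"

lemma binomial_split:
  "(x + y :: 'a::comm_ring_1) ^ Suc K = y ^ Suc K + (\<Sum>i<K. x ^ Suc i * (of_nat (Suc K choose Suc i) * y ^ (K - i))) + x ^ Suc K"
proof -
  have "(x + y) ^ Suc K = (\<Sum>i\<le>Suc K. of_nat (Suc K choose i) * x ^ i * y ^ (Suc K - i))" by (rule binomial_ring)
  also have "\<dots> = y ^ Suc K + (\<Sum>i\<le>K. of_nat (Suc K choose Suc i) * x ^ Suc i * y ^ (K - i))"
    by (subst sum.atMost_Suc_shift) simp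
  also have "(\<Sum>i\<le>K. of_nat (Suc K choose Suc i) * x ^ Suc i * y ^ (K - i)) = (\<Sum>i<K. x ^ Suc i * (of_nat (Suc K choose Suc i) * y ^ (K - i))) + x ^ Suc K"
    unfolding lessThan_Suc_atMost[symmetric] by (simp add: mult_ac binomial_eq_0 del: power_Suc)
  finally show ?thesis by (simp add: add_ac)
qed

text \<open>Summation by parts in each variable. The boundary terms vanish because \<open>gap K i s = 0\<close> for \<open>i + s = K - 1\<close>, and
the differences of \<open>gap\<close> are binomial coefficients, so binomial sums remain.\<close>

lemma gap_polynomial:
  assumes "K > 0"
  shows "(1 - a) * (1 - b) * (\<Sum>i<K. a ^ i * (\<Sum>s<K - i. b ^ s * gap K i s)) = 2 ^ K + (a + b) ^ K - (1 + a) ^ K - (1 + b) ^ K"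
proof -
  obtain K' where K: "K = Suc K'" using assms gr0_implies_Suc by blast
  define B where "B n = (\<Sum>s<n. of_nat (K choose s) * b ^ s)" for n
  define h where "h i = 2 ^ K - choose_sum K (Suc i) - B (K - i)" for i
  have inner: "(1 - b) * (\<Sum>s<K - i. b ^ s * gap K i s) = h i" if "i < K" for i
  proof -
    have "K - i > 0" using that by simp
    then obtain n where n: "K - i = Suc n" using gr0_implies_Suc by blast
    have "gap K i n = 0"
    proof -
      have "Suc i + Suc n = Suc K" using n that by linarith
      from choose_sum_complement[OF this] show ?thesis by (simp add: gap_def)
    qed
    then have "(1 - b) * (\<Sum>s<K - i. b ^ s * gap K i s) = gap K i 0 - (\<Sum>s<n. b ^ Suc s * of_nat (K choose Suc s))"
      unfolding n abel_sum by (simp add: gap_def choose_sum_Suc sum_negf)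
    moreover have "B (K - i) = 1 + (\<Sum>s<n. b ^ Suc s * of_nat (K choose Suc s))"
      unfolding B_def n by (subst sum.lessThan_Suc_shift) (simp add: mult_ac)
    ultimately show ?thesis by (simp add: h_def gap_def choose_sum_def)
  qed
  have B: "B (K - i) = B (K - Suc i) + of_nat (K choose Suc i) * b ^ (K' - i)" if "i < K'" for i
  proof -
    have "K - i = Suc (K - Suc i)" "K - Suc i = K' - i" using that K by auto
    moreover have "K choose (K - Suc i) = K choose Suc i" using that K by (metis Suc_leI binomial_symmetric less_SucI)
    ultimately show ?thesis by (simp add: B_def)
  qed
  have hl: "h K' = 0"
    using choose_sum_complement[of K 1 K] by (simp add: h_def K B_def choose_sum_def)
  have h0: "h 0 = 2 ^ K - 1 - ((1 + b) ^ K - b ^ K)"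
  proof -
    have "(b + 1) ^ K = B K + b ^ K"
      unfolding B_def using binomial_ring[of b 1 K] by (simp add: lessThan_Suc_atMost[symmetric] mult_ac)
    then show ?thesis by (simp add: h_def choose_sum_def add.commute)
  qed
  have "(1 - a) * (1 - b) * (\<Sum>i<K. a ^ i * (\<Sum>s<K - i. b ^ s * gap K i s)) = (1 - a) * (\<Sum>i<K. a ^ i * ((1 - b) * (\<Sum>s<K - i. b ^ s * gap K i s)))"
    by (simp only: sum_distrib_left mult_ac)
  also have "\<dots> = (1 - a) * (\<Sum>i<Suc K'. a ^ i * h i)"
    unfolding K[symmetric] by (simp add: inner)
  also have "\<dots> = h 0 + (\<Sum>i<K'. a ^ Suc i * (h (Suc i) - h i))"
    unfolding abel_sum hl by simp
  also have "(\<Sum>i<K'. a ^ Suc i * (h (Suc i) - h i)) = (\<Sum>i<K'. a ^ Suc i * (of_nat (K choose Suc i) * b ^ (K' - i))) - (\<Sum>i<K'. a ^ Suc i * (of_nat (K choose Suc i) * 1 ^ (K' - i)))"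
    unfolding sum_subtractf[symmetric]
  proof (rule sum.cong[OF refl])
    fix i assume "i \<in> {..<K'}"
    then have "h (Suc i) - h i = of_nat (K choose Suc i) * b ^ (K' - i) - of_nat (K choose Suc i) * 1 ^ (K' - i)"
      using B[of i] by (simp add: h_def choose_sum_Suc)
    then show "a ^ Suc i * (h (Suc i) - h i) = a ^ Suc i * (of_nat (K choose Suc i) * b ^ (K' - i)) - a ^ Suc i * (of_nat (K choose Suc i) * 1 ^ (K' - i))"
      by (simp only: right_diff_distrib)
  qed
  also have "(\<Sum>i<K'. a ^ Suc i * (of_nat (K choose Suc i) * b ^ (K' - i))) = (a + b) ^ K - b ^ K - a ^ K"
    using binomial_split[of a b K'] unfolding K by (simp only: add_diff_cancel_right' add_diff_cancel_left')
  also have "(\<Sum>i<K'. a ^ Suc i * (of_nat (K choose Suc i) * 1 ^ (K' - i))) = (a + 1) ^ K - 1 ^ K - a ^ K"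
    using binomial_split[of a 1 K'] unfolding K by (simp only: add_diff_cancel_right' add_diff_cancel_left')
  finally show ?thesis unfolding h0 by (simp add: add.commute)
qed

lemma choose_sum_polynomial:
  assumes "K > 0"
  shows "(1 - a) * (\<Sum>i<K. a ^ i * choose_sum K (Suc i)) = (1 + a) ^ K - (2 * a) ^ K"
proof -
  obtain K' where K: "K = Suc K'" using assms gr0_implies_Suc by blast
  have "choose_sum K K = 2 ^ K - 1"
    using choose_sum_complement[of K 1 K] by (simp add: choose_sum_def)
  then have "(1 - a) * (\<Sum>i<K. a ^ i * choose_sum K (Suc i)) = 1 + (\<Sum>i<K'. a ^ Suc i * (of_nat (K choose Suc i) * 1 ^ (K' - i))) - a ^ K * (2 ^ K - 1)"
    unfolding K abel_sum by (simp add: choose_sum_Suc[of _ "Suc _"]) (simp add: choose_sum_def)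
  also have "(\<Sum>i<K'. a ^ Suc i * (of_nat (K choose Suc i) * 1 ^ (K' - i))) = (a + 1) ^ K - 1 ^ K - a ^ K"
    using binomial_split[of a 1 K'] unfolding K by (simp only: add_diff_cancel_right' add_diff_cancel_left')
  finally show ?thesis by (simp add: algebra_simps power_mult_distrib)
qed

definition main_coeff :: "nat \<Rightarrow> nat \<Rightarrow> nat \<Rightarrow> rat" where
  "main_coeff K i s = (if i + s < K then ((-1) ^ s - (-1) ^ i) / 2 ^ (i + s + 1) * gap K i s else 0)"

definition sum_coeff :: "nat \<Rightarrow> nat \<Rightarrow> rat" where
  "sum_coeff K i = (1 - (-1) ^ i) / 2 ^ i * choose_sum K (Suc i)"

text \<open>For even \<open>K\<close> each of the two halves of \<open>kappa_main\<close> is the polynomial of \<open>gap_polynomial\<close> with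
one sign changed; their combination keeps the monomials with \<open>i\<close> and \<open>s\<close> of different parity.\<close>

lemma kappa_main_polynomial:
  fixes y z :: rat
  assumes K: "even K" "K > 0" and yz: "0 < y" "y < 1" "0 < z" "z < 1"
  shows "kappa_main (y / 2) (z / 2) (Suc K) = (\<Sum>i<Suc K. y ^ i * (\<Sum>s<Suc K. z ^ s * main_coeff K i s))"
proof -
  define Q where "Q a b = (\<Sum>i<K. a ^ i * (\<Sum>s<K - i. b ^ s * gap K i s))" for a b
  have bracket: "bracket a (- b) K = Q a b" if "1 - a \<noteq> 0" "1 - b \<noteq> 0" for a b
    using gap_polynomial[OF K(2), of a b] that unfolding bracket_def Q_def[symmetric]
    by (simp add: divide_eq_eq mult_ac)
  have "kappa_main (y / 2) (z / 2) (Suc K) = (Q (y / 2) (- (z / 2)) - Q (- (y / 2)) (z / 2)) / 2"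
    unfolding kappa_main_def diff_Suc_1 using bracket[of "y / 2" "- (z / 2)"] bracket[of "- (y / 2)" "z / 2"] yz by simp
  also have "\<dots> = (\<Sum>i<K. y ^ i * (\<Sum>s<K - i. z ^ s * main_coeff K i s))"
  proof -
    have "(y / 2) ^ i * ((- (z / 2)) ^ s * gap K i s) - (- (y / 2)) ^ i * ((z / 2) ^ s * gap K i s) = 2 * (y ^ i * (z ^ s * main_coeff K i s))"
      if "i < K" "s < K - i" for i s
    proof -
      have "(- (z / 2)) ^ s = (-1) ^ s * (z / 2) ^ s" "(- (y / 2)) ^ i = (-1) ^ i * (y / 2) ^ i"
        by (rule power_minus)+
      moreover have "(y / 2) ^ i * (z / 2) ^ s = y ^ i * z ^ s * 2 / 2 ^ (i + s + 1)"
        by (simp add: power_add power_divide)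
      then have "2 * (y ^ i * (z ^ s * main_coeff K i s)) = (y / 2) ^ i * (z / 2) ^ s * (((-1) ^ s - (-1) ^ i) * gap K i s)"
        using that by (simp add: main_coeff_def)
      ultimately show ?thesis by (simp only:) (simp only: algebra_simps)
    qed
    then have "Q (y / 2) (- (z / 2)) - Q (- (y / 2)) (z / 2) = (\<Sum>i<K. \<Sum>s<K - i. 2 * (y ^ i * (z ^ s * main_coeff K i s)))"
      unfolding Q_def sum_distrib_left sum_subtractf[symmetric] by (intro sum.cong refl) auto
    then show ?thesis by (simp add: sum_distrib_left[symmetric])
  qed
  also have "\<dots> = (\<Sum>i<Suc K. y ^ i * (\<Sum>s<Suc K. z ^ s * main_coeff K i s))"
  proof -
    have "(\<Sum>s<Suc K. z ^ s * main_coeff K i s) = (\<Sum>s<K - i. z ^ s * main_coeff K i s)" for i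
      by (intro sum.mono_neutral_right) (auto simp: main_coeff_def)
    then show ?thesis by simp
  qed
  finally show ?thesis .
qed

lemma kappa_sum_polynomial:
  fixes y :: rat
  assumes K: "even K" "K > 0" and y: "0 < y" "y < 1"
  shows "kappa_sum (y / 2) (Suc K) = (\<Sum>i<K. y ^ i * sum_coeff K i)"
proof -
  define R where "R a = (\<Sum>i<K. a ^ i * choose_sum K (Suc i))" for a
  have R: "((1 + a) ^ K - (2 * a) ^ K) / (1 - a) = R a" if "1 - a \<noteq> 0" for a
    using choose_sum_polynomial[OF K(2), of a] that unfolding R_def[symmetric] by (simp add: divide_eq_eq mult_ac)
  have m: "(2 * - (y / 2)) ^ K = (2 * (y / 2)) ^ K" using K(1) by simp
  have "kappa_sum (y / 2) (Suc K) = R (y / 2) - ((1 + - (y / 2)) ^ K - (2 * - (y / 2)) ^ K) / (1 - - (y / 2))"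
    unfolding kappa_sum_def diff_Suc_1 m using R[of "y / 2"] y by (simp add: diff_divide_distrib)
  also have "\<dots> = R (y / 2) - R (- (y / 2))"
    using R[of "- (y / 2)"] y by simp
  also have "\<dots> = (\<Sum>i<K. y ^ i * sum_coeff K i)"
    unfolding R_def sum_subtractf[symmetric]
  proof (intro sum.cong refl)
    fix i
    have "(- (y / 2)) ^ i = (-1) ^ i * (y / 2) ^ i" by (rule power_minus)
    then show "(y / 2) ^ i * choose_sum K (Suc i) - (- (y / 2)) ^ i * choose_sum K (Suc i) = y ^ i * sum_coeff K i"
      by (simp add: sum_coeff_def power_divide left_diff_distrib right_diff_distrib diff_divide_distrib mult_ac)
  qed
  finally show ?thesis .
qed

section \<open>The weighted sum formulas\<close>

lemma slot_sum_determined: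
  fixes f :: "nat list \<Rightarrow> 'v::rat_algebra"
  assumes "infinite Y" "infinite Y'"
    and eq: "\<And>y z. y \<in> Y \<Longrightarrow> z \<in> Y' \<Longrightarrow> marked_sum y z w k f = (\<Sum>i<k. y ^ i * (\<Sum>s<k. z ^ s * c i s)) *\<^sub>Q x"
    and "i < k" "s < k"
  shows "slot_sum w k f i s = c i s *\<^sub>Q x"
proof -
  define v where "v i s = slot_sum w k f i s - c i s *\<^sub>Q x" for i s
  have "(\<Sum>i<k. y ^ i *\<^sub>Q (\<Sum>s<k. z ^ s *\<^sub>Q v i s)) = 0" if "y \<in> Y" "z \<in> Y'" for y z
    using eq[OF that] unfolding marked_sum_slots v_def
    by (simp add: scaleQ_diff_right sum_subtractf scaleQ_sum_left scaleQ_sum_right scaleQ_scaleQ sum_distrib_left)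
  then have "(\<Sum>s<k. z ^ s *\<^sub>Q v i s) = 0" if "z \<in> Y'" for z
    using that by (intro coefficients_unique[OF assms(1) _ assms(4), where v = "\<lambda>i. \<Sum>s<k. z ^ s *\<^sub>Q v i s"])
  then have "v i s = 0"
    by (rule coefficients_unique[OF assms(2) _ assms(5)])
  then show ?thesis by (simp add: v_def)
qed

lemma slot_sum_determined_last:
  fixes f :: "nat list \<Rightarrow> 'v::rat_algebra"
  assumes "infinite Y"
    and eq: "\<And>y. y \<in> Y \<Longrightarrow> marked_sum y 0 w k f = (\<Sum>i<k. y ^ i * c i) *\<^sub>Q x"
    and "i < k"
  shows "slot_sum w k f i 0 = c i *\<^sub>Q x"
proof -
  obtain K where K: "k = Suc K" using assms(3) by (cases k) auto
  have z: "(\<Sum>s<k. 0 ^ s *\<^sub>Q g s) = g 0" for g :: "nat \<Rightarrow> 'v"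
    unfolding K by (subst sum.lessThan_Suc_shift) (simp add: scaleQ_one)
  have "(\<Sum>i<k. y ^ i *\<^sub>Q (slot_sum w k f i 0 - c i *\<^sub>Q x)) = 0" if "y \<in> Y" for y
    using eq[OF that] unfolding marked_sum_slots z
    by (simp add: scaleQ_diff_right sum_subtractf scaleQ_sum_left scaleQ_scaleQ)
  then have "slot_sum w k f i 0 - c i *\<^sub>Q x = 0"
    by (intro coefficients_unique[OF assms(1) _ assms(3), where v = "\<lambda>i. slot_sum w k f i 0 - c i *\<^sub>Q x"])
  then show ?thesis by simp
qed

lemma index_set_slot_sum:
  fixes f :: "nat list \<Rightarrow> 'v::rat_algebra"
  assumes "1 \<le> i" "i \<le> r"
  shows "(\<Sum>ks\<in>index_set i k r. (2 ^ (ks ! (i - 1) - 2) - 1) *\<^sub>Q f ks) = slot_sum w_main k f (i - 1) (r - i)"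
    and "(\<Sum>ks\<in>index_set i k r. f ks) = slot_sum w_sum k f (i - 1) (r - i)"
proof -
  have r: "i - 1 + (r - i) + 1 = r" using assms by simp
  have fin: "finite {ks \<in> indices k. length ks = r}" by (simp add: finite_indices)
  show "(\<Sum>ks\<in>index_set i k r. (2 ^ (ks ! (i - 1) - 2) - 1) *\<^sub>Q f ks) = slot_sum w_main k f (i - 1) (r - i)"
    unfolding slot_sum_def r
    by (intro sum.mono_neutral_cong_left fin) (auto simp: index_set_def indices_def w_main_def)
  show "(\<Sum>ks\<in>index_set i k r. f ks) = slot_sum w_sum k f (i - 1) (r - i)"
    unfolding slot_sum_def r
    by (intro sum.mono_neutral_cong_left fin) (auto simp: index_set_def indices_def w_sum_def scaleQ_one)
qed

text \<open>The part common to both sides: the two generating function identities, on intervals of parameters, give the theorem for any function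
of indices. For even \<open>k\<close> both sides vanish because \<open>x\<close> does.\<close>

lemma weighted_sum_formulas:
  fixes f :: "nat list \<Rightarrow> 'v::rat_algebra"
  assumes main: "\<And>y z. 0 < y \<Longrightarrow> y < 1/2 \<Longrightarrow> 1/2 < z \<Longrightarrow> z < 1 \<Longrightarrow>
      marked_sum y z w_main k f = (if odd k then kappa_main (y / 2) (z / 2) k else 0) *\<^sub>Q x"
    and sum: "\<And>y. 0 < y \<Longrightarrow> y < 1/2 \<Longrightarrow> marked_sum y 0 w_sum k f = (if odd k then kappa_sum (y / 2) k else 0) *\<^sub>Q x"
    and even: "even k \<Longrightarrow> x = 0"
    and i: "1 \<le> i" "i \<le> r" "r < k"
  shows "(\<Sum>ks\<in>index_set i k r. (2 ^ (ks ! (i - 1) - 2) - 1) *\<^sub>Q f ks)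
       = ((-1) ^ i * ((-1) ^ r - (-1) ^ k) / 2 ^ r
           * (2 ^ (k - 1) - (\<Sum>u = 0..i - 1. of_nat ((k - 1) choose u))
                - (\<Sum>v = 0..r - i. of_nat ((k - 1) choose v)))) *\<^sub>Q x" (is ?A)
    and "(\<Sum>ks\<in>index_set r k r. 2 ^ (ks ! (r - 1)) *\<^sub>Q f ks)
       = ((1 + (-1) ^ r) / 2 powi (int r - 2)
           * (2 ^ (k - 1) - 1 + (\<Sum>u = 0..r - 1. of_nat ((k - 1) choose u)))) *\<^sub>Q x" (is ?B)
proof -
  obtain K where K: "k = Suc K" "K > 0" using i by (cases k) auto
  have inf: "infinite {0<..<1/2 :: rat}" "infinite {1/2<..<1 :: rat}" by (simp_all add: infinite_Ioo)
  define c where "c i s = (if odd k then main_coeff K i s else 0)" for i s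
  define c' where "c' i = (if odd k \<and> i < K then sum_coeff K i else 0)" for i
  have slot: "slot_sum w_main k f j s = c j s *\<^sub>Q x" if "j < k" "s < k" for j s
  proof (rule slot_sum_determined[OF inf _ that])
    fix y z :: rat assume yz: "y \<in> {0<..<1/2}" "z \<in> {1/2<..<1}"
    have "(if odd k then kappa_main (y / 2) (z / 2) k else 0) = (\<Sum>i<k. y ^ i * (\<Sum>s<k. z ^ s * c i s))"
      using kappa_main_polynomial[of K y z] yz K by (simp add: c_def)
    then show "marked_sum y z w_main k f = (\<Sum>i<k. y ^ i * (\<Sum>s<k. z ^ s * c i s)) *\<^sub>Q x"
      using main[of y z] yz by simp
  qed
  have slot': "slot_sum w_sum k f j 0 = c' j *\<^sub>Q x" if "j < k" for j
  proof (rule slot_sum_determined_last[OF inf(1) _ that])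
    fix y :: rat assume y: "y \<in> {0<..<1/2}"
    have "(if odd k then kappa_sum (y / 2) k else 0) = (\<Sum>i<k. y ^ i * c' i)"
      using kappa_sum_polynomial[of K y] y K by (simp add: c'_def)
    then show "marked_sum y 0 w_sum k f = (\<Sum>i<k. y ^ i * c' i) *\<^sub>Q x"
      using sum[of y] y by simp
  qed
  have cs: "choose_sum K (Suc n) = (\<Sum>u = 0..n. of_nat (K choose u))" for n
    by (simp add: choose_sum_def lessThan_Suc_atMost atLeast0AtMost)
  have A: "(\<Sum>ks\<in>index_set i k r. (2 ^ (ks ! (i - 1) - 2) - 1) *\<^sub>Q f ks) = c (i - 1) (r - i) *\<^sub>Q x"
    unfolding index_set_slot_sum(1)[OF i(1,2)] using i by (intro slot) auto
  show ?A
  proof (cases "odd k")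
    case True
    obtain j where j: "i = Suc j" using i(1) by (cases i) auto
    obtain t where t: "r = Suc j + t" using i(2) j le_Suc_ex by blast
    have "main_coeff K j t = (-1) ^ i * ((-1) ^ r - (-1) ^ k) / 2 ^ r * (2 ^ K - choose_sum K (Suc j) - choose_sum K (Suc t))"
      using i True K(1) unfolding main_coeff_def gap_def j t
      by (simp add: power_add algebra_simps minus_one_power_iff)
    then show ?thesis unfolding A using True by (simp add: c_def cs j t K(1))
  next
    case False
    then show ?thesis using A even by simp
  qed
  have r: "1 \<le> r" "r - r = 0" "r - 1 < k" "0 < k" using i by auto
  have B: "(\<Sum>ks\<in>index_set r k r. 2 ^ (ks ! (r - 1)) *\<^sub>Q f ks) = (4 * (c (r - 1) 0 + c' (r - 1))) *\<^sub>Q x"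
  proof -
    have "(\<Sum>ks\<in>index_set r k r. 2 ^ (ks ! (r - 1)) *\<^sub>Q f ks) = (\<Sum>ks\<in>index_set r k r. 4 *\<^sub>Q ((2 ^ (ks ! (r - 1) - 2) - 1) *\<^sub>Q f ks + f ks))"
    proof (intro sum.cong refl)
      fix ks assume "ks \<in> index_set r k r"
      then have "2 \<le> ks ! (r - 1)" by (simp add: index_set_def)
      then obtain m where m: "ks ! (r - 1) = 2 + m" using le_Suc_ex by blast
      have "(2 ^ (ks ! (r - 1) - 2) - 1) *\<^sub>Q f ks + f ks = 2 ^ m *\<^sub>Q f ks"
        unfolding m using scaleQ_add_left[of "2 ^ m - 1" 1 "f ks"] by (simp add: scaleQ_one)
      then show "2 ^ (ks ! (r - 1)) *\<^sub>Q f ks = 4 *\<^sub>Q ((2 ^ (ks ! (r - 1) - 2) - 1) *\<^sub>Q f ks + f ks)"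
        unfolding m by (simp add: scaleQ_scaleQ power_add)
    qed
    \<comment> \<open>The weight splits as \<open>2 ^ k = 4 * (2 ^ (k - 2) - 1) + 4\<close>.\<close>
    also have "\<dots> = 4 *\<^sub>Q (slot_sum w_main k f (r - 1) 0 + slot_sum w_sum k f (r - 1) 0)"
      using index_set_slot_sum[OF r(1) order_refl, where k = k and f = f] unfolding r(2)
      by (simp add: scaleQ_sum_right[symmetric] sum.distrib)
    finally show ?thesis
      unfolding slot[OF r(3,4)] slot'[OF r(3)] by (simp add: scaleQ_scaleQ scaleQ_add_left[symmetric])
  qed
  show ?B
  proof (cases "odd k")
    case True
    obtain j where j: "r = Suc j" using r(1) by (cases r) auto
    have "choose_sum K (Suc 0) = 1" by (simp add: choose_sum_def)
    then have E: "4 * (main_coeff K j 0 + sum_coeff K j) = (1 + (-1) ^ r) / (2 ^ r / 4) * (2 ^ K - 1 + choose_sum K (Suc j))"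
      using i True K(1) unfolding main_coeff_def sum_coeff_def gap_def j
      by (simp add: minus_one_power_iff field_simps)
    have P: "(2 :: rat) powi (int r - 2) = 2 ^ r / 4" by (simp add: power_int_diff)
    have c: "c (r - 1) 0 = main_coeff K j 0" "c' (r - 1) = sum_coeff K j"
      using True i j K(1) by (simp_all add: c_def c'_def)
    have n: "r - 1 = j" "k - 1 = K" using j K(1) by simp_all
    show ?thesis
      unfolding B unfolding c unfolding E unfolding P cs n ..
  next
    case False
    then show ?thesis using B even by simp
  qed
qed

lemma coarsenings_index: "is_index ks \<Longrightarrow> l \<in> set (coarsenings ks) \<Longrightarrow> is_index l"
proof (induction ks arbitrary: l rule: coarsenings.induct)
  case (3 k m ks)
  from 3(3) have i: "is_index (m # ks)" "is_index ((k + m) # ks)" "k \<noteq> 0" by (auto simp: is_index_def)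
  from 3(4) consider l' where "l = k # l'" "l' \<in> set (coarsenings (m # ks))" | "l \<in> set (coarsenings ((k + m) # ks))"
    by auto
  then show ?case
  proof cases
    case 1
    then show ?thesis using 3(1)[OF i(1)] i(3) by (simp add: is_index_def)
  qed (rule 3(2)[OF i(2)])
qed simp_all

text \<open>The class \<open>x\<close> is the residue of the constant term of the expansion of \<open>A\<close>. This relation is linear, so identities can be
transported from finite nested sums.\<close>

definition represents_S :: "(nat \<Rightarrow> real) \<Rightarrow> zbar \<Rightarrow> bool" where
  "represents_S A x \<longleftrightarrow> (\<exists>P. asymptotic A P \<and> zpoly P \<and> abs_zbar (coeff P 0) = x)"

lemma abs_zbar_add: "x \<in> mzv_algebra \<Longrightarrow> y \<in> mzv_algebra \<Longrightarrow> abs_zbar (x + y) = abs_zbar x + abs_zbar y"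
  by (simp add: plus_zbar.abs_eq mzv_rel_refl)

lemma abs_zbar_scale: "x \<in> mzv_algebra \<Longrightarrow> abs_zbar (of_rat q * x) = q *\<^sub>Q abs_zbar x"
  by (simp add: scaleQ_zbar.abs_eq mzv_rel_refl)

lemma abs_zbar_eq: "x \<in> mzv_algebra \<Longrightarrow> y \<in> mzv_algebra \<Longrightarrow> x - y \<in> zeta2_ideal \<Longrightarrow> abs_zbar x = abs_zbar y"
proof -
  assume "x \<in> mzv_algebra" "y \<in> mzv_algebra" "x - y \<in> zeta2_ideal"
  then have "mzv_rel x y" by (auto simp: mzv_rel_def)
  moreover have "mzv_rel x x" "mzv_rel y y" using \<open>x \<in> mzv_algebra\<close> \<open>y \<in> mzv_algebra\<close> by (auto intro: mzv_rel_refl)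
  ultimately show ?thesis using Quotient3_rel[OF Quotient3_zbar, of x y] by blast
qed

lemma represents_S_add: "represents_S A x \<Longrightarrow> represents_S B y \<Longrightarrow> represents_S (\<lambda>N. A N + B N) (x + y)"
proof -
  assume "represents_S A x" "represents_S B y"
  then obtain P Q where "asymptotic A P" "zpoly P" "abs_zbar (coeff P 0) = x" "asymptotic B Q" "zpoly Q" "abs_zbar (coeff Q 0) = y"
    unfolding represents_S_def by blast
  then show ?thesis unfolding represents_S_def
    by (intro exI[of _ "P + Q"]) (auto simp: asymptotic_add zpoly_closed abs_zbar_add zpoly_def mzv_algebra.add)
qed

lemma represents_S_scale: "represents_S A x \<Longrightarrow> represents_S (\<lambda>N. of_rat q * A N) (q *\<^sub>Q x)"
proof -
  assume "represents_S A x"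
  then obtain P where "asymptotic A P" "zpoly P" "abs_zbar (coeff P 0) = x"
    unfolding represents_S_def by blast
  then show ?thesis unfolding represents_S_def
    by (intro exI[of _ "smult (of_rat q) P"]) (auto simp: asymptotic_const_mult abs_zbar_scale zpoly_def mzv_algebra.mult mzv_algebra.rat)
qed

lemma represents_S_0: "represents_S (\<lambda>N. 0) 0"
  unfolding represents_S_def using asymptotic_0
  by (intro exI[of _ 0]) (simp add: zpoly_def mzv_algebra_01 zero_zbar_def)

lemma represents_S_sum: "(\<And>i. i \<in> S \<Longrightarrow> represents_S (A i) (x i)) \<Longrightarrow> represents_S (\<lambda>N. \<Sum>i\<in>S. A i N) (\<Sum>i\<in>S. x i)"
  by (induction S rule: infinite_finite_induct) (simp_all add: represents_S_0 represents_S_add)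

lemma represents_S_sum_list:
  "(\<And>l. l \<in> set ls \<Longrightarrow> represents_S (A l) (x l)) \<Longrightarrow> represents_S (\<lambda>N. \<Sum>l\<leftarrow>ls. A l N) (\<Sum>l\<leftarrow>ls. x l)"
  by (induction ls) (simp_all add: represents_S_0 represents_S_add)

lemma represents_S_interpolated:
  assumes "is_index ks"
  shows "represents_S (\<lambda>N. half_chain_sum (pos_list N @ neg_list N) ks) (interpolated zeta_S (1/2) ks)"
proof -
  have "represents_S (\<lambda>N. chain_sum (pos_list N @ neg_list N) l) (zeta_S l)" if "l \<in> set (coarsenings ks)" for l
    unfolding represents_S_def zeta_S_def using zeta_star_S_asymptotic[OF coarsenings_index[OF assms that]] by blast
  then have "represents_S (\<lambda>N. \<Sum>l\<leftarrow>coarsenings ks. of_rat ((1/2) ^ (length ks - length l)) * chain_sum (pos_list N @ neg_list N) l)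
    (\<Sum>l\<leftarrow>coarsenings ks. (1/2) ^ (length ks - length l) *\<^sub>Q zeta_S l)"
    by (intro represents_S_sum_list represents_S_scale)
  then show ?thesis
    by (simp add: half_chain_sum_def interpolated_def of_rat_power of_rat_divide)
qed

lemma represents_S_marked:
  assumes "\<And>j. w' j = of_rat (w j)"
  shows "represents_S (\<lambda>N. marked_gf (of_rat y) (of_rat z) w' (pos_list N @ neg_list N) $ k) (marked_sum y z w k (interpolated zeta_S (1/2)))"
proof -
  have "represents_S (\<lambda>N. \<Sum>ks\<in>indices k. \<Sum>i<length ks. of_rat (y ^ i * z ^ (length ks - 1 - i) * w (ks ! i)) * half_chain_sum (pos_list N @ neg_list N) ks)
      (\<Sum>ks\<in>indices k. \<Sum>i<length ks. (y ^ i * z ^ (length ks - 1 - i) * w (ks ! i)) *\<^sub>Q interpolated zeta_S (1/2) ks)"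
    by (intro represents_S_sum represents_S_scale represents_S_interpolated) (simp add: indices_def)
  then show ?thesis
    by (simp add: marked_sum_def marked_gf_def gen_def mark_def of_rat_mult of_rat_power assms)
qed

text \<open>A convergent sequence has a constant expansion, so its class is that of the limit.\<close>

lemma represents_S_limit:
  assumes "represents_S A x" "A \<longlonglongrightarrow> L" "L - of_rat q * zeta_nat k \<in> zeta2_ideal" "k \<ge> 2"
  shows "x = q *\<^sub>Q frakZ_S k"
proof -
  from assms(1) obtain P where P: "asymptotic A P" "zpoly P" "abs_zbar (coeff P 0) = x"
    unfolding represents_S_def by blast
  then have "P = [:L:]" using asymptotic_const assms(2) by blast
  then have "L \<in> mzv_algebra" "x = abs_zbar L" using P by (auto simp: zpoly_def dest: spec[of _ 0])
  moreover have "abs_zbar L = abs_zbar (of_rat q * zeta_nat k)"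
    using calculation assms by (intro abs_zbar_eq mzv_algebra.mult mzv_algebra.rat zeta_nat_in) auto
  ultimately show ?thesis
    using assms(4) by (simp add: abs_zbar_scale zeta_nat_in frakZ_S_def mzv_single)
qed

lemma frakZ_S_even:
  assumes "even k" "k \<ge> 2"
  shows "frakZ_S k = 0"
proof -
  have "abs_zbar (zeta_nat k) = abs_zbar 0"
    using even_zeta[of k] assms by (intro abs_zbar_eq zeta_nat_in mzv_algebra_01) auto
  then show ?thesis using assms by (simp add: frakZ_S_def mzv_single zero_zbar_def)
qed

lemma of_rat_w: "w_main j = (of_rat (w_main j) :: real)" "w_sum j = (of_rat (w_sum j) :: real)"
  by (simp_all add: w_main_def w_sum_def of_rat_diff of_rat_power)

lemma symmetric_marked_sums:
  assumes "k \<ge> 2"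
  shows "0 < y \<Longrightarrow> y < 1/2 \<Longrightarrow> 1/2 < z \<Longrightarrow> z < 1 \<Longrightarrow>
      marked_sum y z w_main k (interpolated zeta_S (1/2)) = (if odd k then kappa_main (y / 2) (z / 2) k else 0) *\<^sub>Q frakZ_S k"
    and "0 < y \<Longrightarrow> y < 1/2 \<Longrightarrow>
      marked_sum y 0 w_sum k (interpolated zeta_S (1/2)) = (if odd k then kappa_sum (y / 2) k else 0) *\<^sub>Q frakZ_S k"
proof -
  assume y: "0 < y" "y < 1/2"
  show "marked_sum y z w_main k (interpolated zeta_S (1/2)) = (if odd k then kappa_main (y / 2) (z / 2) k else 0) *\<^sub>Q frakZ_S k"
    if z: "1/2 < z" "z < 1"
  proof -
    obtain L where L: "(\<lambda>N. marked_gf (of_rat y) (of_rat z) w_main (pos_list N @ neg_list N) $ k) \<longlonglongrightarrow> L"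
      "L - (if odd k then of_rat (kappa_main (y / 2) (z / 2) k) * zeta_nat k else 0) \<in> zeta2_ideal"
      using symmetric_main_limit[OF y z assms] by blast
    from L(2) have "L - of_rat (if odd k then kappa_main (y / 2) (z / 2) k else 0) * zeta_nat k \<in> zeta2_ideal"
      by (cases "odd k") (simp_all only: not_False_eq_True not_True_eq_False if_True if_False of_rat_0 mult_zero_left)
    with represents_S_marked[OF of_rat_w(1)] L(1) show ?thesis
      using assms by (intro represents_S_limit)
  qed
  obtain L where L: "(\<lambda>N. marked_gf (of_rat y) 0 w_sum (pos_list N @ neg_list N) $ k) \<longlonglongrightarrow> L"
    "L - (if odd k then of_rat (kappa_sum (y / 2) k) * zeta_nat k else 0) \<in> zeta2_ideal"
    using symmetric_sum_limit[OF y assms] by blast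
  from L(2) have "L - of_rat (if odd k then kappa_sum (y / 2) k else 0) * zeta_nat k \<in> zeta2_ideal"
    by (cases "odd k") (simp_all only: not_False_eq_True not_True_eq_False if_True if_False of_rat_0 mult_zero_left)
  with represents_S_marked[OF of_rat_w(2), where y = y and z = 0 and k = k] L(1)
  show "marked_sum y 0 w_sum k (interpolated zeta_S (1/2)) = (if odd k then kappa_sum (y / 2) k else 0) *\<^sub>Q frakZ_S k"
    using assms unfolding of_rat_0 by (intro represents_S_limit)
qed

abbreviation almost_all_primes :: "(nat \<Rightarrow> bool) \<Rightarrow> bool" where
  "almost_all_primes P \<equiv> \<forall>\<^sub>F p in sequentially. prime p \<longrightarrow> P p"

text \<open>Families integral at almost all primes, for which \<open>rat_mod\<close> is reduction modulo \<open>p\<close> and hence additive and multiplicative.\<close>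

definition represents_A :: "(nat \<Rightarrow> rat) \<Rightarrow> ring_A \<Rightarrow> bool" where
  "represents_A f x \<longleftrightarrow> almost_all_primes (\<lambda>p. f p \<in> p_integral p) \<and> family_A f = x"

lemma adele_relI:
  assumes "almost_all_primes (\<lambda>p. [f p = g p] (mod int p))"
  shows "adele_rel f g"
proof -
  obtain N where "\<And>p. p \<ge> N \<Longrightarrow> prime p \<Longrightarrow> [f p = g p] (mod int p)"
    using assms unfolding eventually_sequentially by blast
  then have "{p. prime p \<and> \<not> [f p = g p] (mod int p)} \<subseteq> {..N}"
    by (auto simp: not_le intro: ccontr)
  then show ?thesis unfolding adele_rel_def by (rule finite_subset) simp
qed

lemma rational_integral: "almost_all_primes (\<lambda>p. q \<in> p_integral p)"
proof -
  have "\<forall>\<^sub>F p in sequentially. nat (snd (quotient_of q)) < p" by (rule eventually_gt_at_top)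
  then show ?thesis
  proof (rule eventually_mono, intro impI)
    fix p :: nat assume p: "nat (snd (quotient_of q)) < p" "prime p"
    interpret prime_modulus p by unfold_locales (rule p(2))
    have "snd (quotient_of q) > 0" by (rule quotient_of_denom_pos')
    then have "\<not> int p dvd snd (quotient_of q)" using p(1) zdvd_imp_le by fastforce
    moreover have "q = of_int (fst (quotient_of q)) / of_int (snd (quotient_of q))"
      by (rule quotient_of_div) simp
    ultimately show "q \<in> p_integral p" using p_integralI by metis
  qed
qed

lemma represents_A_cong:
  assumes "represents_A f x" "represents_A g y" "almost_all_primes (\<lambda>p. f p - g p \<in> p_ideal p)"
  shows "x = y"
proof -
  have "almost_all_primes (\<lambda>p. [rat_mod p (f p) = rat_mod p (g p)] (mod int p))"
    using assms(3) conjunct1[OF assms(2)[unfolded represents_A_def]]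
  proof eventually_elim
    case (elim p)
    show ?case
    proof
      assume "prime p"
      then interpret prime_modulus p by unfold_locales
      show "[rat_mod p (f p) = rat_mod p (g p)] (mod int p)"
        using elim \<open>prime p\<close> by (intro rat_mod_cong) auto
    qed
  qed
  then have "family_A f = family_A g"
    unfolding family_A_def ring_A.abs_eq_iff by (rule adele_relI)
  then show ?thesis using assms by (simp add: represents_A_def)
qed

lemma represents_A_add:
  assumes "represents_A f x" "represents_A g y"
  shows "represents_A (\<lambda>p. f p + g p) (x + y)"
proof -
  have e: "almost_all_primes (\<lambda>p. f p \<in> p_integral p)" "almost_all_primes (\<lambda>p. g p \<in> p_integral p)"
    using assms by (simp_all add: represents_A_def)
  then have "almost_all_primes (\<lambda>p. f p + g p \<in> p_integral p \<and> [rat_mod p (f p + g p) = rat_mod p (f p) + rat_mod p (g p)] (mod int p))"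
  proof eventually_elim
    case (elim p)
    show ?case
    proof
      assume "prime p"
      then interpret prime_modulus p by unfold_locales
      show "f p + g p \<in> p_integral p \<and> [rat_mod p (f p + g p) = rat_mod p (f p) + rat_mod p (g p)] (mod int p)"
        using elim \<open>prime p\<close> by (intro conjI R_add rat_mod_add_mult p_integral_denominator) auto
    qed
  qed
  then have 1: "almost_all_primes (\<lambda>p. f p + g p \<in> p_integral p)"
    and 2: "almost_all_primes (\<lambda>p. [rat_mod p (f p + g p) = rat_mod p (f p) + rat_mod p (g p)] (mod int p))"
    by (auto elim: eventually_mono)
  from 2 have "family_A (\<lambda>p. f p + g p) = family_A f + family_A g"
    unfolding family_A_def plus_ring_A.abs_eq ring_A.abs_eq_iff by (rule adele_relI)
  with 1 show ?thesis using assms by (simp add: represents_A_def)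
qed

lemma represents_A_scale:
  assumes "represents_A f x"
  shows "represents_A (\<lambda>p. q * f p) (q *\<^sub>Q x)"
proof -
  have e: "almost_all_primes (\<lambda>p. f p \<in> p_integral p)"
    using assms by (simp add: represents_A_def)
  have "almost_all_primes (\<lambda>p. q * f p \<in> p_integral p \<and> [rat_mod p (q * f p) = rat_mod p q * rat_mod p (f p)] (mod int p))"
    using e rational_integral[of q]
  proof eventually_elim
    case (elim p)
    show ?case
    proof
      assume "prime p"
      then interpret prime_modulus p by unfold_locales
      show "q * f p \<in> p_integral p \<and> [rat_mod p (q * f p) = rat_mod p q * rat_mod p (f p)] (mod int p)"
        using elim \<open>prime p\<close> by (intro conjI R_mult rat_mod_add_mult p_integral_denominator) auto
    qed
  qed
  then have 1: "almost_all_primes (\<lambda>p. q * f p \<in> p_integral p)"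
    and 2: "almost_all_primes (\<lambda>p. [rat_mod p (q * f p) = rat_mod p q * rat_mod p (f p)] (mod int p))"
    by (auto elim: eventually_mono)
  from 2 have "family_A (\<lambda>p. q * f p) = q *\<^sub>Q family_A f"
    unfolding family_A_def scaleQ_ring_A.abs_eq ring_A.abs_eq_iff by (rule adele_relI)
  with 1 show ?thesis using assms by (simp add: represents_A_def)
qed

lemma represents_A_0: "represents_A (\<lambda>p. 0) 0"
proof -
  have "family_A (\<lambda>p. 0) = 0 *\<^sub>Q family_A (\<lambda>p. 0)"
    using represents_A_scale[of "\<lambda>p. 0" "family_A (\<lambda>p. 0)" 0] rational_integral[of 0]
    by (simp add: represents_A_def)
  then show ?thesis using rational_integral[of 0] by (simp add: represents_A_def)
qed

lemma represents_A_sum: "(\<And>i. i \<in> S \<Longrightarrow> represents_A (f i) (x i)) \<Longrightarrow> represents_A (\<lambda>p. \<Sum>i\<in>S. f i p) (\<Sum>i\<in>S. x i)"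
  by (induction S rule: infinite_finite_induct) (simp_all add: represents_A_0 represents_A_add)

lemma represents_A_sum_list:
  "(\<And>l. l \<in> set ls \<Longrightarrow> represents_A (f l) (x l)) \<Longrightarrow> represents_A (\<lambda>p. \<Sum>l\<leftarrow>ls. f l p) (\<Sum>l\<leftarrow>ls. x l)"
  by (induction ls) (simp_all add: represents_A_0 represents_A_add)

lemma represents_A_marked:
  "represents_A (\<lambda>p. marked_gf y z w (pos_list (p - 1)) $ k) (marked_sum y z w k (interpolated zeta_A (1/2)))"
proof -
  have "represents_A (\<lambda>p. chain_sum (pos_list (p - 1)) l) (zeta_A l)" for l
    unfolding represents_A_def zeta_A_def mult_harmonic_sum_eq
    by (intro conjI always_eventually allI impI refl prime_modulus.chain_sum_integral prime_modulus.intro)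
  then have "represents_A (\<lambda>p. \<Sum>ks\<in>indices k. \<Sum>i<length ks. (y ^ i * z ^ (length ks - 1 - i) * w (ks ! i)) * half_chain_sum (pos_list (p - 1)) ks)
      (\<Sum>ks\<in>indices k. \<Sum>i<length ks. (y ^ i * z ^ (length ks - 1 - i) * w (ks ! i)) *\<^sub>Q interpolated zeta_A (1/2) ks)"
    unfolding half_chain_sum_def interpolated_def
    by (intro represents_A_sum represents_A_sum_list represents_A_scale)
  then show ?thesis
    by (simp add: marked_sum_def marked_gf_def gen_def mark_def)
qed

lemma represents_A_frakZ: "k \<ge> 2 \<Longrightarrow> represents_A (\<lambda>p. bernoulli (p - k) / of_nat k) (frakZ_A k)"
proof -
  assume k: "k \<ge> 2"
  have "almost_all_primes (\<lambda>p. bernoulli (p - k) / of_nat k \<in> p_integral p)"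
    using eventually_gt_at_top[of k]
  proof eventually_elim
    case (elim p)
    then show ?case using prime_modulus.Z_integral[of p k] k by (simp add: prime_modulus_def prime_modulus.Z_def)
  qed
  then show ?thesis by (simp add: represents_A_def frakZ_A_def)
qed

lemma frakZ_A_even:
  assumes "even k" "k \<ge> 2"
  shows "frakZ_A k = 0"
proof (rule represents_A_cong[OF represents_A_frakZ represents_A_0])
  show "almost_all_primes (\<lambda>p. bernoulli (p - k) / of_nat k - 0 \<in> p_ideal p)"
    using eventually_gt_at_top[of "k + 1"]
  proof eventually_elim
    case (elim p)
    then show ?case using prime_modulus.Z_even[of p k] assms by (auto simp: prime_modulus_def prime_modulus.Z_def)
  qed
qed (rule assms)

lemma finite_marked_sums:
  assumes "k \<ge> 2"
  shows "0 < y \<Longrightarrow> y < 1/2 \<Longrightarrow> 1/2 < z \<Longrightarrow> z < 1 \<Longrightarrow>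
      marked_sum y z w_main k (interpolated zeta_A (1/2)) = (if odd k then kappa_main (y / 2) (z / 2) k else 0) *\<^sub>Q frakZ_A k"
    and "0 < y \<Longrightarrow> y < 1/2 \<Longrightarrow>
      marked_sum y 0 w_sum k (interpolated zeta_A (1/2)) = (if odd k then kappa_sum (y / 2) k else 0) *\<^sub>Q frakZ_A k"
proof -
  assume y: "0 < y" "y < 1/2"
  show "marked_sum y z w_main k (interpolated zeta_A (1/2)) = (if odd k then kappa_main (y / 2) (z / 2) k else 0) *\<^sub>Q frakZ_A k"
    if z: "1/2 < z" "z < 1"
  proof (rule represents_A_cong[OF represents_A_marked represents_A_scale[OF represents_A_frakZ[OF assms]]])
    show "almost_all_primes (\<lambda>p. marked_gf y z w_main (pos_list (p - 1)) $ k - (if odd k then kappa_main (y / 2) (z / 2) k else 0) * (bernoulli (p - k) / of_nat k) \<in> p_ideal p)"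
      using eventually_gt_at_top[of "k + 1"] rational_integral[of "y / 2"] rational_integral[of "1 / (1 - y / 2)"] rational_integral[of "1 / (1 + y / 2)"]
        rational_integral[of "z / 2"] rational_integral[of "1 / (1 - z / 2)"] rational_integral[of "1 / (1 + z / 2)"]
    proof eventually_elim
      case (elim p)
      show ?case
      proof
        assume "prime p"
        then interpret prime_modulus p by unfold_locales
        have "marked_gf (2 * (y / 2)) (2 * (z / 2)) w_main (pos_list (p - 1)) $ k - (if odd k then kappa_main (y / 2) (z / 2) k else 0) * Z k \<in> p_ideal p"
          using elim \<open>prime p\<close> y z assms by (intro marked_main_mod) auto
        then show "marked_gf y z w_main (pos_list (p - 1)) $ k - (if odd k then kappa_main (y / 2) (z / 2) k else 0) * (bernoulli (p - k) / of_nat k) \<in> p_ideal p"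
          by (simp add: Z_def)
      qed
    qed
  qed
  show "marked_sum y 0 w_sum k (interpolated zeta_A (1/2)) = (if odd k then kappa_sum (y / 2) k else 0) *\<^sub>Q frakZ_A k"
  proof (rule represents_A_cong[OF represents_A_marked represents_A_scale[OF represents_A_frakZ[OF assms]]])
    show "almost_all_primes (\<lambda>p. marked_gf y 0 w_sum (pos_list (p - 1)) $ k - (if odd k then kappa_sum (y / 2) k else 0) * (bernoulli (p - k) / of_nat k) \<in> p_ideal p)"
      using eventually_gt_at_top[of "k + 1"] rational_integral[of "y / 2"] rational_integral[of "1 / (1 - y / 2)"] rational_integral[of "1 / (1 + y / 2)"]
    proof eventually_elim
      case (elim p)
      show ?case
      proof
        assume "prime p"
        then interpret prime_modulus p by unfold_locales
        have "marked_gf (2 * (y / 2)) 0 w_sum (pos_list (p - 1)) $ k - (if odd k then kappa_sum (y / 2) k else 0) * Z k \<in> p_ideal p"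
          using elim \<open>prime p\<close> y assms by (intro marked_sum_mod) auto
        then show "marked_gf y 0 w_sum (pos_list (p - 1)) $ k - (if odd k then kappa_sum (y / 2) k else 0) * (bernoulli (p - k) / of_nat k) \<in> p_ideal p"
          by (simp add: Z_def)
      qed
    qed
  qed
qed

theorem theorem1p5:
  fixes i r k :: nat
  assumes "1 \<le> i" and "i \<le> r" and "r < k"
  shows
    "((\<Sum>ks\<in>index_set i k r. (2 ^ (ks ! (i - 1) - 2) - 1) *\<^sub>Q interpolated zeta_A (1/2) ks)
       = ((-1) ^ i * ((-1) ^ r - (-1) ^ k) / 2 ^ r
           * (2 ^ (k - 1) - (\<Sum>u = 0..i - 1. of_nat ((k - 1) choose u))
                - (\<Sum>v = 0..r - i. of_nat ((k - 1) choose v)))) *\<^sub>Q frakZ_A k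
      \<and> (\<Sum>ks\<in>index_set r k r. 2 ^ (ks ! (r - 1)) *\<^sub>Q interpolated zeta_A (1/2) ks)
       = ((1 + (-1) ^ r) / 2 powi (int r - 2)
           * (2 ^ (k - 1) - 1 + (\<Sum>u = 0..r - 1. of_nat ((k - 1) choose u)))) *\<^sub>Q frakZ_A k)
     \<and> ((\<Sum>ks\<in>index_set i k r. (2 ^ (ks ! (i - 1) - 2) - 1) *\<^sub>Q interpolated zeta_S (1/2) ks)
       = ((-1) ^ i * ((-1) ^ r - (-1) ^ k) / 2 ^ r
           * (2 ^ (k - 1) - (\<Sum>u = 0..i - 1. of_nat ((k - 1) choose u))
                - (\<Sum>v = 0..r - i. of_nat ((k - 1) choose v)))) *\<^sub>Q frakZ_S k
      \<and> (\<Sum>ks\<in>index_set r k r. 2 ^ (ks ! (r - 1)) *\<^sub>Q interpolated zeta_S (1/2) ks)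
       = ((1 + (-1) ^ r) / 2 powi (int r - 2)
           * (2 ^ (k - 1) - 1 + (\<Sum>u = 0..r - 1. of_nat ((k - 1) choose u)))) *\<^sub>Q frakZ_S k)"
proof -
  have k: "k \<ge> 2" using assms by linarith
  show ?thesis
    by (intro conjI weighted_sum_formulas(1)[OF _ _ _ assms] weighted_sum_formulas(2)[OF _ _ _ assms]
        finite_marked_sums symmetric_marked_sums frakZ_A_even frakZ_S_even k)
qed

end
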